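(* Let $M$ be a compact path-connected real-analytic Riemannian manifold without boundary (with real-analytic metric), and let $N\subset M$ be a closed, path-connected, analytic embedded submanifold. Let $\operatorname{Cut}N\subset M$ be the cut locus of $N$. Let $Y$ be a path-connected topological space and let $f,g\colon M\to Y$ be two continuous maps. Then $$\mathrm{D}(f,g)\leq \mathrm{D}_M(N;f,g)+\mathrm{D}_M(\operatorname{Cut}N;f,g)+1.$$
   Context: Homotopic distance: for continuous maps $f,g\colon X\to Y$, $\mathrm{D}(f,g)$ is the least integer $n\geq 0$ such that there is an open covering $U_0\cup\dots\cup U_n=X$ for which the restrictions $f_{|U_j}$ and $g_{|U_j}$ are homotopic as maps $U_j\to Y$, for all $j=0,\dots,n$; if there is no such covering, $\mathrm{D}(f,g)=\infty$. Subspace distance: for a subspace $A\subset X$, $\mathrm{D}_X(A;f,g):=\mathrm{D}(f_{|A},g_{|A})$, where the covering sets are open in $A$. Cut locus: for $y\in M$, the distance $d(y,N)$ is the infimum of the lengths of all piecewise smooth curves joining $y$ to some point of $N$. A unit speed geodesic $\gamma\colon[0,t_0]\to M$ ($t_0>0$) with $\gamma(0)\in N$ is an $N$-segment if $d(\gamma(t),N)=t$ for all $t\in[0,t_0]$. The endpoint $\gamma(t_0)$ of an $N$-segment is a cut point of $N$ if there is no $N$-segment properly containing $\gamma([0,t_0])$ (that is, extending $\gamma$ beyond $t_0$). The cut locus $\operatorname{Cut}N$ is the set of all cut points of $N$. *)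

theory Defs
  imports "HOL-Analysis.Analysis"
begin

section \<open>Homotopic distance\<close>

text \<open>
  The infimum of the empty set in \<^typ>\<open>enat\<close> is \<open>\<infinity>\<close>.
  Maps are total functions, so the restriction of a map to a subspace is the same function,
  considered on the subspace topology.
\<close>

definition homotopic_distance ::
    "'a topology \<Rightarrow> 'b topology \<Rightarrow> ('a \<Rightarrow> 'b) \<Rightarrow> ('a \<Rightarrow> 'b) \<Rightarrow> enat" where
  "homotopic_distance X Y f g = Inf {enat n | n. \<exists>U :: nat \<Rightarrow> 'a set.
      (\<forall>j\<le>n. openin X (U j)) \<and> (\<Union>j\<le>n. U j) = topspace X \<and>
      (\<forall>j\<le>n. homotopic_with (\<lambda>_. True) (subtopology X (U j)) Y f g)}"

definition subspace_distance ::
    "'a topology \<Rightarrow> 'a set \<Rightarrow> 'b topology \<Rightarrow> ('a \<Rightarrow> 'b) \<Rightarrow> ('a \<Rightarrow> 'b) \<Rightarrow> enat" where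
  "subspace_distance X A Y f g = homotopic_distance (subtopology X A) Y f g"


section \<open>Real-analytic manifolds\<close>

text \<open>
  Local expansion into a convergent power series in the coordinates. The set \<open>S\<close> is always
  relatively open in the model space of the manifold (see below). For infinite families,
  \<open>has_sum\<close> means unconditional convergence.
\<close>

definition real_analytic_on ::
    "('e::euclidean_space \<Rightarrow> 'f::real_normed_vector) \<Rightarrow> 'e set \<Rightarrow> bool" where
  "real_analytic_on f S \<longleftrightarrow>
    (\<forall>a\<in>S. \<exists>r>0. \<exists>c :: ('e \<Rightarrow> nat) \<Rightarrow> 'f. \<forall>x \<in> S \<inter> ball a r.
      ((\<lambda>\<alpha>. (\<Prod>b\<in>Basis. ((x - a) \<bullet> b) ^ \<alpha> b) *\<^sub>R c \<alpha>) has_sum f x)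
        {\<alpha>. \<forall>b. b \<notin> Basis \<longrightarrow> \<alpha> b = 0})"

text \<open>
  A chart is a pair of its domain and its coordinate map. Charts take values in a model space
  \<open>V\<close>, which is the whole type \<open>'e\<close> for manifolds of dimension \<open>DIM('e)\<close>. As every type of class
  \<open>euclidean_space\<close> has positive dimension, \<open>V = {0}\<close> is admitted as well; it is the model
  space of the manifolds of dimension \<open>0\<close>.
\<close>

type_synonym ('a, 'e) chart = "'a set \<times> ('a \<Rightarrow> 'e)"

definition is_chart :: "'a topology \<Rightarrow> 'e::euclidean_space set \<Rightarrow> ('a, 'e) chart \<Rightarrow> bool" where
  "is_chart M V \<kappa> \<longleftrightarrow> openin M (fst \<kappa>) \<and>
    openin (top_of_set V) (snd \<kappa> ` fst \<kappa>) \<and>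
    homeomorphic_map (subtopology M (fst \<kappa>)) (top_of_set (snd \<kappa> ` fst \<kappa>)) (snd \<kappa>)"

definition transition :: "('a, 'e) chart \<Rightarrow> ('a, 'e) chart \<Rightarrow> 'e \<Rightarrow> 'e" where
  "transition \<kappa> \<kappa>' = snd \<kappa>' \<circ> inv_into (fst \<kappa>) (snd \<kappa>)"

definition compatible :: "('a, 'e::euclidean_space) chart \<Rightarrow> ('a, 'e) chart \<Rightarrow> bool" where
  "compatible \<kappa> \<kappa>' \<longleftrightarrow>
    real_analytic_on (transition \<kappa> \<kappa>') (snd \<kappa> ` (fst \<kappa> \<inter> fst \<kappa>')) \<and>
    real_analytic_on (transition \<kappa>' \<kappa>) (snd \<kappa>' ` (fst \<kappa> \<inter> fst \<kappa>'))"

text \<open>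
  The atlas \<open>A\<close> need not be maximal; the charts of the maximal atlas are those satisfying
  \<open>analytic_chart\<close>.
\<close>

definition real_analytic_manifold ::
    "'a topology \<Rightarrow> 'e::euclidean_space set \<Rightarrow> ('a, 'e) chart set \<Rightarrow> bool" where
  "real_analytic_manifold M V A \<longleftrightarrow>
    Hausdorff_space M \<and> second_countable M \<and> (V = UNIV \<or> V = {0}) \<and>
    (\<Union>\<kappa>\<in>A. fst \<kappa>) = topspace M \<and>
    (\<forall>\<kappa>\<in>A. is_chart M V \<kappa>) \<and>
    (\<forall>\<kappa>\<in>A. \<forall>\<kappa>'\<in>A. compatible \<kappa> \<kappa>')"

definition analytic_chart ::
    "'a topology \<Rightarrow> 'e::euclidean_space set \<Rightarrow> ('a, 'e) chart set \<Rightarrow> ('a, 'e) chart \<Rightarrow> bool" where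
  "analytic_chart M V A \<kappa> \<longleftrightarrow> is_chart M V \<kappa> \<and> (\<forall>\<kappa>'\<in>A. compatible \<kappa> \<kappa>')"

text \<open>In a slice chart, \<open>N\<close> is given by the vanishing of the coordinates outside \<open>B\<close>.\<close>

definition analytic_embedded_submanifold ::
    "'a topology \<Rightarrow> 'e::euclidean_space set \<Rightarrow> ('a, 'e) chart set \<Rightarrow> nat \<Rightarrow> 'a set \<Rightarrow> bool" where
  "analytic_embedded_submanifold M V A k N \<longleftrightarrow> N \<subseteq> topspace M \<and>
    (\<forall>p\<in>N. \<exists>\<kappa>. analytic_chart M V A \<kappa> \<and> p \<in> fst \<kappa> \<and>
      (\<exists>B. B \<subseteq> Basis \<inter> V \<and> card B = k \<and>
        snd \<kappa> ` (fst \<kappa> \<inter> N) = snd \<kappa> ` fst \<kappa> \<inter> span B))"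


section \<open>Riemannian metrics\<close>

text \<open>
  A metric is given by its local expressions: \<open>G \<kappa> x u v\<close> is the inner product, at the point with
  coordinates \<open>x\<close> in the chart \<open>\<kappa>\<close>, of the tangent vectors with components \<open>u\<close> and \<open>v\<close> in \<open>V\<close>.
  The last clause is the transformation law under change of charts.
\<close>

type_synonym ('a, 'e) metric = "('a, 'e) chart \<Rightarrow> 'e \<Rightarrow> 'e \<Rightarrow> 'e \<Rightarrow> real"

definition analytic_riemannian_metric ::
    "'e::euclidean_space set \<Rightarrow> ('a, 'e) chart set \<Rightarrow> ('a, 'e) metric \<Rightarrow> bool" where
  "analytic_riemannian_metric V A G \<longleftrightarrow>
    (\<forall>\<kappa>\<in>A. \<forall>x \<in> snd \<kappa> ` fst \<kappa>.
      bilinear (G \<kappa> x) \<and> (\<forall>u v. G \<kappa> x u v = G \<kappa> x v u) \<and> (\<forall>v \<in> V - {0}. 0 < G \<kappa> x v v)) \<and>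
    (\<forall>\<kappa>\<in>A. \<forall>b\<in>Basis. \<forall>b'\<in>Basis. real_analytic_on (\<lambda>x. G \<kappa> x b b') (snd \<kappa> ` fst \<kappa>)) \<and>
    (\<forall>\<kappa>\<in>A. \<forall>\<kappa>'\<in>A. \<forall>p \<in> fst \<kappa> \<inter> fst \<kappa>'. \<forall>u\<in>V. \<forall>v\<in>V.
      let D = frechet_derivative (transition \<kappa> \<kappa>') (at (snd \<kappa> p) within V)
      in G \<kappa> (snd \<kappa> p) u v = G \<kappa>' (snd \<kappa>' p) (D u) (D v))"


section \<open>Curves, length and distance\<close>

text \<open>
  Smoothness is \<open>C\<^sup>\<infinity>\<close>, with derivatives taken within the set \<open>S\<close>, hence one-sided
  at the end points of an interval; \<open>D k\<close> is the \<open>k\<close>-th derivative.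
\<close>

definition smooth_on :: "(real \<Rightarrow> 'e::real_normed_vector) \<Rightarrow> real set \<Rightarrow> bool" where
  "smooth_on x S \<longleftrightarrow> (\<exists>D :: nat \<Rightarrow> real \<Rightarrow> 'e. D 0 = x \<and>
    (\<forall>k. \<forall>t\<in>S. (D k has_vector_derivative D (Suc k) t) (at t within S)))"

definition smooth_curve ::
    "'a topology \<Rightarrow> ('a, 'e::euclidean_space) chart set \<Rightarrow> real set \<Rightarrow> (real \<Rightarrow> 'a) \<Rightarrow> bool" where
  "smooth_curve M A I c \<longleftrightarrow> continuous_map (top_of_set I) M c \<and>
    (\<forall>\<kappa>\<in>A. smooth_on (snd \<kappa> \<circ> c) {t\<in>I. c t \<in> fst \<kappa>})"

definition piecewise_smooth_curve ::
    "'a topology \<Rightarrow> ('a, 'e::euclidean_space) chart set \<Rightarrow> real \<Rightarrow> real \<Rightarrow> (real \<Rightarrow> 'a) \<Rightarrow> bool" where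
  "piecewise_smooth_curve M A a b c \<longleftrightarrow> a < b \<and> continuous_map (top_of_set {a..b}) M c \<and>
    (\<exists>n. \<exists>\<tau> :: nat \<Rightarrow> real. \<tau> 0 = a \<and> \<tau> n = b \<and>
      (\<forall>i<n. \<tau> i < \<tau> (Suc i) \<and> smooth_curve M A {\<tau> i..\<tau> (Suc i)} c))"

definition velocity :: "('a, 'e::real_normed_vector) chart \<Rightarrow> real set \<Rightarrow> (real \<Rightarrow> 'a) \<Rightarrow> real \<Rightarrow> 'e" where
  "velocity \<kappa> I c t = vector_derivative (snd \<kappa> \<circ> c) (at t within I)"

text \<open>
  By the transformation law, the speed does not depend on the choice of the chart, as long as the
  curve is differentiable at \<open>t\<close> within \<open>I\<close>. For a piecewise smooth curve, the finitely many points
  where this fails do not matter for the length.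
\<close>

definition speed ::
    "('a, 'e::euclidean_space) chart set \<Rightarrow> ('a, 'e) metric \<Rightarrow> real set \<Rightarrow> (real \<Rightarrow> 'a) \<Rightarrow> real \<Rightarrow> real" where
  "speed A G I c t =
    (let \<kappa> = (SOME \<kappa>. \<kappa> \<in> A \<and> c t \<in> fst \<kappa>)
     in sqrt (G \<kappa> (snd \<kappa> (c t)) (velocity \<kappa> I c t) (velocity \<kappa> I c t)))"

definition curve_length ::
    "('a, 'e::euclidean_space) chart set \<Rightarrow> ('a, 'e) metric \<Rightarrow> real \<Rightarrow> real \<Rightarrow> (real \<Rightarrow> 'a) \<Rightarrow> real" where
  "curve_length A G a b c = integral {a..b} (speed A G {a..b} c)"

definition dist_to ::
    "'a topology \<Rightarrow> ('a, 'e::euclidean_space) chart set \<Rightarrow> ('a, 'e) metric \<Rightarrow> 'a set \<Rightarrow> 'a \<Rightarrow> real" where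
  "dist_to M A G N y = Inf {curve_length A G a b c | a b c.
      piecewise_smooth_curve M A a b c \<and> c a = y \<and> c b \<in> N}"


section \<open>Geodesics and the cut locus\<close>

text \<open>
  The Levi-Civita connection in a chart: \<open>christoffel V G \<kappa> x u v\<close> is the vector with components
  \<open>\<Gamma>\<^sup>k\<^sub>i\<^sub>j u\<^sup>i v\<^sup>j\<close> (sum over \<open>i, j\<close>), characterised by Koszul's formula for
  constant coordinate fields.
\<close>

definition metric_deriv ::
    "'e::euclidean_space set \<Rightarrow> ('a, 'e) metric \<Rightarrow> ('a, 'e) chart \<Rightarrow> 'e \<Rightarrow> 'e \<Rightarrow> 'e \<Rightarrow> 'e \<Rightarrow> real" where
  "metric_deriv V G \<kappa> x w u v = frechet_derivative (\<lambda>y. G \<kappa> y u v) (at x within V) w"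

definition christoffel ::
    "'e::euclidean_space set \<Rightarrow> ('a, 'e) metric \<Rightarrow> ('a, 'e) chart \<Rightarrow> 'e \<Rightarrow> 'e \<Rightarrow> 'e \<Rightarrow> 'e" where
  "christoffel V G \<kappa> x u v = (THE z. z \<in> V \<and> (\<forall>w\<in>V. G \<kappa> x z w =
     (metric_deriv V G \<kappa> x u v w + metric_deriv V G \<kappa> x v u w - metric_deriv V G \<kappa> x w u v) / 2))"

definition geodesic ::
    "'a topology \<Rightarrow> 'e::euclidean_space set \<Rightarrow> ('a, 'e) chart set \<Rightarrow> ('a, 'e) metric \<Rightarrow>
     real set \<Rightarrow> (real \<Rightarrow> 'a) \<Rightarrow> bool" where
  "geodesic M V A G I c \<longleftrightarrow> smooth_curve M A I c \<and>
    (\<forall>\<kappa>\<in>A. \<forall>t\<in>I. c t \<in> fst \<kappa> \<longrightarrow>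
      vector_derivative (velocity \<kappa> I c) (at t within I) +
      christoffel V G \<kappa> (snd \<kappa> (c t)) (velocity \<kappa> I c t) (velocity \<kappa> I c t) = 0)"

definition N_segment ::
    "'a topology \<Rightarrow> 'e::euclidean_space set \<Rightarrow> ('a, 'e) chart set \<Rightarrow> ('a, 'e) metric \<Rightarrow> 'a set \<Rightarrow>
     real \<Rightarrow> (real \<Rightarrow> 'a) \<Rightarrow> bool" where
  "N_segment M V A G N t0 \<gamma> \<longleftrightarrow> 0 < t0 \<and> geodesic M V A G {0..t0} \<gamma> \<and>
    (\<forall>t\<in>{0..t0}. speed A G {0..t0} \<gamma> t = 1) \<and> \<gamma> 0 \<in> N \<and>
    (\<forall>t\<in>{0..t0}. dist_to M A G N (\<gamma> t) = t)"

definition cut_locus ::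
    "'a topology \<Rightarrow> 'e::euclidean_space set \<Rightarrow> ('a, 'e) chart set \<Rightarrow> ('a, 'e) metric \<Rightarrow> 'a set \<Rightarrow> 'a set" where
  "cut_locus M V A G N = {\<gamma> t0 | \<gamma> t0. N_segment M V A G N t0 \<gamma> \<and>
     \<not> (\<exists>t1>t0. \<exists>\<gamma>'. N_segment M V A G N t1 \<gamma>' \<and> (\<forall>t\<in>{0..t0}. \<gamma>' t = \<gamma> t))}"

end

theory Submission
 imports Defs
begin

text \<open>
The infimum $d$ of the lengths of curves makes $M$ a compact geodesic space. Put $\rho = d(\cdot, N)$ and let
$x \preceq y$ mean $\rho(y) = \rho(x) + d(x, y)$; the cut locus consists of the points off $N$ that are maximal for
$\preceq$. Geodesics do not branch, so a non-maximal point is joined to $N$ by a unique $N$-segment, and a point off $N$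
has a unique maximal point above it. By compactness the resulting maps are continuous, and following the segments
deforms $M - \mathrm{Cut}\,N$ into $N$ and $M - N$ into $\mathrm{Cut}\,N$. Open coverings of $N$ and of
$\mathrm{Cut}\,N$ pull back along these deformations and together cover $M$, because both $M - N$ and
$M - \mathrm{Cut}\,N$ are open.

That $\mathrm{Cut}\,N$ is closed is the analytic part. Near $N$ the function $\rho$ is $C^2$ off $N$ by a tube
in a slice chart. If $x$ is an interior point of a minimal geodesic from $w$ to $z$ along which $\rho$ grows at unit
speed, and $\rho$ is $C^2$ near $w$, put $E(y) = \exp_y(l \nabla\rho(y))$ with $l = d(w, x)$. The broken paths from
$y$ through $E(y)$ to $z$ have length at least $\rho(z) - \rho(y)$, with equality at $y = w$; comparing both sides to
second order shows that the derivative of $E$ at $w$ has trivial kernel. The inverse function theorem makes $\rho$ a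
$C^2$ function near $x$.
Conversely, if $\rho$ is $C^2$ near a point off $N$, then Brouwer's fixed point theorem produces an
$N$-segment through that point which extends beyond it. Thus the non-cut points off $N$ form an open set.
\<close>

section \<open>Homotopic distance and deformations\<close>

text \<open>The usual description of cut points by conjugate points and Jacobi fields would require
  a global exponential map and a second variation formula. Here the geodesic flow is solved only up
  to time one near zero velocity, so exponential maps exist on small coordinate balls only; a
  Lebesgue number makes their size uniform (\<open>rad\<close>), and every global statement is
  reached in steps shorter than \<open>rad\<close>. The second order comparison of broken paths
  takes the place of conjugate point theory. The distance is built from chains of arcs that each lie
  in one chart, which turns splitting and concatenation into inductions; its agreement with lengths
  of piecewise smooth curves is a separate step. The metric is prescribed on the charts of the given
  atlas, whereas slice charts belong to the maximal atlas, so the metric has to be transported to a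
  larger family of charts. For the model space \<open>{0}\<close> the manifold is a single point and
  \<open>N\<close> is all of it.\<close>

lemma homotopic_distance_le:
 assumes "ALL j<=n. openin X (U j)" "(\<Union>j\<le>n. U j) = topspace X"
  and "ALL j<=n. homotopic_with (%_. True) (subtopology X (U j)) Y f g"
 shows "homotopic_distance X Y f g <= enat n"
 unfolding homotopic_distance_def by (rule Inf_lower) (use assms in blast)

text \<open>The defining set consists of finite values, so its infimum is infinite only if it is
  empty and otherwise is attained by well-ordering.\<close>

lemma homotopic_distance_cases:
 obtains "homotopic_distance X Y f g = \<infinity>"
 | n U where "homotopic_distance X Y f g = enat n" "ALL j<=n. openin X (U j)" "(\<Union>j\<le>n. U j) = topspace X"
  "ALL j<=n. homotopic_with (%_. True) (subtopology X (U j)) Y f g"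
proof (cases "homotopic_distance X Y f g")
 case (enat n)
 define S where "S = {enat n | n. EX U :: nat => 'a set.
   (ALL j<=n. openin X (U j)) & (\<Union>j\<le>n. U j) = topspace X &
   (ALL j<=n. homotopic_with (%_. True) (subtopology X (U j)) Y f g)}"
 have eq: "Inf S = enat n" using enat unfolding homotopic_distance_def S_def .
 have "S ~= {}" using eq by (auto simp: Inf_enat_def split: if_splits)
 hence "Inf S : S" unfolding Inf_enat_def by (auto intro: LeastI)
 thus ?thesis using eq enat that(2) unfolding S_def by auto
qed (use that in auto)

text \<open>On the preimage of \<open>V\<close> under \<open>r\<close> there is a chain of
  homotopies from \<open>f\<close> to \<open>f o r\<close> to \<open>g o r\<close> to
  \<open>g\<close>: the outer two come from the deformation of the identity into \<open>r\<close>,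
  the middle one from the homotopy on \<open>V\<close>.\<close>

lemma homotopic_with_deform:
 assumes h: "homotopic_with (%_. True) (subtopology X U) X id r" and r: "r ` U \<subseteq> B"
  and U: "openin X U" and V: "openin (subtopology X B) V"
  and fg: "homotopic_with (%_. True) (subtopology (subtopology X B) V) Y f g"
  and f: "continuous_map X Y f" and g: "continuous_map X Y g"
 shows "openin X {x : U. r x : V} & homotopic_with (%_. True) (subtopology X {x : U. r x : V}) Y f g"
proof -
 define W where "W = {x : U. r x : V}"
 have UX: "U \<subseteq> topspace X" using U openin_subset by blast
 have VB: "V \<subseteq> B" using V openin_subset by fastforce
 have cr: "continuous_map (subtopology X U) X r" using h homotopic_with_imp_continuous_maps by blast
 hence crB: "continuous_map (subtopology X U) (subtopology X B) r"
  using r by (auto simp: continuous_map_in_subtopology)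
 have "openin (subtopology X U) {x : topspace (subtopology X U). r x : V}"
  using crB V openin_continuous_map_preimage by blast
 moreover have "{x : topspace (subtopology X U). r x : V} = W" using UX W_def by auto
 ultimately have "openin X W" using U openin_open_subtopology by metis
 have WU: "W \<subseteq> U" by (auto simp: W_def)
 have hW: "homotopic_with (%_. True) (subtopology X W) X id r"
 proof -
  have "continuous_map (subtopology X W) (subtopology X U) id"
   using WU by (metis continuous_map_from_subtopology_mono continuous_map_id continuous_map_in_subtopology continuous_map_subtopology_eu
     id_apply image_subset_iff inf.orderE continuous_map_from_subtopology topspace_subtopology_subset Int_iff image_id openin_subset[OF \<open>openin X W\<close>])
  from homotopic_with_compose_continuous_map_right[OF h this, of "%_. True"]
  show ?thesis by simp
 qed
 have "continuous_map (subtopology X W) (subtopology (subtopology X B) V) r"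
  using continuous_map_from_subtopology_mono[OF cr WU] VB
  by (auto simp: continuous_map_in_subtopology W_def subtopology_subtopology)
 from homotopic_with_compose_continuous_map_right[OF fg this, of "%_. True"]
 have 1: "homotopic_with (%_. True) (subtopology X W) Y (f \<circ> r) (g \<circ> r)" by simp
 have 2: "homotopic_with (%_. True) (subtopology X W) Y f (f \<circ> r)"
  using homotopic_with_compose_continuous_map_left[OF hW f, of "%_. True"] by simp
 have 3: "homotopic_with (%_. True) (subtopology X W) Y (g \<circ> r) g"
  using homotopic_with_compose_continuous_map_left[OF hW g, of "%_. True"] by (simp add: homotopic_with_sym)
 show ?thesis using \<open>openin X W\<close> homotopic_with_trans[OF homotopic_with_trans[OF 2 1] 3] W_def by simp
qed

text \<open>The \<open>n + 1\<close> sets over \<open>B\<close> and the \<open>m + 1\<close> sets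
  over \<open>C\<close> pull back to \<open>n + m + 2\<close> open sets, whose last index is
  \<open>n + m + 1\<close>; this is the origin of the summand 1.\<close>

lemma homotopic_distance_le_two_deformations:
 assumes U: "openin X U" "homotopic_with (%_. True) (subtopology X U) X id r" "r ` U \<subseteq> B"
  and W: "openin X W" "homotopic_with (%_. True) (subtopology X W) X id q" "q ` W \<subseteq> C"
  and cover: "U \<union> W = topspace X" and BC: "B \<subseteq> topspace X" "C \<subseteq> topspace X"
  and f: "continuous_map X Y f" and g: "continuous_map X Y g"
 shows "homotopic_distance X Y f g <= subspace_distance X B Y f g + subspace_distance X C Y f g + 1"
proof (cases rule: homotopic_distance_cases[of "subtopology X B" Y f g])
 case 1
 thus ?thesis by (simp add: subspace_distance_def)
next
 case B: (2 n P)
 show ?thesis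
 proof (cases rule: homotopic_distance_cases[of "subtopology X C" Y f g])
  case 1
  thus ?thesis by (simp add: subspace_distance_def)
 next
  case C: (2 m Q)
  define O' where "O' j = (if j <= n then {x : U. r x : P j} else {x : W. q x : Q (j - n - 1)})" for j
  have O1: "openin X (O' j) & homotopic_with (%_. True) (subtopology X (O' j)) Y f g"
   if "j <= n + m + 1" for j
  proof (cases "j <= n")
   case True
   thus ?thesis using homotopic_with_deform[OF U(2,3,1) _ _ f g] B by (simp add: O'_def)
  next
   case False
   hence "j - n - 1 <= m" using that by simp
   thus ?thesis using homotopic_with_deform[OF W(2,3,1) _ _ f g] C False by (simp add: O'_def)
  qed
  have "(\<Union>j\<le>n+m+1. O' j) = topspace X"
  proof
   show "(\<Union>j\<le>n+m+1. O' j) \<subseteq> topspace X" using O1 openin_subset by blast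
   show "topspace X \<subseteq> (\<Union>j\<le>n+m+1. O' j)"
   proof
    fix x assume "x : topspace X"
    then consider "x : U" | "x : W" using cover by blast
    thus "x : (\<Union>j\<le>n+m+1. O' j)"
    proof cases
     case 1
     hence "r x : topspace (subtopology X B)" using U(3) BC by auto
     then obtain j where "j <= n" "r x : P j" using B by blast
     hence "x : O' j" using 1 by (simp add: O'_def)
     thus ?thesis using \<open>j <= n\<close> by auto
    next
     case 2
     hence "q x : topspace (subtopology X C)" using W(3) BC by auto
     then obtain j where "j <= m" "q x : Q j" using C by blast
     hence "x : O' (n + 1 + j)" using 2 by (simp add: O'_def)
     moreover have "n + 1 + j <= n + m + 1" using \<open>j <= m\<close> by simp
     ultimately show ?thesis by blast
    qed
   qed
  qed
  hence "homotopic_distance X Y f g <= enat (n + m + 1)" using O1 by (intro homotopic_distance_le) auto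
  thus ?thesis using B C by (simp add: subspace_distance_def one_enat_def)
 qed
qed

text \<open>The preimage of a closed \<open>C\<close> is the projection of the part of the graph
  over \<open>C\<close>, and projections along a compact factor are closed maps. The deformations
  below are only given by uniqueness and closed conditions, so this is the way to their
  continuity.\<close>

lemma continuous_map_into_compact_closed_graph:
 assumes K: "compact_space K" and f: "f : topspace Z \<rightarrow> topspace K"
  and cl: "closedin (prod_topology Z K) {(z, y). z : topspace Z & y = f z}"
 shows "continuous_map Z K f" unfolding continuous_map_closedin
proof (intro conjI allI impI ballI)
 fix C assume C: "closedin K C"
 let ?G = "{(z, y). z : topspace Z & y = f z}"
 have "closedin (prod_topology Z K) (?G \<inter> (topspace Z \<times> C))"
  using cl C by (intro closedin_Int) (auto simp: closedin_prod_Times_iff)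
 hence "closedin Z (fst ` (?G \<inter> (topspace Z \<times> C)))"
  using closed_map_fst[OF K] unfolding closed_map_def by blast
 moreover have "fst ` (?G \<inter> (topspace Z \<times> C)) = {z : topspace Z. f z : C}" by force
 ultimately show "closedin Z {z : topspace Z. f z : C}" by simp
qed (use f in auto)

section \<open>Compact geodesic spaces\<close>

text \<open>The part of Riemannian geometry that the deformation argument uses. \<open>split\<close>
  plays the role of minimal geodesics, and \<open>nonbranching\<close> is asked at scale
  \<open>ep\<close> only, because geodesics are controlled only inside normal balls; the uniqueness
  lemmas below remove this restriction.\<close>

locale geodesic_space = Metric_space X d for X :: "'a set" and d +
 fixes N :: "'a set" and rho :: "'a => real" and ep :: real
 assumes compact: "compact_space mtopology"
  and N_sub: "N \<subseteq> X"
  and N_closed: "closedin mtopology N"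
  and rho_attained: "x : X ==> EX n:N. rho x = d x n"
  and rho_le: "x : X ==> n : N ==> rho x <= d x n"
  and split: "x : X ==> y : X ==> 0 <= s ==> s <= d x y ==> EX m:X. d x m = s & d m y = d x y - s"
  and eps: "0 < ep"
  and nonbranching: "[| a : X; x : X; b : X; b' : X; d a x < ep; d x b < ep; a ~= x;
   d a b = d a x + d x b; d a b' = d a x + d x b'; d x b' = d x b |] ==> b = b'"
begin

definition below :: "'a => 'a => bool" (infix "\<preceq>" 50) where
 "x \<preceq> y \<longleftrightarrow> rho y = rho x + d x y"

definition cut :: "'a set" where
 "cut = {x : X - N. ALL y:X. x \<preceq> y --> y = x}"

lemma rho_nonneg: "x : X ==> 0 <= rho x" using rho_attained nonneg by metis

lemma rho_lip: "x : X ==> y : X ==> rho y <= rho x + d x y"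
proof -
 assume x: "x : X" and y: "y : X"
 obtain n where n: "n : N" "rho x = d x n" using rho_attained x by blast
 have "rho y <= d y n" using rho_le y n by blast
 also have "\<dots> <= d y x + d x n" using triangle x y n N_sub by blast
 finally show ?thesis using n commute by simp
qed

lemma rho_zero_iff: "x : X ==> rho x = 0 \<longleftrightarrow> x : N"
proof
 assume x: "x : X" and "rho x = 0"
 then obtain n where "n : N" "d x n = 0" using rho_attained by metis
 thus "x : N" using x N_sub zero by blast
next
 assume x: "x : X" and "x : N"
 thus "rho x = 0" using rho_le[OF x \<open>x : N\<close>] rho_nonneg[OF x] by simp
qed

lemma rho_pos: "x : X ==> x ~: N ==> 0 < rho x"
 using rho_nonneg rho_zero_iff by fastforce

lemma below_refl: "x : X ==> x \<preceq> x" by (simp add: below_def)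

text \<open>\<open>rho\<close> is 1-Lipschitz, so
  \<open>rho z <= rho x + d x z <= rho x + d x y + d y z = rho z\<close>, with equality throughout.
  The additivity of distances is the form in which \<open>nonbranching\<close> is applied.\<close>

lemma below_trans:
 assumes "x : X" "y : X" "z : X" "x \<preceq> y" "y \<preceq> z"
 shows "x \<preceq> z" "d x z = d x y + d y z"
proof -
 have "rho z <= rho x + d x z" "d x z <= d x y + d y z" using assms rho_lip triangle by auto
 thus "x \<preceq> z" "d x z = d x y + d y z" using assms by (auto simp: below_def)
qed

text \<open>Equality in the Lipschitz estimate over a whole split distance forces equality on both
  parts.\<close>

lemma below_split:
 assumes "x : X" "y : X" "x \<preceq> y" "0 <= s" "s <= d x y"
 obtains m where "m : X" "x \<preceq> m" "m \<preceq> y" "d x m = s" "d m y = d x y - s"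
proof -
 obtain m where m: "m : X" "d x m = s" "d m y = d x y - s" using split assms by blast
 have "rho m <= rho x + d x m" "rho y <= rho m + d m y" using rho_lip[of x m] rho_lip[of m y] assms m by blast+
 hence "x \<preceq> m" "m \<preceq> y" using m assms(3) by (auto simp: below_def)
 thus ?thesis using that m by blast
qed

lemma foot_exists: "x : X ==> EX n:N. n \<preceq> x"
 unfolding below_def using rho_attained rho_zero_iff N_sub commute by (metis add_0 subsetD)

lemma lower_exists:
 assumes "x : X" "0 <= t" "t <= rho x"
 obtains y where "y : X" "y \<preceq> x" "rho y = t" "d y x = rho x - t"
proof -
 obtain n where n: "n : N" "n \<preceq> x" using foot_exists assms by blast
 have nX: "n : X" "rho n = 0" using n N_sub rho_zero_iff by auto
 hence "d n x = rho x" using n by (simp add: below_def)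
 with below_split[OF nX(1) assms(1) n(2) assms(2)] assms(3) obtain m where
  "m : X" "n \<preceq> m" "m \<preceq> x" "d n m = t" "d m x = d n x - t" by metis
 thus ?thesis using that nX \<open>d n x = rho x\<close> by (auto simp: below_def)
qed

text \<open>A point \<open>a\<close> below \<open>x\<close> provides a common initial piece of the
  two continuations through \<open>x\<close>, so they cannot branch. Such an \<open>a\<close>
  different from \<open>x\<close> exists since \<open>x\<close> is off \<open>N\<close>.\<close>

lemma upward_unique_step:
 assumes X: "x : X" "y : X" "y' : X" and x: "x ~: N" and le: "x \<preceq> y" "x \<preceq> y'"
  and eq: "d x y' = d x y" and small: "d x y < ep"
 shows "y = y'"
proof -
 have "0 < rho x" using rho_pos X x by blast
 \<comment> \<open>The height of \<open>a\<close>: half of \<open>ep\<close> below \<open>x\<close>,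
   or zero if \<open>N\<close> is nearer.\<close>
 define t where "t = max 0 (rho x - ep / 2)"
 obtain a where a: "a : X" "a \<preceq> x" "rho a = t" "d a x = rho x - t"
  using lower_exists[of x t] X \<open>0 < rho x\<close> eps by (auto simp: t_def)
 have "d a x < ep" "a ~= x" using a \<open>0 < rho x\<close> eps by (auto simp: t_def)
 thus ?thesis using nonbranching[of a x y y'] a X below_trans(2)[OF a(1) X(1) _ a(2)] le eq small by auto
qed

text \<open>Both continuations are cut after \<open>ep / 2\<close>; the short case identifies the
  two intermediate points, and the argument restarts from there. Finitely many steps
  suffice.\<close>

lemma upward_unique:
 assumes "x : X" "y : X" "y' : X" "x ~: N" "x \<preceq> y" "x \<preceq> y'" "rho y' = rho y"
 shows "y = y'"
proof -
 have main: "d x y <= real k * (ep / 2) ==> x : X ==> x ~: N ==> x \<preceq> y ==> x \<preceq> y' ==> y = y'" for k x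
 proof (induction k arbitrary: x)
  case 0
  hence "d x y < ep" using eps by simp
  moreover have "d x y' = d x y" using 0 assms(7) by (simp add: below_def)
  ultimately show ?case using upward_unique_step[of x y y'] 0 assms(2,3) by blast
 next
  case (Suc k)
  show ?case
  proof (cases "d x y < ep")
   case True
   have "d x y' = d x y" using Suc.prems assms(7) by (simp add: below_def)
   thus ?thesis using upward_unique_step[of x y y'] Suc.prems assms(2,3) True by blast
  next
   case False
   moreover have "d x y' = d x y" using Suc.prems assms(7) by (simp add: below_def)
   ultimately have le: "ep / 2 <= d x y" "ep / 2 <= d x y'" using eps by simp_all
   obtain m where m: "m : X" "x \<preceq> m" "m \<preceq> y" "d x m = ep/2" "d m y = d x y - ep/2"
    by (rule below_split[of x y "ep/2"]) (use Suc.prems assms(2) eps le in simp_all)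
   obtain m' where m': "m' : X" "x \<preceq> m'" "m' \<preceq> y'" "d x m' = ep/2"
    by (rule below_split[of x y' "ep/2"]) (use Suc.prems assms(3) eps le in simp_all)
   have "m = m'" using upward_unique_step[of x m m'] m m' Suc.prems eps by simp
   moreover have "m ~: N" using m Suc.prems eps rho_zero_iff[of m] rho_nonneg[of x] by (auto simp: below_def)
   moreover have "d m y <= real k * (ep/2)" using m Suc.prems(1) by (simp add: algebra_simps)
   ultimately show ?thesis using Suc.IH[of m] m m' by blast
  qed
 qed
 obtain k where "d x y / (ep/2) <= real k" using real_arch_simple by blast
 hence "d x y <= real k * (ep/2)" using eps by (simp add: field_simps)
 thus ?thesis using main assms by blast
qed

text \<open>Mirror image of \<open>upward_unique\<close>: the common piece is now the continuation
  of \<open>x\<close> towards the point \<open>z\<close> strictly above it. Below a maximal point no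
  such piece exists, and several segments may arrive.\<close>

lemma downward_unique:
 assumes "y : X" "y' : X" "x : X" "z : X" "y \<preceq> x" "y' \<preceq> x" "x \<preceq> z" "z ~= x" "rho y' = rho y"
 shows "y = y'"
proof -
 have step: "y = y'" if prem: "y : X" "y' : X" "x : X" "z : X" "y \<preceq> x" "y' \<preceq> x" "x \<preceq> z" "z ~= x"
  "d y' x = d y x" "d y x < ep" for x z y y'
 proof -
  have "0 < d x z" using prem by simp
  obtain m where m: "m : X" "x \<preceq> m" "d x m = min (ep/2) (d x z)"
   by (rule below_split[of x z "min (ep/2) (d x z)"]) (use prem eps \<open>0 < d x z\<close> in auto)
  have "m ~= x" using m(3) prem(3) eps \<open>0 < d x z\<close> by (auto simp: min_def split: if_splits)
  thus ?thesis using nonbranching[of m x y y'] prem m eps below_trans(2)[of y x m] below_trans(2)[of y' x m]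
   by (auto simp: commute[of _ x] commute[of m] min_def)
 qed
 have main: "d y x <= real k * (ep / 2) ==> x : X ==> z : X ==> y \<preceq> x ==> y' \<preceq> x ==> x \<preceq> z ==> z ~= x ==> y = y'" for k x z
 proof (induction k arbitrary: x z)
  case 0
  hence "d y x < ep" using eps by simp
  moreover have "d y' x = d y x" using 0 assms(9) by (simp add: below_def)
  ultimately show ?case using step[of y y' x z] 0 assms(1,2) by blast
 next
  case (Suc k)
  show ?case
  proof (cases "d y x < ep")
   case True
   have "d y' x = d y x" using Suc.prems assms(9) by (simp add: below_def)
   thus ?thesis using step[of y y' x z] Suc.prems assms(1,2) True by blast
  next
   case False
   moreover have le2: "d y' x = d y x" using Suc.prems assms(9) by (simp add: below_def)
   ultimately have le: "ep / 2 <= d y x" using eps by simp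
   obtain m where m: "m : X" "y \<preceq> m" "m \<preceq> x" "d m x = ep/2" "d y m = d y x - ep/2"
    by (rule below_split[of y x "d y x - ep/2"]) (use Suc.prems assms(1) eps le in simp_all)
   obtain m' where m': "m' : X" "y' \<preceq> m'" "m' \<preceq> x" "d m' x = ep/2"
    by (rule below_split[of y' x "d y x - ep/2"]) (use Suc.prems assms(2) eps le le2 in simp_all)
   have "m = m'" using step[of m m' x z] m m' Suc.prems eps by simp
   moreover have "x ~= m" using m Suc.prems eps by auto
   moreover have "d y m <= real k * (ep/2)" using m Suc.prems(1) by (simp add: algebra_simps)
   ultimately show ?thesis using Suc.IH[of m x] m m' Suc.prems by blast
  qed
 qed
 obtain k where "d y x / (ep/2) <= real k" using real_arch_simple by blast
 hence "d y x <= real k * (ep/2)" using eps by (simp add: field_simps)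
 thus ?thesis using main assms by blast
qed

lemma continuous_map_rho: "continuous_map mtopology euclideanreal rho"
proof -
 have "\<bar>rho x - rho y\<bar> <= d x y" if "x : X" "y : X" for x y
  using rho_lip[of x y] rho_lip[of y x] that commute[of x y] by simp
 hence "Lipschitz_continuous_map Self euclidean_metric rho"
  unfolding Lipschitz_continuous_map_def by (auto simp: dist_real_def intro!: exI[of _ 1])
 thus ?thesis using Lipschitz_continuous_imp_continuous_map[of Self euclidean_metric rho]
  by (simp add: mtopology_of_def)
qed

lemma continuous_map_d:
 assumes "continuous_map Z mtopology p" "continuous_map Z mtopology q"
 shows "continuous_map Z euclideanreal (%z. d (p z) (q z))"
 using continuous_map_mdist[of Z Self p q] assms by (simp add: mtopology_of_def)

lemma closedin_eq_reals:
 assumes "continuous_map Z euclideanreal f" "continuous_map Z euclideanreal g"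
 shows "closedin Z {z : topspace Z. f z = g z}"
proof -
 have "closedin Z {z : topspace Z. f z - g z : {0}}"
  by (rule closedin_continuous_map_preimage[of Z euclideanreal])
   (use assms in \<open>auto intro!: continuous_intros\<close>)
 thus ?thesis by simp
qed

lemma closedin_below_graph:
 assumes p: "continuous_map Z mtopology p" and q: "continuous_map Z mtopology q"
 shows "closedin Z {z : topspace Z. p z \<preceq> q z}" unfolding below_def
 using continuous_map_compose[OF p continuous_map_rho] continuous_map_compose[OF q continuous_map_rho]
  continuous_map_d[OF p q] by (intro closedin_eq_reals) (auto simp: o_def intro!: continuous_intros)

text \<open>The points above \<open>x\<close> form a compact set because the relation is closed; a
  point of this set where \<open>rho\<close> is largest has nothing strictly above it.\<close>

lemma cut_above_exists:
 assumes x: "x : X" "x ~: N"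
 obtains y where "y : cut" "x \<preceq> y"
proof -
 let ?S = "{y : topspace mtopology. (%_. x) y \<preceq> (%y. y) y}"
 have "closedin mtopology ?S" by (rule closedin_below_graph) (use x in auto)
 hence c: "compactin mtopology ?S" using compact closedin_compact_space by blast
 have "compact (rho ` ?S)" using image_compactin[OF c continuous_map_rho] by simp
 moreover have "?S ~= {}" using x below_refl by auto
 ultimately obtain y where y: "y : ?S" "ALL z:?S. rho z <= rho y"
  using compact_attains_sup[of "rho ` ?S"] by auto
 have "z = y" if "z : X" "y \<preceq> z" for z
 proof -
  have "z : ?S" using below_trans(1)[of x y z] that y x by auto
  hence "rho z <= rho y" using y by blast
  thus ?thesis using that y by (auto simp: below_def) (metis nonneg add_0_right antisym_conv3 le_add_same_cancel1 linorder_not_less zero order_antisym)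
 qed
 moreover have "y ~: N" using y rho_pos[OF x] rho_zero_iff[of y] nonneg[of x y] by (auto simp: below_def)
 ultimately show ?thesis using y that by (auto simp: cut_def)
qed

text \<open>On the way to the higher of two maximal points lies a point at the height of the lower
  one. \<open>upward_unique\<close> identifies the two, so the lower maximal point is below the
  higher one, hence equal to it.\<close>

lemma cut_above_unique:
 assumes "x : X" "x ~: N" "y : cut" "y' : cut" "x \<preceq> y" "x \<preceq> y'"
 shows "y = y'"
proof -
 have *: "y = y'" if "y : cut" "y' : cut" "x \<preceq> y" "x \<preceq> y'" "rho y <= rho y'" for y y'
 proof -
  have X: "y : X" "y' : X" using that by (auto simp: cut_def)
  note prem = that
  obtain m where m: "m : X" "x \<preceq> m" "m \<preceq> y'" "d x m = d x y"
   by (rule below_split[of x y' "d x y"]) (use assms(1) prem X in \<open>auto simp: below_def\<close>)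
  have "rho m = rho y" using m that by (simp add: below_def)
  hence "m = y" using upward_unique[of x y m] assms(1,2) X(1) m(1,2) that(3) by simp
  thus ?thesis using m X that by (auto simp: cut_def)
 qed
 show ?thesis using *[of y y'] *[of y' y] assms(3-) by (cases "rho y <= rho y'") auto
qed

definition to_cut :: "'a => 'a" where "to_cut x = (THE y. y : cut & x \<preceq> y)"

lemma to_cut:
 assumes "x : X" "x ~: N"
 shows "to_cut x : cut" "x \<preceq> to_cut x" "y : cut ==> x \<preceq> y ==> y = to_cut x"
proof -
 have "EX! y. y : cut & x \<preceq> y"
  using cut_above_exists[OF assms] cut_above_unique[OF assms] by metis
 from theI'[OF this] show 1: "to_cut x : cut" "x \<preceq> to_cut x" unfolding to_cut_def by auto
 show "y : cut ==> x \<preceq> y ==> y = to_cut x" using cut_above_unique[OF assms] 1 by blast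
qed

lemma cut_subset: "cut \<subseteq> X" by (auto simp: cut_def)

lemma homotopy_by_graph:
 assumes W: "W \<subseteq> X" and h: "!!s x. s : {0..1::real} ==> x : W ==> h (s, x) : X"
  and cl: "closedin (prod_topology (prod_topology (top_of_set {0..1}) (subtopology mtopology W)) mtopology)
    {((s, x), y). s : {0..1} & x : W & y = h (s, x)}"
  and h0: "!!x. x : W ==> h (0, x) = x"
 shows "homotopic_with (%_. True) (subtopology mtopology W) mtopology id (%x. h (1, x))"
proof -
 let ?Z = "prod_topology (top_of_set {0..1::real}) (subtopology mtopology W)"
 have tW: "topspace (subtopology mtopology W) = W" using W by auto
 have "continuous_map ?Z mtopology h"
 proof (rule continuous_map_into_compact_closed_graph[OF compact])
  show "h : topspace ?Z \<rightarrow> topspace mtopology" using h W by auto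
  have "{(z, y). z : topspace ?Z & y = h z} = {((s, x), y). s : {0..1} & x : W & y = h (s, x)}"
   using tW by auto
  thus "closedin (prod_topology ?Z mtopology) {(z, y). z : topspace ?Z & y = h z}" using cl by simp
 qed
 hence "homotopic_with (%_. True) (subtopology mtopology W) mtopology (%x. h (0, x)) (%x. h (1, x))"
  unfolding homotopic_with_def by (intro exI[of _ h]) auto
 moreover have "homotopic_with (%_. True) (subtopology mtopology W) mtopology (%x. h (0, x)) id"
  using continuous_map_compose[OF _ \<open>continuous_map ?Z mtopology h\<close>, of "subtopology mtopology W" "%x. (0, x)"]
  by (intro homotopic_with_equal) (use h0 W in \<open>auto simp: o_def continuous_map_pairwise\<close>)
 ultimately show ?thesis using homotopic_with_symD homotopic_with_trans by blast
qed

text \<open>By uniqueness, \<open>y = to_cut x\<close> is equivalent to the closed conditions that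
  \<open>y\<close> is above \<open>x\<close> and in \<open>cut\<close>, so the graph is closed. The
  homotopy is described likewise, by a point above \<open>x\<close> at a prescribed height.\<close>

lemma deformation_to_cut:
 assumes cl: "closedin mtopology cut"
 shows "homotopic_with (%_. True) (subtopology mtopology (X - N)) mtopology id to_cut"
proof -
 let ?W = "X - N"
 let ?Z = "subtopology mtopology ?W"
 let ?I = "top_of_set {0..1::real}"
 have cR: "continuous_map ?Z mtopology to_cut"
 proof (rule continuous_map_into_compact_closed_graph[OF compact])
  show "to_cut : topspace ?Z \<rightarrow> topspace mtopology" using to_cut cut_subset by auto
  let ?P = "prod_topology ?Z mtopology"
  have "closedin ?P {z : topspace ?P. fst z \<preceq> snd z}"
   by (rule closedin_below_graph) (auto intro: continuous_map_fst continuous_map_snd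
     continuous_map_into_fulltopology)
  moreover have "closedin ?P {z : topspace ?P. snd z : cut}"
   by (rule closedin_continuous_map_preimage[OF continuous_map_snd cl])
  ultimately have "closedin ?P ({z : topspace ?P. fst z \<preceq> snd z} \<inter> {z : topspace ?P. snd z : cut})"
   by (rule closedin_Int)
  moreover have "\<dots> = {(z, y). z : topspace ?Z & y = to_cut z}" using to_cut cut_subset by auto
  ultimately show "closedin ?P {(z, y). z : topspace ?Z & y = to_cut z}" by simp
 qed
 \<comment> \<open>The height moves linearly from \<open>rho x\<close> to that of the maximal
   point.\<close>
 define t where "t s x = (1 - s) * rho x + s * rho (to_cut x)" for s x
 have ex: "EX y:X. x \<preceq> y & rho y = t s x" if prem: "x : ?W" "s : {0..1}" for x s
 proof -
  have R: "to_cut x : X" "x \<preceq> to_cut x" using to_cut cut_subset that by auto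
  have "t s x - rho x = s * d x (to_cut x)" using R(2) by (simp add: t_def below_def algebra_simps)
  moreover have "s * d x (to_cut x) <= d x (to_cut x)" "0 <= s * d x (to_cut x)"
   using that mult_left_le_one_le[of "d x (to_cut x)" s] by auto
  moreover obtain y where "y : X" "x \<preceq> y" "d x y = s * d x (to_cut x)"
   by (rule below_split[of x "to_cut x" "s * d x (to_cut x)"]) (use prem R calculation in auto)
  moreover have "rho y = t s x" using calculation by (simp add: below_def)
  ultimately show ?thesis by blast
 qed
 define h where "h = (%(s, x). SOME y. y : X & x \<preceq> y & rho y = t s x)"
 have h: "h (s, x) : X" "x \<preceq> h (s, x)" "rho (h (s, x)) = t s x" if "x : ?W" "s : {0..1}" for x s
  using someI_ex[OF ex[OF that, unfolded Bex_def]] by (auto simp: h_def)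
 have hu: "y = h (s, x)" if prem: "x : ?W" "s : {0..1}" "y : X" "x \<preceq> y" "rho y = t s x" for x y s
  by (rule upward_unique[of x]) (use prem h[OF prem(1,2)] in simp_all)
 have "homotopic_with (%_. True) ?Z mtopology id (%x. h (1, x))"
 proof (rule homotopy_by_graph)
  let ?P = "prod_topology (prod_topology ?I ?Z) mtopology"
  have c1': "continuous_map ?P ?Z (%z. snd (fst z))"
   by (rule continuous_map_compose[OF continuous_map_fst continuous_map_snd, unfolded o_def])
  have c1: "continuous_map ?P mtopology (%z. snd (fst z))" by (rule continuous_map_into_fulltopology[OF c1'])
  have c2: "continuous_map ?P mtopology snd" by (rule continuous_map_snd)
  have c3: "continuous_map ?P euclideanreal (%z. fst (fst z))" by (rule continuous_map_into_fulltopology[OF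
      continuous_map_compose[OF continuous_map_fst continuous_map_fst, unfolded o_def]])
  have "closedin ?P {z : topspace ?P. snd (fst z) \<preceq> snd z}" by (rule closedin_below_graph[OF c1 c2])
  moreover have "closedin ?P {z : topspace ?P. rho (snd z) = t (fst (fst z)) (snd (fst z))}" unfolding t_def
   using continuous_map_compose[OF c2 continuous_map_rho] continuous_map_compose[OF c1 continuous_map_rho]
    continuous_map_compose[OF continuous_map_compose[OF c1' cR] continuous_map_rho] c3
   by (intro closedin_eq_reals) (auto simp: o_def intro!: continuous_intros)
  ultimately have "closedin ?P ({z : topspace ?P. snd (fst z) \<preceq> snd z} \<inter>
    {z : topspace ?P. rho (snd z) = t (fst (fst z)) (snd (fst z))})" by (rule closedin_Int)
  moreover have "\<dots> = {((s, x), y). s : {0..1} & x : ?W & y = h (s, x)}"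
   using h hu by (auto 0 3)
  ultimately show "closedin ?P {((s, x), y). s : {0..1} & x : ?W & y = h (s, x)}" by simp
  show "h (0, x) = x" if "x : ?W" for x using hu[of x 0 x] that below_refl by (auto simp: t_def)
 qed (use h in auto)
 moreover have "h (1, x) = to_cut x" if "x : ?W" for x
  using hu[of x 1 "to_cut x"] that to_cut(1,2)[of x] cut_subset by (auto simp: t_def)
 ultimately show ?thesis by (elim homotopic_with_eq) auto
qed

text \<open>The homotopy takes the point below \<open>x\<close> at height
  \<open>(1 - s) * rho x\<close>. Its uniqueness off \<open>N\<close> comes from a point strictly
  above \<open>x\<close>; on \<open>N\<close> a point below \<open>x\<close> has distance 0 from
  \<open>x\<close>.\<close>

lemma deformation_to_N:
 assumes cl: "closedin mtopology cut"
 shows "EX r. homotopic_with (%_. True) (subtopology mtopology (X - cut)) mtopology id r & r ` (X - cut) \<subseteq> N"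
proof -
 let ?W = "X - cut"
 let ?Z = "subtopology mtopology ?W"
 let ?I = "top_of_set {0..1::real}"
 define t where "t s x = (1 - s) * rho x" for s x
 have ex: "EX y:X. y \<preceq> x & rho y = t s x" if "x : ?W" "s : {0..1}" for x s
 proof -
  have "0 <= t s x" "t s x <= rho x"
   using that rho_nonneg[of x] mult_left_le_one_le[of "rho x" "1-s"] by (auto simp: t_def)
  with lower_exists[of x "t s x"] that show ?thesis by auto
 qed
 define h where "h = (%(s, x). SOME y. y : X & y \<preceq> x & rho y = t s x)"
 have h: "h (s, x) : X" "h (s, x) \<preceq> x" "rho (h (s, x)) = t s x" if "x : ?W" "s : {0..1}" for x s
  using someI_ex[OF ex[OF that, unfolded Bex_def]] by (auto simp: h_def)
 have hu: "y = h (s, x)" if prem: "x : ?W" "s : {0..1}" "y : X" "y \<preceq> x" "rho y = t s x" for x y s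
 proof (cases "x : N")
  case True
  hence "rho x = 0" "t s x = 0" using rho_zero_iff[of x] that by (auto simp: t_def)
  hence "d y x = 0" "d (h (s,x)) x = 0" using that h[OF that(1,2)] by (auto simp: below_def)
  thus ?thesis using that h[OF that(1,2)] by auto
 next
  case False
  then obtain z where "z : X" "x \<preceq> z" "z ~= x" using prem by (auto simp: cut_def)
  thus ?thesis using downward_unique[of y "h (s, x)" x z] h[OF that(1,2)] that by simp
 qed
 have "homotopic_with (%_. True) ?Z mtopology id (%x. h (1, x))"
 proof (rule homotopy_by_graph)
  let ?P = "prod_topology (prod_topology ?I ?Z) mtopology"
  have c1': "continuous_map ?P ?Z (%z. snd (fst z))"
   by (rule continuous_map_compose[OF continuous_map_fst continuous_map_snd, unfolded o_def])
  have c1: "continuous_map ?P mtopology (%z. snd (fst z))" by (rule continuous_map_into_fulltopology[OF c1'])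
  have c2: "continuous_map ?P mtopology snd" by (rule continuous_map_snd)
  have c3: "continuous_map ?P euclideanreal (%z. fst (fst z))" by (rule continuous_map_into_fulltopology[OF
      continuous_map_compose[OF continuous_map_fst continuous_map_fst, unfolded o_def]])
  have "closedin ?P {z : topspace ?P. snd z \<preceq> snd (fst z)}" by (rule closedin_below_graph[OF c2 c1])
  moreover have "closedin ?P {z : topspace ?P. rho (snd z) = t (fst (fst z)) (snd (fst z))}" unfolding t_def
   using continuous_map_compose[OF c2 continuous_map_rho] continuous_map_compose[OF c1 continuous_map_rho] c3
   by (intro closedin_eq_reals) (auto simp: o_def intro!: continuous_intros)
  ultimately have "closedin ?P ({z : topspace ?P. snd z \<preceq> snd (fst z)} \<inter>
    {z : topspace ?P. rho (snd z) = t (fst (fst z)) (snd (fst z))})" by (rule closedin_Int)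
  moreover have "\<dots> = {((s, x), y). s : {0..1} & x : ?W & y = h (s, x)}"
   using h hu by (auto 0 3)
  ultimately show "closedin ?P {((s, x), y). s : {0..1} & x : ?W & y = h (s, x)}" by simp
  show "h (0, x) = x" if "x : ?W" for x using hu[of x 0 x] that below_refl by (auto simp: t_def)
 qed (use h in auto)
 moreover have "h (1, x) : N" if "x : ?W" for x
  using h[of x 1] that rho_zero_iff[of "h (1, x)"] by (auto simp: t_def)
 ultimately show ?thesis by (intro exI[of _ "%x. h (1, x)"]) auto
qed

theorem homotopic_distance_le_cut:
 assumes cl: "closedin mtopology cut"
  and f: "continuous_map mtopology Y f" and g: "continuous_map mtopology Y g"
 shows "homotopic_distance mtopology Y f g <=
  subspace_distance mtopology N Y f g + subspace_distance mtopology cut Y f g + 1"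
proof -
 obtain r where r: "homotopic_with (%_. True) (subtopology mtopology (X - cut)) mtopology id r" "r ` (X - cut) \<subseteq> N"
  using deformation_to_N[OF cl] by blast
 have "openin mtopology (X - cut)" "openin mtopology (X - N)" using cl N_closed openin_diff[OF open_in_mspace] by auto
 thus ?thesis
 proof (intro homotopic_distance_le_two_deformations[OF _ r _ deformation_to_cut[OF cl] _ _ _ _ f g])
  show "X - cut \<union> (X - N) = topspace mtopology" by (auto simp: cut_def)
  show "to_cut ` (X - N) \<subseteq> cut" using to_cut by auto
 qed (use N_sub cut_subset in auto)
qed

end

section \<open>Functions of class $C^k$\<close>

text \<open>Higher derivatives are taken one basis direction at a time, so every level again
  concerns functions with values in \<open>'b\<close>, and no spaces of multilinear maps occur.
  Derivatives within \<open>S\<close> cover closed intervals as well as open sets.\<close>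

primrec Ck :: "nat => ('a::euclidean_space => 'b::real_normed_vector) => 'a set => bool" where
 "Ck 0 f S \<longleftrightarrow> continuous_on S f"
| "Ck (Suc n) f S \<longleftrightarrow> (EX f'. (ALL x:S. (f has_derivative f' x) (at x within S)) &
   (ALL b:Basis. Ck n (%x. f' x b) S))"

lemma Ck_SucI:
 assumes "!!x. x : S ==> (f has_derivative f' x) (at x within S)"
  and "!!b. b : Basis ==> Ck n (%x. f' x b) S"
 shows "Ck (Suc n) f S" using assms by auto

lemma Ck_SucD: "Ck (Suc n) f S ==> Ck n f S"
proof (induction n arbitrary: f)
 case 0
 thus ?case by (metis Ck.simps continuous_on_eq_continuous_within has_derivative_continuous)
next
 case (Suc n)
 thus ?case by (metis Ck.simps(2))
qed

lemma Ck_mono: "Ck n f S ==> m <= n ==> Ck m f S"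
proof (induction n)
 case (Suc n)
 thus ?case by (cases "m = Suc n") (auto dest: Ck_SucD simp del: Ck.simps)
qed auto

lemma Ck_continuous_on: "Ck n f S ==> continuous_on S f" using Ck_mono[of n f S 0] by simp

lemma Ck_cong: "Ck n f S ==> (!!x. x : S ==> f x = g x) ==> Ck n g S"
proof (induction n)
 case 0
 thus ?case using continuous_on_cong[of S S f g] by auto
next
 case (Suc n)
 then obtain f' where "ALL x:S. (f has_derivative f' x) (at x within S)" "ALL b:Basis. Ck n (%x. f' x b) S"
  by auto
 hence "ALL x:S. (g has_derivative f' x) (at x within S)" "ALL b:Basis. Ck n (%x. f' x b) S"
  using Suc.prems(2) by (metis has_derivative_transform)+
 thus ?case by auto
qed

lemma Ck_subset: "Ck n f S ==> T \<subseteq> S ==> Ck n f T"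
proof (induction n arbitrary: f)
 case 0
 thus ?case using continuous_on_subset by auto
next
 case (Suc n)
 then obtain f' where "ALL x:S. (f has_derivative f' x) (at x within S)" "ALL b:Basis. Ck n (%x. f' x b) S"
  by auto
 hence "ALL x:T. (f has_derivative f' x) (at x within T)" "ALL b:Basis. Ck n (%x. f' x b) T"
  using Suc by (auto intro: has_derivative_subset)
 thus ?case by auto
qed

lemma Ck_const [simp]: "Ck n (%x. c) S"
proof (induction n arbitrary: c)
 case (Suc n)
 show ?case by (rule Ck_SucI[of _ _ "%x v. 0"]) (auto intro: Suc)
qed simp

lemma Ck_linear: "bounded_linear f ==> Ck n f S"
proof (cases n)
 case (Suc m)
 assume "bounded_linear f"
 thus ?thesis unfolding Suc by (intro Ck_SucI[of _ _ "%x. f"]) (auto intro: bounded_linear_imp_has_derivative)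
qed (auto intro: linear_continuous_on)

lemma Ck_id [simp]: "Ck n (%x. x) S" by (rule Ck_linear) (rule bounded_linear_ident)

lemma Ck_add: "Ck n f S ==> Ck n g S ==> Ck n (%x. f x + g x) S"
proof (induction n arbitrary: f g)
 case 0
 thus ?case by (auto intro: continuous_intros)
next
 case (Suc n)
 then obtain f' g' where "ALL x:S. (f has_derivative f' x) (at x within S)" "ALL b:Basis. Ck n (%x. f' x b) S"
  "ALL x:S. (g has_derivative g' x) (at x within S)" "ALL b:Basis. Ck n (%x. g' x b) S"
  by auto
 thus ?case by (intro Ck_SucI[of _ _ "%x v. f' x v + g' x v"]) (auto intro: Suc.IH derivative_eq_intros)
qed

lemma Ck_bilinear: "bounded_bilinear B ==> Ck n f S ==> Ck n g S ==> Ck n (%x. B (f x) (g x)) S"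
proof (induction n arbitrary: f g)
 case 0
 thus ?case by (auto intro: bounded_bilinear.continuous_on)
next
 case (Suc n)
 then obtain f' g' where *: "ALL x:S. (f has_derivative f' x) (at x within S)" "ALL b:Basis. Ck n (%x. f' x b) S"
  "ALL x:S. (g has_derivative g' x) (at x within S)" "ALL b:Basis. Ck n (%x. g' x b) S"
  by auto
 have "Ck n f S" "Ck n g S" using Suc.prems by (auto dest: Ck_SucD simp del: Ck.simps)
 hence "Ck n (%x. B (f x) (g' x b)) S" "Ck n (%x. B (f' x b) (g x)) S" if "b : Basis" for b
  using Suc.IH[OF Suc.prems(1), of f "%x. g' x b"] Suc.IH[OF Suc.prems(1), of "%x. f' x b" g] * that by auto
 thus ?case by (intro Ck_SucI[of _ _ "%x v. B (f x) (g' x v) + B (f' x v) (g x)"] Ck_add)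
   (use * Suc.prems(1) in \<open>auto intro: bounded_bilinear.FDERIV\<close>)
qed

lemma Ck_bounded_linear: "bounded_linear L ==> Ck n f S ==> Ck n (%x. L (f x)) S"
proof (induction n arbitrary: f)
 case 0
 thus ?case by (auto intro: bounded_linear.continuous_on)
next
 case (Suc n)
 then obtain f' where "ALL x:S. (f has_derivative f' x) (at x within S)" "ALL b:Basis. Ck n (%x. f' x b) S"
  by auto
 thus ?case using Suc
  by (intro Ck_SucI[of _ _ "%x v. L (f' x v)"]) (auto intro: bounded_linear.has_derivative)
qed

lemmas Ck_scaleR = Ck_bilinear[OF bounded_bilinear_scaleR]
 and Ck_mult = Ck_bilinear[OF bounded_bilinear_mult]
 and Ck_inner = Ck_bilinear[OF bounded_bilinear_inner]
 and Ck_inner_left = Ck_bounded_linear[OF bounded_linear_inner_left]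
 and Ck_fst = Ck_bounded_linear[OF bounded_linear_fst]
 and Ck_snd = Ck_bounded_linear[OF bounded_linear_snd]
 and Ck_minus = Ck_bounded_linear[OF bounded_linear_minus[OF bounded_linear_ident]]

lemma Ck_diff: "Ck n f S ==> Ck n g S ==> Ck n (%x. f x - g x) S"
 using Ck_add[OF _ Ck_minus, of n f S g] by simp

lemma Ck_sum: "(!!i. i : I ==> Ck n (f i) S) ==> Ck n (%x. \<Sum>i\<in>I. f i x) S"
 by (induction I rule: infinite_finite_induct) (auto intro: Ck_add)

lemma Ck_componentwise:
 fixes f :: "'a::euclidean_space => 'b::euclidean_space"
 assumes "!!b. b : Basis ==> Ck n (%x. f x \<bullet> b) S"
 shows "Ck n f S"
proof -
 have "Ck n (%x. \<Sum>b\<in>Basis. (f x \<bullet> b) *\<^sub>R b) S"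
  by (intro Ck_sum Ck_scaleR assms Ck_const)
 thus ?thesis by (rule Ck_cong) (simp add: euclidean_representation)
qed

lemma Ck_Pair:
 assumes "Ck n f S" "Ck n g S"
 shows "Ck n (%x. (f x, g x)) S"
proof -
 have "Ck n (%x. (f x, 0) + (0, g x)) S"
  by (intro Ck_add Ck_bounded_linear[where L="%x. (x, 0)"] Ck_bounded_linear[where L="%x. (0, x)"] assms
    bounded_linear_Pair bounded_linear_ident bounded_linear_zero)
 thus ?thesis by simp
qed

lemma linear_sum_Basis:
 fixes f :: "'a::euclidean_space => 'b::real_vector"
 assumes "linear f"
 shows "f v = (\<Sum>b\<in>Basis. (v \<bullet> b) *\<^sub>R f b)"
proof -
 have "f v = f (\<Sum>b\<in>Basis. (v \<bullet> b) *\<^sub>R b)" by (simp add: euclidean_representation)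
 also have "\<dots> = (\<Sum>b\<in>Basis. (v \<bullet> b) *\<^sub>R f b)"
  using assms by (simp add: linear_sum linear_scale)
 finally show ?thesis .
qed

lemma Ck_derivative_dir:
 assumes "ALL x:S. (f has_derivative f' x) (at x within S)" "ALL b:Basis. Ck n (%x. f' x b) S"
  and "Ck n v S"
 shows "Ck n (%x. f' x (v x)) S"
proof -
 have "Ck n (%x. \<Sum>b\<in>Basis. (v x \<bullet> b) *\<^sub>R f' x b) S"
  using assms by (intro Ck_sum Ck_scaleR Ck_inner_left) auto
 thus ?thesis by (rule Ck_cong) (metis assms(1) has_derivative_linear linear_sum_Basis)
qed

lemma Ck_compose:
 assumes "Ck n f T" "Ck n g S" "g ` S \<subseteq> T"
 shows "Ck n (%x. f (g x)) S" using assms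
proof (induction n arbitrary: f)
 case 0
 thus ?case by (auto intro: continuous_on_compose2)
next
 case (Suc n)
 then obtain f' g' where *: "ALL x:T. (f has_derivative f' x) (at x within T)" "ALL b:Basis. Ck n (%x. f' x b) T"
  "ALL x:S. (g has_derivative g' x) (at x within S)" "ALL b:Basis. Ck n (%x. g' x b) S"
  by auto
 have g: "Ck n g S" using Suc.prems by (auto dest: Ck_SucD simp del: Ck.simps)
 show ?case
 proof (rule Ck_SucI[of _ _ "%x v. f' (g x) (g' x v)"])
  fix x assume "x : S"
  hence "(f has_derivative f' (g x)) (at (g x) within g ` S)"
   using *(1) Suc.prems(3) by (meson has_derivative_subset image_subset_iff)
  thus "((%x. f (g x)) has_derivative (%v. f' (g x) (g' x v))) (at x within S)"
   using has_derivative_in_compose[of g "g' x" x S f "f' (g x)"] *(3) \<open>x : S\<close> by blast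
 next
  fix b :: 'c assume b: "b : Basis"
  have "Ck n (%x. \<Sum>c\<in>Basis. (g' x b \<bullet> c) *\<^sub>R f' (g x) c) S"
   using Suc.IH[OF _ g Suc.prems(3)] *(2,4) b by (intro Ck_sum Ck_scaleR Ck_inner_left) blast+
  moreover have "(\<Sum>c\<in>Basis. (g' x b \<bullet> c) *\<^sub>R f' (g x) c) = f' (g x) (g' x b)" if "x : S" for x
  proof -
   have "g x : T" using that Suc.prems by auto
   hence "linear (f' (g x))" using *(1) has_derivative_linear by blast
   thus ?thesis using linear_sum_Basis[of "f' (g x)" "g' x b"] by simp
  qed
  ultimately show "Ck n (%x. f' (g x) (g' x b)) S" by (rule Ck_cong)
 qed
qed

lemma Ck_inverse:
 fixes f :: "'a::euclidean_space => real"
 shows "Ck n f S ==> (!!x. x : S ==> f x ~= 0) ==> Ck n (%x. inverse (f x)) S"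
proof (induction n)
 case 0
 thus ?case by (auto intro: continuous_intros)
next
 case (Suc n)
 then obtain f' where *: "ALL x:S. (f has_derivative f' x) (at x within S)" "ALL b:Basis. Ck n (%x. f' x b) S"
  by auto
 have f: "Ck n f S" using Suc.prems by (auto dest: Ck_SucD simp del: Ck.simps)
 have i: "Ck n (%x. inverse (f x)) S" using Suc f by blast
 show ?case
 proof (rule Ck_SucI[of _ _ "%x v. - (inverse (f x) * f' x v * inverse (f x))"])
  show "((%x. inverse (f x)) has_derivative (%v. - (inverse (f x) * f' x v * inverse (f x)))) (at x within S)"
   if "x : S" for x by (rule Deriv.has_derivative_inverse) (use * Suc.prems(2)[OF that] that in auto)
 qed (intro Ck_minus Ck_mult i, use * in auto)
qed

lemma Ck_sqrt:
 fixes f :: "'a::euclidean_space => real"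
 shows "Ck n f S ==> (!!x. x : S ==> f x > 0) ==> Ck n (%x. sqrt (f x)) S"
proof (induction n)
 case 0
 thus ?case by (auto intro: continuous_intros)
next
 case (Suc n)
 then obtain f' where *: "ALL x:S. (f has_derivative f' x) (at x within S)" "ALL b:Basis. Ck n (%x. f' x b) S"
  by auto
 have f: "Ck n f S" using Suc.prems by (auto dest: Ck_SucD simp del: Ck.simps)
 have i: "Ck n (%x. inverse (2 * sqrt (f x))) S" using Suc f by (intro Ck_inverse Ck_mult) (auto, smt (verit))
 show ?case
 proof (rule Ck_SucI[of _ _ "%x v. f' x v * inverse (2 * sqrt (f x))"])
  show "((%x. sqrt (f x)) has_derivative (%v. f' x v * inverse (2 * sqrt (f x)))) (at x within S)"
   if "x : S" for x using * Suc.prems(2)[OF that] that by (auto intro!: derivative_eq_intros simp: field_simps)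
 qed (intro Ck_mult i, use * in auto)
qed

text \<open>In finite dimension, continuity of the derivative in each basis direction is continuity
  in operator norm.\<close>

lemma Ck_blinfun_derivative:
 fixes f :: "'a::euclidean_space => 'b::real_normed_vector"
 assumes "Ck (Suc 0) f S"
 obtains f' :: "'a => 'a \<Rightarrow>\<^sub>L 'b" where "!!x. x : S ==> (f has_derivative f' x) (at x within S)"
  "continuous_on S f'"
proof -
 obtain f' where *: "ALL x:S. (f has_derivative f' x) (at x within S)" "ALL b:Basis. continuous_on S (%x. f' x b)"
  using assms by auto
 have ap: "blinfun_apply (Blinfun (f' x)) = f' x" if "x : S" for x
  using * that by (intro bounded_linear_Blinfun_apply) (auto intro: has_derivative_bounded_linear)
 have "continuous_on S (%x. Blinfun (f' x))"
 proof (rule continuous_on_blinfun_componentwise)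
  fix i :: 'a assume "i : Basis"
  thus "continuous_on S (%x. blinfun_apply (Blinfun (f' x)) i)"
   using *(2) ap by (auto cong: continuous_on_cong)
 qed
 thus ?thesis using that[of "%x. Blinfun (f' x)"] * ap by auto
qed

lemma Ck_of_blinfun:
 fixes f :: "'a::euclidean_space => 'b::real_normed_vector" and f' :: "'a => 'a \<Rightarrow>\<^sub>L 'b"
 assumes "!!x. x : S ==> (f has_derivative f' x) (at x within S)" "continuous_on S f'"
 shows "Ck (Suc 0) f S"
 by (rule Ck_SucI[of _ _ "%x. blinfun_apply (f' x)"]) (use assms in \<open>auto intro: continuous_intros\<close>)

lemma Ck_lipschitz:
 fixes f :: "'a::euclidean_space => 'b::real_normed_vector"
 assumes f: "Ck (Suc 0) f S" and K: "compact K" "convex K" "K \<subseteq> S"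
 obtains L where "0 < L" "!!x y. x : K ==> y : K ==> norm (f x - f y) <= L * norm (x - y)"
proof -
 obtain f' :: "'a => 'a \<Rightarrow>\<^sub>L 'b" where f': "!!x. x : S ==> (f has_derivative f' x) (at x within S)" "continuous_on S f'"
  using Ck_blinfun_derivative[OF f] by blast
 have "compact (f' ` K)" by (rule compact_continuous_image[OF continuous_on_subset[OF f'(2) K(3)] K(1)])
 hence "bounded (f' ` K)" by (rule compact_imp_bounded)
 then obtain L where L: "L > 0" "!!x. x : K ==> norm (f' x) <= L"
  unfolding bounded_pos by auto
 have "norm (f x - f y) <= L * norm (x - y)" if "x : K" "y : K" for x y
 proof (rule differentiable_bound[OF K(2)])
  show "(f has_derivative f' z) (at z within K)" if "z : K" for z
   using f' K that by (auto intro: has_derivative_subset)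
  show "onorm (blinfun_apply (f' z)) <= L" if "z : K" for z
   using L(2)[OF that] by (simp add: norm_blinfun.rep_eq)
 qed (use that in auto)
 thus ?thesis using L that by blast
qed

text \<open>The constant is the sum of the Lipschitz constants in the basis directions. The Taylor
  estimate is the mean value inequality for \<open>f - f' x\<close> on the segment from
  \<open>x\<close> to \<open>y\<close>, where the derivative has norm at most
  \<open>L * norm (y - x)\<close>.\<close>

lemma Ck_deriv_lipschitz:
 fixes f :: "'a::euclidean_space => 'b::real_normed_vector"
 assumes f: "ALL x:S. (f has_derivative f' x) (at x within S)" "ALL b:Basis. Ck (Suc 0) (%x. f' x b) S"
  and K: "compact K" "convex K" "K \<subseteq> S"
 obtains L where "0 < L" "!!x y v. x : K ==> y : K ==> norm (f' x v - f' y v) <= L * norm (x - y) * norm v"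
  "!!x y. x : K ==> y : K ==> norm (f y - f x - f' x (y - x)) <= L * (norm (y - x))\<^sup>2"
proof -
 have "ALL b:Basis. EX L>0. ALL x:K. ALL y:K. norm (f' x b - f' y b) <= L * norm (x - y)"
 proof
  fix b :: 'a assume "b : Basis"
  hence "Ck (Suc 0) (%x. f' x b) S" using f(2) by blast
  from Ck_lipschitz[OF this K] show "EX L>0. ALL x:K. ALL y:K. norm (f' x b - f' y b) <= L * norm (x - y)"
   by metis
 qed
 then obtain L where L: "!!b. b : Basis ==> 0 < L b"
  "!!b x y. b : Basis ==> x : K ==> y : K ==> norm (f' x b - f' y b) <= L b * norm (x - y)"
  by metis
 define M where "M = (\<Sum>b\<in>Basis. L b)"
 have M: "M > 0" unfolding M_def using L by (intro sum_pos) auto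
 have 1: "norm (f' x v - f' y v) <= M * norm (x - y) * norm v" if "x : K" "y : K" for x y v
 proof -
  have "linear (f' x)" "linear (f' y)" using that K f(1) has_derivative_linear by blast+
  hence "f' x v - f' y v = (\<Sum>b\<in>Basis. (v \<bullet> b) *\<^sub>R (f' x b - f' y b))"
   using linear_sum_Basis[of "f' x" v] linear_sum_Basis[of "f' y" v] by (simp add: sum_subtractf scaleR_diff_right)
  also have "norm \<dots> <= (\<Sum>b\<in>Basis. norm v * (L b * norm (x - y)))"
  proof (rule sum_norm_le)
   fix b :: 'a assume b: "b : Basis"
   have "\<bar>v \<bullet> b\<bar> <= norm v" using b by (simp add: Basis_le_norm)
   thus "norm ((v \<bullet> b) *\<^sub>R (f' x b - f' y b)) <= norm v * (L b * norm (x - y))"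
    using L(2)[OF b that] by (auto intro!: mult_mono)
  qed
  also have "\<dots> = M * norm (x - y) * norm v" by (simp add: M_def sum_distrib_left sum_distrib_right mult_ac)
  finally show ?thesis .
 qed
 have 2: "norm (f y - f x - f' x (y - x)) <= M * (norm (y - x))\<^sup>2" if "x : K" "y : K" for x y
 proof -
  have seg: "closed_segment x y \<subseteq> K" using that K(2) by (simp add: closed_segment_subset)
  have lin: "linear (f' x)" "bounded_linear (f' x)" using that K f(1) has_derivative_linear has_derivative_bounded_linear by blast+
  have "norm ((f y - f' x y) - (f x - f' x x)) <= (M * norm (y - x)) * norm (y - x)"
  proof (rule differentiable_bound[of "closed_segment x y"])
   fix z assume z: "z : closed_segment x y"
   have "(f has_derivative f' z) (at z within closed_segment x y)"
    using f(1) z seg K by (meson has_derivative_subset subsetD order_trans)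
   thus "((%z. f z - f' x z) has_derivative (%h. f' z h - f' x h)) (at z within closed_segment x y)"
    by (intro has_derivative_diff bounded_linear_imp_has_derivative lin)
   show "onorm (%h. f' z h - f' x h) <= M * norm (y - x)"
   proof (rule onorm_le)
    fix h
    have "norm (f' z h - f' x h) <= M * norm (z - x) * norm h" using 1 z seg that by blast
    also have "\<dots> <= M * norm (y - x) * norm h"
     using M segment_bound1[OF z] by (intro mult_right_mono mult_left_mono) auto
    finally show "norm (f' z h - f' x h) <= M * norm (y - x) * norm h" .
   qed
  qed auto
  thus ?thesis using lin by (simp add: linear_diff algebra_simps power2_eq_square)
 qed
 show ?thesis using that[OF M 1 2] by blast
qed

text \<open>The inverse \<open>g\<close> has the derivative inverse to \<open>F (g y)\<close>. That
  this derivative depends continuously on \<open>y\<close> follows from the formula for a difference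
  of two inverse operators.\<close>

lemma C1_inverse_function:
 fixes f :: "'a::euclidean_space => 'a"
 assumes f: "Ck (Suc 0) f S" and S: "open S" "x0 : S"
  and f': "(f has_derivative A) (at x0)" and inj: "!!h. A h = 0 ==> h = 0"
 obtains U V g where "open U" "U \<subseteq> S" "x0 : U" "open V" "f x0 : V" "homeomorphism U V f g" "Ck (Suc 0) g V"
proof -
 have "EX F :: 'a => 'a \<Rightarrow>\<^sub>L 'a. (ALL x:S. (f has_derivative blinfun_apply (F x)) (at x)) & continuous_on S (F :: 'a => 'a \<Rightarrow>\<^sub>L 'a)"
 proof (rule Ck_blinfun_derivative[OF f])
  fix F :: "'a => 'a \<Rightarrow>\<^sub>L 'a"
  assume "!!x. x : S ==> (f has_derivative blinfun_apply (F x)) (at x within S)" "continuous_on S (F :: 'a => 'a \<Rightarrow>\<^sub>L 'a)"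
  thus ?thesis using at_within_open[OF _ S(1)] by (intro exI[of _ F]) simp
 qed
 then obtain F :: "'a => 'a \<Rightarrow>\<^sub>L 'a" where F0: "ALL x:S. (f has_derivative blinfun_apply (F x)) (at x)"
  and F1: "continuous_on S (F :: 'a => 'a \<Rightarrow>\<^sub>L 'a)" by auto
 have F: "(f has_derivative blinfun_apply (F x)) (at x)" if "x : S" for x using F0 that by blast
 have FA: "blinfun_apply (F x0) = A" by (rule has_derivative_unique[OF F[OF S(2)] f'])
 have linA: "linear A" by (rule has_derivative_linear[OF f'])
 have injA: "inj A" using linA inj by (simp add: linear_injective_0)
 obtain B where B: "linear B" "B \<circ> A = id" using linear_injective_left_inverse[OF linA injA] by blast
 have bB: "bounded_linear B" using B linear_linear by blast
 have BF: "Blinfun B o\<^sub>L F x0 = id_blinfun"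
  using B(2) bounded_linear_Blinfun_apply[OF bB] FA by (intro blinfun_eqI) (simp add: fun_eq_iff)
 obtain U V g g' where *: "open U" "U \<subseteq> S" "x0 : U" "open V" "f x0 : V" "homeomorphism U V f g"
  and g': "!!y. y : V ==> (g has_derivative (g' y)) (at y)"
   "!!y. y : V ==> g' y = inv (blinfun_apply (F (g y)))" "!!y. y : V ==> bij (blinfun_apply (F (g y)))"
  by (rule inverse_function_theorem[OF S(1) _ F1 S(2) BF]) (erule F, rule that, assumption+)
 have gc: "continuous_on V g" and gV: "g ` V = U" using *(6) by (auto simp: homeomorphism_def)
 have cont: "continuous_on V (%y. g' y b)" for b unfolding continuous_on_eq_continuous_at[OF *(4)]
 proof
  fix y0 assume y0: "y0 : V"
  have inv: "F (g y) (g' y h) = h" if "y : V" for y h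
   using g'(2,3)[OF that] by (simp add: bij_is_surj surj_f_inv_f)
  have inv2: "g' y (F (g y) h) = h" if "y : V" for y h using g'(2,3)[OF that] by (simp add: bij_is_inj)
  have bl: "bounded_linear (g' y0)" by (rule has_derivative_bounded_linear[OF g'(1)[OF y0]])
  obtain C where C: "C > 0" "!!h. norm (g' y0 h) <= norm h * C"
   using bounded_linear.pos_bounded[OF bl] by blast
  have "continuous_on V (%y. F (g y))" by (rule continuous_on_compose2[OF F1 gc]) (use gV *(2) in auto)
  hence tF: "((%y. F (g y)) \<longlongrightarrow> F (g y0)) (at y0)"
   using *(4) y0 by (simp add: continuous_on_eq_continuous_at isCont_def)
  \<comment> \<open>Resolvent identity: if \<open>S\<close> and \<open>S0\<close> are inverse to
    \<open>F\<close> and \<open>F0\<close>, then \<open>S - S0 = S0 (F0 - F) S\<close>.\<close>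
  have id: "g' y b - g' y0 b = g' y0 ((F (g y0) - F (g y)) (g' y b))" if "y : V" for y
  proof -
   have "g' y0 ((F (g y0) - F (g y)) (g' y b)) = g' y0 (F (g y0) (g' y b) - b)"
    using inv that by (simp add: blinfun.diff_left)
   also have "\<dots> = g' y b - g' y0 b" using inv2 y0 bl by (simp add: linear_diff[OF bounded_linear.linear])
   finally show ?thesis by simp
  qed
  \<comment> \<open>The smallness condition absorbs half of \<open>norm (g' y b)\<close>, so that
    this unknown quantity is at most twice the fixed \<open>norm (g' y0 b)\<close>.\<close>
  have bound: "norm (g' y b - g' y0 b) <= 2 * C * norm (F (g y0) - F (g y)) * norm (g' y0 b)"
   if "y : V" "C * norm (F (g y0) - F (g y)) < 1/2" for y
  proof -
   let ?k = "norm (F (g y0) - F (g y))"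
   have "norm (g' y b - g' y0 b) <= norm ((F (g y0) - F (g y)) (g' y b)) * C" using id[OF that(1)] C(2) by simp
   also have "\<dots> <= (?k * norm (g' y b)) * C" using C norm_blinfun by (intro mult_right_mono) auto
   finally have 1: "norm (g' y b - g' y0 b) <= C * ?k * norm (g' y b)" by (simp add: mult_ac)
   have "norm (g' y b) <= norm (g' y b - g' y0 b) + norm (g' y0 b)"
    using norm_triangle_sub[of "g' y b" "g' y0 b"] by simp
   moreover have "C * ?k * norm (g' y b) <= 1/2 * norm (g' y b)" using that by (intro mult_right_mono) auto
   ultimately have "norm (g' y b) <= 2 * norm (g' y0 b)" using 1 by linarith
   hence "C * ?k * norm (g' y b) <= C * ?k * (2 * norm (g' y0 b))" using C by (intro mult_left_mono) auto
   thus ?thesis using 1 by (simp add: mult_ac)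
  qed
  have tk: "((%y. norm (F (g y0) - F (g y))) \<longlongrightarrow> 0) (at y0)"
   using tendsto_norm[OF tendsto_diff[OF tendsto_const[of "F (g y0)"] tF]] by simp
  have "((%y. C * norm (F (g y0) - F (g y))) \<longlongrightarrow> C * 0) (at y0)" by (intro tendsto_mult tk tendsto_const)
  hence "\<forall>\<^sub>F y in at y0. C * norm (F (g y0) - F (g y)) < 1/2" by (rule order_tendstoD) simp
  moreover have "\<forall>\<^sub>F y in at y0. y : V" using *(4) y0 eventually_at_in_open' by blast
  ultimately have ev: "\<forall>\<^sub>F y in at y0. norm (g' y b - g' y0 b) <= 2 * C * norm (F (g y0) - F (g y)) * norm (g' y0 b)"
   by eventually_elim (rule bound)
  have "((%y. 2 * C * norm (F (g y0) - F (g y)) * norm (g' y0 b)) \<longlongrightarrow> 2 * C * 0 * norm (g' y0 b)) (at y0)"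
   by (intro tendsto_intros tk)
  hence "((%y. 2 * C * norm (F (g y0) - F (g y)) * norm (g' y0 b)) \<longlongrightarrow> 0) (at y0)" by simp
  with ev have "((%y. g' y b - g' y0 b) \<longlongrightarrow> 0) (at y0)" by (rule Lim_null_comparison)
  thus "isCont (%y. g' y b) y0" by (simp add: isCont_def LIM_zero_iff)
 qed
 have "Ck (Suc 0) g V"
 proof (rule Ck_SucI[of _ _ g'])
  show "(g has_derivative g' y) (at y within V)" if "y : V" for y
   using g'(1)[OF that] by (rule has_derivative_at_withinI)
  show "Ck 0 (%y. g' y b) V" for b using cont by simp
 qed
 thus ?thesis using that * by blast
qed

lemma Ck_SucE:
 assumes "Ck (Suc n) f S"
 obtains f' where "ALL x:S. (f has_derivative f' x) (at x within S)" "ALL b:Basis. Ck n (%x. f' x b) S"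
 using assms by auto

lemma Ck_has_derivative:
 assumes "Ck (Suc n) f S" "open S" "x : S"
 shows "EX D. (f has_derivative D) (at x)"
proof -
 obtain f' where "ALL x:S. (f has_derivative f' x) (at x within S)" "ALL b:Basis. Ck n (%x. f' x b) S"
  by (rule Ck_SucE[OF assms(1)]) (rule that, assumption+)
 thus ?thesis using assms(3) at_within_open[OF assms(3,2)] by metis
qed

section \<open>Positive definite bilinear forms and linear systems depending on a parameter\<close>

lemma bilinear_sum_Basis:
 fixes B :: "'b::euclidean_space => 'b => real"
 assumes "bilinear B"
 shows "B u w = (\<Sum>b\<in>Basis. \<Sum>b'\<in>Basis. (u \<bullet> b) * (w \<bullet> b') * B b b')"
proof -
 have l: "linear (%u. B u w)" "!!u. linear (B u)" for w using assms by (auto simp: bilinear_def)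
 have "B u w = (\<Sum>b\<in>Basis. (u \<bullet> b) *\<^sub>R B b w)" by (rule linear_sum_Basis[OF l(1)])
 also have "\<dots> = (\<Sum>b\<in>Basis. (u \<bullet> b) *\<^sub>R (\<Sum>b'\<in>Basis. (w \<bullet> b') *\<^sub>R B b b'))"
  by (intro sum.cong refl arg_cong[where f="%x. _ *\<^sub>R x"] linear_sum_Basis[OF l(2)])
 finally show ?thesis by (simp add: sum_distrib_left mult_ac)
qed

lemma bilinear_diff_bound:
 fixes B C :: "'b::euclidean_space => 'b => real"
 assumes "bilinear B" "bilinear C"
 shows "\<bar>B u w - C u w\<bar> <= (\<Sum>b\<in>Basis. \<Sum>b'\<in>Basis. \<bar>B b b' - C b b'\<bar>) * norm u * norm w"
proof -
 have "B u w - C u w = (\<Sum>b\<in>Basis. \<Sum>b'\<in>Basis. (u \<bullet> b) * (w \<bullet> b') * (B b b' - C b b'))"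
  unfolding bilinear_sum_Basis[OF assms(1), of u w] bilinear_sum_Basis[OF assms(2), of u w]
  by (simp add: sum_subtractf right_diff_distrib)
 also have "\<bar>\<dots>\<bar> <= (\<Sum>b\<in>Basis. \<Sum>b'\<in>Basis. \<bar>(u \<bullet> b) * (w \<bullet> b') * (B b b' - C b b')\<bar>)"
  by (intro order.trans[OF sum_abs] sum_mono sum_abs)
 also have "\<dots> <= (\<Sum>b\<in>Basis. \<Sum>b'\<in>Basis. norm u * norm w * \<bar>B b b' - C b b'\<bar>)"
  unfolding abs_mult by (intro sum_mono mult_right_mono mult_mono) (auto simp: Basis_le_norm)
 also have "\<dots> = (\<Sum>b\<in>Basis. \<Sum>b'\<in>Basis. \<bar>B b b' - C b b'\<bar>) * norm u * norm w"
  by (simp add: sum_distrib_left sum_distrib_right mult_ac)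
 finally show ?thesis .
qed

lemma pos_form_coercive:
 fixes B :: "'b::euclidean_space => 'b => real"
 assumes B: "bilinear B" and pos: "!!v. v ~= 0 ==> 0 < B v v"
 obtains m where "0 < m" "!!v. m * (norm v)\<^sup>2 <= B v v"
proof -
 have bb: "bounded_bilinear B" using B bilinear_conv_bounded_bilinear by blast
 have "continuous_on (sphere 0 1) (%v. B v v)"
  by (rule bounded_bilinear.continuous_on[OF bb]) (auto intro: continuous_intros)
 moreover have "sphere (0::'b) 1 ~= {}" using vector_choose_size[of 1] by auto
 ultimately obtain v0 where v0: "v0 : sphere 0 1" "!!v. v : sphere 0 1 ==> B v0 v0 <= B v v"
  using continuous_attains_inf[of "sphere (0::'b) 1" "%v. B v v"] by auto
 have "B v0 v0 * (norm v)\<^sup>2 <= B v v" for v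
 proof (cases "v = 0")
  case False
  have "B v0 v0 <= B ((1 / norm v) *\<^sub>R v) ((1 / norm v) *\<^sub>R v)" using False by (intro v0(2)) simp
  also have "\<dots> = B v v / (norm v)\<^sup>2" using B by (simp add: bilinear_lmul bilinear_rmul power2_eq_square)
  finally show ?thesis using False by (simp add: field_simps)
 next
  case True
  thus ?thesis using B by (simp add: bilinear_lzero)
 qed
 moreover have "0 < B v0 v0" using v0(1) pos[of v0] by (cases "v0 = 0") auto
 ultimately show ?thesis using that by blast
qed

text \<open>\<open>T\<close> raises an index: it inverts the Gram operator \<open>L\<close>, which
  is injective by positivity and hence bijective in finite dimension.\<close>

lemma form_inverse:
 fixes B :: "'b::euclidean_space => 'b => real"
 assumes B: "bilinear B" and pos: "!!v. v ~= 0 ==> 0 < B v v"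
 obtains T where "linear T" "!!c w. B (T c) w = c \<bullet> w" "!!z c. (!!b. b : Basis ==> B z b = c \<bullet> b) ==> z = T c"
proof -
 have l: "linear (%u. B u w)" "linear (B u)" for u w using B by (auto simp: bilinear_def)
 define L where "L v = (\<Sum>b\<in>Basis. B v b *\<^sub>R b)" for v
 have Lb: "L v \<bullet> b = B v b" if "b : Basis" for v b
  unfolding L_def using that by (simp add: inner_sum_left inner_Basis if_distrib cong: if_cong)
 have Lw: "L v \<bullet> w = B v w" for v w
 proof -
  have "B v w = (\<Sum>b\<in>Basis. (w \<bullet> b) * B v b)" using linear_sum_Basis[OF l(2), of v w] by simp
  moreover have "L v \<bullet> w = (\<Sum>b\<in>Basis. B v b * (b \<bullet> w))" by (simp add: L_def inner_sum_left)
  ultimately show ?thesis by (simp add: inner_commute mult.commute)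
 qed
 have "linear L"
  by (rule linearI; rule euclidean_eqI) (simp_all add: Lw inner_add_left bilinear_ladd[OF B] bilinear_lmul[OF B])
 moreover have "inj L"
 proof (rule linear_injective_0[OF \<open>linear L\<close>, THEN iffD2], intro allI impI)
  fix v assume "L v = 0"
  hence "B v v = 0" using Lw[of v v] by simp
  thus "v = 0" using pos[of v] by auto
 qed
 ultimately obtain T where T: "linear T" "!!x. T (L x) = x" "!!x. L (T x) = x"
  using linear_injective_isomorphism by blast
 show ?thesis
 proof (rule that[OF T(1)])
  show "B (T c) w = c \<bullet> w" for c w using Lw[of "T c" w] T(3) by simp
  show "z = T c" if "!!b. b : Basis ==> B z b = c \<bullet> b" for z c
  proof -
   have "L z = c" by (rule euclidean_eqI) (simp add: that Lb)
   thus ?thesis using T(2)[of z] by simp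
  qed
 qed
qed

text \<open>The product is \<open>f x * h y + (f y - f x) * h y\<close>, and the second term is a
  small factor times one of order \<open>norm (y - x)\<close>. So continuity of \<open>f\<close>
  suffices; in \<open>Ck_solve\<close> the role of \<open>f\<close> is played by a solution whose
  differentiability is still to be shown.\<close>

lemma has_derivative_mult_vanishing:
 fixes f h :: "'a::real_normed_vector => real"
 assumes f: "continuous (at x within S) f" and h: "(h has_derivative h') (at x within S)" and h0: "h x = 0"
 shows "((%y. f y * h y) has_derivative (%v. f x * h' v)) (at x within S)"
proof -
 have "((%y. (f y - f x) * h y) has_derivative (%v. 0)) (at x within S)"
  unfolding has_derivative_within_alt2
 proof (intro conjI allI impI bounded_linear_zero)
  fix e :: real assume e: "0 < e"
  have bl: "bounded_linear h'" using h has_derivative_bounded_linear by blast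
  obtain K where K: "0 < K" "!!v. norm (h' v) <= norm v * K" using bounded_linear.pos_bounded[OF bl] by blast
  have 1: "\<forall>\<^sub>F y in at x within S. norm (h y - h x - h' (y - x)) <= 1 * norm (y - x)"
   using h unfolding has_derivative_within_alt2 by (meson zero_less_one)
  have "(f \<longlongrightarrow> f x) (at x within S)" using f by (simp add: continuous_within)
  hence 2: "\<forall>\<^sub>F y in at x within S. dist (f y) (f x) < e / (K + 1)" using e K by (intro tendstoD) auto
  from 1 2 show "\<forall>\<^sub>F y in at x within S. norm ((f y - f x) * h y - (f x - f x) * h x - 0) <= e * norm (y - x)"
  proof eventually_elim
   case (elim y)
   have "norm (h y) <= norm (h y - h' (y - x)) + norm (h' (y - x))"
    using norm_triangle_sub[of "h y" "h' (y - x)"] by simp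
   also have "\<dots> <= (K + 1) * norm (y - x)" using elim(1) K(2)[of "y - x"] h0 by (simp add: algebra_simps)
   finally have "norm (h y) <= (K + 1) * norm (y - x)" .
   hence "\<bar>f y - f x\<bar> * \<bar>h y\<bar> <= e / (K + 1) * ((K + 1) * norm (y - x))"
    using elim(2) K(1) by (intro mult_mono) (auto simp: dist_real_def)
   also have "\<dots> = e * norm (y - x)" using K(1) by (simp add: field_simps)
   finally show ?case by (simp add: abs_mult)
  qed
 qed
 from has_derivative_add[OF this has_derivative_mult_right[OF h, of "f x"]]
 show ?thesis by (simp add: algebra_simps)
qed

text \<open>Coercivity of \<open>g x0\<close>, applied to the difference of solutions, bounds
  \<open>m * norm (z x - z x0)\<close> by the changes of the form and of the right side. Once the
  form has changed by less than \<open>m / 2\<close>, the term containing the difference is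
  absorbed, whence the factor \<open>2 / m\<close>.\<close>

lemma continuous_solve:
 fixes g :: "'a::euclidean_space => 'b::euclidean_space => 'b => real"
 assumes bil: "!!x. x : S ==> bilinear (g x)" and pos: "!!x v. x : S ==> v ~= 0 ==> 0 < g x v v"
  and g: "!!b b'. b : Basis ==> b' : Basis ==> continuous_on S (%x. g x b b')"
  and c: "continuous_on S c" and z: "!!x w. x : S ==> g x (z x) w = c x \<bullet> w"
 shows "continuous_on S z" unfolding continuous_on_def
proof
 fix x0 assume x0: "x0 : S"
 obtain m where m: "0 < m" "!!v. m * (norm v)\<^sup>2 <= g x0 v v"
  using pos_form_coercive[OF bil[OF x0] pos[OF x0]] by blast
 define ep where "ep x = (\<Sum>b\<in>Basis. \<Sum>b'\<in>Basis. \<bar>g x0 b b' - g x b b'\<bar>)" for x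
 define dl where "dl x = norm (c x - c x0)" for x
 have ep0: "0 <= ep x" for x unfolding ep_def by (intro sum_nonneg) auto
 have "(ep \<longlongrightarrow> (\<Sum>b\<in>(Basis::'b set). \<Sum>b'\<in>(Basis::'b set). \<bar>g x0 b b' - g x0 b b'\<bar>)) (at x0 within S)"
  unfolding ep_def using g x0
  by (intro tendsto_sum tendsto_rabs tendsto_diff tendsto_const) (auto simp: continuous_on_def)
 hence te: "(ep \<longlongrightarrow> 0) (at x0 within S)" by simp
 have "(dl \<longlongrightarrow> norm (c x0 - c x0)) (at x0 within S)"
  unfolding dl_def using c x0 by (intro tendsto_norm tendsto_diff tendsto_const) (auto simp: continuous_on_def)
 hence td: "(dl \<longlongrightarrow> 0) (at x0 within S)" by simp
 have bound: "norm (z x - z x0) <= 2 / m * (ep x * norm (z x0) + dl x)" if x: "x : S" "ep x < m / 2" for x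
 proof -
  let ?y = "z x - z x0"
  have "g x0 ?y ?y = (g x0 (z x) ?y - g x (z x) ?y) + (c x - c x0) \<bullet> ?y"
   using z[OF x(1), of ?y] z[OF x0, of ?y] bil[OF x0] by (simp add: bilinear_lsub inner_diff_left)
  also have "\<dots> <= ep x * norm (z x) * norm ?y + dl x * norm ?y"
  proof (rule add_mono)
   show "g x0 (z x) ?y - g x (z x) ?y <= ep x * norm (z x) * norm ?y"
    using bilinear_diff_bound[OF bil[OF x0] bil[OF x(1)], of "z x" ?y] by (simp add: ep_def)
   show "(c x - c x0) \<bullet> ?y <= dl x * norm ?y" unfolding dl_def by (rule norm_cauchy_schwarz)
  qed
  finally have "(m * norm ?y) * norm ?y <= (ep x * norm (z x) + dl x) * norm ?y"
   using m(2)[of ?y] by (simp add: power2_eq_square algebra_simps)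
  hence 1: "m * norm ?y <= ep x * norm (z x) + dl x \<or> ?y = 0"
   by (metis mult_right_le_imp_le zero_less_norm_iff)
  have "norm (z x) <= norm ?y + norm (z x0)" using norm_triangle_sub[of "z x" "z x0"] by simp
  hence "ep x * norm (z x) <= ep x * norm ?y + ep x * norm (z x0)"
   using ep0[of x] by (metis distrib_left mult_left_mono)
  moreover have "ep x * norm ?y <= m / 2 * norm ?y" using x by (intro mult_right_mono) auto
  ultimately have "m / 2 * norm ?y <= ep x * norm (z x0) + dl x"
  proof (cases "?y = 0")
   case True
   thus ?thesis using ep0[of x] by (simp add: dl_def)
  next
   case False
   have "m / 2 * norm ?y = m * norm ?y - m / 2 * norm ?y" by (simp add: algebra_simps)
   with False 1 show ?thesis
    using \<open>ep x * norm (z x) <= _\<close> \<open>ep x * norm ?y <= m / 2 * norm ?y\<close> by linarith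
  qed
  thus ?thesis using m(1) by (simp add: field_simps)
 qed
 have "\<forall>\<^sub>F x in at x0 within S. ep x < m / 2" using te m(1) by (intro order_tendstoD) auto
 moreover have "\<forall>\<^sub>F x in at x0 within S. x : S" by (simp add: eventually_at_filter)
 ultimately have "\<forall>\<^sub>F x in at x0 within S. norm (z x - z x0) <= 2 / m * (ep x * norm (z x0) + dl x)"
  by eventually_elim (rule bound)
 moreover have "((%x. 2 / m * (ep x * norm (z x0) + dl x)) \<longlongrightarrow> 2 / m * (0 * norm (z x0) + 0)) (at x0 within S)"
  by (intro tendsto_mult tendsto_add tendsto_const te td)
 hence "((%x. 2 / m * (ep x * norm (z x0) + dl x)) \<longlongrightarrow> 0) (at x0 within S)" by simp
 ultimately have "((%x. z x - z x0) \<longlongrightarrow> 0) (at x0 within S)" by (rule Lim_null_comparison)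
 thus "(z \<longlongrightarrow> z x0) (at x0 within S)" by (simp add: LIM_zero_iff)
qed

text \<open>Differentiating the equation for \<open>z\<close> gives a system with the same form
  \<open>g x\<close> for the derivative of \<open>z\<close>, whose right side involves first
  derivatives of the data and \<open>z\<close> itself. So induction on \<open>n\<close> applies,
  with the solution general in the induction. Gradients and Christoffel vectors are treated this
  way.\<close>

lemma Ck_solve:
 fixes g :: "'a::euclidean_space => 'b::euclidean_space => 'b => real"
 assumes bil: "!!x. x : S ==> bilinear (g x)" and pos: "!!x v. x : S ==> v ~= 0 ==> 0 < g x v v"
  and g: "!!b b'. b : Basis ==> b' : Basis ==> Ck n (%x. g x b b') S"
  and rhs: "Ck n rhs S" and z: "!!x w. x : S ==> g x (z x) w = rhs x \<bullet> w"
 shows "Ck n z S" using g rhs z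
proof (induction n arbitrary: rhs z)
 case 0
 show ?case unfolding Ck.simps by (rule continuous_solve[OF bil pos]) (use 0 in auto)
next
 case (Suc n)
 have gn: "Ck n (%x. g x b b') S" if "b : Basis" "b' : Basis" for b b'
  using Suc.prems(1)[OF that] by (rule Ck_SucD)
 have zn: "Ck n z S" by (rule Suc.IH[OF gn Ck_SucD[OF Suc.prems(2)] Suc.prems(3)])
 have zc: "continuous_on S z" using zn by (rule Ck_continuous_on)
 define dg where "dg b b' = (SOME D. (ALL x:S. ((%x. g x b b') has_derivative D x) (at x within S)) &
   (ALL i:Basis. Ck n (%x. D x i) S))" for b b'
 have dg': "(ALL x:S. ((%x. g x b b') has_derivative dg b b' x) (at x within S)) &
   (ALL i:Basis. Ck n (%x. dg b b' x i) S)" if "b : Basis" "b' : Basis" for b b'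
  by (rule someI_ex[OF Suc.prems(1)[OF that, unfolded Ck.simps], folded dg_def])
 hence dg: "((%x. g x b b') has_derivative dg b b' x) (at x within S)"
  if "b : Basis" "b' : Basis" "x : S" for b b' x using that by blast
 have dgC: "Ck n (%x. dg b b' x i) S" if "b : Basis" "b' : Basis" "i : Basis" for b b' i
  using dg' that by blast
 obtain drhs where drhs': "ALL x:S. (rhs has_derivative drhs x) (at x within S)"
  "ALL i:Basis. Ck n (%x. drhs x i) S" by (rule Ck_SucE[OF Suc.prems(2)]) (rule that, assumption+)
 note drhs = bspec[OF drhs'(1)] bspec[OF drhs'(2)]
 \<comment> \<open>The derivative of \<open>rhs\<close> minus the derivative of the form, evaluated
   at the vector \<open>z x\<close>.\<close>
 define rhs' where "rhs' x v = (\<Sum>b\<in>Basis. (drhs x v \<bullet> b - (\<Sum>b'\<in>Basis. (z x \<bullet> b') * dg b' b x v)) *\<^sub>R b)" for x v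
 define P where "P x T \<longleftrightarrow> linear T & (ALL c w. g x (T c) w = c \<bullet> w) &
   (ALL z c. (ALL b:Basis. g x z b = c \<bullet> b) --> z = T c)" for x T
 define T where "T x = (SOME T. P x T)" for x
 have PT: "P x (T x)" if "x : S" for x
 proof -
  have "EX T. P x T"
  proof (rule form_inverse[OF bil[OF that] pos[OF that]])
   fix T assume *: "linear T" "!!c w. g x (T c) w = c \<bullet> w"
    "!!z c. (!!b. b : Basis ==> g x z b = c \<bullet> b) ==> z = T c"
   have "P x T" unfolding P_def using *(1,2) by (intro conjI allI impI *(3)) auto
   thus ?thesis by blast
  qed
  thus ?thesis unfolding T_def by (rule someI_ex)
 qed
 have T: "linear (T x)" "g x (T x c) w = c \<bullet> w"
  "(!!b. b : Basis ==> g x z b = c \<bullet> b) ==> z = T x c" if "x : S" for x c w z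
  using PT[OF that] unfolding P_def by auto
 have der: "(z has_derivative (%v. T x0 (rhs' x0 v))) (at x0 within S)" if x0: "x0 : S" for x0
 proof -
  \<comment> \<open>The increment \<open>z x - z x0\<close> solves the system frozen at
    \<open>x0\<close> with right side \<open>c x\<close>. In \<open>c\<close> the function
    \<open>z\<close>, so far only continuous, is multiplied by factors that vanish at
    \<open>x0\<close>.\<close>
  define c where "c x = (\<Sum>b\<in>Basis. ((rhs x \<bullet> b - rhs x0 \<bullet> b) - (\<Sum>b'\<in>Basis. (z x \<bullet> b') * (g x b' b - g x0 b' b))) *\<^sub>R b)" for x
  have cz: "z x = z x0 + T x0 (c x)" if "x : S" for x
  proof -
   have lin: "linear (%u. g x u b)" "linear (%u. g x0 u b)" for b
    using bil[OF that] bil[OF x0] by (auto simp: bilinear_def)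
   have "z x - z x0 = T x0 (c x)"
   proof (rule T(3)[OF x0])
    fix b :: 'b assume b: "b : Basis"
    have "g x (z x) b = (\<Sum>b'\<in>Basis. (z x \<bullet> b') * g x b' b)" "g x0 (z x) b = (\<Sum>b'\<in>Basis. (z x \<bullet> b') * g x0 b' b)"
     using linear_sum_Basis[OF lin(1), of "z x"] linear_sum_Basis[OF lin(2), of "z x"] by simp_all
    hence "(\<Sum>b'\<in>Basis. (z x \<bullet> b') * (g x b' b - g x0 b' b)) = rhs x \<bullet> b - g x0 (z x) b"
     using Suc.prems(3)[OF that, of b] by (simp add: right_diff_distrib sum_subtractf)
    moreover have "c x \<bullet> b = (rhs x \<bullet> b - rhs x0 \<bullet> b) - (\<Sum>b'\<in>Basis. (z x \<bullet> b') * (g x b' b - g x0 b' b))"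
     unfolding c_def using b by (simp add: inner_sum_left inner_Basis if_distrib cong: if_cong)
    ultimately show "g x0 (z x - z x0) b = c x \<bullet> b"
     using Suc.prems(3)[OF x0, of b] bilinear_lsub[OF bil[OF x0]] by simp
   qed
   thus ?thesis by (simp add: algebra_simps)
  qed
  have "(c has_derivative rhs' x0) (at x0 within S)" unfolding c_def rhs'_def
  proof (intro has_derivative_sum has_derivative_scaleR_left has_derivative_diff)
   fix b :: 'b assume b: "b : Basis"
   show "((%x. rhs x \<bullet> b - rhs x0 \<bullet> b) has_derivative (%x. drhs x0 x \<bullet> b)) (at x0 within S)"
    using has_derivative_diff[OF has_derivative_inner_left[OF drhs(1)[OF x0], of b] has_derivative_const, of "rhs x0 \<bullet> b"]
    by simp
   fix b' :: 'b assume b': "b' : Basis"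
   have zi: "continuous (at x0 within S) (%x. z x \<bullet> b')"
    using zc x0 by (simp add: continuous_on_eq_continuous_within continuous_inner)
   have "((%x. g x b' b - g x0 b' b) has_derivative dg b' b x0) (at x0 within S)"
    using has_derivative_diff[OF dg[OF b' b x0] has_derivative_const, of "g x0 b' b"] by simp
   from has_derivative_mult_vanishing[OF zi this]
   show "((%x. z x \<bullet> b' * (g x b' b - g x0 b' b)) has_derivative (%x. z x0 \<bullet> b' * dg b' b x0 x)) (at x0 within S)"
    by simp
  qed
  hence "((%x. T x0 (c x)) has_derivative (%v. T x0 (rhs' x0 v))) (at x0 within S)"
   by (rule bounded_linear.has_derivative[OF T(1)[OF x0, unfolded linear_conv_bounded_linear]])
  from has_derivative_add[OF has_derivative_const[of "z x0"] this]
  have zd: "((%x. z x0 + T x0 (c x)) has_derivative (%v. T x0 (rhs' x0 v))) (at x0 within S)" by simp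
  show ?thesis by (rule has_derivative_transform[OF x0 cz zd])
 qed
 show ?case
 proof (rule Ck_SucI[of _ _ "%x v. T x (rhs' x v)"])
  show "(z has_derivative (%v. T x (rhs' x v))) (at x within S)" if "x : S" for x using der that .
  fix i :: 'a assume i: "i : Basis"
  show "Ck n (%x. T x (rhs' x i)) S"
  proof (rule Suc.IH[OF gn])
   show "Ck n (%x. rhs' x i) S" unfolding rhs'_def using i
    by (intro Ck_sum Ck_scaleR Ck_const Ck_diff Ck_inner_left Ck_mult drhs(2) zn dgC) auto
  qed (use T(2) in auto)
 qed
qed

lemma smooth_on_imp_Ck:
 assumes "smooth_on x S"
 shows "Ck n x S"
proof -
 obtain D where D: "D 0 = x" "!!k t. t : S ==> (D k has_vector_derivative D (Suc k) t) (at t within S)"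
  using assms unfolding smooth_on_def by blast
 have "Ck n (D k) S" for k
 proof (induction n arbitrary: k)
  case 0
  show ?case unfolding Ck.simps continuous_on_eq_continuous_within
   by (intro ballI has_vector_derivative_continuous[OF D(2)])
 next
  case (Suc n)
  show ?case by (rule Ck_SucI[of _ _ "%t h. h *\<^sub>R D (Suc k) t"])
    (use D(2) Suc in \<open>auto simp: has_vector_derivative_def\<close>)
 qed
 thus ?thesis using D(1) by metis
qed

text \<open>\<open>smooth_on\<close> asks for one coherent sequence of derivatives of all orders. On
  a set without isolated points the vector derivative is unique, so iterating it gives this
  sequence, and every member is again of all classes.\<close>

lemma Ck_imp_smooth_on:
 assumes x: "!!n. Ck n x S" and S: "!!t. t : S ==> at t within S ~= bot"
 shows "smooth_on x S"
proof -
 define D where "D = rec_nat x (%_ f t. vector_derivative f (at t within S))"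
 have D0: "D 0 = x" and DS: "!!k. D (Suc k) = (%t. vector_derivative (D k) (at t within S))"
  by (auto simp: D_def)
 have *: "Ck n (D k) S" for n k
 proof (induction k arbitrary: n)
  case 0
  thus ?case using x D0 by simp
 next
  case (Suc k)
  obtain f' where f': "ALL t:S. (D k has_derivative f' t) (at t within S)" "ALL b:Basis. Ck n (%t. f' t b) S"
   by (rule Ck_SucE[OF Suc[of "Suc n"]]) (rule that, assumption+)
  have "D (Suc k) t = f' t 1" if "t : S" for t
  proof -
   have "linear (f' t)" by (rule has_derivative_linear[OF f'(1)[rule_format, OF that]])
   hence eq: "(%h. h *\<^sub>R f' t 1) = f' t"
    using linear_scale[of "f' t" _ 1] by (intro ext) (metis mult.right_neutral real_scaleR_def)
   have "(D k has_vector_derivative f' t 1) (at t within S)"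
    unfolding has_vector_derivative_def eq by (rule f'(1)[rule_format, OF that])
   thus ?thesis unfolding DS by (rule vector_derivative_within[OF S[OF that]])
  qed
  moreover have "Ck n (%t. f' t 1) S" using f'(2) by simp
  ultimately show ?case using Ck_cong[of n "%t. f' t 1" S "D (Suc k)"] by simp
 qed
 have "(D k has_vector_derivative D (Suc k) t) (at t within S)" if "t : S" for k t
 proof -
  obtain f' where f': "ALL t:S. (D k has_derivative f' t) (at t within S)" "ALL b:Basis. Ck 0 (%t. f' t b) S"
   by (rule Ck_SucE[OF *[of "Suc 0" k]]) (rule that, assumption+)
  have "D k differentiable (at t within S)" unfolding differentiable_def
   using f'(1)[rule_format, OF \<open>t : S\<close>] by blast
  thus ?thesis unfolding DS by (simp only: vector_derivative_works)
 qed
 thus ?thesis unfolding smooth_on_def using D0 by blast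
qed

section \<open>Ordinary differential equations near an equilibrium\<close>

text \<open>The weight \<open>exp (2 * L * s)\<close> turns integration against a Lipschitz constant
  \<open>L\<close> into a contraction by one half. Both \<open>gronwall\<close> and
  \<open>picard\<close> rest on this.\<close>

lemma integral_exp_le:
 fixes L :: real
 assumes "0 < L" "0 <= t"
 shows "(%s. exp (2 * L * s)) integrable_on {0..t}" "L * integral {0..t} (%s. exp (2 * L * s)) <= exp (2 * L * t) / 2"
proof -
 have "((%s. exp (2 * L * s)) has_integral (exp (2 * L * t) / (2 * L) - exp (2 * L * 0) / (2 * L))) {0..t}"
  using assms by (intro fundamental_theorem_of_calculus)
   (auto intro!: derivative_eq_intros simp flip: has_real_derivative_iff_has_vector_derivative)
 hence *: "(%s. exp (2 * L * s)) integrable_on {0..t}"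
  "integral {0..t} (%s. exp (2 * L * s)) = exp (2 * L * t) / (2 * L) - 1 / (2 * L)"
  by (auto simp: has_integral_iff)
 show "(%s. exp (2 * L * s)) integrable_on {0..t}" by fact
 have "L * integral {0..t} (%s. exp (2 * L * s)) = exp (2 * L * t) / 2 - 1 / 2"
  unfolding *(2) using assms by (simp add: field_simps)
 thus "L * integral {0..t} (%s. exp (2 * L * s)) <= exp (2 * L * t) / 2" by simp
qed

text \<open>At the maximum \<open>u\<close> of the weighted difference, the integral inequality
  returns at most half of its left side, which can be subtracted. The defect \<open>dl\<close>
  allows \<open>z\<close> to be an approximate solution, as is needed for differentiating a
  flow.\<close>

lemma gronwall:
 fixes y z :: "real => 'b::banach"
 assumes c: "continuous_on {0..1} y" "continuous_on {0..1} z" "continuous_on {0..1} Y" "continuous_on {0..1} Z"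
  and y: "!!t. t : {0..1} ==> y t = a + integral {0..t} Y"
  and z: "!!t. t : {0..1} ==> z t = b + integral {0..t} Z"
  and L: "0 < L" "0 <= dl" and YZ: "!!s. s : {0..1} ==> norm (Y s - Z s) <= L * norm (y s - z s) + dl"
  and t: "t : {0..1}"
 shows "norm (y t - z t) <= 2 * (norm (a - b) + dl) * exp (2 * L)"
proof -
 let ?f = "%t. norm (y t - z t)"
 have cf: "continuous_on {0..1} (%t. exp (- (2 * L * t)) * ?f t)" by (intro continuous_intros c)
 obtain u where u: "u : {0..1}" "!!s. s : {0..1} ==> exp (- (2 * L * s)) * ?f s <= exp (- (2 * L * u)) * ?f u"
  using continuous_attains_sup[OF compact_Icc _ cf] by auto
 define m where "m = exp (- (2 * L * u)) * ?f u"
 have m0: "0 <= m" by (simp add: m_def)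
 have le: "?f s <= m * exp (2 * L * s)" if "s : {0..1}" for s
 proof -
  have "?f s = exp (- (2 * L * s)) * ?f s * exp (2 * L * s)" by (simp add: exp_minus field_simps)
  also have "\<dots> <= m * exp (2 * L * s)" unfolding m_def by (intro mult_right_mono u(2) that) auto
  finally show ?thesis .
 qed
 have sub: "{0..u} \<subseteq> {0..1}" using u(1) by auto
 have i: "Y integrable_on {0..u}" "Z integrable_on {0..u}"
  using c sub by (auto intro!: integrable_continuous_interval continuous_on_subset[OF _ sub])
 have "?f u = norm ((a - b) + integral {0..u} (%s. Y s - Z s))"
  unfolding y[OF u(1)] z[OF u(1)] integral_diff[OF i] by (simp add: algebra_simps)
 also have "\<dots> <= norm (a - b) + norm (integral {0..u} (%s. Y s - Z s))" by (rule norm_triangle_ineq)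
 also have "norm (integral {0..u} (%s. Y s - Z s)) <= integral {0..u} (%s. dl + (L * m) * exp (2 * L * s))"
 proof (rule integral_norm_bound_integral)
  show "(%s. Y s - Z s) integrable_on {0..u}" by (intro integrable_diff i)
  show "(%s. dl + L * m * exp (2 * L * s)) integrable_on {0..u}"
   by (intro integrable_continuous_interval continuous_intros)
  show "norm (Y s - Z s) <= dl + L * m * exp (2 * L * s)" if "s : {0..u}" for s
  proof -
   have s: "s : {0..1}" using that sub by auto
   have "L * ?f s <= L * (m * exp (2 * L * s))" using le[OF s] L by (intro mult_left_mono) auto
   thus ?thesis using YZ[OF s] by (simp add: mult.assoc)
  qed
 qed
 also have "integral {0..u} (%s. dl + (L * m) * exp (2 * L * s)) = dl * u + m * (L * integral {0..u} (%s. exp (2 * L * s)))"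
  using u(1) integral_exp_le(1)[of L u] L
  by (subst integral_add) (auto intro!: integrable_continuous_interval continuous_intros)
 also have "\<dots> <= dl + m * (exp (2 * L * u) / 2)"
  using u(1) L m0 integral_exp_le(2)[of L u] mult_left_le[of u dl] by (intro add_mono mult_left_mono) auto
 finally have "?f u <= (norm (a - b) + dl) + m * exp (2 * L * u) / 2" by simp
 moreover have "m * exp (2 * L * u) = ?f u" by (simp add: m_def exp_minus field_simps)
 ultimately have 1: "?f u <= 2 * (norm (a - b) + dl)" by simp
 have "m <= 1 * ?f u" unfolding m_def using L u(1) by (intro mult_right_mono) auto
 hence m2: "m <= 2 * (norm (a - b) + dl)" using 1 by simp
 have "?f t <= m * exp (2 * L * t)" by (rule le[OF t])
 also have "\<dots> <= 2 * (norm (a - b) + dl) * exp (2 * L)" using m2 m0 t L by (intro mult_mono) auto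
 finally show ?thesis .
qed

text \<open>Fixed point of the integral operator in the supremum norm with weight
  \<open>exp (- 2 L t)\<close>. In this norm the operator contracts by one half on the whole
  interval, however large \<open>L\<close> is, so time need not be subdivided.\<close>

lemma picard:
 fixes F :: "real => 'b::banach => 'b"
 assumes F: "!!y. continuous_on {0..1} y ==> continuous_on {0..1} (%s. F s (y s))"
  and L: "0 < L" and lip: "!!s x y. s : {0..1} ==> norm (F s x - F s y) <= L * norm (x - y)"
 obtains y where "continuous_on {0..1} y" "!!t. t : {0..1} ==> y t = z + integral {0..t} (%s. F s (y s))"
proof -
 \<comment> \<open>Precomposition with \<open>clip\<close> extends functions on the interval to
   bounded continuous functions on the line, which form a complete space.\<close>
 define clip :: "real => real" where "clip t = max 0 (min 1 t)" for t
 have clip: "clip t : {0..1}" "t : {0..1} ==> clip t = t" for t by (auto simp: clip_def)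
 have cclip: "continuous_on UNIV clip" unfolding clip_def by (intro continuous_intros)
 \<comment> \<open>The integral operator conjugated with the weight: the solution is
   \<open>exp (2 * L * t)\<close> times the fixed point.\<close>
 define Q where "Q u t = exp (- (2 * L * t)) *\<^sub>R (z + integral {0..t} (%s. F s (exp (2 * L * s) *\<^sub>R u s)))"
  for u :: "real => 'b" and t
 have cu: "continuous_on {0..1} (%s. F s (exp (2 * L * s) *\<^sub>R apply_bcontfun u s))" for u
  by (intro F continuous_intros continuous_on_apply_bcontfun)
 have cQ: "continuous_on {0..1} (Q (apply_bcontfun u))" for u
  unfolding Q_def using integrable_continuous_interval[OF cu[of u]]
  by (intro continuous_intros indefinite_integral_continuous_1)
 have Qb: "(%t. Q (apply_bcontfun u) (clip t)) : bcontfun" for u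
 proof -
  have "continuous_on UNIV (%t. Q (apply_bcontfun u) (clip t))"
   by (rule continuous_on_compose2[OF cQ cclip]) (use clip(1) in auto)
  moreover have "bounded (range (%t. Q (apply_bcontfun u) (clip t)))"
  proof (rule bounded_subset)
   show "bounded (Q (apply_bcontfun u) ` {0..1})"
    by (intro compact_imp_bounded compact_continuous_image cQ compact_Icc)
   show "range (%t. Q (apply_bcontfun u) (clip t)) \<subseteq> Q (apply_bcontfun u) ` {0..1}" using clip(1) by auto
  qed
  ultimately show ?thesis by (simp add: bcontfun_def)
 qed
 define P where "P u = Bcontfun (%t. Q (apply_bcontfun u) (clip t))" for u
 have P: "apply_bcontfun (P u) t = Q (apply_bcontfun u) (clip t)" for u t
  unfolding P_def using Bcontfun_inverse[OF Qb] by simp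
 have "dist (P u) (P v) <= 1/2 * dist u v" for u v
 proof (rule dist_bound)
  fix t0
  define t where "t = clip t0"
  have t: "t : {0..1}" unfolding t_def by (rule clip(1))
  have sub: "{0..t} \<subseteq> {0..1}" using t by auto
  have i: "(%s. F s (exp (2 * L * s) *\<^sub>R apply_bcontfun u s)) integrable_on {0..t}" for u
   by (intro integrable_continuous_interval continuous_on_subset[OF cu sub])
  have "norm (integral {0..t} (%s. F s (exp (2 * L * s) *\<^sub>R apply_bcontfun u s)) - integral {0..t} (%s. F s (exp (2 * L * s) *\<^sub>R apply_bcontfun v s)))
   = norm (integral {0..t} (%s. F s (exp (2 * L * s) *\<^sub>R apply_bcontfun u s) - F s (exp (2 * L * s) *\<^sub>R apply_bcontfun v s)))"
   using integral_diff[OF i i] by simp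
  also have "\<dots> <= integral {0..t} (%s. L * dist u v * exp (2 * L * s))"
  proof (rule integral_norm_bound_integral)
   show "(%s. F s (exp (2 * L * s) *\<^sub>R apply_bcontfun u s) - F s (exp (2 * L * s) *\<^sub>R apply_bcontfun v s)) integrable_on {0..t}"
    by (intro integrable_diff i)
   show "(%s. L * dist u v * exp (2 * L * s)) integrable_on {0..t}"
    by (intro integrable_continuous_interval continuous_intros)
   fix s assume "s : {0..t}"
   hence s: "s : {0..1}" using sub by auto
   have "norm (exp (2 * L * s) *\<^sub>R apply_bcontfun u s - exp (2 * L * s) *\<^sub>R apply_bcontfun v s)
     = exp (2 * L * s) * dist (apply_bcontfun u s) (apply_bcontfun v s)"
    by (simp add: dist_norm flip: scaleR_diff_right)
   also have "\<dots> <= exp (2 * L * s) * dist u v" by (intro mult_left_mono dist_bounded) auto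
   finally have "L * norm (exp (2 * L * s) *\<^sub>R apply_bcontfun u s - exp (2 * L * s) *\<^sub>R apply_bcontfun v s) <= L * (exp (2 * L * s) * dist u v)"
    using L by (intro mult_left_mono) auto
   thus "norm (F s (exp (2 * L * s) *\<^sub>R apply_bcontfun u s) - F s (exp (2 * L * s) *\<^sub>R apply_bcontfun v s)) <= L * dist u v * exp (2 * L * s)"
    using lip[OF s, of "exp (2 * L * s) *\<^sub>R apply_bcontfun u s" "exp (2 * L * s) *\<^sub>R apply_bcontfun v s"] by (simp add: mult_ac)
  qed
  also have "\<dots> = dist u v * (L * integral {0..t} (%s. exp (2 * L * s)))" by simp
  also have "\<dots> <= dist u v * (exp (2 * L * t) / 2)"
   using integral_exp_le(2)[of L t] L t by (intro mult_left_mono) auto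
  finally have "norm (integral {0..t} (%s. F s (exp (2 * L * s) *\<^sub>R apply_bcontfun u s)) - integral {0..t} (%s. F s (exp (2 * L * s) *\<^sub>R apply_bcontfun v s)))
   <= dist u v * (exp (2 * L * t) / 2)" .
  hence "exp (- (2 * L * t)) * norm (integral {0..t} (%s. F s (exp (2 * L * s) *\<^sub>R apply_bcontfun u s)) - integral {0..t} (%s. F s (exp (2 * L * s) *\<^sub>R apply_bcontfun v s)))
   <= exp (- (2 * L * t)) * (dist u v * (exp (2 * L * t) / 2))" by (intro mult_left_mono) auto
  also have "\<dots> = 1/2 * dist u v" by (simp add: exp_minus field_simps)
  finally show "dist (apply_bcontfun (P u) t0) (apply_bcontfun (P v) t0) <= 1/2 * dist u v"
   unfolding P t_def[symmetric] Q_def dist_norm scaleR_diff_right[symmetric] norm_scaleR by simp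
 qed
 then obtain u where u: "P u = u" using banach_fix_type[of "1/2" P] by auto
 define y where "y t = exp (2 * L * t) *\<^sub>R apply_bcontfun u t" for t
 show ?thesis
 proof (rule that)
  show "continuous_on {0..1} y" unfolding y_def by (intro continuous_intros continuous_on_apply_bcontfun)
  fix t :: real assume t: "t : {0..1}"
  have "apply_bcontfun u t = Q (apply_bcontfun u) t" using P[of u t] u clip(2)[OF t] by simp
  thus "y t = z + integral {0..t} (%s. F s (y s))"
   unfolding y_def[of t] by (simp add: Q_def y_def[abs_def] exp_minus)
 qed
qed

lemma has_derivative_quadratic:
 fixes f :: "'a::real_normed_vector => 'b::real_normed_vector"
 assumes A: "bounded_linear A" and S: "open S" "x : S"
  and q: "!!y. y : S ==> norm (f y - f x - A (y - x)) <= C * (norm (y - x))\<^sup>2"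
 shows "(f has_derivative A) (at x)" unfolding has_derivative_within_alt2
proof (intro conjI allI impI A)
 fix e :: real assume e: "0 < e"
 define K where "K = \<bar>C\<bar> + 1"
 have K: "K > 0" "C <= K" by (auto simp: K_def)
 have "\<forall>\<^sub>F y in at x. y : S" using S eventually_at_in_open' by blast
 moreover have "\<forall>\<^sub>F y in at x. dist y x < e / K"
  using e K by (intro eventually_at_ball'[THEN eventually_mono, of "e / K" x UNIV, simplified]) (auto simp: dist_commute)
 ultimately show "\<forall>\<^sub>F y in at x. norm (f y - f x - A (y - x)) <= e * norm (y - x)"
 proof eventually_elim
  case (elim y)
  have "norm (f y - f x - A (y - x)) <= C * (norm (y - x))\<^sup>2" by (rule q[OF elim(1)])
  also have "\<dots> <= (K * norm (y - x)) * norm (y - x)"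
   using K by (simp add: power2_eq_square mult_right_mono mult_ac)
  also have "\<dots> <= e * norm (y - x)"
   using elim(2) K by (intro mult_right_mono) (auto simp: dist_norm field_simps)
  finally show ?case .
 qed
qed

lemma integral_form:
 fixes y :: "real => 'b::banach"
 assumes "!!t. t : {0..1} ==> (y has_vector_derivative Y t) (at t within {0..1})" "t : {0..1}"
 shows "y t = y 0 + integral {0..t} Y"
proof -
 have "(Y has_integral (y t - y 0)) {0..t}"
  using assms(2) by (intro fundamental_theorem_of_calculus has_vector_derivative_within_subset[OF assms(1)]) auto
 thus ?thesis by (simp add: integral_unique)
qed

text \<open>Near a zero of \<open>X\<close> solutions move slowly: their distance from
  \<open>z0\<close> stays below \<open>C * norm (u - z0)\<close>. So for \<open>u\<close> close to
  \<open>z0\<close> they exist up to time one inside the ball where \<open>X\<close> is controlled.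
  The derivative in the initial value comes from the linearised equation.\<close>

theorem local_flow:
 fixes X :: "'z::euclidean_space => 'z"
 assumes X: "Ck (Suc (Suc 0)) X W" and z0: "X z0 = 0" and R: "0 < R" "cball z0 R \<subseteq> W" "open W"
 obtains r H C where "0 < r" "r < R" "0 < C" "!!u. u : ball z0 r ==> H u 0 = u"
  "!!u t. u : ball z0 r ==> t : {0..1} ==> norm (H u t - z0) <= C * norm (u - z0)"
  "!!u t. u : ball z0 r ==> t : {0..1} ==> H u t : ball z0 R"
  "!!u t. u : ball z0 r ==> t : {0..1} ==> (H u has_vector_derivative X (H u t)) (at t within {0..1})"
  "!!u u' t. u : ball z0 r ==> u' : ball z0 r ==> t : {0..1} ==> norm (H u t - H u' t) <= C * norm (u - u')"
  "Ck (Suc 0) (%u. H u 1) (ball z0 r)"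
  "!!u y t. u : ball z0 r ==> y 0 = u ==> (ALL t:{0..1}. y t : cball z0 R &
    (y has_vector_derivative X (y t)) (at t within {0..1})) ==> t : {0..1} ==> y t = H u t"
proof -
 let ?K = "cball z0 R"
 have K: "compact ?K" "convex ?K" "?K \<subseteq> W" using R by auto
 obtain DX' where DX': "ALL x:W. (X has_derivative DX' x) (at x within W)" "ALL b:Basis. Ck (Suc 0) (%x. DX' x b) W"
  by (rule Ck_SucE[OF X]) (rule that, assumption+)
 obtain L1 where L1: "0 < L1" "!!x y. x : ?K ==> y : ?K ==> norm (X x - X y) <= L1 * norm (x - y)"
  by (rule Ck_lipschitz[OF Ck_SucD[OF X] K]) (rule that, assumption+)
 obtain L2 where L2: "0 < L2" "!!x y v. x : ?K ==> y : ?K ==> norm (DX' x v - DX' y v) <= L2 * norm (x - y) * norm v"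
  "!!x y. x : ?K ==> y : ?K ==> norm (X y - X x - DX' x (y - x)) <= L2 * (norm (y - x))\<^sup>2"
  by (rule Ck_deriv_lipschitz[OF DX' K]) (rule that, assumption+)
 define DX where "DX x = Blinfun (DX' x)" for x
 have DX: "blinfun_apply (DX x) = DX' x" if "x : ?K" for x
 proof -
  have "bounded_linear (DX' x)" by (rule has_derivative_bounded_linear[OF DX'(1)[rule_format]]) (use that K in auto)
  thus ?thesis unfolding DX_def by (rule bounded_linear_Blinfun_apply)
 qed
 have DXlip: "norm (DX x - DX y) <= L2 * norm (x - y)" if "x : ?K" "y : ?K" for x y
  by (rule norm_blinfun_bound) (use L2 that DX in \<open>auto simp: blinfun.diff_left\<close>)
 have DXc: "continuous_on ?K DX"
 proof (rule lipschitz_on_continuous_on[of L2], rule lipschitz_onI)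
  show "dist (DX x) (DX y) <= L2 * dist x y" if "x : ?K" "y : ?K" for x y
   using DXlip[OF that] by (simp add: dist_norm)
 qed (use L2 in auto)
 have "bounded (DX ` ?K)" by (intro compact_imp_bounded compact_continuous_image DXc K)
 then obtain L3 where L3: "L3 > 0" "!!x. x : ?K ==> norm (DX x) <= L3"
  unfolding bounded_pos by auto
 \<comment> \<open>Outside the ball \<open>X\<close> is replaced by its value at the nearest point
   of the ball. This projection does not increase distances, so \<open>X'\<close> is globally
   Lipschitz with the constant of \<open>X\<close> on the ball.\<close>
 define X' where "X' x = X (closest_point ?K x)" for x
 have cpK: "closest_point ?K x : ?K" for x by (rule closest_point_in_set) (use R in auto)
 have X'eq: "X' x = X x" if "x : ?K" for x using that by (simp add: X'_def closest_point_self)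
 have X'lip: "norm (X' x - X' y) <= L1 * norm (x - y)" for x y
 proof -
  have "norm (X' x - X' y) <= L1 * norm (closest_point ?K x - closest_point ?K y)"
   unfolding X'_def by (intro L1 cpK)
  also have "\<dots> <= L1 * norm (x - y)"
   using L1 closest_point_lipschitz[of ?K x y] R by (intro mult_left_mono) (auto simp: dist_norm)
  finally show ?thesis .
 qed
 have X'c: "continuous_on UNIV X'"
 proof (rule lipschitz_on_continuous_on[of L1], rule lipschitz_onI)
  show "dist (X' x) (X' y) <= L1 * dist x y" for x y using X'lip by (simp add: dist_norm)
 qed (use L1 in auto)
 have X'yc: "continuous_on {0..1::real} (%s. X' (y s))" if "continuous_on {0..1} y" for y
  by (rule continuous_on_compose2[OF X'c that]) auto
 have "EX y. continuous_on {0..1::real} y & (ALL t:{0..1}. y t = u + integral {0..t} (%s. X' (y s)))" for u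
  by (rule picard[of "%s. X'" L1 u, OF X'yc L1(1) X'lip]) auto
 then obtain H where Hc: "!!u. continuous_on {0..1::real} (H u)"
  and H: "!!u t. t : {0..1} ==> H u t = u + integral {0..t} (%s. X' (H u s))" by metis
 define C where "C = 2 * exp (2 * L1)"
 have C: "C >= 2" using L1 by (simp add: C_def)
 have lip: "norm (H u t - H u' t) <= C * norm (u - u')" if "t : {0..1}" for u u' t
  using gronwall[OF Hc Hc X'yc[OF Hc] X'yc[OF Hc] H H L1(1) order_refl _ that] X'lip by (simp add: C_def mult_ac)
 have near: "norm (H u t - z0) <= C * norm (u - z0)" if "t : {0..1}" for u t
 proof -
  have "X' z0 = 0" using X'eq[of z0] z0 R by simp
  hence "norm (H u t - z0) <= 2 * (norm (u - z0) + 0) * exp (2 * L1)" using X'lip[of _ z0]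
   by (intro gronwall[of "H u" "%_. z0" "%s. X' (H u s)" "%_. 0" u z0 L1 0 t, OF Hc continuous_on_const
      X'yc[OF Hc] continuous_on_const H _ L1(1) order_refl _ that]) auto
  thus ?thesis by (simp add: C_def mult_ac)
 qed
 \<comment> \<open>Chosen so that \<open>C * r < R\<close>: solutions that start in the
   \<open>r\<close>-ball never leave the region where \<open>X'\<close> and \<open>X\<close>
   agree.\<close>
 define r where "r = R / (C + 1)"
 have r: "0 < r" "r < R" "C * r < R" using R C by (auto simp: r_def field_simps)
 have inball: "H u t : ball z0 R" if "u : ball z0 r" "t : {0..1}" for u t
 proof -
  have "norm (H u t - z0) <= C * norm (u - z0)" by (rule near[OF that(2)])
  also have "\<dots> <= C * r" using that(1) C by (intro mult_left_mono) (auto simp: dist_norm norm_minus_commute)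
  also have "\<dots> < R" by (rule r)
  finally show ?thesis by (simp add: dist_norm norm_minus_commute)
 qed
 have inK: "H u t : ?K" if "u : ball z0 r" "t : {0..1}" for u t using inball[OF that] by auto
 have deriv: "(H u has_vector_derivative X (H u t)) (at t within {0..1})" if "u : ball z0 r" "t : {0..1}" for u t
 proof -
  have "((%t. u + integral {0..t} (%s. X' (H u s))) has_vector_derivative 0 + X' (H u t)) (at t within {0..1})"
   by (intro has_vector_derivative_add has_vector_derivative_const
     integral_has_vector_derivative X'yc Hc that)
  hence "((%t. u + integral {0..t} (%s. X' (H u s))) has_vector_derivative X (H u t)) (at t within {0..1})"
   using X'eq[OF inK[OF that]] by simp
  with that(2) H[of _ u] show ?thesis by (rule has_vector_derivative_transform)
 qed
 have uniq: "y t = H u t" if "u : ball z0 r" "y 0 = u"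
  and y': "ALL t:{0..1}. y t : ?K & (y has_vector_derivative X (y t)) (at t within {0..1})"
  and t: "t : {0..1}" for u y t
 proof -
  note y = bspec[OF y']
  have yc: "continuous_on {0..1} y" unfolding continuous_on_eq_continuous_within
   by (intro ballI has_vector_derivative_continuous[OF conjunct2[OF y]])
  have "y t = u + integral {0..t} (%s. X' (y s))" if "t : {0..1}" for t
   unfolding \<open>y 0 = u\<close>[symmetric] by (rule integral_form[OF _ that]) (use y X'eq in auto)
  note g = gronwall[OF yc Hc X'yc[OF yc] X'yc[OF Hc] this H L1(1) order_refl _ t]
  have "norm (y t - H u t) <= 2 * (norm (u - u) + 0) * exp (2 * L1)"
  proof (rule g)
   fix s :: real
   show "norm (X' (y s) - X' (H u s)) <= L1 * norm (y s - H u s) + 0" using X'lip[of "y s" "H u s"] by simp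
  qed
  thus ?thesis by simp
 qed
 have DXyc: "continuous_on {0..1} (%s. DX (H u s))" if "u : ball z0 r" for u
  by (rule continuous_on_compose2[OF DXc Hc]) (use inK that in auto)
 \<comment> \<open>The linearised equation along \<open>H u\<close> with the identity as initial
   value; its solution is the derivative of the flow.\<close>
 have "EX W. continuous_on {0..1::real} W & (ALL t:{0..1}. W t = id_blinfun + integral {0..t} (%s. DX (H u s) o\<^sub>L W s))"
  if u: "u : ball z0 r" for u
 proof (rule picard[of "%s w. DX (H u s) o\<^sub>L w" L3 id_blinfun])
  show "continuous_on {0..1} (%s. DX (H u s) o\<^sub>L y s)" if "continuous_on {0..1} y" for y :: "real => 'z \<Rightarrow>\<^sub>L 'z"
   by (intro continuous_intros that DXyc u)
  show "norm ((DX (H u s) o\<^sub>L x) - (DX (H u s) o\<^sub>L y)) <= L3 * norm (x - y)" if "s : {0..1}" for s and x y :: "'z \<Rightarrow>\<^sub>L 'z"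
  proof -
   have "(DX (H u s) o\<^sub>L x) - (DX (H u s) o\<^sub>L y) = DX (H u s) o\<^sub>L (x - y)"
    by (simp add: bounded_bilinear.diff_right[OF bounded_bilinear_blinfun_compose])
   also have "norm \<dots> <= norm (DX (H u s)) * norm (x - y)" by (rule norm_blinfun_compose)
   also have "\<dots> <= L3 * norm (x - y)" by (intro mult_right_mono L3 inK u that) auto
   finally show ?thesis .
  qed
 qed (use L3 in auto)
 hence "ALL u. EX W. u : ball z0 r --> continuous_on {0..1::real} W & (ALL t:{0..1}. W t = id_blinfun + integral {0..t} (%s. DX (H u s) o\<^sub>L W s))"
  by blast
 then obtain V where "ALL u. u : ball z0 r --> continuous_on {0..1::real} (V u) & (ALL t:{0..1}. V u t = id_blinfun + integral {0..t} (%s. DX (H u s) o\<^sub>L V u s))"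
  unfolding choice_iff by (elim exE)
 hence Vc: "continuous_on {0..1::real} (V u)"
  and V: "!!t. t : {0..1} ==> V u t = id_blinfun + integral {0..t} (%s. DX (H u s) o\<^sub>L V u s)"
  if "u : ball z0 r" for u using that by auto
 have Vic: "continuous_on {0..1} (%s. DX (H u s) o\<^sub>L V u s)" if "u : ball z0 r" for u
  by (intro continuous_intros Vc DXyc that)
 have Xc: "continuous_on {0..1} (%s. X (H u s))" if "u : ball z0 r" for u
  using X'yc[OF Hc[of u]] by (rule continuous_on_eq) (use X'eq inK that in auto)
 have HX: "H u t = u + integral {0..t} (%s. X (H u s))" if "u : ball z0 r" "t : {0..1}" for u t
 proof -
  have "integral {0..t} (%s. X' (H u s)) = integral {0..t} (%s. X (H u s))"
   by (rule integral_cong) (use X'eq inK that in auto)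
  thus ?thesis using H[OF that(2), of u] by simp
 qed
 define C2 where "C2 = 2 * (L2 * C\<^sup>2) * exp (2 * L3)"
 \<comment> \<open>\<open>H u t + V u t h\<close> satisfies the equation of \<open>H u'\<close> up
   to a Taylor remainder of size \<open>L2 * (C * norm h)^2\<close>, and \<open>gronwall\<close>
   carries this quadratic defect to time one.\<close>
 have quad: "norm (H u' 1 - H u 1 - V u 1 (u' - u)) <= C2 * (norm (u' - u))\<^sup>2"
  if x: "u : ball z0 r" "u' : ball z0 r" for u u'
 proof -
  define h where "h = u' - u"
  let ?z = "%t. H u t + V u t h"
  let ?Z = "%s. X (H u s) + (DX (H u s) o\<^sub>L V u s) h"
  have zI: "?z t = u' + integral {0..t} ?Z" if "t : {0..1}" for t
  proof -
   have sub: "{0..t} \<subseteq> {0..1}" using that by auto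
   have i1: "(%s. X (H u s)) integrable_on {0..t}"
    by (intro integrable_continuous_interval continuous_on_subset[OF Xc sub] x)
   have i2: "(%s. DX (H u s) o\<^sub>L V u s) integrable_on {0..t}"
    by (intro integrable_continuous_interval continuous_on_subset[OF Vic sub] x)
   have bl: "bounded_linear (%A. blinfun_apply A h)" by (rule blinfun.bounded_linear_left)
   have i3: "(%s. (DX (H u s) o\<^sub>L V u s) h) integrable_on {0..t}"
    using integrable_linear[OF i2 bl] by (simp add: o_def)
   have "integral {0..t} (%s. (DX (H u s) o\<^sub>L V u s) h) = integral {0..t} (%s. DX (H u s) o\<^sub>L V u s) h"
    using integral_linear[OF i2 bl] by (simp add: o_def)
   hence "V u t h = h + integral {0..t} (%s. (DX (H u s) o\<^sub>L V u s) h)"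
    by (subst V[OF x(1) that]) (simp add: blinfun.add_left)
   thus ?thesis using HX[OF x(1) that] integral_add[OF i1 i3] by (simp add: h_def)
  qed
  have zB: "norm (X (H u' s) - ?Z s) <= L3 * norm (H u' s - ?z s) + L2 * (C * norm h)\<^sup>2" if s: "s : {0..1}" for s
  proof -
   let ?p = "H u s" and ?q = "H u' s"
   have pq: "?p : ?K" "?q : ?K" using inK x s by auto
   have "X ?q - ?Z s = (X ?q - X ?p - DX' ?p (?q - ?p)) + DX ?p (?q - ?z s)"
    using DX[OF pq(1)] by (simp add: blinfun.diff_right blinfun.add_right flip: DX[OF pq(1)])
   also have "norm \<dots> <= L2 * (norm (?q - ?p))\<^sup>2 + norm (DX ?p) * norm (?q - ?z s)"
    by (rule norm_triangle_mono[OF L2(3)[OF pq] norm_blinfun])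
   also have "\<dots> <= L2 * (C * norm h)\<^sup>2 + L3 * norm (?q - ?z s)"
    using lip[OF s, of u' u] L2(1) L3(2)[OF pq(1)] unfolding h_def
    by (intro add_mono mult_left_mono power_mono mult_right_mono) auto
   finally show ?thesis by simp
  qed
  have "norm (H u' 1 - ?z 1) <= 2 * (norm (u' - u') + L2 * (C * norm h)\<^sup>2) * exp (2 * L3)"
  proof (rule gronwall[of "H u'" ?z "%s. X (H u' s)" ?Z u' u' L3 "L2 * (C * norm h)\<^sup>2" 1])
   show "continuous_on {0..1} ?z" by (intro continuous_intros Hc Vc x)
   show "continuous_on {0..1} ?Z" by (intro continuous_on_add Xc x blinfun.continuous_on Vic continuous_on_const)
   show "0 <= L2 * (C * norm h)\<^sup>2" using L2 by simp
   show "continuous_on {0..1} (H u')" by (rule Hc)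
   show "continuous_on {0..1} (%s. X (H u' s))" by (rule Xc[OF x(2)])
   show "H u' t = u' + integral {0..t} (%s. X (H u' s))" if "t : {0..1}" for t by (rule HX[OF x(2) that])
  qed (rule zI zB L3 | assumption | simp)+
  thus ?thesis by (simp add: h_def C2_def power_mult_distrib mult_ac diff_diff_eq)
 qed
 have der1: "((%u. H u 1) has_derivative V u 1) (at u)" if "u : ball z0 r" for u
  by (rule has_derivative_quadratic[OF blinfun.bounded_linear_right open_ball that quad[OF that]])
 have "continuous_on (ball z0 r) (%u. V u 1)" unfolding continuous_on_eq_continuous_at[OF open_ball]
 proof
  fix u assume u: "u : ball z0 r"
  have "bounded (V u ` {0..1})" by (intro compact_imp_bounded compact_continuous_image Vc u compact_Icc)
  then obtain B where B: "B > 0" "!!t. t : {0..1} ==> norm (V u t) <= B"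
   unfolding bounded_pos by auto
  have bound: "norm (V u' 1 - V u 1) <= 2 * (L2 * C * B) * exp (2 * L3) * norm (u' - u)" if u': "u' : ball z0 r" for u'
  proof -
   have "norm ((DX (H u' s) o\<^sub>L V u' s) - (DX (H u s) o\<^sub>L V u s)) <= L3 * norm (V u' s - V u s) + L2 * C * B * norm (u' - u)"
    if s: "s : {0..1}" for s
   proof -
    let ?p = "H u s" and ?q = "H u' s"
    have pq: "?p : ?K" "?q : ?K" using inK u u' s by auto
    have "(DX ?q o\<^sub>L V u' s) - (DX ?p o\<^sub>L V u s) = (DX ?q o\<^sub>L (V u' s - V u s)) + ((DX ?q - DX ?p) o\<^sub>L V u s)"
     by (simp add: bounded_bilinear.diff_right[OF bounded_bilinear_blinfun_compose]
       bounded_bilinear.diff_left[OF bounded_bilinear_blinfun_compose])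
    also have "norm \<dots> <= norm (DX ?q) * norm (V u' s - V u s) + norm (DX ?q - DX ?p) * norm (V u s)"
     by (rule norm_triangle_mono[OF norm_blinfun_compose norm_blinfun_compose])
    also have "\<dots> <= L3 * norm (V u' s - V u s) + (L2 * (C * norm (u' - u))) * B"
    proof (rule add_mono)
     show "norm (DX ?q) * norm (V u' s - V u s) <= L3 * norm (V u' s - V u s)"
      by (intro mult_right_mono L3 pq) auto
     have "norm (DX ?q - DX ?p) <= L2 * norm (?q - ?p)" by (rule DXlip[OF pq(2,1)])
     also have "\<dots> <= L2 * (C * norm (u' - u))" using L2 lip[OF s] by (intro mult_left_mono) auto
     finally show "norm (DX ?q - DX ?p) * norm (V u s) <= L2 * (C * norm (u' - u)) * B"
      using B s C L2 by (intro mult_mono) auto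
    qed
    finally show ?thesis by (simp add: mult_ac)
   qed
   hence "norm (V u' 1 - V u 1) <= 2 * (norm (id_blinfun - id_blinfun :: 'z \<Rightarrow>\<^sub>L 'z) + L2 * C * B * norm (u' - u)) * exp (2 * L3)"
    using L2 L3 C B by (intro gronwall[of "V u'" "V u" "%s. DX (H u' s) o\<^sub>L V u' s" "%s. DX (H u s) o\<^sub>L V u s"
       id_blinfun id_blinfun L3 "L2 * C * B * norm (u' - u)" 1] Vc Vic V u u') auto
   thus ?thesis by (simp add: mult_ac)
  qed
  have "((%u'. 2 * (L2 * C * B) * exp (2 * L3) * norm (u' - u)) \<longlongrightarrow> 2 * (L2 * C * B) * exp (2 * L3) * norm (u - u)) (at u)"
   by (intro tendsto_intros)
  hence t0: "((%u'. 2 * (L2 * C * B) * exp (2 * L3) * norm (u' - u)) \<longlongrightarrow> 0) (at u)" by simp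
  have ev: "\<forall>\<^sub>F u' in at u. norm (V u' 1 - V u 1) <= 2 * (L2 * C * B) * exp (2 * L3) * norm (u' - u)"
   using eventually_at_in_open'[OF open_ball u] by eventually_elim (rule bound)
  have "((%u'. V u' 1 - V u 1) \<longlongrightarrow> 0) (at u)" by (rule Lim_null_comparison[OF ev t0])
  thus "isCont (%u. V u 1) u" by (simp add: isCont_def LIM_zero_iff)
 qed
 hence "Ck (Suc 0) (%u. H u 1) (ball z0 r)"
 proof (intro Ck_of_blinfun[where f="%u. H u 1" and f'="%u. V u 1" and S="ball z0 r"])
  show "((%u. H u 1) has_derivative blinfun_apply (V u 1)) (at u within ball z0 r)" if "u : ball z0 r" for u
   using der1[OF that] by (rule has_derivative_at_withinI)
 qed
 moreover have "H u 0 = u" for u using H[of 0 u] by simp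
 ultimately show ?thesis using C near lip inball deriv r by (intro that[of r C H]) (auto intro: uniq)
qed

section \<open>Real-analytic functions are smooth\<close>

definition multi_idx :: "('e::euclidean_space => nat) set" where
 "multi_idx = {a. ALL b. b ~: Basis --> a b = 0}"

definition monomial :: "('e::euclidean_space => nat) => 'e => real" where
 "monomial a y = (\<Prod>b\<in>Basis. (y \<bullet> b) ^ a b)"

definition monomial_deriv :: "('e::euclidean_space => nat) => 'e => 'e => real" where
 "monomial_deriv a y v = (\<Sum>i\<in>Basis. (real (a i) * (v \<bullet> i) * (y \<bullet> i) ^ (a i - 1)) * (\<Prod>j\<in>Basis - {i}. (y \<bullet> j) ^ a j))"

lemma monomial_has_derivative: "(monomial a has_derivative monomial_deriv a y) (at y within S)"
 unfolding monomial_def[abs_def] monomial_deriv_def[abs_def]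
 by (rule has_derivative_prod) (auto intro!: derivative_eq_intros simp: mult_ac)

text \<open>Differentiating one factor costs a power of \<open>t\<close> and yields its exponent;
  summed over the variables, the exponents add up to the degree.\<close>

lemma monomial_deriv_bound:
 assumes y: "!!b. b : Basis ==> \<bar>y \<bullet> b\<bar> <= t" and t: "0 < t"
 shows "\<bar>monomial_deriv a y v\<bar> <= norm v / t * real (sum a Basis) * t ^ sum a Basis"
proof -
 have "\<bar>(real (a i) * (v \<bullet> i) * (y \<bullet> i) ^ (a i - 1)) * (\<Prod>j\<in>Basis - {i}. (y \<bullet> j) ^ a j)\<bar> <= norm v / t * real (a i) * t ^ sum a Basis"
  if i: "i : Basis" for i
 proof (cases "a i = 0")
  case False
  have "\<bar>\<Prod>j\<in>Basis - {i}. (y \<bullet> j) ^ a j\<bar> <= (\<Prod>j\<in>Basis - {i}. t ^ a j)"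
   unfolding abs_prod power_abs by (intro prod_mono) (auto intro!: power_mono y)
  moreover have "\<bar>y \<bullet> i\<bar> ^ (a i - 1) <= t ^ (a i - 1)" using y[OF i] by (intro power_mono) auto
  moreover have "\<bar>v \<bullet> i\<bar> <= norm v" using i by (simp add: Basis_le_norm)
  ultimately have "\<bar>(real (a i) * (v \<bullet> i) * (y \<bullet> i) ^ (a i - 1)) * (\<Prod>j\<in>Basis - {i}. (y \<bullet> j) ^ a j)\<bar>
    <= (real (a i) * norm v * t ^ (a i - 1)) * (\<Prod>j\<in>Basis - {i}. t ^ a j)"
   unfolding abs_mult power_abs by (intro mult_mono) (use t in auto)
  also have "\<dots> = norm v / t * real (a i) * (t ^ a i * (\<Prod>j\<in>Basis - {i}. t ^ a j))"
   using False t by (cases "a i") auto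
  also have "t ^ a i * (\<Prod>j\<in>Basis - {i}. t ^ a j) = t ^ sum a Basis"
   using i by (simp add: power_sum prod.remove[of Basis i])
  finally show ?thesis .
 qed (use t in auto)
 hence "\<bar>monomial_deriv a y v\<bar> <= (\<Sum>i\<in>Basis. norm v / t * real (a i) * t ^ sum a Basis)"
  unfolding monomial_deriv_def by (intro order.trans[OF sum_abs] sum_mono)
 thus ?thesis by (simp add: sum_distrib_left sum_distrib_right)
qed

lemma monomial_deriv_Basis:
 assumes b: "b : Basis"
 shows "monomial_deriv (l(b := Suc (l b))) y b = real (Suc (l b)) * monomial l y"
  "a b = 0 ==> monomial_deriv a y b = 0"
proof -
 have 1: "monomial_deriv a y b = real (a b) * (y \<bullet> b) ^ (a b - 1) * (\<Prod>j\<in>Basis - {b}. (y \<bullet> j) ^ a j)" for a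
 proof -
  have "monomial_deriv a y b = (\<Sum>i\<in>Basis. if i = b then real (a b) * (y \<bullet> b) ^ (a b - 1) * (\<Prod>j\<in>Basis - {b}. (y \<bullet> j) ^ a j) else 0)"
   unfolding monomial_deriv_def using b by (intro sum.cong) (auto simp: inner_Basis)
  thus ?thesis using b by simp
 qed
 have "(\<Prod>j\<in>Basis - {b}. (y \<bullet> j) ^ (l(b := Suc (l b))) j) = (\<Prod>j\<in>Basis - {b}. (y \<bullet> j) ^ l j)"
  by (intro prod.cong) auto
 thus "monomial_deriv (l(b := Suc (l b))) y b = real (Suc (l b)) * monomial l y"
  unfolding 1 monomial_def using b by (simp add: prod.remove[of Basis b])
 show "a b = 0 ==> monomial_deriv a y b = 0" unfolding 1 by simp
qed

lemma countable_multi_idx: "countable (multi_idx :: ('e::euclidean_space => nat) set)"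
proof -
 have "countable ((%g b. if b : Basis then g b else 0) ` (PiE (Basis::'e set) (%_. UNIV :: nat set)))"
  by (intro countable_image countable_PiE) auto
 moreover have "multi_idx \<subseteq> (%g b. if b : Basis then g b else 0) ` (PiE (Basis::'e set) (%_. UNIV :: nat set))"
 proof
  fix a :: "'e => nat" assume "a : multi_idx"
  hence "a = (%b. if b : Basis then restrict a Basis b else 0)" by (auto simp: multi_idx_def)
  thus "a : (%g b. if b : Basis then g b else 0) ` (PiE (Basis::'e set) (%_. UNIV :: nat set))"
   by (intro image_eqI[of _ _ "restrict a Basis"]) auto
 qed
 ultimately show ?thesis by (rule countable_subset[rotated])
qed

lemma infinite_multi_idx: "infinite (multi_idx :: ('e::euclidean_space => nat) set)"
proof -
 obtain b :: 'e where b: "b : Basis" using nonempty_Basis by blast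
 have "inj (%k i. if i = b then k else 0 :: nat)" by (rule injI) (metis)
 hence "infinite (range (%k i. if i = b then k else 0 :: nat))" by (rule range_inj_infinite)
 moreover have "range (%k i. if i = b then k else 0 :: nat) \<subseteq> multi_idx" using b by (auto simp: multi_idx_def)
 ultimately show ?thesis by (rule infinite_super[rotated])
qed

lemma power_half_le: "real n * (1/2) ^ n <= 1"
proof -
 have "n < 2 ^ n" by (rule less_exp)
 hence "real n <= 2 ^ n" by (metis less_imp_le of_nat_le_iff of_nat_numeral of_nat_power)
 thus ?thesis by (simp add: power_one_over field_simps)
qed

text \<open>Convergence at the single corner \<open>a + s * One\<close> makes all coefficients
  absolutely summable with weight \<open>s ^ degree\<close>. At points with coordinates at most
  \<open>t = s / 2\<close>, the factor \<open>degree\<close> produced by differentiation is absorbed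
  by \<open>(1/2) ^ degree\<close>, so the termwise derivatives have a summable majorant.\<close>

lemma power_series_has_derivative:
 fixes f :: "'e::euclidean_space => real"
 assumes r: "0 < r" and f: "!!x. x : ball a r ==> ((%m. monomial m (x - a) * c m) has_sum f x) multi_idx"
 obtains t f' where "0 < t" "t <= r" "!!x. x : ball a t ==> (f has_derivative f' x) (at x)"
  "!!x b. b : Basis ==> x : ball a t ==>
   ((%j. monomial j (x - a) * (real (Suc (j b)) * c (j(b := Suc (j b))))) has_sum f' x b) multi_idx"
proof -
 \<comment> \<open>The corner with all coordinates \<open>s\<close> has distance
   \<open>r / 2\<close> from \<open>a\<close>.\<close>
 define s where "s = r / (2 * norm (One::'e))"
 have One: "norm (One::'e) >= 1"
 proof -
  obtain b :: 'e where b: "b : Basis" using nonempty_Basis by blast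
  have "\<bar>One \<bullet> b\<bar> <= norm (One::'e)" using b by (rule Basis_le_norm)
  thus ?thesis using b by simp
 qed
 have s: "0 < s" "s <= r" using r One by (auto simp: s_def field_simps)
 define t where "t = s / 2"
 have t: "0 < t" "t <= r" "s = 2 * t" using s by (auto simp: t_def)
 have "a + s *\<^sub>R One : ball a r" using s One r by (simp add: dist_norm s_def)
 from f[OF this] have "(%m. monomial m (s *\<^sub>R One) * c m) summable_on multi_idx"
  by (auto intro: has_sum_imp_summable)
 hence "(%m. norm (monomial m (s *\<^sub>R One) * c m)) summable_on multi_idx"
  by (rule summable_on_iff_abs_summable_on_real[THEN iffD1])
 moreover have "monomial m (s *\<^sub>R One) = s ^ sum m Basis" for m :: "'e => nat"
  unfolding monomial_def by (simp add: power_sum)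
 ultimately have sum1: "(%m. s ^ sum m Basis * \<bar>c m\<bar>) summable_on multi_idx"
  using s by (simp add: abs_mult)
 define e where "e = from_nat_into (multi_idx :: ('e => nat) set)"
 have e: "bij_betw e UNIV multi_idx"
  unfolding e_def by (rule bij_betw_from_nat_into[OF countable_multi_idx infinite_multi_idx])
 have "e n : multi_idx" for n using e by (auto simp: bij_betw_def)
 define M where "M n = (s ^ sum (e n) Basis * \<bar>c (e n)\<bar>) / t" for n
 have "summable (%n. s ^ sum (e n) Basis * \<bar>c (e n)\<bar>)"
  using sum1 summable_on_reindex_bij_betw[OF e, where f="%m. s ^ sum m Basis * \<bar>c m\<bar>"]
  by (auto intro: summable_on_imp_summable)
 hence M: "summable M" unfolding M_def by (rule summable_divide)
 define u where "u n x = monomial (e n) (x - a) * c (e n)" for n x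
 define u' where "u' n x v = monomial_deriv (e n) (x - a) v * c (e n)" for n x v
 have u'b: "\<bar>u' n x v\<bar> <= M n * norm v" if x: "x : ball a t" for n x v
 proof -
  have "\<bar>(x - a) \<bullet> b\<bar> <= t" if "b : Basis" for b
   using Basis_le_norm[OF that, of "x - a"] x by (simp add: dist_norm norm_minus_commute)
  hence "\<bar>monomial_deriv (e n) (x - a) v\<bar> <= norm v / t * real (sum (e n) Basis) * t ^ sum (e n) Basis"
   using t(1) by (rule monomial_deriv_bound)
  also have "\<dots> = norm v / t * s ^ sum (e n) Basis * (real (sum (e n) Basis) * (1/2) ^ sum (e n) Basis)"
   unfolding t(3) by (simp add: power_mult_distrib power_one_over field_simps)
  also have "\<dots> <= norm v / t * s ^ sum (e n) Basis * 1"
   using s t by (intro mult_left_mono power_half_le) auto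
  finally have "\<bar>monomial_deriv (e n) (x - a) v\<bar> <= norm v / t * s ^ sum (e n) Basis" by simp
  hence "\<bar>monomial_deriv (e n) (x - a) v\<bar> * \<bar>c (e n)\<bar> <= norm v / t * s ^ sum (e n) Basis * \<bar>c (e n)\<bar>"
   by (rule mult_right_mono) simp
  thus ?thesis by (simp add: u'_def M_def abs_mult mult_ac)
 qed
 have su': "summable (%n. norm (u' n x v))" if "x : ball a t" for x v
  by (rule summable_comparison_test'[OF summable_mult2[OF M, of "norm v"], of 0]) (use u'b[OF that] in auto)
 define g' where "g' x v = (\<Sum>n. u' n x v)" for x v
 have us: "(%n. u n x) sums f x" if "x : ball a t" for x
 proof -
  have "((%m. monomial m (x - a) * c m) has_sum f x) multi_idx" using f t that by auto
  hence "((%n. u n x) has_sum f x) UNIV"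
   unfolding u_def using has_sum_reindex_bij_betw[OF e, where f="%m. monomial m (x - a) * c m"] by auto
  thus ?thesis by (rule has_sum_imp_sums)
 qed
 have at: "a : ball a t" using t by simp
 have "EX g. ALL x:ball a t. (%n. u n x) sums g x & (g has_derivative g' x) (at x within ball a t)"
 proof (rule has_derivative_series[where S="ball a t" and f=u and f'=u' and g'=g' and x=a and l="f a"])
  show "convex (ball a t)" "a : ball a t" "(%n. u n a) sums f a" using at us by auto
 next
  fix n x assume "x : ball a t"
  have "((%x. monomial (e n) (x - a)) has_derivative monomial_deriv (e n) (x - a)) (at x within ball a t)"
   by (rule has_derivative_compose[where f="%x. x - a" and f'="%h. h" and g="monomial (e n)", OF _ monomial_has_derivative])
    (auto intro!: derivative_eq_intros)
  thus "(u n has_derivative u' n x) (at x within ball a t)"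
   unfolding u_def[abs_def] u'_def[abs_def] by (rule has_derivative_mult_left)
 next
  fix ep :: real assume ep: "0 < ep"
  obtain N where N: "!!n. n >= N ==> norm (\<Sum>i. M (i + n)) < ep"
   using suminf_exist_split[OF ep M] by blast
  have "\<bar>(\<Sum>i<n. u' i x h) - g' x h\<bar> <= ep * norm h" if "n >= N" "x : ball a t" for n x h
  proof -
   have su: "summable (%n. u' n x h)" using su'[OF that(2)] by (rule summable_norm_cancel)
   have "g' x h = (\<Sum>i. u' (i + n) x h) + (\<Sum>i<n. u' i x h)"
    unfolding g'_def by (rule suminf_split_initial_segment[OF su])
   hence "\<bar>(\<Sum>i<n. u' i x h) - g' x h\<bar> = \<bar>\<Sum>i. u' (i + n) x h\<bar>" by simp
   also have "\<dots> <= (\<Sum>i. \<bar>u' (i + n) x h\<bar>)"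
    using summable_norm[of "%i. u' (i + n) x h"] summable_ignore_initial_segment[OF su'[OF that(2), of h], of n] by simp
   also have "\<dots> <= (\<Sum>i. M (i + n) * norm h)"
    using summable_ignore_initial_segment[OF su'[OF that(2), of h], of n]
     summable_mult2[OF summable_ignore_initial_segment[OF M, of n], of "norm h"] u'b[OF that(2)]
    by (intro suminf_le) auto
   also have "\<dots> = (\<Sum>i. M (i + n)) * norm h"
    by (rule suminf_mult2[symmetric]) (rule summable_ignore_initial_segment[OF M])
   also have "\<dots> <= ep * norm h" using N[OF that(1)] by (intro mult_right_mono) auto
   finally show ?thesis .
  qed
  thus "\<forall>\<^sub>F n in sequentially. ALL x:ball a t. ALL h. norm ((\<Sum>i<n. u' i x h) - g' x h) <= ep * norm h"
   unfolding eventually_sequentially real_norm_def by blast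
 qed
 then obtain g where g: "!!x. x : ball a t ==> (%n. u n x) sums g x"
  "!!x. x : ball a t ==> (g has_derivative g' x) (at x within ball a t)" by blast
 have gf: "f x = g x" if "x : ball a t" for x using sums_unique2[OF us[OF that] g(1)[OF that]] .
 have "(f has_derivative g' x) (at x)" if "x : ball a t" for x
  using has_derivative_transform[OF that gf g(2)[OF that]] at_within_open[OF that open_ball] by simp
 moreover have "((%j. monomial j (x - a) * (real (Suc (j b)) * c (j(b := Suc (j b))))) has_sum g' x b) multi_idx"
  if b: "b : Basis" and x: "x : ball a t" for x b
 proof -
  define h where "h m = monomial_deriv m (x - a) b * c m" for m
  have "(%n. u' n x b) sums g' x b"
   unfolding g'_def by (rule summable_sums[OF summable_norm_cancel[OF su'[OF x]]])
  hence "((%n. u' n x b) has_sum g' x b) UNIV" by (rule norm_summable_imp_has_sum[OF su'[OF x]])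
  hence "((%n. h (e n)) has_sum g' x b) UNIV" by (simp add: u'_def h_def)
  hence 1: "(h has_sum g' x b) multi_idx" using has_sum_reindex_bij_betw[OF e, where f=h] by auto
  \<comment> \<open>Monomials without the variable \<open>b\<close> have derivative zero in this
    direction; on the others, lowering the exponent of \<open>b\<close> by one is a bijection onto
    all multi-indices. So the derivative is again a power series.\<close>
  have "(h has_sum g' x b) {m : multi_idx. 0 < m b}"
   by (rule has_sum_cong_neutral[THEN iffD1, OF _ _ _ 1]) (use monomial_deriv_Basis(2)[OF b] in \<open>auto simp: h_def\<close>)
  moreover have "bij_betw (%j. j(b := Suc (j b))) multi_idx {m : multi_idx. 0 < m b}"
  proof (rule bij_betwI[where g="%m. m(b := m b - 1)"])
   show "(%j. j(b := Suc (j b))) : multi_idx \<rightarrow> {m : multi_idx. 0 < m b}"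
    using b by (auto simp: multi_idx_def)
   show "(%m. m(b := m b - 1)) : {m : multi_idx. 0 < m b} \<rightarrow> multi_idx"
    using b by (auto simp: multi_idx_def)
  qed auto
  ultimately have "((%j. h (j(b := Suc (j b)))) has_sum g' x b) multi_idx"
   using has_sum_reindex_bij_betw[where f=h and g="%j. j(b := Suc (j b))" and A=multi_idx and B="{m : multi_idx. 0 < m b}"] by auto
  thus ?thesis unfolding h_def monomial_deriv_Basis(1)[OF b] by (simp add: mult_ac)
 qed
 ultimately show ?thesis using that[of t g'] t by blast
qed

lemma real_analytic_on_real_iff:
 fixes f :: "'e::euclidean_space => real"
 assumes "open S"
 shows "real_analytic_on f S \<longleftrightarrow> (ALL a:S. EX r>0. ball a r \<subseteq> S &
  (EX c. ALL x:ball a r. ((%b. monomial b (x - a) * c b) has_sum f x) multi_idx))"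
 (is "_ \<longleftrightarrow> ?R")
proof
 assume L: "real_analytic_on f S"
 show ?R
 proof
  fix a assume a: "a : S"
  obtain r c where r: "0 < r" "ALL x:S \<inter> ball a r. ((%b. monomial b (x - a) * c b) has_sum f x) multi_idx"
   using L a unfolding real_analytic_on_def monomial_def multi_idx_def by auto
  obtain r' where r': "0 < r'" "ball a r' \<subseteq> S" using assms a openE by blast
  show "EX r>0. ball a r \<subseteq> S & (EX c. ALL x:ball a r. ((%b. monomial b (x - a) * c b) has_sum f x) multi_idx)"
   using r r' by (intro exI[of _ "min r r'"] conjI exI[of _ c] ballI) (auto simp: subset_iff)
 qed
next
 assume R: ?R
 thus "real_analytic_on f S" unfolding real_analytic_on_def monomial_def multi_idx_def by (auto 0 4)
qed

lemma real_analytic_on_derivative: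
 fixes f :: "'e::euclidean_space => real"
 assumes S: "open S" and f: "real_analytic_on f S"
 obtains f' where "ALL x:S. (f has_derivative f' x) (at x)" "ALL b:Basis. real_analytic_on (%x. f' x b) S"
proof -
 have loc: "EX t>0. ball a t \<subseteq> S & (EX f'. (ALL x:ball a t. (f has_derivative f' x) (at x)) &
   (ALL b:Basis. EX c. ALL x:ball a t. ((%m. monomial m (x - a) * c m) has_sum f' x b) multi_idx))" if a: "a : S" for a
 proof -
  obtain r c where r: "0 < r" "ball a r \<subseteq> S" and c: "!!x. x : ball a r ==> ((%m. monomial m (x - a) * c m) has_sum f x) multi_idx"
   using f a unfolding real_analytic_on_real_iff[OF S] by blast
  show ?thesis
  proof (rule power_series_has_derivative[OF r(1) c])
   fix t f' assume t: "0 < t" "t <= r" and f': "!!x. x : ball a t ==> (f has_derivative f' x) (at x)"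
    and s: "!!x b. b : Basis ==> x : ball a t ==>
     ((%l. monomial l (x - a) * (real (Suc (l b)) * c (l(b := Suc (l b))))) has_sum f' x b) multi_idx"
   have "ALL b:Basis. EX c. ALL x:ball a t. ((%m. monomial m (x - a) * c m) has_sum f' x b) multi_idx"
   proof
    fix b :: 'e assume "b : Basis"
    from s[OF this] show "EX c. ALL x:ball a t. ((%m. monomial m (x - a) * c m) has_sum f' x b) multi_idx"
     by (intro exI[of _ "%l. real (Suc (l b)) * c (l(b := Suc (l b)))"]) simp
   qed
   moreover have "ball a t \<subseteq> S" using t r by auto
   ultimately show ?thesis using t(1) f' by blast
  qed
 qed
 define F where "F x = frechet_derivative f (at x)" for x
 have F: "(f has_derivative F x) (at x)" if "x : S" for x
 proof -
  obtain t f' where "0 < t" "ALL y:ball x t. (f has_derivative f' y) (at y)" using loc[OF \<open>x : S\<close>] by blast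
  hence "(f has_derivative f' x) (at x)" by simp
  thus ?thesis unfolding F_def using frechet_derivative_works differentiableI by blast
 qed
 have "real_analytic_on (%x. F x b) S" if b: "b : Basis" for b unfolding real_analytic_on_real_iff[OF S]
 proof
  fix a assume "a : S"
  then obtain t f' where t: "0 < t" "ball a t \<subseteq> S" and f': "ALL x:ball a t. (f has_derivative f' x) (at x)"
   and s: "ALL b:Basis. EX c. ALL x:ball a t. ((%m. monomial m (x - a) * c m) has_sum f' x b) multi_idx"
   using loc[of a] by blast
  have eq: "f' x = F x" if "x : ball a t" for x
   using has_derivative_unique[OF f'[rule_format, OF that] F] t(2) that by blast
  from s b obtain c where c: "ALL x:ball a t. ((%m. monomial m (x - a) * c m) has_sum f' x b) multi_idx" by blast
  thus "EX r>0. ball a r \<subseteq> S & (EX c. ALL x:ball a r. ((%m. monomial m (x - a) * c m) has_sum F x b) multi_idx)"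
   using t eq by (intro exI[of _ t] conjI exI[of _ c]) auto
 qed
 thus ?thesis using that F by blast
qed

lemma real_analytic_on_imp_Ck_real:
 fixes f :: "'e::euclidean_space => real"
 assumes S: "open S" and f: "real_analytic_on f S"
 shows "Ck n f S" using f
proof (induction n arbitrary: f)
 case 0
 then obtain f' where f': "ALL x:S. (f has_derivative f' x) (at x)" "ALL b:Basis. real_analytic_on (%x. f' x b) S"
  by (rule real_analytic_on_derivative[OF S])
 thus ?case unfolding Ck.simps continuous_on_eq_continuous_at[OF S] by (intro ballI has_derivative_continuous) blast
next
 case (Suc n)
 then obtain f' where f': "ALL x:S. (f has_derivative f' x) (at x)" "ALL b:Basis. real_analytic_on (%x. f' x b) S"
  using real_analytic_on_derivative[OF S] by blast
 show ?case by (rule Ck_SucI[of _ _ f']) (use f' Suc.IH in \<open>auto intro: has_derivative_at_withinI\<close>)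
qed

lemma real_analytic_on_imp_Ck:
 fixes f :: "'e::euclidean_space => 'f::euclidean_space"
 assumes S: "open S" and f: "real_analytic_on f S"
 shows "Ck n f S"
proof (rule Ck_componentwise)
 fix b :: 'f
 have "real_analytic_on (%x. f x \<bullet> b) S" unfolding real_analytic_on_def
 proof
  fix a assume "a : S"
  then obtain r c where r: "0 < r" "ALL x:S \<inter> ball a r.
   ((%m. (\<Prod>b\<in>Basis. ((x - a) \<bullet> b) ^ m b) *\<^sub>R c m) has_sum f x) {m. ALL b. b ~: Basis --> m b = 0}"
   using f unfolding real_analytic_on_def by blast
  have "ALL x:S \<inter> ball a r. ((%m. (\<Prod>b\<in>Basis. ((x - a) \<bullet> b) ^ m b) *\<^sub>R (c m \<bullet> b)) has_sum f x \<bullet> b) {m. ALL b. b ~: Basis --> m b = 0}"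
   using has_sum_bounded_linear[OF bounded_linear_inner_left[of b]] r(2) by (fastforce simp: o_def)
  thus "EX r>0. EX c. ALL x:S \<inter> ball a r. ((%m. (\<Prod>b\<in>Basis. ((x - a) \<bullet> b) ^ m b) *\<^sub>R c m) has_sum f x \<bullet> b) {m. ALL b. b ~: Basis --> m b = 0}"
   using r(1) by (intro exI[of _ r] conjI exI[of _ "%m. c m \<bullet> b"]) auto
 qed
 thus "Ck n (%x. f x \<bullet> b) S" by (rule real_analytic_on_imp_Ck_real[OF S])
qed

section \<open>Geodesics in a coordinate chart\<close>

lemma form_cauchy_schwarz:
 fixes B :: "'b::euclidean_space => 'b => real"
 assumes B: "bilinear B" and sym: "!!u v. B u v = B v u" and pos: "!!v. v ~= 0 ==> 0 < B v v"
 shows "\<bar>B u v\<bar> <= sqrt (B u u) * sqrt (B v v)"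
proof (cases "v = 0")
 case True
 thus ?thesis using B by (simp add: bilinear_rzero)
next
 case False
 hence vv: "0 < B v v" by (rule pos)
 have nn: "0 <= B w w" for w using pos[of w] B by (cases "w = 0") (auto simp: bilinear_lzero)
 define t where "t = B u v / B v v"
 have "0 <= B (u - t *\<^sub>R v) (u - t *\<^sub>R v)" by (rule nn)
 also have "\<dots> = B u u - (B u v)\<^sup>2 / B v v"
  using vv B sym[of v u] by (simp add: bilinear_lsub bilinear_rsub bilinear_lmul bilinear_rmul t_def power2_eq_square field_simps)
 finally have "(B u v)\<^sup>2 <= B u u * B v v" using vv by (simp add: field_simps)
 hence "\<bar>B u v\<bar> <= sqrt (B u u * B v v)" by (simp add: real_le_rsqrt)
 thus ?thesis by (simp add: real_sqrt_mult)
qed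

text \<open>Bootstrapping: if the solution is of class \<open>n\<close>, so is its derivative
  \<open>X (y t)\<close>.\<close>

lemma Ck_ode_solution:
 fixes y :: "real => 'z::euclidean_space"
 assumes X: "!!n. Ck n X W" and y: "!!t. t : S ==> (y has_vector_derivative X (y t)) (at t within S)"
  and W: "!!t. t : S ==> y t : W"
 shows "Ck n y S"
proof (induction n)
 case 0
 show ?case unfolding Ck.simps continuous_on_eq_continuous_within
  by (intro ballI has_vector_derivative_continuous[OF y])
next
 case (Suc n)
 have "Ck n (%t. X (y t)) S" by (rule Ck_compose[OF X Suc]) (use W in auto)
 thus ?case
  by (intro Ck_SucI[of _ _ "%t h. h *\<^sub>R X (y t)"]) (use y in \<open>auto simp: has_vector_derivative_def\<close>)
qed

locale local_metric =
 fixes Om :: "'e::euclidean_space set" and g :: "'e => 'e => 'e => real"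
 assumes open_Om: "open Om"
  and bil: "x : Om ==> bilinear (g x)"
  and sym: "x : Om ==> g x u v = g x v u"
  and pos: "x : Om ==> v ~= 0 ==> 0 < g x v v"
  and smooth: "b : Basis ==> b' : Basis ==> Ck n (%x. g x b b') Om"
begin

definition Dg :: "'e => 'e => 'e => 'e => real" where
 "Dg b b' x = frechet_derivative (%y. g y b b') (at x)"

definition dg :: "'e => 'e => 'e => 'e => real" where
 "dg x w u v = (\<Sum>b\<in>Basis. \<Sum>b'\<in>Basis. (u \<bullet> b) * (v \<bullet> b') * Dg b b' x w)"

lemma Dg: "b : Basis ==> b' : Basis ==> x : Om ==> ((%y. g y b b') has_derivative Dg b b' x) (at x)"
 and Dg_Ck: "b : Basis ==> b' : Basis ==> i : Basis ==> Ck n (%x. Dg b b' x i) Om"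
proof -
 have *: "(ALL x:Om. ((%y. g y b b') has_derivative Dg b b' x) (at x)) & (ALL i:Basis. Ck n (%x. Dg b b' x i) Om)"
  if b: "b : Basis" "b' : Basis" for b b' n
 proof -
  obtain f' where f': "ALL x:Om. ((%y. g y b b') has_derivative f' x) (at x within Om)" "ALL i:Basis. Ck n (%x. f' x i) Om"
   by (rule Ck_SucE[OF smooth[OF b]]) (rule that, assumption+)
  have f'': "((%y. g y b b') has_derivative f' x) (at x)" if "x : Om" for x
   using bspec[OF f'(1) that] unfolding at_within_open[OF that open_Om] .
  have eq: "f' x = Dg b b' x" if "x : Om" for x unfolding Dg_def by (rule frechet_derivative_at[OF f''[OF that]])
  have "Ck n (%x. Dg b b' x i) Om" if "i : Basis" for i
   by (rule Ck_cong[OF f'(2)[rule_format, OF that]]) (simp add: eq)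
  thus ?thesis using f'' eq by auto
 qed
 show "b : Basis ==> b' : Basis ==> x : Om ==> ((%y. g y b b') has_derivative Dg b b' x) (at x)"
  using * by blast
 show "b : Basis ==> b' : Basis ==> i : Basis ==> Ck n (%x. Dg b b' x i) Om"
  using * by blast
qed

lemma g_expand: "x : Om ==> g x u v = (\<Sum>b\<in>Basis. \<Sum>b'\<in>Basis. (u \<bullet> b) * (v \<bullet> b') * g x b b')"
 by (rule bilinear_sum_Basis[OF bil])

lemma dg_linear: "x : Om ==> linear (%w. dg x w u v)"
proof -
 assume x: "x : Om"
 have "linear (%w. \<Sum>b\<in>Basis. \<Sum>b'\<in>Basis. ((u \<bullet> b) * (v \<bullet> b')) *\<^sub>R Dg b b' x w)"
  by (intro linear_compose_sum ballI linear_compose_scale_right has_derivative_linear[OF Dg] x)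
 thus ?thesis by (simp add: dg_def)
qed

lemma dg_bilinear: "bilinear (dg x w)" unfolding bilinear_def dg_def
 by (auto intro!: linearI simp: inner_add_left algebra_simps sum.distrib sum_distrib_left)

lemma has_derivative_g: "x : Om ==> ((%y. g y u v) has_derivative (%w. dg x w u v)) (at x)"
proof -
 assume x: "x : Om"
 have "((%y. \<Sum>b\<in>Basis. \<Sum>b'\<in>Basis. (u \<bullet> b) * (v \<bullet> b') * g y b b') has_derivative (%w. dg x w u v)) (at x)"
  unfolding dg_def by (intro has_derivative_sum has_derivative_mult_right Dg x)
 thus ?thesis by (rule has_derivative_transform_within_open[OF _ open_Om x]) (simp add: g_expand[symmetric])
qed

lemma g_product_rule:
 assumes t: "t : S" and Om: "!!s. s : S ==> x s : Om"
  and x: "(x has_vector_derivative x') (at t within S)"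
  and u: "(u has_vector_derivative u') (at t within S)" and v: "(v has_vector_derivative v') (at t within S)"
 shows "((%s. g (x s) (u s) (v s)) has_vector_derivative
  (dg (x t) x' (u t) (v t) + g (x t) u' (v t) + g (x t) (u t) v')) (at t within S)"
proof -
 let ?f = "%s. \<Sum>b\<in>Basis. \<Sum>b'\<in>Basis. (u s \<bullet> b) * (v s \<bullet> b') * g (x s) b b'"
 let ?D = "%b b'. (u t \<bullet> b) * (v t \<bullet> b') * Dg b b' (x t) x' + ((u t \<bullet> b) * (v' \<bullet> b') + (u' \<bullet> b) * (v t \<bullet> b')) * g (x t) b b'"
 have xt: "x t : Om" using t Om by blast
 have gx: "((%s. g (x s) b b') has_real_derivative Dg b b' (x t) x') (at t within S)"
  if "b : Basis" "b' : Basis" for b b'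
 proof -
  have "((%s. g (x s) b b') has_derivative (%h. Dg b b' (x t) (h *\<^sub>R x'))) (at t within S)"
   using x Dg[OF that xt] unfolding has_vector_derivative_def by (rule has_derivative_compose)
  moreover have "Dg b b' (x t) (h *\<^sub>R x') = h * Dg b b' (x t) x'" for h
   using linear_scale[OF has_derivative_linear[OF Dg[OF that xt]]] by simp
  ultimately show ?thesis by (simp add: has_field_derivative_def mult_commute_abs)
 qed
 have ub: "((%s. u s \<bullet> b) has_real_derivative u' \<bullet> b) (at t within S)"
  and vb: "((%s. v s \<bullet> b) has_real_derivative v' \<bullet> b) (at t within S)" for b
  unfolding has_real_derivative_iff_has_vector_derivative
  by (rule bounded_linear.has_vector_derivative[OF bounded_linear_inner_left u])
   (rule bounded_linear.has_vector_derivative[OF bounded_linear_inner_left v])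
 have "(?f has_real_derivative (\<Sum>b\<in>Basis. \<Sum>b'\<in>Basis. ?D b b')) (at t within S)"
 proof (intro DERIV_sum)
  fix b b' :: 'e assume "b : Basis" "b' : Basis"
  from DERIV_mult[OF DERIV_mult[OF ub[of b] vb[of b']] gx[OF this]]
  show "((%s. (u s \<bullet> b) * (v s \<bullet> b') * g (x s) b b') has_real_derivative ?D b b') (at t within S)"
   by (simp add: algebra_simps)
 qed
 moreover have "(\<Sum>b\<in>Basis. \<Sum>b'\<in>Basis. ?D b b') = dg (x t) x' (u t) (v t) + g (x t) u' (v t) + g (x t) (u t) v'"
  unfolding dg_def g_expand[OF xt, of u'] g_expand[OF xt, of "u t" v'] by (simp add: algebra_simps sum.distrib)
 ultimately have "(?f has_vector_derivative (dg (x t) x' (u t) (v t) + g (x t) u' (v t) + g (x t) (u t) v')) (at t within S)"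
  by (simp add: has_real_derivative_iff_has_vector_derivative)
 hence *: "(?f has_vector_derivative (dg (x t) x' (u t) (v t) + g (x t) u' (v t) + g (x t) (u t) v')) (at t within S)" .
 show ?thesis by (rule has_vector_derivative_transform[OF t _ *]) (rule g_expand[OF Om])
qed

definition chris :: "'e => 'e => 'e => 'e" where
 "chris x u v = (THE z. ALL w. g x z w = (dg x u v w + dg x v u w - dg x w u v) / 2)"

text \<open>Koszul's right side is linear in \<open>w\<close>, hence represented by a unique vector;
  this justifies the definite description in \<open>chris\<close>.\<close>

lemma chris:
 assumes x: "x : Om"
 shows "g x (chris x u v) w = (dg x u v w + dg x v u w - dg x w u v) / 2"
proof -
 let ?f = "%w. (dg x u v w + dg x v u w - dg x w u v) / 2"
 have lin: "linear ?f"
 proof -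
  have l: "linear (dg x u v)" "linear (dg x v u)" "linear (%w. dg x w u v)"
   using dg_bilinear[of x] dg_linear[OF x] by (auto simp: bilinear_def)
  have "linear (%w. (1/2) *\<^sub>R (dg x u v w + dg x v u w - dg x w u v))"
   by (intro linear_compose_scale_right linear_compose_sub linear_compose_add l)
  thus ?thesis by simp
 qed
 obtain T where T: "!!c w. g x (T c) w = c \<bullet> w"
  by (rule form_inverse[OF bil[OF x]], erule pos[OF x], rule that, assumption)
 define c where "c = (\<Sum>b\<in>Basis. ?f b *\<^sub>R b)"
 have cb: "c \<bullet> b = ?f b" if "b : Basis" for b
  unfolding c_def using that by (simp add: inner_sum_left inner_Basis if_distrib cong: if_cong)
 have cw: "c \<bullet> w = ?f w" for w
 proof -
  have "c \<bullet> w = (\<Sum>b\<in>Basis. (w \<bullet> b) * (c \<bullet> b))"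
   by (subst euclidean_inner) (simp add: mult.commute)
  also have "\<dots> = (\<Sum>b\<in>Basis. (w \<bullet> b) *\<^sub>R ?f b)" by (intro sum.cong refl) (simp add: cb)
  also have "\<dots> = ?f w" by (rule linear_sum_Basis[OF lin, symmetric])
  finally show ?thesis .
 qed
 have "EX! z. ALL w. g x z w = ?f w"
 proof (rule ex1I[of _ "T c"])
  show "ALL w. g x (T c) w = ?f w" using T cw by simp
  show "z = T c" if z: "ALL w. g x z w = ?f w" for z
  proof (rule ccontr)
   assume "z ~= T c"
   hence "0 < g x (z - T c) (z - T c)" using pos[OF x] by simp
   thus False using z T cw bil[OF x] by (simp add: bilinear_lsub)
  qed
 qed
 from theI'[OF this] show ?thesis unfolding chris_def by blast
qed

text \<open>The geodesic equation as a first order system for position and velocity.\<close>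

definition spray :: "'e \<times> 'e => 'e \<times> 'e" where
 "spray z = (snd z, - chris (fst z) (snd z) (snd z))"

text \<open>The Christoffel vector solves a linear system whose form and right side are smooth in
  position and velocity, so \<open>Ck_solve\<close> applies.\<close>

lemma spray_Ck: "Ck n spray (Om \<times> UNIV)"
proof -
 have c_fst: "Ck n (%z. h (fst z)) (Om \<times> (UNIV::'e set))" if "Ck n h Om" for h :: "'e => real"
  by (rule Ck_compose[OF that Ck_fst[OF Ck_id]]) auto
 have c_dg: "Ck n (%z. dg (fst z) (p z) (q z) (r z)) (Om \<times> (UNIV::'e set))"
  if "Ck n p (Om \<times> UNIV)" "Ck n q (Om \<times> UNIV)" "Ck n r (Om \<times> UNIV)" for p q r :: "'e \<times> 'e => 'e"
 proof -
  have "Ck n (%z. \<Sum>b\<in>Basis. \<Sum>b'\<in>Basis. (q z \<bullet> b) * (r z \<bullet> b') * (\<Sum>i\<in>Basis. (p z \<bullet> i) * Dg b b' (fst z) i)) (Om \<times> (UNIV::'e set))"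
   by (intro Ck_sum Ck_mult Ck_inner_left that c_fst Dg_Ck)
  thus ?thesis
  proof (rule Ck_cong)
   fix z :: "'e \<times> 'e" assume "z : Om \<times> UNIV"
   hence "fst z : Om" by auto
   hence "(\<Sum>i\<in>Basis. (p z \<bullet> i) * Dg b b' (fst z) i) = Dg b b' (fst z) (p z)" if "b : Basis" "b' : Basis" for b b'
    using linear_sum_Basis[OF has_derivative_linear[OF Dg[OF that]], of "fst z" "p z"] by simp
   thus "(\<Sum>b\<in>Basis. \<Sum>b'\<in>Basis. (q z \<bullet> b) * (r z \<bullet> b') * (\<Sum>i\<in>Basis. (p z \<bullet> i) * Dg b b' (fst z) i)) = dg (fst z) (p z) (q z) (r z)"
    unfolding dg_def by (intro sum.cong refl) auto
  qed
 qed
 have "Ck n (%z. chris (fst z) (snd z) (snd z)) (Om \<times> UNIV)"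
 proof (rule Ck_solve[where g="%z. g (fst z)" and rhs="%z. \<Sum>b\<in>Basis. (dg (fst z) (snd z) (snd z) b - 1/2 * dg (fst z) b (snd z) (snd z)) *\<^sub>R b"])
  show "Ck n (%z. \<Sum>b\<in>Basis. (dg (fst z) (snd z) (snd z) b - 1/2 * dg (fst z) b (snd z) (snd z)) *\<^sub>R b) (Om \<times> UNIV)"
   by (intro Ck_sum Ck_scaleR Ck_diff Ck_mult Ck_const c_dg Ck_snd Ck_id)
  fix z :: "'e \<times> 'e" and w :: 'e assume "z : Om \<times> UNIV"
  hence z: "fst z : Om" by auto
  let ?u = "snd z"
  let ?f = "%w. dg (fst z) ?u ?u w - 1/2 * dg (fst z) w ?u ?u"
  have l: "linear (dg (fst z) ?u ?u)" "linear (%w. dg (fst z) w ?u ?u)"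
   using dg_bilinear[of "fst z"] dg_linear[OF z] by (auto simp: bilinear_def)
  have "linear (%w. dg (fst z) ?u ?u w - (1/2) *\<^sub>R dg (fst z) w ?u ?u)"
   by (intro linear_compose_sub linear_compose_scale_right l)
  hence lin: "linear ?f" by simp
  have "g (fst z) (chris (fst z) ?u ?u) w = ?f w" unfolding chris[OF z] by (simp add: field_simps)
  also have "\<dots> = (\<Sum>b\<in>Basis. (w \<bullet> b) *\<^sub>R ?f b)" by (rule linear_sum_Basis[OF lin])
  also have "\<dots> = (\<Sum>b\<in>Basis. ?f b *\<^sub>R b) \<bullet> w"
   unfolding inner_sum_left by (simp add: inner_commute mult.commute)
  finally show "g (fst z) (chris (fst z) ?u ?u) w = (\<Sum>b\<in>Basis. ?f b *\<^sub>R b) \<bullet> w" .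
 qed (use bil pos c_fst[OF smooth] in auto)
 thus ?thesis unfolding spray_def[abs_def] by (intro Ck_Pair Ck_snd Ck_id Ck_minus)
qed

lemma chris_scale: "x : Om ==> chris x (k *\<^sub>R v) (k *\<^sub>R v) = (k * k) *\<^sub>R chris x v v"
proof -
 assume x: "x : Om"
 have bl: "bilinear (dg x w)" for w by (rule dg_bilinear)
 have lw: "dg x (k *\<^sub>R v) a b = k * dg x v a b" for a b using linear_scale[OF dg_linear[OF x]] by simp
 have "g x (chris x (k *\<^sub>R v) (k *\<^sub>R v) - (k * k) *\<^sub>R chris x v v) w = 0" for w
  using bil[OF x] bl by (simp add: bilinear_lsub bilinear_lmul bilinear_rmul chris[OF x] lw algebra_simps)
 hence "chris x (k *\<^sub>R v) (k *\<^sub>R v) - (k * k) *\<^sub>R chris x v v = 0" using pos[OF x] by fastforce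
 thus ?thesis by simp
qed

text \<open>Time is always the unit interval and the velocity carries the length, because the flow
  is available up to time one for small velocities.\<close>

definition geod :: "(real => 'e \<times> 'e) => bool" where
 "geod c \<longleftrightarrow> (ALL t:{0..1}. fst (c t) : Om & (c has_vector_derivative spray (c t)) (at t within {0..1}))"

lemma geod_fst: "geod c ==> t : {0..1} ==> ((%s. fst (c s)) has_vector_derivative snd (c t)) (at t within {0..1})"
 and geod_snd: "geod c ==> t : {0..1} ==>
  ((%s. snd (c s)) has_vector_derivative - chris (fst (c t)) (snd (c t)) (snd (c t))) (at t within {0..1})"
proof -
 assume a: "geod c" "t : {0..1}"
 hence d: "(c has_vector_derivative spray (c t)) (at t within {0..1})" unfolding geod_def by blast
 show "((%s. fst (c s)) has_vector_derivative snd (c t)) (at t within {0..1})"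
  using bounded_linear.has_vector_derivative[OF bounded_linear_fst d] by (simp add: spray_def)
 show "((%s. snd (c s)) has_vector_derivative - chris (fst (c t)) (snd (c t)) (snd (c t))) (at t within {0..1})"
  using bounded_linear.has_vector_derivative[OF bounded_linear_snd d] by (simp add: spray_def)
qed

lemma geod_in: "geod c ==> t : {0..1} ==> fst (c t) : Om"
 unfolding geod_def by blast

lemma geodI:
 assumes "!!t. t : {0..1} ==> (x has_vector_derivative v t) (at t within {0..1})"
  "!!t. t : {0..1} ==> (v has_vector_derivative - chris (x t) (v t) (v t)) (at t within {0..1})"
  "!!t. t : {0..1} ==> x t : Om"
 shows "geod (%t. (x t, v t))"
 unfolding geod_def spray_def using assms by (auto intro!: has_vector_derivative_Pair)

text \<open>By the Koszul formula the two acceleration terms cancel the derivative of the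
  metric.\<close>

lemma geod_energy:
 assumes "geod c" "t : {0..1}"
 shows "g (fst (c t)) (snd (c t)) (snd (c t)) = g (fst (c 0)) (snd (c 0)) (snd (c 0))"
proof -
 have "((%s. g (fst (c s)) (snd (c s)) (snd (c s))) has_derivative (%h. 0)) (at t within {0..1})" if t: "t : {0..1}" for t
 proof -
  let ?x = "fst (c t)" and ?v = "snd (c t)"
  have x: "?x : Om" by (rule geod_in[OF assms(1) t])
  have "dg ?x ?v ?v ?v + g ?x (- chris ?x ?v ?v) ?v + g ?x ?v (- chris ?x ?v ?v) = 0"
   using bil[OF x] sym[OF x, of ?v "chris ?x ?v ?v"] by (simp add: bilinear_lneg bilinear_rneg chris[OF x])
  thus ?thesis
   using g_product_rule[OF t geod_in[OF assms(1)] geod_fst[OF assms(1) t] geod_snd[OF assms(1) t] geod_snd[OF assms(1) t]]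
   by (simp add: has_vector_derivative_def)
 qed
 from has_derivative_zero_unique[OF convex_real_interval(5) this assms(2), of 0] show ?thesis by auto
qed

lemma geod_scale:
 assumes c: "geod c" and k: "k : {0..1}"
 shows "geod (%t. (fst (c (k * t)), k *\<^sub>R snd (c (k * t))))"
proof (rule geodI)
 fix t :: real assume t: "t : {0..1}"
 hence kt: "k * t : {0..1}" using k mult_le_one[of k t] by auto
 have sub: "(%t. k * t) ` {0..1} \<subseteq> {0..1}" using k by (auto intro: mult_le_one)
 show x: "fst (c (k * t)) : Om" by (rule geod_in[OF c kt])
 have k': "((%t. k * t) has_vector_derivative k) (at t within {0..1})"
  by (auto intro!: derivative_eq_intros simp flip: has_real_derivative_iff_has_vector_derivative)
 have "((%s. fst (c (k * s))) has_vector_derivative k *\<^sub>R snd (c (k * t))) (at t within {0..1})"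
  using vector_diff_chain_within[OF k' has_vector_derivative_within_subset[OF geod_fst[OF c kt] sub]] by (simp add: o_def)
 thus "((%s. fst (c (k * s))) has_vector_derivative k *\<^sub>R snd (c (k * t))) (at t within {0..1})" .
 have "((%s. snd (c (k * s))) has_vector_derivative k *\<^sub>R - chris (fst (c (k * t))) (snd (c (k * t))) (snd (c (k * t)))) (at t within {0..1})"
  using vector_diff_chain_within[OF k' has_vector_derivative_within_subset[OF geod_snd[OF c kt] sub]] by (simp add: o_def)
 from bounded_linear.has_vector_derivative[OF bounded_linear_scaleR_right this, of k]
 show "((%s. k *\<^sub>R snd (c (k * s))) has_vector_derivative
  - chris (fst (c (k * t))) (k *\<^sub>R snd (c (k * t))) (k *\<^sub>R snd (c (k * t)))) (at t within {0..1})"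
  by (simp add: chris_scale[OF x])
qed

lemma geod_reverse:
 assumes c: "geod c"
 shows "geod (%t. (fst (c (1 - t)), - snd (c (1 - t))))"
proof (rule geodI)
 fix t :: real assume t: "t : {0..1}"
 hence kt: "1 - t : {0..1}" by auto
 have sub: "(%t. 1 - t) ` {0..1} \<subseteq> {0..1::real}" by auto
 show x: "fst (c (1 - t)) : Om" by (rule geod_in[OF c kt])
 have k': "((%t. 1 - t) has_vector_derivative -1) (at t within {0..1::real})"
  by (auto intro!: derivative_eq_intros simp flip: has_real_derivative_iff_has_vector_derivative)
 show "((%s. fst (c (1 - s))) has_vector_derivative - snd (c (1 - t))) (at t within {0..1})"
  using vector_diff_chain_within[OF k' has_vector_derivative_within_subset[OF geod_fst[OF c kt] sub]] by (simp add: o_def)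
 have "((%s. snd (c (1 - s))) has_vector_derivative chris (fst (c (1 - t))) (snd (c (1 - t))) (snd (c (1 - t)))) (at t within {0..1})"
  using vector_diff_chain_within[OF k' has_vector_derivative_within_subset[OF geod_snd[OF c kt] sub]] by (simp add: o_def)
 from has_vector_derivative_minus[OF this]
 show "((%s. - snd (c (1 - s))) has_vector_derivative
  - chris (fst (c (1 - t))) (- snd (c (1 - t))) (- snd (c (1 - t)))) (at t within {0..1})"
  using chris_scale[OF x, of "-1" "snd (c (1 - t))"] by simp
qed

lemma metric_bounds:
 assumes K: "compact K" "convex K" "K \<subseteq> Om"
 obtains C m where "0 < C" "0 < m" "!!x u v. x : K ==> \<bar>g x u v\<bar> <= C * norm u * norm v"
  "!!x v. x : K ==> m * (norm v)\<^sup>2 <= g x v v"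
  "!!x y u v. x : K ==> y : K ==> \<bar>g y u v - g x u v\<bar> <= C * norm (y - x) * norm u * norm v"
  "!!x y v. x : K ==> y : K ==> \<bar>g y v v - g x v v - dg x (y - x) v v\<bar> <= C * (norm (y - x))\<^sup>2 * (norm v)\<^sup>2"
proof -
 define P where "P b b' L \<longleftrightarrow> 0 < L & (ALL x:K. \<bar>g x b b'\<bar> <= L) & (ALL x:K. ALL y:K. \<bar>g y b b' - g x b b'\<bar> <= L * norm (y - x)) &
  (ALL x:K. ALL y:K. \<bar>g y b b' - g x b b' - Dg b b' x (y - x)\<bar> <= L * (norm (y - x))\<^sup>2)" for b b' L
 define L where "L b b' = (SOME L. P b b' L)" for b b'
 have PL: "P b b' (L b b')" if b: "b : Basis" "b' : Basis" for b b'
 proof -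
  have "ALL x:Om. ((%y. g y b b') has_derivative Dg b b' x) (at x within Om)"
   using Dg[OF b] has_derivative_at_withinI by blast
  moreover have "ALL i:Basis. Ck (Suc 0) (%x. Dg b b' x i) Om" using Dg_Ck[OF b] by blast
  ultimately obtain L1 where L1: "0 < L1"
   "!!x y. x : K ==> y : K ==> norm (g y b b' - g x b b' - Dg b b' x (y - x)) <= L1 * (norm (y - x))\<^sup>2"
   by (rule Ck_deriv_lipschitz[OF _ _ K]) (rule that, assumption+)
  obtain L2 where L2: "0 < L2" "!!x y. x : K ==> y : K ==> norm (g x b b' - g y b b') <= L2 * norm (x - y)"
   by (rule Ck_lipschitz[OF smooth[OF b] K]) (rule that, assumption+)
  have "bounded ((%x. g x b b') ` K)"
   by (intro compact_imp_bounded compact_continuous_image K continuous_on_subset[OF Ck_continuous_on[OF smooth[OF b]]])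
  then obtain L3 where L3: "0 < L3" "!!x. x : K ==> \<bar>g x b b'\<bar> <= L3" unfolding bounded_pos by auto
  have "P b b' (L1 + L2 + L3)" unfolding P_def
  proof (intro conjI ballI)
   show "0 < L1 + L2 + L3" using L1 L2 L3 by simp
   show "\<bar>g x b b'\<bar> <= L1 + L2 + L3" if "x : K" for x using L3(2)[OF that] L1 L2 by simp
   show "\<bar>g y b b' - g x b b'\<bar> <= (L1 + L2 + L3) * norm (y - x)" if "x : K" "y : K" for x y
    using L2(2)[OF that(2,1)] L1(1) L3(1) mult_right_mono[of L2 "L1 + L2 + L3" "norm (y - x)"] by simp
   show "\<bar>g y b b' - g x b b' - Dg b b' x (y - x)\<bar> <= (L1 + L2 + L3) * (norm (y - x))\<^sup>2" if "x : K" "y : K" for x y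
    using L1(2)[OF that] L2(1) L3(1) mult_right_mono[of L1 "L1 + L2 + L3" "(norm (y - x))\<^sup>2"] by simp
  qed
  thus ?thesis unfolding L_def by (rule someI)
 qed
 define C where "C = (\<Sum>b\<in>(Basis::'e set). \<Sum>b'\<in>(Basis::'e set). L b b')"
 have C: "0 < C" unfolding C_def using PL by (intro sum_pos) (auto simp: P_def)
 have sum_bound: "\<bar>\<Sum>b\<in>Basis. \<Sum>b'\<in>Basis. (u \<bullet> b) * (v \<bullet> b') * q b b'\<bar> <= C * k * norm u * norm v"
  if q: "!!b b'. b : Basis ==> b' : Basis ==> \<bar>q b b'\<bar> <= L b b' * k" and k: "0 <= k" for q :: "'e => 'e => real" and u v :: 'e and k
 proof -
  have "\<bar>\<Sum>b\<in>Basis. \<Sum>b'\<in>Basis. (u \<bullet> b) * (v \<bullet> b') * q b b'\<bar> <= (\<Sum>b\<in>Basis. \<Sum>b'\<in>Basis. \<bar>(u \<bullet> b) * (v \<bullet> b') * q b b'\<bar>)"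
   by (intro order.trans[OF sum_abs] sum_mono sum_abs)
  also have "\<dots> <= (\<Sum>b\<in>Basis. \<Sum>b'\<in>Basis. norm u * norm v * (L b b' * k))"
   unfolding abs_mult by (intro sum_mono mult_mono q) (auto simp: Basis_le_norm)
  also have "\<dots> = C * k * norm u * norm v" by (simp add: C_def sum_distrib_left sum_distrib_right mult_ac)
  finally show ?thesis .
 qed
 have 1: "\<bar>g x u v\<bar> <= C * norm u * norm v" if x: "x : K" for x u v
  using sum_bound[of "%b b'. g x b b'" 1 u v] PL x K(3) g_expand[of x u v] by (auto simp: P_def)
 have 2: "\<bar>g y u v - g x u v\<bar> <= C * norm (y - x) * norm u * norm v" if "x : K" "y : K" for x y u v
 proof -
  have "g y u v - g x u v = (\<Sum>b\<in>Basis. \<Sum>b'\<in>Basis. (u \<bullet> b) * (v \<bullet> b') * (g y b b' - g x b b'))"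
   using g_expand[of x u v] g_expand[of y u v] that K(3) by (simp add: subset_iff sum_subtractf right_diff_distrib)
  thus ?thesis
   using sum_bound[of "%b b'. g y b b' - g x b b'" "norm (y - x)" u v] PL that by (auto simp: P_def)
 qed
 have 3: "\<bar>g y v v - g x v v - dg x (y - x) v v\<bar> <= C * (norm (y - x))\<^sup>2 * (norm v)\<^sup>2" if "x : K" "y : K" for x y v
 proof -
  have "g y v v - g x v v - dg x (y - x) v v = (\<Sum>b\<in>Basis. \<Sum>b'\<in>Basis. (v \<bullet> b) * (v \<bullet> b') * (g y b b' - g x b b' - Dg b b' x (y - x)))"
   using g_expand[of x v v] g_expand[of y v v] that K(3)
   by (simp add: subset_iff sum_subtractf right_diff_distrib dg_def)
  thus ?thesis
   using sum_bound[of "%b b'. g y b b' - g x b b' - Dg b b' x (y - x)" "(norm (y - x))\<^sup>2" v v] PL that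
   by (auto simp: P_def power2_eq_square mult_ac)
 qed
 have "EX m>0. ALL x:K. ALL v. m * (norm v)\<^sup>2 <= g x v v"
 proof (cases "K = {}")
  case False
  have cg: "continuous_on (K \<times> sphere 0 1) (%z. g (fst z) (snd z) (snd z))"
  proof (rule continuous_on_eq)
   show "continuous_on (K \<times> sphere 0 1) (%z. \<Sum>b\<in>Basis. \<Sum>b'\<in>Basis. (snd z \<bullet> b) * (snd z \<bullet> b') * g (fst z) b b')"
    by (intro continuous_intros continuous_on_compose2[OF Ck_continuous_on[OF smooth[of _ _ 0]] continuous_on_fst[OF continuous_on_id]])
     (use K in auto)
   show "(\<Sum>b\<in>Basis. \<Sum>b'\<in>Basis. (snd z \<bullet> b) * (snd z \<bullet> b') * g (fst z) b b') = g (fst z) (snd z) (snd z)"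
    if "z : K \<times> sphere 0 1" for z using that K(3) by (auto simp: g_expand[symmetric] subset_iff)
  qed
  have ne: "sphere (0::'e) 1 ~= {}" using vector_choose_size[of 1] by auto
  have cK: "compact (K \<times> sphere (0::'e) 1)" by (intro compact_Times K compact_sphere)
  have "K \<times> sphere (0::'e) 1 ~= {}" using False ne by auto
  then obtain z0 where z0: "z0 : K \<times> sphere 0 1" "!!z. z : K \<times> sphere 0 1 ==> g (fst z0) (snd z0) (snd z0) <= g (fst z) (snd z) (snd z)"
   using continuous_attains_inf[OF cK _ cg] by blast
  define m where "m = g (fst z0) (snd z0) (snd z0)"
  have "snd z0 ~= 0" "fst z0 : Om" using z0(1) K(3) by auto
  hence "0 < m" unfolding m_def using pos by blast
  moreover have "m * (norm v)\<^sup>2 <= g x v v" if x: "x : K" for x v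
  proof (cases "v = 0")
   case False
   have xO: "x : Om" using x K by auto
   have "m <= g x ((1 / norm v) *\<^sub>R v) ((1 / norm v) *\<^sub>R v)"
    unfolding m_def using z0(2)[of "(x, (1 / norm v) *\<^sub>R v)"] x False by simp
   also have "\<dots> = g x v v / (norm v)\<^sup>2"
    using bil[OF xO] by (simp add: bilinear_lmul bilinear_rmul power2_eq_square)
   finally show ?thesis using False by (simp add: field_simps)
  next
   case True
   thus ?thesis using bil[of x] x K by (auto simp: bilinear_lzero)
  qed
  ultimately show ?thesis by blast
 qed (auto intro: exI[of _ 1])
 then obtain m where "0 < m" "!!x v. x : K ==> m * (norm v)\<^sup>2 <= g x v v" by blast
 thus ?thesis using that[of C m] C 1 2 3 by blast
qed

text \<open>First variation of the energy, with a remainder uniform in both geodesics. Energies are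
  constant in time, so their difference \<open>k\<close> can be evaluated at every \<open>t\<close>;
  there it agrees up to second order with the derivative of \<open>a\<close>, twice the inner
  product of the velocity of \<open>c\<close> with \<open>q - c\<close>. Integrating
  \<open>a - t * k\<close> from \<open>a 0 = 0\<close> gives the estimate.\<close>

lemma first_variation:
 assumes K: "compact K" "convex K" "K \<subseteq> Om"
 obtains C where "0 < C" "!!c q e B. geod c ==> geod q ==> fst (c 0) = fst (q 0) ==>
  (!!t. t : {0..1} ==> fst (c t) : K & fst (q t) : K & norm (q t - c t) <= e & norm (snd (c t)) <= 1) ==>
  \<bar>g (fst (q 0)) (snd (q 0)) (snd (q 0)) - g (fst (c 0)) (snd (c 0)) (snd (c 0))
   - 2 * g (fst (c 1)) (snd (c 1)) (fst (q 1) - fst (c 1))\<bar> <= C * e\<^sup>2"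
proof -
 obtain C m where C: "0 < C" and "0 < m" and b1: "!!x u v. x : K ==> \<bar>g x u v\<bar> <= C * norm u * norm v"
  and "!!x v. x : K ==> m * (norm v)\<^sup>2 <= g x v v"
  and b2: "!!x y u v. x : K ==> y : K ==> \<bar>g y u v - g x u v\<bar> <= C * norm (y - x) * norm u * norm v"
  and b3: "!!x y v. x : K ==> y : K ==> \<bar>g y v v - g x v v - dg x (y - x) v v\<bar> <= C * (norm (y - x))\<^sup>2 * (norm v)\<^sup>2"
  by (rule metric_bounds[OF K]) (rule that, assumption+)
 have main: "\<bar>g (fst (q 0)) (snd (q 0)) (snd (q 0)) - g (fst (c 0)) (snd (c 0)) (snd (c 0))
   - 2 * g (fst (c 1)) (snd (c 1)) (fst (q 1) - fst (c 1))\<bar> <= 4 * C * e\<^sup>2"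
  if c: "geod c" and q: "geod q" and eq0: "fst (c 0) = fst (q 0)"
   and h: "!!t. t : {0..1} ==> fst (c t) : K & fst (q t) : K & norm (q t - c t) <= e & norm (snd (c t)) <= 1"
  for c q e
 proof -
  define k where "k = g (fst (q 0)) (snd (q 0)) (snd (q 0)) - g (fst (c 0)) (snd (c 0)) (snd (c 0))"
  define a where "a t = 2 * g (fst (c t)) (snd (c t)) (fst (q t) - fst (c t))" for t
  define a' where "a' t = dg (fst (c t)) (fst (q t) - fst (c t)) (snd (c t)) (snd (c t))
    + 2 * g (fst (c t)) (snd (c t)) (snd (q t) - snd (c t))" for t
  have ad: "((%t. a t - t * k) has_vector_derivative a' t - k) (at t within {0..1})" if t: "t : {0..1}" for t
  proof -
   let ?x = "fst (c t)" and ?v = "snd (c t)" and ?z = "fst (q t) - fst (c t)" and ?z' = "snd (q t) - snd (c t)"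
   have x: "?x : Om" by (rule geod_in[OF c t])
   have "((%s. g (fst (c s)) (snd (c s)) (fst (q s) - fst (c s))) has_vector_derivative
    (dg ?x ?v ?v ?z + g ?x (- chris ?x ?v ?v) ?z + g ?x ?v ?z')) (at t within {0..1})"
    by (rule g_product_rule[OF t geod_in[OF c] geod_fst[OF c t] geod_snd[OF c t]
       has_vector_derivative_diff[OF geod_fst[OF q t] geod_fst[OF c t]]])
   moreover have "dg ?x ?v ?v ?z + g ?x (- chris ?x ?v ?v) ?z + g ?x ?v ?z' = a' t / 2"
    using bil[OF x] by (simp add: bilinear_lneg chris[OF x] a'_def field_simps)
   ultimately have "((%s. g (fst (c s)) (snd (c s)) (fst (q s) - fst (c s))) has_real_derivative a' t / 2) (at t within {0..1})"
    by (simp add: has_real_derivative_iff_has_vector_derivative)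
   hence "((%t. a t - t * k) has_real_derivative a' t - k) (at t within {0..1})"
    unfolding a_def by (auto intro!: derivative_eq_intros)
   thus ?thesis by (simp add: has_real_derivative_iff_has_vector_derivative)
  qed
  have bound: "\<bar>a' t - k\<bar> <= 4 * C * e\<^sup>2" if t: "t : {0..1}" for t
  proof -
   let ?x = "fst (c t)" and ?v = "snd (c t)" and ?y = "fst (q t)" and ?w = "snd (q t)"
   have xy: "?x : K" "?y : K" "norm ?v <= 1" using h[OF t] by auto
   hence O: "?x : Om" "?y : Om" using K(3) by auto
   have e1: "norm (?y - ?x) <= e" "norm (?w - ?v) <= e"
    using h[OF t] norm_fst_le[of "?y - ?x" "?w - ?v"] norm_snd_le[of "?w - ?v" "?y - ?x"]
    by (auto simp: minus_prod_def)
   have e: "0 <= e" using e1(1) norm_ge_zero order_trans by blast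
   \<comment> \<open>The terms of first order in \<open>q - c\<close> make up \<open>a' t\<close>;
     the three remaining ones are quadratic in \<open>e\<close>.\<close>
   have "k = g ?y ?w ?w - g ?x ?v ?v" unfolding k_def using geod_energy[OF q t] geod_energy[OF c t] by simp
   moreover have "g ?y ?w ?w = g ?y ?v ?v + 2 * g ?y ?v (?w - ?v) + g ?y (?w - ?v) (?w - ?v)"
    using bil[OF O(2)] sym[OF O(2), of ?w ?v] by (simp add: bilinear_lsub bilinear_rsub)
   ultimately have "k - a' t = (g ?y ?v ?v - g ?x ?v ?v - dg ?x (?y - ?x) ?v ?v)
     + 2 * (g ?y ?v (?w - ?v) - g ?x ?v (?w - ?v)) + g ?y (?w - ?v) (?w - ?v)" by (simp add: a'_def)
   moreover have "\<bar>g ?y ?v ?v - g ?x ?v ?v - dg ?x (?y - ?x) ?v ?v\<bar> <= C * e\<^sup>2 * 1"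
    using C e1 xy e by (intro order.trans[OF b3[OF xy(1,2)]] mult_mono mult_left_mono power_mono) (auto intro: power_le_one)
   moreover have "\<bar>g ?y ?v (?w - ?v) - g ?x ?v (?w - ?v)\<bar> <= C * e * 1 * e"
    using C e1 xy e by (intro order.trans[OF b2[OF xy(1,2)]] mult_mono mult_left_mono) auto
   moreover have "\<bar>g ?y (?w - ?v) (?w - ?v)\<bar> <= C * e * e"
    using C e1 xy e by (intro order.trans[OF b1[OF xy(2)]] mult_mono mult_left_mono) auto
   ultimately show ?thesis by (simp add: power2_eq_square abs_le_iff)
  qed
  have "norm ((a 1 - 1 * k) - (a 0 - 0 * k)) <= 4 * C * e\<^sup>2 * norm (1 - 0 :: real)"
  proof (rule differentiable_bound[where S="{0..1}" and f="%t. a t - t * k" and f'="%t h. h *\<^sub>R (a' t - k)"])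
   show "((%t. a t - t * k) has_derivative (%h. h *\<^sub>R (a' t - k))) (at t within {0..1})" if "t : {0..1}" for t
    using ad[OF that] by (simp add: has_vector_derivative_def)
   show "onorm (%h. h *\<^sub>R (a' t - k)) <= 4 * C * e\<^sup>2" if "t : {0..1}" for t
    using bound[OF that] by (intro onorm_le) (auto simp: abs_mult mult.commute intro: mult_left_mono)
  qed auto
  moreover have "a 0 = 0" unfolding a_def using eq0 bil[OF geod_in[OF c, of 0]] by (simp add: bilinear_rzero)
  ultimately show ?thesis by (simp add: a_def k_def abs_minus_commute)
 qed
 show ?thesis by (rule that[of "4 * C"]) (use C main in auto)
qed

end

lemma quadratic_bound:
 fixes f :: "'a::euclidean_space => 'b::real_normed_vector"
 assumes S: "convex S" "x : S" "y : S" and f: "!!z. z : S ==> (f has_derivative f' z) (at z within S)"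
  and C: "0 <= C" "!!z h. z : S ==> norm (f' z h - f' x h) <= C * norm (z - x) * norm h"
 shows "norm (f y - f x - f' x (y - x)) <= C * (norm (y - x))\<^sup>2"
proof -
 have seg: "closed_segment x y \<subseteq> S" using S by (simp add: closed_segment_subset)
 have lin: "bounded_linear (f' x)" by (rule has_derivative_bounded_linear[OF f[OF S(2)]])
 have "norm ((f y - f' x y) - (f x - f' x x)) <= (C * norm (y - x)) * norm (y - x)"
 proof (rule differentiable_bound[of "closed_segment x y"])
  fix z assume z: "z : closed_segment x y"
  have zS: "z : S" using z seg by blast
  show "((%z. f z - f' x z) has_derivative (%h. f' z h - f' x h)) (at z within closed_segment x y)"
   by (rule has_derivative_diff[OF has_derivative_subset[OF f[OF zS] seg] bounded_linear_imp_has_derivative[OF lin]])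
  show "onorm (%h. f' z h - f' x h) <= C * norm (y - x)"
  proof (rule onorm_le)
   fix h
   have "norm (f' z h - f' x h) <= C * norm (z - x) * norm h" by (rule C(2)[OF zS])
   also have "\<dots> <= C * norm (y - x) * norm h"
    using C(1) segment_bound1[OF z] by (intro mult_right_mono mult_left_mono) auto
   finally show "norm (f' z h - f' x h) <= C * norm (y - x) * norm h" .
  qed
 qed auto
 moreover have eq: "f y - f x - f' x (y - x) = (f y - f' x y) - (f x - f' x x)"
  using linear_diff[OF bounded_linear.linear[OF lin], of y x] by simp
 ultimately show ?thesis unfolding eq power2_eq_square by (simp only: mult.assoc)
qed

context local_metric
begin

text \<open>\<open>ex (x, v)\<close> is the exponential map, and \<open>V x y\<close> the initial
  velocity of the geodesic from \<open>x\<close> to \<open>y\<close>. They arise from the flow of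
  the spray at time one near the zero vector over \<open>p\<close>, and from the inverse function
  theorem for the map sending \<open>(x, v)\<close> to \<open>(x, ex (x, v))\<close>. The derivative
  of the energy in the end point is the Gauss lemma.\<close>

theorem normal_coords:
 assumes p: "p : Om"
 obtains r s s' C ex V where "0 < r" "0 < s'" "s' <= s" "0 < C" "cball p r \<subseteq> Om"
  "Ck (Suc 0) ex (ball (p, 0) s)" "(ex has_derivative (%w. fst w + snd w)) (at (p, 0))"
  "!!x y. x : ball p r ==> y : ball p r ==> (x, V x y) : ball (p, 0) s & ex (x, V x y) = y"
  "!!x v. (x, v) : ball (p, 0) s' ==> x : ball p r & ex (x, v) : ball p r & V x (ex (x, v)) = v"
  "Ck (Suc 0) (%z. V (fst z) (snd z)) (ball p r \<times> ball p r)"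
  "!!x v. (x, v) : ball (p, 0) s ==> EX c. geod c & c 0 = (x, v) & (ALL t:{0..1}. fst (c t) = ex (x, t *\<^sub>R v))"
  "!!x y. x : ball p r ==> y : ball p r ==> EX c. geod c & c 0 = (x, V x y) & c 1 = (y, - V y x)"
  "!!a y. a : ball p r ==> y : ball p r ==>
   ((%y. g a (V a y) (V a y) / 2) has_derivative (%h. - g y (V y a) h)) (at y)"
  "!!x y. x : ball p r ==> y : ball p r ==> norm (y - x) <= C * norm (V x y) & norm (V x y) <= C * norm (y - x)"
  "!!a x y. a : ball p r ==> x : ball p r ==> y : ball p r ==>
   \<bar>g a (V a y) (V a y) / 2 - g a (V a x) (V a x) / 2 + g x (V x a) (y - x)\<bar> <= C * (norm (y - x))\<^sup>2"
proof -
 obtain R0 where R0: "0 < R0" "cball p R0 \<subseteq> Om" using open_Om p open_contains_cball by blast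
 define R where "R = min R0 1"
 have R: "0 < R" "R <= 1" "cball p R \<subseteq> Om" using R0 by (auto simp: R_def)
 define z0 where "z0 = (p, 0 :: 'e)"
 have fstK: "fst z : cball p R & norm (snd z) <= R" if "z : cball z0 R" for z
  using that dist_fst_le[of z0 z] dist_snd_le[of z0 z] by (auto simp: z0_def)
 have "spray z0 = 0" using chris_scale[OF p, of 0 0] by (simp add: spray_def z0_def zero_prod_def)
 moreover have "cball z0 R \<subseteq> Om \<times> UNIV" using fstK R(3) by fastforce
 moreover have "open (Om \<times> (UNIV :: 'e set))" using open_Om by (simp add: open_Times)
 ultimately obtain rf H L where rf12: "0 < rf" "rf < R" and H0: "!!j. j : ball z0 rf ==> H j 0 = j"
  and Hn: "!!j t. j : ball z0 rf ==> t : {0..1} ==> norm (H j t - z0) <= L * norm (j - z0)"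
  and HR: "!!j t. j : ball z0 rf ==> t : {0..1} ==> H j t : ball z0 R"
  and Hd: "!!j t. j : ball z0 rf ==> t : {0..1} ==> (H j has_vector_derivative spray (H j t)) (at t within {0..1})"
  and HL: "!!j j' t. j : ball z0 rf ==> j' : ball z0 rf ==> t : {0..1} ==> norm (H j t - H j' t) <= L * norm (j - j')"
  and HC: "Ck (Suc 0) (%j. H j 1) (ball z0 rf)"
  and Hu: "!!j y t. j : ball z0 rf ==> y 0 = j ==> (ALL t:{0..1}. y t : cball z0 R &
    (y has_vector_derivative spray (y t)) (at t within {0..1})) ==> t : {0..1} ==> y t = H j t"
  and rf3: "0 < L" by (rule local_flow[OF spray_Ck _ R(1)]) (rule that, assumption+)
 note rf = rf12 rf3
 have Hg: "geod (H j)" if "j : ball z0 rf" for j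
 proof -
  have "fst (H j t) : Om" if "t : {0..1}" for t
   using HR[OF \<open>j : ball z0 rf\<close> that] fstK[of "H j t"] R(3) by auto
  thus ?thesis unfolding geod_def using Hd[OF that] by blast
 qed
 have geod_unique: "c t = H (c 0) t" if "c 0 : ball z0 rf" "geod c" "!!t. t : {0..1} ==> c t : cball z0 R" "t : {0..1}" for c t
  by (rule Hu[where y=c and t=t and j="c 0", OF that(1) refl _ that(4)]) (use that(2,3) in \<open>auto simp: geod_def\<close>)
 define ex where "ex j = fst (H j 1)" for j
 have exC: "Ck (Suc 0) ex (ball z0 rf)" unfolding ex_def[abs_def] by (rule Ck_fst[OF HC])
 have shrink: "norm ((x, k *\<^sub>R v) - z0) <= norm ((x, v) - z0)" if "k : {0..1}" for x v k
 proof -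
  have "norm (k *\<^sub>R v) <= norm v" using that by (auto intro: mult_left_le_one_le)
  thus ?thesis by (simp add: z0_def norm_Pair real_sqrt_le_iff power_mono)
 qed
 have homog: "ex (x, k *\<^sub>R v) = fst (H (x, v) k)" if j: "(x, v) : ball z0 rf" and k: "k : {0..1}" for x v k
 proof -
  let ?c = "%t. (fst (H (x, v) (k * t)), k *\<^sub>R snd (H (x, v) (k * t)))"
  have s: "?c 0 = (x, k *\<^sub>R v)" using H0[OF j] by simp
  have in1: "k * t : {0..1}" if "t : {0..1}" for t using that k mult_le_one[of k t] by auto
  have "?c 0 : ball z0 rf" unfolding s using j shrink[OF k, of x v] by (simp add: dist_norm norm_minus_commute)
  moreover have "geod ?c" by (rule geod_scale[OF Hg[OF j] k])
  moreover have "?c t : cball z0 R" if "t : {0..1}" for t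
   using HR[OF j in1[OF that]] shrink[OF k, of "fst (H (x, v) (k * t))" "snd (H (x, v) (k * t))"]
   by (simp add: dist_norm norm_minus_commute)
  ultimately have "?c 1 = H (?c 0) 1" by (rule geod_unique) auto
  thus ?thesis unfolding s ex_def by (metis fst_conv mult.right_neutral)
 qed
 have ex0: "ex (x, 0) = x" if "(x, 0) : ball z0 rf" for x using homog[OF that, of 0] H0[OF that] by simp
 have z0b: "z0 : ball z0 rf" using rf by simp
 obtain A where A: "(ex has_derivative A) (at z0)"
  using Ck_has_derivative[OF exC open_ball z0b] by (rule exE)
 have linA: "linear A" by (rule has_derivative_linear[OF A])
 \<comment> \<open>The derivative of \<open>ex\<close> at \<open>z0\<close> is read off along rays
   on which \<open>ex\<close> is a known curve \<open>q\<close>. Constant geodesics give it in the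
   first factor, \<open>homog\<close> in the second.\<close>
 have Adir: "A w = k" if eq: "!!t. t : {0..1} ==> ex (z0 + t *\<^sub>R w) = q t"
  and q: "(q has_vector_derivative k) (at 0 within {0..1})" for w q k
 proof -
  have l: "((%t::real. z0 + t *\<^sub>R w) has_derivative (%t. t *\<^sub>R w)) (at 0 within {0..1})"
   by (auto intro!: derivative_eq_intros)
  have A': "(ex has_derivative A) (at (z0 + 0 *\<^sub>R w))" using A by simp
  have "((%t. ex (z0 + t *\<^sub>R w)) has_derivative (%t. A (t *\<^sub>R w))) (at 0 within {0..1})"
   by (rule has_derivative_compose[OF l A'])
  hence "((%t. ex (z0 + t *\<^sub>R w)) has_vector_derivative A w) (at 0 within {0..1})"
   unfolding has_vector_derivative_def linear_scale[OF linA] .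
  hence "(q has_vector_derivative A w) (at 0 within {0..1})"
   by (rule has_vector_derivative_transform[rotated 2]) (use eq in auto)
  moreover have "at (0::real) within {0..1} ~= bot" by (simp add: trivial_limit_within islimpt_Icc)
  ultimately show ?thesis using q vector_derivative_unique_within by blast
 qed
 have small: "EX e>0. norm (e *\<^sub>R h) < rf" for h :: 'e
 proof (intro exI conjI)
  let ?e = "rf / (2 * (norm h + 1))"
  have n: "0 < norm h + 1" using norm_ge_zero[of h] by linarith
  thus e: "?e > 0" using rf by simp
  have "norm (?e *\<^sub>R h) = ?e * norm h" by (simp only: norm_scaleR abs_of_pos[OF e])
  also have "\<dots> <= ?e * (norm h + 1)" using e by (intro mult_left_mono) auto
  also have "\<dots> = rf / 2" using n by (simp add: field_simps)
  finally have le: "norm (?e *\<^sub>R h) <= rf / 2" .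
  show "norm (?e *\<^sub>R h) < rf" by (rule le_less_trans[OF le]) (use rf in simp)
 qed
 have A1: "A (h, 0) = h" for h
 proof -
  obtain e where e: "e > 0" "norm (e *\<^sub>R h) < rf" using small by blast
  have "A (e *\<^sub>R h, 0) = e *\<^sub>R h"
  proof (rule Adir[where q="%t. p + t *\<^sub>R (e *\<^sub>R h)"])
   fix t :: real assume t: "t : {0..1}"
   have "norm (t *\<^sub>R (e *\<^sub>R h)) <= norm (e *\<^sub>R h)" unfolding norm_scaleR using t e
    by (intro mult_left_le_one_le) auto
   hence "norm (t *\<^sub>R (e *\<^sub>R h)) < rf" using e(2) by simp
   hence "(p + t *\<^sub>R (e *\<^sub>R h), 0) : ball z0 rf" by (simp add: z0_def dist_norm norm_Pair)
   thus "ex (z0 + t *\<^sub>R (e *\<^sub>R h, 0)) = p + t *\<^sub>R (e *\<^sub>R h)" using ex0 by (simp add: z0_def)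
  qed (auto intro!: derivative_eq_intros)
  moreover have "A (e *\<^sub>R h, 0) = e *\<^sub>R A (h, 0)" using linear_scale[OF linA, of e "(h, 0)"] by simp
  ultimately show ?thesis using e(1) by simp
 qed
 have A2: "A (0, h) = h" for h
 proof -
  obtain e where e: "e > 0" "norm (e *\<^sub>R h) < rf" using small by blast
  hence b: "(p, e *\<^sub>R h) : ball z0 rf" by (simp add: z0_def dist_norm norm_Pair)
  have "A (0, e *\<^sub>R h) = e *\<^sub>R h"
  proof (rule Adir[where q="%t. fst (H (p, e *\<^sub>R h) t)"])
   show "ex (z0 + t *\<^sub>R (0, e *\<^sub>R h)) = fst (H (p, e *\<^sub>R h) t)" if "t : {0..1}" for t
    using homog[OF b that] by (simp add: z0_def)
   show "((%t. fst (H (p, e *\<^sub>R h) t)) has_vector_derivative e *\<^sub>R h) (at 0 within {0..1})"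
    using geod_fst[OF Hg[OF b], of 0] H0[OF b] by simp
  qed
  moreover have "A (0, e *\<^sub>R h) = e *\<^sub>R A (0, h)" using linear_scale[OF linA, of e "(0, h)"] by simp
  ultimately show ?thesis using e(1) by simp
 qed
 have Ahk: "A w = fst w + snd w" for w using linear_add[OF linA, of "(fst w, 0)" "(0, snd w)"] A1 A2 by simp
 \<comment> \<open>Its derivative at \<open>z0\<close> sends \<open>(h, k)\<close> to
   \<open>(h, h + k)\<close>, which is injective.\<close>
 define F where "F j = (fst j, ex j)" for j :: "'e \<times> 'e"
 have FC: "Ck (Suc 0) F (ball z0 rf)" unfolding F_def[abs_def] by (intro Ck_Pair Ck_fst Ck_id exC)
 have dF: "(F has_derivative (%w. (fst w, A w))) (at z0)"
  unfolding F_def[abs_def] by (intro has_derivative_Pair A has_derivative_fst has_derivative_ident)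
 obtain U V' G where U: "open U" "U \<subseteq> ball z0 rf" "z0 : U" and V': "open V'" "F z0 : V'"
  and hom: "homeomorphism U V' F G" and GC: "Ck (Suc 0) G V'"
 proof (rule C1_inverse_function[OF FC open_ball z0b dF])
  show "h = 0" if "(fst h, A h) = 0" for h using that Ahk[of h] by (auto simp: zero_prod_def prod_eq_iff)
 qed (rule that, assumption+)
 have GF: "G (F j) = j" if "j : U" for j using hom that by (auto simp: homeomorphism_def)
 have FG: "F (G z) = z" "G z : U" if "z : V'" for z using hom that by (auto simp: homeomorphism_def)
 have Fz0: "F z0 = (p, p)" using ex0[of p] z0b by (simp add: F_def z0_def)
 obtain s1 where s1: "0 < s1" "ball z0 s1 \<subseteq> U" using U open_contains_ball by blast
 \<comment> \<open>The factor \<open>L + 1\<close> leaves room for final velocities: by the bound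
   \<open>L\<close> for the flow, a reversed geodesic still starts inside \<open>U\<close>, where
   \<open>G\<close> inverts \<open>F\<close>.\<close>
 define V'' where "V'' = V' \<inter> G -` ball z0 (s1 / (L + 1))"
 have "open V''" unfolding V''_def by (rule continuous_open_preimage[OF Ck_continuous_on[OF GC] V'(1) open_ball])
 moreover have "(p, p) : V''" using GF[OF U(3)] V'(2) Fz0 s1(1) rf(3) by (simp add: V''_def)
 ultimately obtain r1 where r1: "0 < r1" "ball (p, p) r1 \<subseteq> V''" using open_contains_ball by blast
 define r0 where "r0 = min (r1 / 2) (min s1 R)"
 have r0: "0 < r0" using r1 s1 R by (simp add: r0_def)
 have prod_ball: "(x, y) : V''" if "x : ball p r0" "y : ball p r0" for x y
 proof -
  have "dist (p, p) (x, y) <= dist p x + dist p y" by (simp add: dist_Pair_Pair sqrt_sum_squares_le_sum)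
  also have "\<dots> < r1" using that by (simp add: r0_def)
  finally show ?thesis using r1 by auto
 qed
 define V where "V x y = snd (G (x, y))" for x y
 have Gxy: "G (x, y) = (x, V x y)" "(x, V x y) : U" "ex (x, V x y) = y" "(x, V x y) : ball z0 (s1 / (L + 1))"
  if "x : ball p r0" "y : ball p r0" for x y
 proof -
  have v: "(x, y) : V'" "G (x, y) : ball z0 (s1 / (L + 1))" using prod_ball[OF that] by (auto simp: V''_def)
  have "F (G (x, y)) = (x, y)" by (rule FG(1)[OF v(1)])
  hence e: "fst (G (x, y)) = x" "ex (G (x, y)) = y" by (auto simp: F_def)
  thus G: "G (x, y) = (x, V x y)" by (simp add: V_def prod_eq_iff)
  show "(x, V x y) : U" "ex (x, V x y) = y" "(x, V x y) : ball z0 (s1 / (L + 1))"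
   using FG(2)[OF v(1)] e v(2) unfolding G by auto
 qed
 have Vrf: "(x, V x y) : ball z0 rf" if "x : ball p r0" "y : ball p r0" for x y
  using Gxy(2)[OF that] U(2) by blast
 have VC: "Ck (Suc 0) (%z. V (fst z) (snd z)) (ball p r0 \<times> ball p r0)"
 proof -
  have "Ck (Suc 0) G (ball p r0 \<times> ball p r0)"
   by (rule Ck_subset[OF GC]) (use prod_ball in \<open>auto simp: V''_def\<close>)
  from Ck_snd[OF this] show ?thesis by (simp add: V_def)
 qed
 have V0: "V x x = 0" if "x : ball p r0" for x
 proof -
  have "(x, 0) : ball z0 s1" using that by (simp add: r0_def z0_def dist_norm norm_Pair)
  hence x0: "(x, 0) : U" using s1 by blast
  hence "F (x, 0) = (x, x)" using ex0 U(2) by (auto simp: F_def)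
  thus ?thesis using GF[OF x0] by (simp add: V_def)
 qed
 \<comment> \<open>The geodesic from \<open>x\<close> to \<open>y\<close> run backwards starts at
   \<open>y\<close> with minus the final velocity; by uniqueness this vector is
   \<open>V y x\<close>.\<close>
 have rev: "H (x, V x y) 1 = (y, - V y x)" if xy: "x : ball p r0" "y : ball p r0" for x y
 proof -
  let ?j = "(x, V x y)"
  have j: "?j : ball z0 rf" by (rule Vrf[OF xy])
  define w where "w = snd (H ?j 1)"
  have e1: "H ?j 1 = (y, w)" using Gxy(3)[OF xy] by (simp add: ex_def w_def prod_eq_iff)
  let ?c = "%t. (fst (H ?j (1 - t)), - snd (H ?j (1 - t)))"
  have n: "norm ((a, - b) - z0) = norm ((a, b) - z0)" for a b :: 'e by (simp add: z0_def norm_Pair)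
  have "norm ((y, - w) - z0) <= L * norm (?j - z0)" using Hn[OF j, of 1] n e1 by simp
  also have "\<dots> <= L * (s1 / (L + 1))"
   using Gxy(4)[OF xy] rf by (intro mult_left_mono) (auto simp: dist_norm norm_minus_commute)
  also have "\<dots> < s1" using s1 rf by (simp add: field_simps)
  finally have U1: "(y, - w) : U" using s1(2) by (auto simp: dist_norm norm_minus_commute)
  hence b: "(y, - w) : ball z0 rf" using U(2) by blast
  have g0: "?c 0 = (y, - w)" using e1 by simp
  have "?c 1 = H (?c 0) 1"
  proof (rule geod_unique)
   show "?c 0 : ball z0 rf" using g0 b by simp
   show "geod ?c" by (rule geod_reverse[OF Hg[OF j]])
   show "?c t : cball z0 R" if "t : {0..1}" for t
    using HR[OF j, of "1 - t"] that n[of "fst (H ?j (1 - t))" "snd (H ?j (1 - t))"]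
    by (simp add: dist_norm norm_minus_commute[of z0])
  qed auto
  hence "H (y, - w) 1 = (x, - V x y)" using H0[OF j] g0 by simp
  hence "ex (y, - w) = x" by (simp add: ex_def)
  hence "F (y, - w) = (y, x)" by (simp add: F_def)
  hence "V y x = - w" using GF[OF U1] by (simp add: V_def)
  thus ?thesis using e1 by simp
 qed
 define r where "r = r0 / 2"
 have r: "0 < r" "cball p r \<subseteq> ball p r0" "ball p r \<subseteq> ball p r0" using r0 by (auto simp: r_def)
 have rR: "cball p r \<subseteq> cball p R" using r0 by (auto simp: r_def r0_def)
 have rR2: "z : cball p R" "z : Om" if "z : ball p r" for z
 proof -
  have "z : cball p r" using that by auto
  thus "z : cball p R" using rR by blast
  thus "z : Om" using R(3) by blast
 qed
 have cpt: "compact (cball p r \<times> cball p r)" "convex (cball p r \<times> cball p r)" "cball p r \<times> cball p r \<subseteq> ball p r0 \<times> ball p r0"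
  using r by (auto intro: compact_Times convex_Times)
 obtain LV where LV: "0 < LV" "!!z z'. z : cball p r \<times> cball p r ==> z' : cball p r \<times> cball p r ==>
   norm (V (fst z) (snd z) - V (fst z') (snd z')) <= LV * norm (z - z')"
  by (rule Ck_lipschitz[OF VC cpt]) (rule that, assumption+)
 have LV2: "norm (V a y - V a y') <= LV * norm (y - y')" "norm (V y a - V y' a) <= LV * norm (y - y')"
  if "a : ball p r" "y : ball p r" "y' : ball p r" for a y y'
  using LV(2)[of "(a, y)" "(a, y')"] LV(2)[of "(y, a)" "(y', a)"] that by (auto simp: norm_Pair)
 have KR: "compact (cball p R)" "convex (cball p R)" by auto
 obtain C1 where C1: "0 < C1" "!!c m i B. geod c ==> geod m ==> fst (c 0) = fst (m 0) ==>
  (!!t. t : {0..1} ==> fst (c t) : cball p R & fst (m t) : cball p R & norm (m t - c t) <= i & norm (snd (c t)) <= 1) ==>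
  \<bar>g (fst (m 0)) (snd (m 0)) (snd (m 0)) - g (fst (c 0)) (snd (c 0)) (snd (c 0))
   - 2 * g (fst (c 1)) (snd (c 1)) (fst (m 1) - fst (c 1))\<bar> <= C1 * i\<^sup>2"
  using first_variation[OF KR R(3)] by metis
 obtain Cg where Cg1: "!!x u v. x : cball p R ==> \<bar>g x u v\<bar> <= Cg * norm u * norm v"
  and Cg2: "!!x y u v. x : cball p R ==> y : cball p R ==> \<bar>g y u v - g x u v\<bar> <= Cg * norm (y - x) * norm u * norm v"
  and Cg0: "0 < Cg" by (rule metric_bounds[OF KR R(3)]) (rule that, assumption+)
 note Cg = Cg0 Cg1 Cg2
 \<comment> \<open>Gauss lemma: \<open>first_variation\<close> for the geodesics from
   \<open>a\<close> to \<open>y0\<close> and from \<open>a\<close> to \<open>y\<close>, the former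
   arriving with velocity \<open>- V y0 a\<close>.\<close>
 have gauss: "((%y. g a (V a y) (V a y) / 2) has_derivative (%h. - g y0 (V y0 a) h)) (at y0)"
  if a: "a : ball p r" and y0: "y0 : ball p r" for a y0
 proof (rule has_derivative_quadratic[OF _ open_ball y0])
  note y0R = rR2[OF y0]
  hence "linear (g y0 (V y0 a))" using bil[OF y0R(2)] by (simp add: bilinear_def)
  thus "bounded_linear (%h. - g y0 (V y0 a) h)" by (intro bounded_linear_minus) (simp add: linear_linear)
  fix y assume y: "y : ball p r"
  have r0': "a : ball p r0" "y : ball p r0" "y0 : ball p r0" using a y y0 r by auto
  note b = Vrf[OF r0'(1,2)] Vrf[OF r0'(1,3)]
  define i where "i = L * (LV * norm (y - y0))"
  have "\<bar>g (fst (H (a, V a y) 0)) (snd (H (a, V a y) 0)) (snd (H (a, V a y) 0))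
    - g (fst (H (a, V a y0) 0)) (snd (H (a, V a y0) 0)) (snd (H (a, V a y0) 0))
    - 2 * g (fst (H (a, V a y0) 1)) (snd (H (a, V a y0) 1)) (fst (H (a, V a y) 1) - fst (H (a, V a y0) 1))\<bar> <= C1 * i\<^sup>2"
  proof (rule C1(2)[OF Hg[OF b(2)] Hg[OF b(1)]])
   show "fst (H (a, V a y0) 0) = fst (H (a, V a y) 0)" using H0[OF b(1)] H0[OF b(2)] by simp
   fix t :: real assume t: "t : {0..1}"
   have "norm (H (a, V a y) t - H (a, V a y0) t) <= L * norm ((a, V a y) - (a, V a y0))" by (rule HL[OF b t])
   also have "\<dots> <= i" unfolding i_def using LV2(1)[OF a y y0] rf
    by (intro mult_left_mono) (auto simp: norm_Pair)
   finally show "fst (H (a, V a y0) t) : cball p R & fst (H (a, V a y) t) : cball p R &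
     norm (H (a, V a y) t - H (a, V a y0) t) <= i & norm (snd (H (a, V a y0) t)) <= 1"
    using fstK[of "H (a, V a y0) t"] fstK[of "H (a, V a y) t"] HR[OF b(1) t] HR[OF b(2) t] R(2) by auto
  qed
  hence "\<bar>g a (V a y) (V a y) - g a (V a y0) (V a y0) + 2 * g y0 (V y0 a) (y - y0)\<bar> <= C1 * i\<^sup>2"
   unfolding H0[OF b(1)] H0[OF b(2)] rev[OF r0'(1,2)] rev[OF r0'(1,3)]
   using bil[OF y0R(2)] by (simp add: bilinear_lneg)
  hence "\<bar>(g a (V a y) (V a y) - g a (V a y0) (V a y0) + 2 * g y0 (V y0 a) (y - y0)) / 2\<bar> <= C1 * (L * LV)\<^sup>2 / 2 * (norm (y - y0))\<^sup>2"
   by (simp add: i_def power_mult_distrib abs_divide mult_ac)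
  thus "norm (g a (V a y) (V a y) / 2 - g a (V a y0) (V a y0) / 2 - - g y0 (V y0 a) (y - y0)) <= C1 * (L * LV)\<^sup>2 / 2 * (norm (y - y0))\<^sup>2"
   by (simp add: field_simps)
 qed
 define C2 where "C2 = Cg * (LV * (2 * r)) + Cg * LV"
 have C2: "0 < C2" unfolding C2_def using Cg LV r by (intro add_pos_pos mult_pos_pos) auto
 \<comment> \<open>The derivative found in \<open>gauss\<close> is Lipschitz in the point, with a
   constant independent of \<open>a\<close>; hence a Taylor remainder uniform in all three
   points.\<close>
 have quad: "\<bar>g a (V a y) (V a y) / 2 - g a (V a x) (V a x) / 2 + g x (V x a) (y - x)\<bar> <= C2 * (norm (y - x))\<^sup>2"
  if a: "a : ball p r" and x: "x : ball p r" and y: "y : ball p r" for a x y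
 proof -
  have "norm (g a (V a y) (V a y) / 2 - g a (V a x) (V a x) / 2 - - g x (V x a) (y - x)) <= C2 * (norm (y - x))\<^sup>2"
  proof (rule quadratic_bound[where f="%y. g a (V a y) (V a y) / 2" and f'="%z h. - g z (V z a) h" and S="ball p r"])
   show "((%y. g a (V a y) (V a y) / 2) has_derivative (%h. - g z (V z a) h)) (at z within ball p r)" if "z : ball p r" for z
    using gauss[OF a that] by (rule has_derivative_at_withinI)
   fix z h assume z: "z : ball p r"
   note R' = rR2(1)[OF x] rR2(1)[OF z] rR2(2)[OF x]
   have "norm (V z a) <= LV * norm (z - a)" using LV2(2)[OF a z a] V0[of a] a r by auto
   also have "\<dots> <= LV * (2 * r)"
    using LV z a dist_triangle2[of z a p] by (intro mult_left_mono) (auto simp: dist_norm norm_minus_commute)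
   finally have V1: "norm (V z a) <= LV * (2 * r)" .
   have "- g z (V z a) h - - g x (V x a) h = - (g z (V z a) h - g x (V z a) h) - g x (V z a - V x a) h"
    using bil[OF R'(3)] by (simp add: bilinear_lsub)
   also have "norm \<dots> <= \<bar>g z (V z a) h - g x (V z a) h\<bar> + \<bar>g x (V z a - V x a) h\<bar>" by simp
   also have "\<dots> <= Cg * norm (z - x) * (LV * (2 * r)) * norm h + Cg * (LV * norm (z - x)) * norm h"
   proof (rule add_mono)
    show "\<bar>g z (V z a) h - g x (V z a) h\<bar> <= Cg * norm (z - x) * (LV * (2 * r)) * norm h"
     using V1 Cg(1) by (intro order.trans[OF Cg2[OF R'(1,2)]] mult_right_mono mult_left_mono) auto
    show "\<bar>g x (V z a - V x a) h\<bar> <= Cg * (LV * norm (z - x)) * norm h"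
     using LV2(2)[OF a z x] Cg(1) by (intro order.trans[OF Cg1[OF R'(1)]] mult_right_mono mult_left_mono) auto
   qed
   also have "\<dots> = C2 * norm (z - x) * norm h" by (simp add: C2_def algebra_simps)
   finally show "norm (- g z (V z a) h - - g x (V x a) h) <= C2 * norm (z - x) * norm h" .
  qed (use C2 x y in auto)
  thus ?thesis by simp
 qed
 have comp: "norm (y - x) <= L * norm (V x y) & norm (V x y) <= LV * norm (y - x)" if x: "x : ball p r" and y: "y : ball p r" for x y
 proof
  have r0': "x : ball p r0" "y : ball p r0" using x y r by auto
  have "norm (V x y - V x x) <= LV * norm (y - x)" by (rule LV2(1)[OF x y x])
  thus "norm (V x y) <= LV * norm (y - x)" using V0[OF r0'(1)] by simp
  have x0: "(x, 0) : ball z0 rf" using Vrf[OF r0'(1) r0'(1)] V0[OF r0'(1)] by simp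
  have "norm (fst (H (x, V x y) 1 - H (x, 0) 1)) <= norm (H (x, V x y) 1 - H (x, 0) 1)"
   by (metis norm_fst_le prod.collapse)
  also have "\<dots> <= L * norm ((x, V x y) - (x, 0))" by (rule HL[OF Vrf[OF r0'] x0]) auto
  finally show "norm (y - x) <= L * norm (V x y)" using Gxy(3)[OF r0'] ex0[OF x0] by (simp add: ex_def norm_Pair)
 qed
 have "open (U \<inter> F -` (ball p r \<times> ball p r))"
  by (rule continuous_open_preimage[OF continuous_on_subset[OF Ck_continuous_on[OF FC] U(2)] U(1)]) (intro open_Times open_ball)
 moreover have "z0 : U \<inter> F -` (ball p r \<times> ball p r)" using U(3) Fz0 r by simp
 ultimately obtain s0 where s0: "0 < s0" "ball z0 s0 \<subseteq> U \<inter> F -` (ball p r \<times> ball p r)"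
  using open_contains_ball by blast
 define s' where "s' = min s0 rf"
 have s': "x : ball p r & ex (x, v) : ball p r & V x (ex (x, v)) = v" if "(x, v) : ball z0 s'" for x v
 proof -
  have "(x, v) : ball z0 s0" using that by (simp add: s'_def)
  hence *: "(x, v) : U" "F (x, v) : ball p r \<times> ball p r" using s0(2) by auto
  thus ?thesis using GF[OF *(1)] by (simp add: F_def V_def)
 qed
 have geo1: "EX c. geod c & c 0 = (x, v) & (ALL t:{0..1}. fst (c t) = ex (x, t *\<^sub>R v))" if "(x, v) : ball z0 rf" for x v
  using Hg[OF that] H0[OF that] homog[OF that] by (intro exI[of _ "H (x, v)"]) simp
 have geo2: "EX c. geod c & c 0 = (x, V x y) & c 1 = (y, - V y x)" if "x : ball p r" "y : ball p r" for x y
 proof -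
  have r0': "x : ball p r0" "y : ball p r0" using that r by auto
  show ?thesis using Hg[OF Vrf[OF r0']] H0[OF Vrf[OF r0']] rev[OF r0'] by (intro exI[of _ "H (x, V x y)"]) simp
 qed
 define C where "C = L + LV + C2"
 have C: "0 < C" "L <= C" "LV <= C" "C2 <= C" using rf LV C2 by (auto simp: C_def)
 show ?thesis
 proof (rule that[of r s' rf C ex V, folded z0_def])
  show "Ck (Suc 0) (%z. V (fst z) (snd z)) (ball p r \<times> ball p r)" by (rule Ck_subset[OF VC]) (use r in auto)
  show "(x, V x y) : ball z0 rf & ex (x, V x y) = y" if "x : ball p r" "y : ball p r" for x y
   using Vrf[of x y] Gxy(3)[of x y] that r(3) by blast
  show "norm (y - x) <= C * norm (V x y) & norm (V x y) <= C * norm (y - x)" if "x : ball p r" "y : ball p r" for x y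
  proof -
   have "L * norm (V x y) <= C * norm (V x y)" "LV * norm (y - x) <= C * norm (y - x)"
    using C by (auto intro: mult_right_mono)
   thus ?thesis using comp[OF that] by linarith
  qed
  show "\<bar>g a (V a y) (V a y) / 2 - g a (V a x) (V a x) / 2 + g x (V x a) (y - x)\<bar> <= C * (norm (y - x))\<^sup>2"
   if "a : ball p r" "x : ball p r" "y : ball p r" for a x y
  proof -
   have "C2 * (norm (y - x))\<^sup>2 <= C * (norm (y - x))\<^sup>2" using C by (intro mult_right_mono) auto
   thus ?thesis using quad[OF that] by linarith
  qed
  show "cball p r \<subseteq> Om" using rR R(3) by blast
  show "(ex has_derivative (%w. fst w + snd w)) (at z0)"
   by (rule has_derivative_eq_rhs[OF A]) (simp add: fun_eq_iff Ahk)
 qed (use r C s' s0 rf exC geo1 geo2 gauss in \<open>auto simp: s'_def\<close>)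
qed

end

text \<open>Normal coordinates with uniform constants, for a distance \<open>dl\<close> that inside
  the ball is the length of the connecting geodesic. \<open>ex\<close> is controlled on pairs in the
  \<open>s\<close>-ball; on the smaller \<open>s'\<close>-ball its values stay in the
  \<open>r\<close>-ball and \<open>V\<close> inverts it.\<close>

locale normal_ball = local_metric Om g for Om :: "'e::euclidean_space set" and g +
 fixes dl :: "'e => 'e => real" and p :: 'e and r s s' C :: real
  and ex :: "'e \<times> 'e => 'e" and V :: "'e => 'e => 'e"
 assumes r_pos: "0 < r" and s'_pos: "0 < s'" "s' <= s" and C_pos: "0 < C"
  and ball_sub: "cball p r \<subseteq> Om"
  and exC: "Ck (Suc 0) ex (ball (p, 0) s)"
  and ex_deriv: "(ex has_derivative (%w. fst w + snd w)) (at (p, 0))"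
  and exV: "x : ball p r ==> y : ball p r ==> (x, V x y) : ball (p, 0) s & ex (x, V x y) = y"
  and Vex: "(x, v) : ball (p, 0) s' ==> x : ball p r & ex (x, v) : ball p r & V x (ex (x, v)) = v"
  and VC: "Ck (Suc 0) (%z. V (fst z) (snd z)) (ball p r \<times> ball p r)"
  and ex_geod: "(x, v) : ball (p, 0) s ==> EX \<gamma>. geod \<gamma> & \<gamma> 0 = (x, v) & (ALL t:{0..1}. fst (\<gamma> t) = ex (x, t *\<^sub>R v))"
  and V_geod: "x : ball p r ==> y : ball p r ==> EX \<gamma>. geod \<gamma> & \<gamma> 0 = (x, V x y) & \<gamma> 1 = (y, - V y x)"
  and comp: "x : ball p r ==> y : ball p r ==> norm (y - x) <= C * norm (V x y) & norm (V x y) <= C * norm (y - x)"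
  and quad: "a : ball p r ==> x : ball p r ==> y : ball p r ==>
   \<bar>g a (V a y) (V a y) / 2 - g a (V a x) (V a x) / 2 + g x (V x a) (y - x)\<bar> <= C * (norm (y - x))\<^sup>2"
  and dist_eq: "x : ball p r ==> y : ball p r ==> dl x y = sqrt (g x (V x y) (V x y))"

section \<open>Short geodesics realise the distance\<close>

context local_metric
begin

text \<open>\<open>upper\<close> bounds the distance from above by curves, \<open>lower\<close> from
  below by calibrations: functions of gradient norm at most one, cut off at a level
  \<open>m\<close>. The connecting geodesic gives one inequality for \<open>dl\<close>; the other
  comes from the radial function, whose gradient is known by the Gauss lemma.\<close>

theorem normal_ball_exists:
 fixes dl :: "'e => 'e => real"
 assumes p: "p : Om"
  and upper: "!!c c' B. (ALL n. Ck n c {0..1}) ==> (ALL t:{0..1}. c t : Om &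
   (c has_vector_derivative c' t) (at t within {0..1}) & sqrt (g (c t) (c' t) (c' t)) <= B) ==> dl (c 0) (c 1) <= B"
  and lower: "!!U f f' K m x y. open U ==> U \<subseteq> Om ==> compact K ==> K \<subseteq> U ==>
   (ALL x:U. (f has_derivative f' x) (at x) & (ALL v. \<bar>f' x v\<bar> <= sqrt (g x v v))) ==>
   (ALL x:U - K. m <= f x) ==> x : U ==> y : U ==> min (f y) m - min (f x) m <= dl x y"
 shows "EX r s s' C ex V. normal_ball Om g dl p r s s' C ex V"
proof -
 obtain r s s' C ex V where exC: "Ck (Suc 0) ex (ball (p, 0) s)"
  and exd: "(ex has_derivative (%w. fst w + snd w)) (at (p, 0))"
  and exV: "!!x y. x : ball p r ==> y : ball p r ==> (x, V x y) : ball (p, 0) s & ex (x, V x y) = y"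
  and Vex: "!!x v. (x, v) : ball (p, 0) s' ==> x : ball p r & ex (x, v) : ball p r & V x (ex (x, v)) = v"
  and VC: "Ck (Suc 0) (%z. V (fst z) (snd z)) (ball p r \<times> ball p r)"
  and geo1: "!!x v. (x, v) : ball (p, 0) s ==> EX b. geod b & b 0 = (x, v) & (ALL t:{0..1}. fst (b t) = ex (x, t *\<^sub>R v))"
  and geo2: "!!x y. x : ball p r ==> y : ball p r ==> EX b. geod b & b 0 = (x, V x y) & b 1 = (y, - V y x)"
  and gauss: "!!a y. a : ball p r ==> y : ball p r ==>
   ((%y. g a (V a y) (V a y) / 2) has_derivative (%h. - g y (V y a) h)) (at y)"
  and comp: "!!x y. x : ball p r ==> y : ball p r ==> norm (y - x) <= C * norm (V x y) & norm (V x y) <= C * norm (y - x)"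
  and quad: "!!a x y. a : ball p r ==> x : ball p r ==> y : ball p r ==>
   \<bar>g a (V a y) (V a y) / 2 - g a (V a x) (V a x) / 2 + g x (V x a) (y - x)\<bar> <= C * (norm (y - x))\<^sup>2"
  and r: "0 < r" "0 < s'" "s' <= s" "0 < C" "cball p r \<subseteq> Om"
  by (rule normal_coords[OF p]) (rule that, assumption+)
 have KR: "compact (cball p r)" "convex (cball p r)" by auto
 obtain Cg m0 where b1: "!!x u v. x : cball p r ==> \<bar>g x u v\<bar> <= Cg * norm u * norm v"
  and b2: "!!x v. x : cball p r ==> m0 * (norm v)\<^sup>2 <= g x v v" and Cg: "0 < Cg" and m0: "0 < m0"
  by (rule metric_bounds[OF KR r(5)]) (rule that, assumption+)
 have O: "x : cball p r" "x : Om" if "x : ball p r" for x using that r(5) by auto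
 define D where "D a y = g a (V a y) (V a y)" for a y
 have D0: "0 <= D a y" if "a : ball p r" for a y
  unfolding D_def using pos[OF O(2)[OF that], of "V a y"] bil[OF O(2)[OF that]] by (cases "V a y = 0") (auto simp: bilinear_lzero)
 have Dsym: "g y (V y a) (V y a) = D a y" if ay: "a : ball p r" "y : ball p r" for a y
 proof -
  obtain b where b: "geod b" "b 0 = (a, V a y)" "b 1 = (y, - V y a)" using geo2[OF ay] by blast
  show ?thesis using geod_energy[OF b(1), of 1] b bil[OF O(2)[OF ay(2)]]
   by (simp add: D_def bilinear_lneg bilinear_rneg)
 qed
 have le_upper: "dl a y <= sqrt (D a y)" if ay: "a : ball p r" "y : ball p r" for a y
 proof -
  obtain b where b: "geod b" "b 0 = (a, V a y)" "b 1 = (y, - V y a)" using geo2[OF ay] by blast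
  have sm: "Ck n b {0..1}" for n
   by (rule Ck_ode_solution[OF spray_Ck]) (use b(1) in \<open>auto simp: geod_def mem_Times_iff\<close>)
  have "dl (fst (b 0)) (fst (b 1)) <= sqrt (D a y)"
  proof (rule upper)
   show "ALL n. Ck n (%t. fst (b t)) {0..1}" using Ck_fst[OF sm] by blast
   show "ALL t:{0..1}. fst (b t) : Om & ((%t. fst (b t)) has_vector_derivative snd (b t)) (at t within {0..1}) &
     sqrt (g (fst (b t)) (snd (b t)) (snd (b t))) <= sqrt (D a y)"
    using geod_in[OF b(1)] geod_fst[OF b(1)] geod_energy[OF b(1)] b(2) by (simp add: D_def)
  qed
  thus ?thesis using b by simp
 qed
 \<comment> \<open>A lower bound for the radial function around \<open>a\<close> outside the half
   ball, if \<open>a\<close> lies within \<open>r / 4\<close> of \<open>p\<close>.\<close>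
 define m where "m = sqrt m0 * ((r / 4) / C)"
 have m: "0 < m" using m0 r by (simp add: m_def)
 \<comment> \<open>Small enough that radial distances between points of the \<open>r2\<close>-ball
   are at most \<open>m / 2\<close>; together with \<open>ep <= m / 2\<close> this keeps the cut-off
   at \<open>m\<close> inactive.\<close>
 define r2 where "r2 = min (r / 4) (m / (4 * sqrt Cg * C))"
 have r2: "0 < r2" "r2 <= r / 4" "sqrt Cg * (C * (2 * r2)) <= m / 2"
 proof -
  show "0 < r2" "r2 <= r / 4" using r m Cg by (auto simp: r2_def)
  have "sqrt Cg * (C * (2 * r2)) <= sqrt Cg * (C * (2 * (m / (4 * sqrt Cg * C))))"
   using Cg r by (intro mult_left_mono) (auto simp: r2_def)
  also have "\<dots> = m / 2" using Cg r by (simp add: field_simps)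
  finally show "sqrt Cg * (C * (2 * r2)) <= m / 2" .
 qed
 have sub2: "ball p r2 \<subseteq> ball p r" using r2 by auto
 have le_lower: "sqrt (D a y) <= dl a y" if ay2: "a : ball p r2" "y : ball p r2" for a y
 proof (rule field_le_epsilon)
  fix e :: real assume e: "0 < e"
  have ay: "a : ball p r" "y : ball p r" using ay2 sub2 by auto
  define ep where "ep = min e (m / 2)"
  have ep: "0 < ep" "ep <= m / 2" "ep <= e" using e m by (auto simp: ep_def)
  \<comment> \<open>\<open>sqrt (D a y)\<close> is not smooth at \<open>a\<close>. Adding the square
    of \<open>ep\<close> under the root removes the singularity, keeps the gradient norm at most one
    and changes the value by at most \<open>ep\<close>.\<close>
  let ?f = "%y. sqrt (D a y + ep\<^sup>2)"
  let ?f' = "%y h. - g y (V y a) h / ?f y"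
  have fpos: "0 < D a z + ep\<^sup>2" for z using D0[OF ay(1), of z] ep by (intro add_nonneg_pos) auto
  have "min (?f y) m - min (?f a) m <= dl a y"
  proof (rule lower[of "ball p r" "cball p (r / 2)" ?f ?f' m a y])
   show "ALL z:ball p r. (?f has_derivative ?f' z) (at z) & (ALL v. \<bar>?f' z v\<bar> <= sqrt (g z v v))"
   proof (intro ballI conjI allI)
    fix z assume z: "z : ball p r"
    have "((%y. 2 * (g a (V a y) (V a y) / 2) + ep\<^sup>2) has_derivative (%h. 2 * (- g z (V z a) h))) (at z)"
     by (intro has_derivative_add_const has_derivative_mult_right gauss[OF ay(1) z])
    hence d: "((%y. D a y + ep\<^sup>2) has_derivative (%h. - 2 * g z (V z a) h)) (at z)"
     by (simp add: D_def)
    show "(?f has_derivative ?f' z) (at z)" by (rule has_derivative_eq_rhs[OF has_derivative_real_sqrt[OF fpos d]])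
      (auto simp: fun_eq_iff divide_inverse[symmetric])
    fix v
    have "\<bar>g z (V z a) v\<bar> <= sqrt (g z (V z a) (V z a)) * sqrt (g z v v)"
     using O(2)[OF z] by (intro form_cauchy_schwarz bil sym pos)
    also have "\<dots> <= ?f z * sqrt (g z v v)"
    proof (rule mult_right_mono)
     show "sqrt (g z (V z a) (V z a)) <= ?f z" using Dsym[OF ay(1) z] by simp
     show "0 <= sqrt (g z v v)"
      using pos[OF O(2)[OF z], of v] bil[OF O(2)[OF z]] by (cases "v = 0") (auto simp: bilinear_lzero)
    qed
    finally show "\<bar>?f' z v\<bar> <= sqrt (g z v v)" using fpos[of z] by (simp add: abs_divide field_simps)
   qed
   show "ALL z:ball p r - cball p (r / 2). m <= ?f z"
   proof
    fix z assume z: "z : ball p r - cball p (r / 2)"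
    have "r / 4 <= norm (z - a)"
     using z ay2(1) r2(2) dist_triangle[of p z a] by (auto simp: dist_norm norm_minus_commute)
    also have "\<dots> <= C * norm (V a z)" using comp[OF ay(1)] z by blast
    finally have n: "(r / 4) / C <= norm (V a z)" using r(4) by (simp add: field_simps)
    have "m <= sqrt m0 * norm (V a z)" unfolding m_def using m0 n by (intro mult_left_mono) auto
    also have "\<dots> = sqrt (m0 * (norm (V a z))\<^sup>2)" using m0 by (simp add: real_sqrt_mult)
    also have "\<dots> <= sqrt (D a z)" using b2[OF O(1)[OF ay(1)]] by (simp add: D_def)
    also have "\<dots> <= ?f z" by simp
    finally show "m <= ?f z" .
   qed
  qed (use r ay O in auto)
  moreover have "sqrt (D a y) <= m / 2"
  proof -
   have "D a y <= Cg * norm (V a y) * norm (V a y)" using b1[OF O(1)[OF ay(1)], of "V a y" "V a y"] by (simp add: D_def)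
   hence "sqrt (D a y) <= sqrt (Cg * (norm (V a y))\<^sup>2)" by (simp add: power2_eq_square mult.assoc)
   also have "\<dots> = sqrt Cg * norm (V a y)" using Cg by (simp add: real_sqrt_mult)
   also have "\<dots> <= sqrt Cg * (C * norm (y - a))" using comp[OF ay] Cg by (intro mult_left_mono) auto
   also have "\<dots> <= sqrt Cg * (C * (2 * r2))"
    using ay2 Cg r dist_triangle2[of y a p] by (intro mult_left_mono) (auto simp: dist_norm norm_minus_commute)
   also have "\<dots> <= m / 2" by (rule r2)
   finally show ?thesis .
  qed
  moreover have "?f y <= sqrt (D a y) + ep"
   using sqrt_add_le_add_sqrt[OF D0[OF ay(1), of y], of "ep\<^sup>2"] ep by simp
  moreover have "V a a = 0" using comp[OF ay(1) ay(1)] by simp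
  hence "?f a = ep" using bil[OF O(2)[OF ay(1)]] ep by (simp add: D_def bilinear_lzero)
  moreover have "sqrt (D a y) <= ?f y" by simp
  ultimately show "sqrt (D a y) <= dl a y + e" using ep by linarith
 qed
 \<comment> \<open>Exponentials of pairs in the \<open>t\<close>-ball move base points by at most
   \<open>C * t\<close>, so they remain in the \<open>r2\<close>-ball.\<close>
 define t where "t = min s' (r2 / (1 + C))"
 have t: "0 < t" "t <= s'" using r r2(1) by (auto simp: t_def)
 have t3: "t * (1 + C) <= r2"
 proof -
  have "t <= r2 / (1 + C)" by (simp add: t_def)
  thus ?thesis using r(4) by (simp add: pos_le_divide_eq)
 qed
 have Vex2: "x : ball p r2 & ex (x, v) : ball p r2 & V x (ex (x, v)) = v" if xv: "(x, v) : ball (p, 0) t" for x v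
 proof -
  have "(x, v) : ball (p, 0) s'" using xv t(2) by auto
  note * = Vex[OF this]
  have n: "norm (x - p) < t" "norm v < t"
   using xv dist_fst_le[of "(p, 0)" "(x, v)"] dist_snd_le[of "(p, 0)" "(x, v)"] by (auto simp: dist_norm norm_minus_commute)
  have "norm (ex (x, v) - x) <= C * norm v" using comp[of x "ex (x, v)"] * by auto
  also have "\<dots> <= C * t" using n r by (intro mult_left_mono) auto
  finally have "norm (ex (x, v) - p) < t + C * t" using n norm_triangle_ineq[of "ex (x, v) - x" "x - p"] by simp
  also have "\<dots> <= r2" using t3 by (simp add: algebra_simps)
  finally have "ex (x, v) : ball p r2" by (simp add: dist_norm norm_minus_commute)
  moreover have "t <= r2"
  proof -
   have "t * 1 <= t * (1 + C)" using t(1) r(4) by (intro mult_left_mono) auto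
   thus ?thesis using t3 by simp
  qed
  hence "x : ball p r2" using n by (simp add: dist_norm norm_minus_commute)
  ultimately show ?thesis using * by blast
 qed
 have "normal_ball Om g dl p r2 s t C ex V"
 proof (unfold_locales, goal_cases)
  case 5 thus ?case using r(5) r2 by force
 next
  case 10 thus ?case by (rule Ck_subset[OF VC]) (use sub2 in auto)
 next
  case (15 x y)
  thus ?case using le_upper[of x y] le_lower[of x y] sub2 unfolding D_def by (metis order_antisym subsetD)
 next
  case 1 show ?case by (rule r2)
 next
  case 2 show ?case by (rule t)
 next
  case 3 show ?case using t r by simp
 next
  case 4 show ?case by (rule r)
 next
  case 6 show ?case by (rule exC)
 next
  case 7 show ?case by (rule exd)
 next
  case (8 x y) thus ?case using exV[of x y] sub2 by blast
 next
  case (9 x v) thus ?case by (rule Vex2)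
 next
  case (11 x v) thus ?case by (rule geo1)
 next
  case (12 x y) thus ?case using geo2[of x y] sub2 by blast
 next
  case (13 x y) thus ?case using comp[of x y] sub2 by blast
 next
  case (14 a x y) thus ?case using quad[of a x y] sub2 by blast
 qed
 thus ?thesis by blast
qed

end

section \<open>First order geometry of the distance in a normal ball\<close>

context normal_ball
begin

abbreviation "B \<equiv> ball p r"

lemma B_Om: "x : B ==> x : Om" using ball_sub by auto

lemma energy_sym: "x : B ==> y : B ==> g y (V y x) (V y x) = g x (V x y) (V x y)"
proof -
 assume xy: "x : B" "y : B"
 obtain c where c: "geod c" "c 0 = (x, V x y)" "c 1 = (y, - V y x)" using V_geod[OF xy] by blast
 show ?thesis using geod_energy[OF c(1), of 1] c bil[OF B_Om[OF xy(2)]] by (simp add: bilinear_lneg bilinear_rneg)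
qed

lemma g_nonneg: "x : Om ==> 0 <= g x v v"
 using pos[of x v] bil[of x] by (cases "v = 0") (auto simp: bilinear_lzero)

lemma dist_sym: "x : B ==> y : B ==> dl x y = dl y x"
 by (simp add: dist_eq energy_sym)

lemma dist_sq: "x : B ==> y : B ==> g x (V x y) (V x y) = (dl x y)\<^sup>2"
 using g_nonneg[OF B_Om] by (simp add: dist_eq)

lemma dist_nonneg: "x : B ==> y : B ==> 0 <= dl x y"
 using g_nonneg[OF B_Om] by (simp add: dist_eq)

lemma dist_pos: "x : B ==> y : B ==> x ~= y ==> 0 < dl x y"
 using comp[of x y] pos[OF B_Om, of x "V x y"] by (cases "V x y = 0") (auto simp: dist_eq)

lemma V_refl: "x : B ==> V x x = 0" using comp[of x x] by simp

text \<open>From the estimate \<open>quad\<close> for half the squared distance, together with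
  \<open>d^2 + 2 * q <= (d + q / d)^2\<close>. The right side is a smooth function of
  \<open>y\<close> that touches the distance from \<open>a\<close> at \<open>x\<close> from
  above.\<close>

lemma upper_support:
 assumes a: "a : B" and x: "x : B" and y: "y : B" and ax: "a ~= x"
 shows "dl a y <= dl a x + (- g x (V x a) (y - x) + C * (norm (y - x))\<^sup>2) / dl a x"
proof -
 let ?d = "dl a x" and ?q = "- g x (V x a) (y - x) + C * (norm (y - x))\<^sup>2"
 have d: "0 < ?d" by (rule dist_pos[OF a x ax])
 have 1: "(dl a y)\<^sup>2 <= ?d\<^sup>2 + 2 * ?q"
  using abs_le_D1[OF quad[OF a x y]] unfolding dist_sq[OF a x] dist_sq[OF a y] by (simp add: field_simps)
 have gen: "(e + q / e)\<^sup>2 = e\<^sup>2 + 2 * q + (q / e)\<^sup>2" if "0 < e" for e q :: real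
  using that by (simp add: power2_eq_square field_simps)
 have "?d\<^sup>2 + 2 * ?q <= (?d + ?q / ?d)\<^sup>2" unfolding gen[OF d, of ?q] by simp
 hence 2: "(dl a y)\<^sup>2 <= (?d + ?q / ?d)\<^sup>2" using 1 by linarith
 moreover have "0 <= ?d + ?q / ?d"
 proof -
  have "0 <= ?d\<^sup>2 + 2 * ?q" using 1 zero_le_power2[of "dl a y"] by linarith
  moreover have "0 <= ?d\<^sup>2" by simp
  moreover have "0 <= e + q" if "0 <= e + 2 * q" "0 <= e" for e q :: real using that by linarith
  ultimately have "0 <= ?d\<^sup>2 + ?q" by blast
  hence "0 <= (?d\<^sup>2 + ?q) / ?d" using d by simp
  also have "\<dots> = ?d + ?q / ?d" using d by (simp add: power2_eq_square field_simps)
  finally show ?thesis .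
 qed
 ultimately show ?thesis by (rule power2_le_imp_le)
qed

text \<open>With \<open>y = x + t *\<^sub>R v\<close> and small positive \<open>t\<close>, a
  positive \<open>f v\<close> would dominate the quadratic bound.\<close>

lemma small_linear_zero:
 fixes f :: "'e => real"
 assumes f: "linear f" and x: "x : B" and le: "!!y. y : B ==> y - x : S ==> f (y - x) <= K * (norm (y - x))\<^sup>2"
  and S: "subspace S" "v : S"
 shows "f v <= 0"
proof (rule ccontr)
 assume "~ f v <= 0"
 hence pv: "0 < f v" by simp
 hence v0: "v ~= 0" using linear_0[OF f] by auto
 obtain e where e: "0 < e" "ball x e \<subseteq> B" using x open_ball open_contains_ball by metis
 define k where "k = (\<bar>K\<bar> + 1) * (norm v)\<^sup>2"
 have p: "0 < k" unfolding k_def using v0 by (intro mult_pos_pos) auto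
 define t where "t = min (e / (2 * norm v)) (f v / (2 * k))"
 have t: "0 < t" "t * norm v < e" "t * k < f v"
 proof -
  show "0 < t" using e pv v0 p by (simp add: t_def)
  have "t * norm v <= e / (2 * norm v) * norm v" by (intro mult_right_mono) (auto simp: t_def)
  also have "\<dots> < e" using v0 e by simp
  finally show "t * norm v < e" .
  have "t * k <= f v / (2 * k) * k" using p by (intro mult_right_mono) (auto simp: t_def)
  also have "\<dots> = f v / 2" using p by simp
  also have "\<dots> < f v" using pv by simp
  finally show "t * k < f v" .
 qed
 have "x + t *\<^sub>R v : B" by (rule subsetD[OF e(2)]) (use t(1,2) in \<open>simp add: dist_norm\<close>)
 from le[OF this] have "t * f v <= K * (t * norm v)\<^sup>2"
  using t(1) S by (simp add: linear_scale[OF f] subspace_scale)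
 also have "\<dots> <= (\<bar>K\<bar> + 1) * (t * norm v)\<^sup>2" by (intro mult_right_mono) auto
 also have "\<dots> = t * (t * k)" by (simp add: power2_eq_square k_def mult_ac)
 finally have "f v <= t * k" using t(1) by simp
 thus False using t(3) by simp
qed

lemma g_linear: "x : Om ==> linear (g x u)" "x : Om ==> linear (%u. g x u v)"
 using bil by (auto simp: bilinear_def)

text \<open>A minimal path has no corner: if the unit vectors at \<open>x\<close> towards
  \<open>a\<close> and towards \<open>b\<close> had a nonzero sum \<open>e\<close>, moving
  \<open>x\<close> in the direction \<open>e\<close> would shorten the sum of the two distances to
  first order, against \<open>eq\<close>.\<close>

lemma corner:
 assumes B: "a : B" "x : B" "b : B" "a ~= x" "x ~= b"
  and eq: "!!y. y : B ==> dl a x + dl x b <= dl a y + dl y b"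
 shows "V x b = - (dl x b / dl x a) *\<^sub>R V x a"
proof -
 let ?m = "dl a x" and ?l = "dl b x"
 have p: "0 < ?m" "0 < ?l" using dist_pos B by auto
 have x: "x : Om" using B_Om B by blast
 define e where "e = (1 / ?m) *\<^sub>R V x a + (1 / ?l) *\<^sub>R V x b"
 have lin: "g x e h = g x (V x a) h / ?m + g x (V x b) h / ?l" for h
  unfolding e_def using bil[OF x] by (simp add: bilinear_ladd bilinear_lmul)
 have "g x e e <= 0"
 proof (rule small_linear_zero[OF g_linear(1)[OF x] B(2) _ subspace_UNIV, of _ "C / ?m + C / ?l"])
  fix y assume y: "y : B"
  have "dl a y <= ?m + (- g x (V x a) (y - x) + C * (norm (y - x))\<^sup>2) / ?m"
   by (rule upper_support[OF B(1,2) y B(4)])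
  moreover have "dl b y <= ?l + (- g x (V x b) (y - x) + C * (norm (y - x))\<^sup>2) / ?l"
   by (rule upper_support[OF B(3,2) y B(5)[symmetric]])
  ultimately have "0 <= (- g x (V x a) (y - x) + C * (norm (y - x))\<^sup>2) / ?m + (- g x (V x b) (y - x) + C * (norm (y - x))\<^sup>2) / ?l"
   using eq[OF y] dist_sym[OF B(2,3)] dist_sym[OF y B(3)] by linarith
  thus "g x e (y - x) <= (C / ?m + C / ?l) * (norm (y - x))\<^sup>2"
   unfolding lin by (simp add: add_divide_distrib diff_divide_distrib algebra_simps)
 qed auto
 hence "e = 0" using pos[OF x, of e] by force
 hence "?l *\<^sub>R ((1 / ?l) *\<^sub>R V x b) = ?l *\<^sub>R (- ((1 / ?m) *\<^sub>R V x a))"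
  unfolding e_def by (metis add_eq_0_iff)
 thus ?thesis using p dist_sym[OF B(1,2)] dist_sym[OF B(2,3)] by simp
qed

end

section \<open>Regularity of a distance function\<close>

lemma derivative_le_of_upper:
 fixes f :: "'a::real_normed_vector => real"
 assumes f: "(f has_derivative D) (at x)"
  and e: "0 < e" and le: "!!t. 0 < t ==> t < e ==> f (x + t *\<^sub>R v) <= f x + t * c + t * t * K"
 shows "D v <= c"
proof -
 have l: "((%t::real. x + t *\<^sub>R v) has_derivative (%t. t *\<^sub>R v)) (at 0 within {0<..})"
  by (auto intro!: derivative_eq_intros)
 have f': "(f has_derivative D) (at (x + 0 *\<^sub>R v))" using f by simp
 have "((%t. f (x + t *\<^sub>R v)) has_derivative (%t. D (t *\<^sub>R v))) (at 0 within {0<..})"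
  by (rule has_derivative_compose[OF l f'])
 hence "((%t. f (x + t *\<^sub>R v)) has_real_derivative D v) (at 0 within {0<..})"
  unfolding has_field_derivative_def linear_scale[OF has_derivative_linear[OF f]] by (simp add: mult_commute_abs)
 hence "((%t. (f (x + t *\<^sub>R v) - f x) / t) \<longlongrightarrow> D v) (at_right 0)"
  by (simp add: has_field_derivative_iff)
 moreover have "((%t. c + t * K) \<longlongrightarrow> c + 0 * K) (at_right 0)" by (intro tendsto_intros)
 moreover have "\<forall>\<^sub>F t in at_right 0. (f (x + t *\<^sub>R v) - f x) / t <= c + t * K"
  using eventually_at_right_less[of 0] eventually_at_right_field[of "%t. t < e" 0] e
  unfolding eventually_at_right_field by (intro exI[of _ e]) (auto simp: field_simps dest!: le)
 ultimately have "D v <= c + 0 * K" by (intro tendsto_le[of "at_right 0"]) auto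
 thus ?thesis by simp
qed

lemma (in local_metric) Ck_g:
 assumes "Ck n x S" "Ck n u S" "Ck n v S" "x ` S \<subseteq> Om"
 shows "Ck n (%s. g (x s) (u s) (v s)) S"
proof -
 have "Ck n (%s. \<Sum>b\<in>Basis. \<Sum>b'\<in>Basis. (u s \<bullet> b) * (v s \<bullet> b') * g (x s) b b') S"
  by (intro Ck_sum Ck_mult Ck_inner_left assms Ck_compose[OF smooth assms(1,4)])
 thus ?thesis by (rule Ck_cong) (use assms(4) in \<open>auto simp: g_expand[symmetric]\<close>)
qed

lemma (in local_metric) riesz_exists:
 assumes x: "x : Om" and f: "linear f"
 shows "EX z. ALL h. g x z h = f h"
proof -
 obtain T where T: "!!c w. g x (T c) w = c \<bullet> w"
  by (rule form_inverse[OF bil[OF x]], erule pos[OF x], rule that, assumption)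
 have "g x (T (\<Sum>b\<in>Basis. f b *\<^sub>R b)) h = f h" for h
 proof -
  have "f h = (\<Sum>b\<in>Basis. (h \<bullet> b) *\<^sub>R f b)" by (rule linear_sum_Basis[OF f])
  thus ?thesis unfolding T inner_sum_left by (simp add: inner_commute mult.commute)
 qed
 thus ?thesis by blast
qed

lemma (in local_metric) g_cancel:
 assumes x: "x : Om" and "!!h. g x z h = g x z' h"
 shows "z = z'"
proof (rule ccontr)
 assume "z ~= z'"
 hence "0 < g x (z - z') (z - z')" using pos[OF x] by simp
 thus False using assms(2) bil[OF x] by (simp add: bilinear_lsub)
qed

section \<open>Derivatives of energy and distance\<close>

context normal_ball
begin

text \<open>For points of this ball \<open>norm (V x y)\<close> is at most
  \<open>C * (2 * r')\<close>, which keeps the pair \<open>(x, V x y)\<close> in the domain of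
  \<open>Vex\<close>.\<close>

definition r' :: real where "r' = min r (s' / (1 + 2 * C))"

lemma r'_pos: "0 < r'" and r'_le: "r' <= r" and r'_s': "r' * (1 + 2 * C) <= s'"
proof -
 show "0 < r'" using r_pos s'_pos C_pos by (simp add: r'_def)
 show "r' <= r" by (simp add: r'_def)
 have "r' <= s' / (1 + 2 * C)" by (simp add: r'_def)
 thus "r' * (1 + 2 * C) <= s'" using C_pos by (simp add: pos_le_divide_eq)
qed

lemma small_ball_sub: "x : ball p r' ==> x : B" using r'_le by auto

lemma small_V: "x : ball p r' ==> y : ball p r' ==> (x, V x y) : ball (p, 0) s'"
proof -
 assume xy: "x : ball p r'" "y : ball p r'"
 have "norm (V x y) <= C * norm (y - x)" using comp small_ball_sub xy by blast
 also have "norm (y - x) <= 2 * r'"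
  using xy norm_triangle_ineq4[of "y - p" "x - p"] by (simp add: dist_norm norm_minus_commute)
 finally have "norm (V x y) <= C * (2 * r')" using C_pos by (simp add: mult_left_mono)
 moreover have "dist (p, 0) (x, V x y) <= dist p x + norm (V x y)"
  using sqrt_sum_squares_le_sum[of "dist p x" "norm (V x y)"] by (simp add: dist_Pair_Pair)
 ultimately show ?thesis using xy r'_s' by (simp add: algebra_simps)
qed

lemma VC': "a ` S \<subseteq> B ==> b ` S \<subseteq> B ==> Ck (Suc 0) a S ==> Ck (Suc 0) b S ==> Ck (Suc 0) (%z. V (a z) (b z)) S"
proof -
 assume *: "a ` S \<subseteq> B" "b ` S \<subseteq> B" "Ck (Suc 0) a S" "Ck (Suc 0) b S"
 have "Ck (Suc 0) (%z. (%w. V (fst w) (snd w)) (a z, b z)) S"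
  by (rule Ck_compose[OF VC Ck_Pair[OF *(3,4)]]) (use * in auto)
 thus ?thesis by simp
qed

lemma has_derivative_energy:
 assumes "a : B" "x : B"
 shows "((%x. g a (V a x) (V a x) / 2) has_derivative (%h. - g x (V x a) h)) (at x)"
  "((%a. g a (V a x) (V a x) / 2) has_derivative (%h. - g a (V a x) h)) (at a)"
proof -
 have 1: "((%x. g a (V a x) (V a x) / 2) has_derivative (%h. - g x (V x a) h)) (at x)" if "a : B" "x : B" for a x
 proof (rule has_derivative_quadratic[OF _ open_ball that(2)])
  show "bounded_linear (%h. - g x (V x a) h)"
   using g_linear(1)[OF B_Om[OF that(2)]] by (intro bounded_linear_minus) (simp add: linear_linear)
  show "norm (g a (V a y) (V a y) / 2 - g a (V a x) (V a x) / 2 - - g x (V x a) (y - x)) <= C * (norm (y - x))\<^sup>2"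
   if "y : B" for y using quad[OF \<open>a : B\<close> \<open>x : B\<close> that] by simp
 qed
 thus "((%x. g a (V a x) (V a x) / 2) has_derivative (%h. - g x (V x a) h)) (at x)" using assms by blast
 have "((%a. g x (V x a) (V x a) / 2) has_derivative (%h. - g a (V a x) h)) (at a)" by (rule 1[OF assms(2,1)])
 thus "((%a. g a (V a x) (V a x) / 2) has_derivative (%h. - g a (V a x) h)) (at a)"
  by (rule has_derivative_transform_within_open[OF _ open_ball assms(1)])
   (rule arg_cong[where f="%t. t / 2"], rule energy_sym, assumption, rule assms(2))
qed

lemma dist_refl: "x : B ==> dl x x = 0"
proof -
 assume x: "x : B"
 show ?thesis using dist_eq[OF x x] V_refl[OF x] bil[OF B_Om[OF x]] by (simp add: bilinear_lzero)
qed

lemma has_derivative_dist: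
 assumes "a : B" "x : B" "a ~= x"
 shows "((%x. dl x a) has_derivative (%h. - g x (V x a) h / dl x a)) (at x)"
proof -
 have p: "0 < g x (V x a) (V x a)" unfolding dist_sq[OF assms(2,1)] using dist_pos[OF assms(2,1)] assms(3) by simp
 have "((%x. 2 * (g x (V x a) (V x a) / 2)) has_derivative (%h. 2 * (- g x (V x a) h))) (at x)"
  by (rule has_derivative_mult_right[OF has_derivative_energy(2)[OF assms(2,1)]])
 hence d: "((%x. g x (V x a) (V x a)) has_derivative (%h. - 2 * g x (V x a) h)) (at x)" by simp
 have "((%x. sqrt (g x (V x a) (V x a))) has_derivative (%h. - g x (V x a) h / dl x a)) (at x)"
  by (rule has_derivative_eq_rhs[OF has_derivative_real_sqrt[OF p d]])
   (auto simp: fun_eq_iff divide_inverse[symmetric] dist_eq[OF assms(2,1)])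
 thus ?thesis by (rule has_derivative_transform_within_open[OF _ open_ball assms(2)])
   (rule dist_eq[symmetric], assumption, rule assms(1))
qed

text \<open>The energy is constant along \<open>(z, E z)\<close>, and its two partial derivatives
  are given by the Gauss lemma at either end. The chain rule thus relates a displacement
  \<open>h\<close> of \<open>y\<close> to the displacement \<open>E' h\<close> of the end
  point.\<close>

lemma energy_chain:
 assumes S: "open S" "y : S" and E: "(E has_derivative E') (at y)" and EB: "!!z. z : S ==> z : B & E z : B"
  and c: "!!z. z : S ==> g z (V z (E z)) (V z (E z)) = k"
 shows "g y (V y (E y)) h + g (E y) (V (E y) y) (E' h) = 0"
proof -
 let ?G = "%z. g (fst z) (V (fst z) (snd z)) (V (fst z) (snd z)) * (1/2)"
 have Gk: "Ck (Suc 0) ?G (B \<times> B)" by (intro Ck_mult Ck_g Ck_const Ck_fst Ck_id VC) (use B_Om in auto)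
 have yB: "y : B" "E y : B" using EB S by auto
 have oBB: "open (B \<times> B)" by (intro open_Times open_ball)
 have mem: "(y, E y) : B \<times> B" using yB by simp
 obtain L where L: "(?G has_derivative L) (at (y, E y))"
  using Ck_has_derivative[OF Gk oBB mem] by (rule exE)
 have linL: "linear L" by (rule has_derivative_linear[OF L])
 have "((%x. ?G (y, x)) has_derivative (%h. L (0, h))) (at (E y))"
  by (rule has_derivative_compose[of "%x. (y, x)" "%h. (0, h)" "E y" UNIV ?G L])
   (use L in \<open>auto intro!: derivative_eq_intros\<close>)
 hence "((%x. g y (V y x) (V y x) / 2) has_derivative (%h. L (0, h))) (at (E y))" by simp
 hence 1: "L (0, k) = - g (E y) (V (E y) y) k" for k
  using has_derivative_unique[OF _ has_derivative_energy(1)[OF yB]] by (metis (no_types))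
 have "((%a. ?G (a, E y)) has_derivative (%h. L (h, 0))) (at y)"
  by (rule has_derivative_compose[of "%x. (x, E y)" "%h. (h, 0)" y UNIV ?G L])
   (use L in \<open>auto intro!: derivative_eq_intros\<close>)
 hence "((%a. g a (V a (E y)) (V a (E y)) / 2) has_derivative (%h. L (h, 0))) (at y)" by simp
 hence 2: "L (h, 0) = - g y (V y (E y)) h" for h
  using has_derivative_unique[OF _ has_derivative_energy(2)[OF yB]] by (metis (no_types))
 have "((%z. ?G (z, E z)) has_derivative (%h. L (h, E' h))) (at y)"
  by (rule has_derivative_compose[of "%z. (z, E z)" "%h. (h, E' h)" y UNIV ?G L])
   (use L E in \<open>auto intro!: derivative_eq_intros\<close>)
 moreover have "((%z. ?G (z, E z)) has_derivative (%h. 0)) (at y)"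
  by (rule has_derivative_transform_within_open[OF has_derivative_const[of "k * (1/2)"] S]) (simp add: c)
 ultimately have "L (h, E' h) = 0" using has_derivative_unique by (metis (no_types))
 thus ?thesis using linear_add[OF linL, of "(h, 0)" "(0, E' h)"] 1 2 by simp
qed

end

locale distance_fn = normal_ball Om g dl p r s s' C ex V
 for Om :: "'e::euclidean_space set" and g dl p r s s' C ex V +
 fixes rho :: "'e => real"
 assumes rho_lip: "x : ball p r ==> y : ball p r ==> rho y <= rho x + dl x y"
begin

text \<open>The function is touched from above at \<open>y\<close> by a constant plus the distance
  from \<open>a\<close>, so \<open>upper_support\<close> bounds \<open>D\<close> in the directions
  \<open>h\<close> and \<open>- h\<close>.\<close>

lemma upper_touch:
 assumes f: "(f has_derivative D) (at y)" and a: "a : B" and y: "y : B" and ay: "a ~= y"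
  and le: "!!z. z : B ==> f z <= f y + dl a z - dl a y"
 shows "D h = - g y (V y a) h / dl a y"
proof -
 have linD: "linear D" by (rule has_derivative_linear[OF f])
 have ling: "linear (g y (V y a))" by (rule g_linear(1)[OF B_Om[OF y]])
 obtain e where e: "0 < e" "ball y e \<subseteq> B" using y open_ball open_contains_ball by metis
 have up: "D v <= - g y (V y a) v / dl a y" for v
 proof (rule derivative_le_of_upper[OF f])
  show "0 < e / (norm v + 1)" using e by (simp add: add_nonneg_pos)
  fix t :: real assume t: "0 < t" "t < e / (norm v + 1)"
  have n1: "0 < norm v + 1" using norm_ge_zero[of v] by linarith
  have "t * norm v <= t * (norm v + 1)" using t by simp
  also have "\<dots> < e" using t n1 by (simp add: field_simps)
  finally have yB: "y + t *\<^sub>R v : B" by (intro subsetD[OF e(2)]) (use t in \<open>simp add: dist_norm\<close>)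
  have "f (y + t *\<^sub>R v) <= f y + (- g y (V y a) (t *\<^sub>R v) + C * (norm (t *\<^sub>R v))\<^sup>2) / dl a y"
   using le[OF yB] upper_support[OF a y yB ay] by simp
  also have "\<dots> = f y + t * (- g y (V y a) v / dl a y) + t * t * (C * (norm v)\<^sup>2 / dl a y)"
   using t linear_scale[OF ling, of t v] by (simp add: power_mult_distrib power2_eq_square add_divide_distrib diff_divide_distrib)
  finally show "f (y + t *\<^sub>R v) <= f y + t * (- g y (V y a) v / dl a y) + t * t * (C * (norm v)\<^sup>2 / dl a y)" .
 qed
 from up[of h] up[of "- h"] show ?thesis using linear_neg[OF linD, of h] linear_neg[OF ling, of h] by simp
qed

lemma derivative_from_below:
 assumes "(rho has_derivative D) (at y)" "a : B" "y : B" "a ~= y" "rho y = rho a + dl a y"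
 shows "D h = - g y (V y a) h / dl a y"
 by (rule upper_touch[OF assms(1-4)]) (use rho_lip[OF assms(2)] assms(5) in force)

lemma derivative_to_above:
 assumes "(rho has_derivative D) (at y)" "b : B" "y : B" "b ~= y" "rho b = rho y + dl y b"
 shows "D h = g y (V y b) h / dl y b"
proof -
 have "- D h = - g y (V y b) h / dl b y"
 proof (rule upper_touch[OF has_derivative_minus[OF assms(1)] assms(2-4)])
  show "- rho z <= - rho y + dl b z - dl b y" if "z : B" for z
   using rho_lip[OF that assms(2)] assms(5) dist_sym[OF assms(2,3)] dist_sym[OF assms(2) that] by simp
 qed
 thus ?thesis using dist_sym[OF assms(2,3)] by simp
qed

lemma gradient_exists:
 assumes S: "open S" "S \<subseteq> B" and rho: "Ck (Suc n) rho S"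
 obtains D P where "!!y. y : S ==> (rho has_derivative D y) (at y)" "!!y h. y : S ==> g y (P y) h = D y h" "Ck n P S"
proof -
 obtain D where D: "ALL y:S. (rho has_derivative D y) (at y within S)" "ALL b:Basis. Ck n (%y. D y b) S"
  by (rule Ck_SucE[OF rho]) (rule that, assumption+)
 have D': "(rho has_derivative D y) (at y)" if "y : S" for y
  using bspec[OF D(1) that] unfolding at_within_open[OF that S(1)] .
 have lin: "linear (D y)" if "y : S" for y by (rule has_derivative_linear[OF D'[OF that]])
 have SO: "y : Om" if "y : S" for y using that S(2) B_Om by blast
 define P where "P y = (SOME z. ALL h. g y z h = D y h)" for y
 have P: "g y (P y) h = D y h" if "y : S" for y h
  using someI_ex[OF riesz_exists[OF SO[OF that] lin[OF that]]] unfolding P_def by blast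
 have "Ck n P S"
 proof (rule Ck_solve[where g=g and rhs="%y. \<Sum>b\<in>Basis. D y b *\<^sub>R b"])
  show "Ck n (%y. \<Sum>b\<in>Basis. D y b *\<^sub>R b) S" by (intro Ck_sum Ck_scaleR Ck_const) (use D(2) in blast)
  show "Ck n (%x. g x b b') S" if "b : Basis" "b' : Basis" for b b'
   by (rule Ck_subset[OF smooth[OF that]]) (use SO in blast)
  show "g x (P x) w = (\<Sum>b\<in>Basis. D x b *\<^sub>R b) \<bullet> w" if "x : S" for x w
  proof -
   have "D x w = (\<Sum>b\<in>Basis. (w \<bullet> b) *\<^sub>R D x b)" by (rule linear_sum_Basis[OF lin[OF that]])
   thus ?thesis unfolding P[OF that] inner_sum_left by (simp add: inner_commute mult.commute)
  qed
 qed (use SO bil pos in auto)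
 thus ?thesis using that D' P by blast
qed

lemma gradient_below:
 assumes P: "!!h. g y (P y) h = D y h" and D: "(rho has_derivative D y) (at y)"
  and a: "a : B" "y : B" "a ~= y" "rho y = rho a + dl a y"
 shows "V y a = - dl a y *\<^sub>R P y"
proof -
 have d: "0 < dl a y" by (rule dist_pos[OF a(1-3)])
 have y: "y : Om" by (rule B_Om[OF a(2)])
 show ?thesis
 proof (rule g_cancel[OF y])
  fix h
  have "g y (- dl a y *\<^sub>R P y) h = - dl a y * D y h" using bil[OF y] P by (simp add: bilinear_lneg bilinear_lmul)
  also have "\<dots> = g y (V y a) h" using derivative_from_below[OF D a, of h] d by simp
  finally show "g y (V y a) h = g y (- dl a y *\<^sub>R P y) h" by simp
 qed
qed

lemma gradient_above:
 assumes P: "!!h. g y (P y) h = D y h" and D: "(rho has_derivative D y) (at y)"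
  and b: "b : B" "y : B" "b ~= y" "rho b = rho y + dl y b"
 shows "V y b = dl y b *\<^sub>R P y"
proof -
 have d: "0 < dl y b" using dist_pos[OF b(2,1)] b(3) by simp
 have y: "y : Om" by (rule B_Om[OF b(2)])
 show ?thesis
 proof (rule g_cancel[OF y])
  fix h
  have "g y (dl y b *\<^sub>R P y) h = dl y b * D y h" using bil[OF y] P by (simp add: bilinear_lmul)
  also have "\<dots> = g y (V y b) h" using derivative_to_above[OF D b, of h] d by simp
  finally show "g y (V y b) h = g y (dl y b *\<^sub>R P y) h" by simp
 qed
qed

text \<open>\<open>f z\<close> goes down the gradient to the point below \<open>z\<close> at
  distance \<open>t\<close>. The gradient is only continuous, so \<open>f\<close> need not be
  locally invertible; but \<open>f\<close> moves points by at most \<open>e\<close>, and by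
  Brouwer's theorem the image of the \<open>e\<close>-ball contains its centre \<open>y\<close>. A
  preimage of \<open>y\<close> lies strictly above \<open>y\<close>.\<close>

lemma not_maximal_if_C1:
 assumes S: "open S" "S \<subseteq> B" "y : S" and rho: "Ck (Suc 0) rho S"
  and low: "0 < t0" "!!z t. z : S ==> 0 < t ==> t < t0 ==> EX a:B. rho z = rho a + dl a z & dl a z = t"
 shows "EX z:B. z ~= y & rho z = rho y + dl y z"
proof -
 obtain D P where D: "!!y. y : S ==> (rho has_derivative D y) (at y)" and P: "!!y h. y : S ==> g y (P y) h = D y h"
  and PC: "Ck 0 P S" by (rule gradient_exists[OF S(1,2) rho]) (rule that, assumption+)
 obtain e where e: "0 < e" "cball y e \<subseteq> S" using S open_contains_cball by metis
 obtain Cg m where "!!x u v. x : cball p r ==> \<bar>g x u v\<bar> <= Cg * norm u * norm v"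
  and b2: "!!x v. x : cball p r ==> m * (norm v)\<^sup>2 <= g x v v" and "0 < Cg" and m: "0 < m"
  by (rule metric_bounds[OF compact_cball convex_cball ball_sub]) (rule that, assumption+)
 \<comment> \<open>The quotient \<open>e * sqrt m / C\<close> converts length into coordinate
   displacement: a vector of Riemannian length \<open>t\<close> has norm at most
   \<open>t / sqrt m\<close>, and its exponential moves the point by at most \<open>C\<close> times
   that.\<close>
 define t where "t = min (t0 / 2) (e * sqrt m / C)"
 have t: "0 < t" "t < t0" "C * (t / sqrt m) <= e"
 proof -
  show "0 < t" "t < t0" using low(1) e m C_pos by (auto simp: t_def)
  have "C * (t / sqrt m) <= C * ((e * sqrt m / C) / sqrt m)"
   using C_pos m by (intro mult_left_mono divide_right_mono) (auto simp: t_def)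
  also have "\<dots> = e" using C_pos m by simp
  finally show "C * (t / sqrt m) <= e" .
 qed
 define f where "f z = ex (z, - t *\<^sub>R P z)" for z
 have f: "f z : B & rho z = rho (f z) + dl (f z) z & dl (f z) z = t & norm (z - f z) <= e & (z, - t *\<^sub>R P z) : ball (p, 0) s"
  if z: "z : S" for z
 proof -
  obtain a where a: "a : B" "rho z = rho a + dl a z" "dl a z = t" using low(2)[OF z t(1,2)] by blast
  have zB: "z : B" using z S by blast
  have az: "a ~= z" using a(3) t(1) dist_refl[OF zB] by auto
  have V: "V z a = - t *\<^sub>R P z" using gradient_below[where P=P and D=D and y=z, OF P[OF z] D[OF z] a(1) zB az a(2)] a(3) by simp
  have fa: "f z = a" using exV[OF zB a(1)] V by (simp add: f_def)
  have "m * (norm (V z a))\<^sup>2 <= t\<^sup>2"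
   using b2[of z "V z a"] zB dist_sq[OF zB a(1)] dist_sym[OF zB a(1)] a(3) by auto
  hence "(norm (V z a))\<^sup>2 <= (t / sqrt m)\<^sup>2" using m by (simp add: power_divide field_simps)
  hence "norm (V z a) <= t / sqrt m" by (rule power2_le_imp_le) (use t m in auto)
  hence "C * norm (V z a) <= C * (t / sqrt m)" using C_pos by (intro mult_left_mono) auto
  hence "norm (a - z) <= e" using comp[OF zB a(1)] t(3) by linarith
  thus ?thesis using fa a exV[OF zB a(1)] V by (simp add: norm_minus_commute)
 qed
 have fc: "continuous_on (cball y e) f" unfolding f_def by (rule continuous_on_compose2[OF Ck_continuous_on[OF exC]])
   (use f e continuous_on_subset[OF Ck_continuous_on[OF PC] e(2)] in \<open>auto intro!: continuous_intros\<close>)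
 have "EX z:cball y e. f z = y"
  by (rule brouwer_surjective_cball[OF fc e(1), of y "{y}"]) (use f e(2) in \<open>force simp: dist_norm norm_minus_commute\<close>)+
 then obtain z where z: "z : cball y e" "f z = y" by blast
 have zS: "z : S" using z e by blast
 note * = f[OF zS]
 have "dl y y = 0" by (rule dist_refl) (use S in blast)
 hence "z ~= y" using * z(2) t(1) by auto
 thus ?thesis using * z(2) zS S(2) by auto
qed

end

text \<open>If \<open>L\<close> were nonzero, \<open>f s\<close> would be comparable to
  \<open>s\<close>, so \<open>T\<close> would grow at least like a positive multiple of
  \<open>s^2\<close>. Its derivative is of order \<open>q s * s\<close> with \<open>q\<close>
  tending to 0, which allows only slower growth.\<close>

lemma vanishing_derivative:
 fixes f :: "real => 'a::real_normed_vector"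
 assumes f: "f 0 = 0" "(f has_vector_derivative L) (at 0)"
  and e: "0 < e" and T: "!!s. \<bar>s\<bar> < e ==> (T has_real_derivative T' s) (at s)"
  and T': "!!s. \<bar>s\<bar> < e ==> \<bar>T' s\<bar> <= q s * norm (f s)" and q: "(q \<longlongrightarrow> 0) (at 0)"
  and k: "0 < k" "!!s. \<bar>s\<bar> < e ==> T 0 + k * (norm (f s))\<^sup>2 <= T s"
 shows "L = 0"
proof (rule ccontr)
 assume "L ~= 0"
 hence L: "0 < norm L" by simp
 have "\<forall>\<^sub>F s in at 0. norm (f s - s *\<^sub>R L) / norm s < norm L / 2"
 proof (rule order_tendstoD)
  show "((%s. norm (f s - s *\<^sub>R L) / norm s) \<longlongrightarrow> 0) (at 0)"
   using f(2) unfolding has_vector_derivative_def has_derivative_at by (simp add: f(1))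
 qed (use L in simp)
 \<comment> \<open>With 1/16 the upper bound for \<open>T s - T 0\<close> becomes
   \<open>k * (norm L * s)^2 / 8\<close>, against a lower bound with 1/4.\<close>
 moreover have "\<forall>\<^sub>F s in at 0. q s < k * norm L / 16"
  by (rule order_tendstoD(2)[OF q]) (use L k in simp)
 ultimately have "\<forall>\<^sub>F s in at 0. norm (f s - s *\<^sub>R L) / norm s < norm L / 2 & q s < k * norm L / 16"
  by eventually_elim simp
 then obtain d where d: "0 < d"
  "ALL s. s ~= 0 & \<bar>s\<bar> < d --> norm (f s - s *\<^sub>R L) / norm s < norm L / 2 & q s < k * norm L / 16"
  unfolding eventually_at by (auto simp: dist_norm)
 have est: "norm (f s) <= 2 * norm L * s" "norm L * s / 2 <= norm (f s)" if "0 < s" "s < d" for s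
 proof -
  have "norm (f s - s *\<^sub>R L) / norm s < norm L / 2" using spec[OF d(2), of s] that by simp
  hence n: "norm (f s - s *\<^sub>R L) <= norm L * s / 2" using that(1) by (simp add: field_simps)
  have ns: "norm (s *\<^sub>R L) = norm L * s" using that by simp
  have "0 <= norm L * s" using that L by simp
  moreover have "norm (f s) - norm (s *\<^sub>R L) <= norm (f s - s *\<^sub>R L)" by (rule norm_triangle_ineq2)
  moreover have "norm (s *\<^sub>R L) - norm (f s) <= norm (f s - s *\<^sub>R L)"
   using norm_triangle_ineq2[of "s *\<^sub>R L" "f s"] by (simp add: norm_minus_commute)
  ultimately show "norm (f s) <= 2 * norm L * s" "norm L * s / 2 <= norm (f s)" using n ns by linarith+
 qed
 define s where "s = min d e / 2"
 have s: "0 < s" "s < d" "s < e" using d e by (auto simp: s_def)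
 obtain z where z: "0 < z" "z < s" "T s - T 0 = (s - 0) * T' z"
  by (rule MVT2[OF s(1), of T T', THEN exE]) (use T s in auto)
 have "T' z <= q z * norm (f z)" using T'[of z] z s by simp
 also have "\<dots> <= (k * norm L / 16) * (2 * norm L * s)"
 proof (rule mult_mono)
  show "q z <= k * norm L / 16" using spec[OF d(2), of z] z s by (simp add: less_imp_le)
  have "2 * norm L * z <= 2 * norm L * s" using z L by simp
  thus "norm (f z) <= 2 * norm L * s" using est(1)[of z] z s by linarith
 qed (use L k in auto)
 finally have "s * T' z <= s * ((k * norm L / 16) * (2 * norm L * s))" using s by simp
 also have "\<dots> = k * (norm L * s)\<^sup>2 / 8" by (simp add: power2_eq_square)
 finally have u: "T s - T 0 <= k * (norm L * s)\<^sup>2 / 8" using z by simp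
 have "(norm L * s / 2)\<^sup>2 <= (norm (f s))\<^sup>2" using est(2)[of s] s by (intro power_mono) auto
 hence "k * (norm L * s / 2)\<^sup>2 <= k * (norm (f s))\<^sup>2" using k by simp
 hence "k * (norm L * s)\<^sup>2 / 4 <= T s - T 0" using k(2)[of s] s by (simp add: power_divide)
 moreover have "0 < k * (norm L * s)\<^sup>2" using k L s by simp
 ultimately show False using u by linarith
qed

context distance_fn
begin

text \<open>Gain of one derivative: the derivative of \<open>rho\<close> is expressed by the vector
  \<open>V x (n x)\<close> to the foot and its length, and both are C^1 if \<open>n\<close> is. That
  \<open>rho\<close> is differentiable at all follows beforehand from
  \<open>rho x = rho (n x) + dl (n x) x\<close>.\<close>

lemma C2_of_C1_feet:
 assumes T: "open T" "T \<subseteq> B" and n: "Ck (Suc 0) n T" "n ` T \<subseteq> B"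
  and foot: "!!x. x : T ==> n x ~= x & rho x = rho (n x) + dl (n x) x" and rhon: "Ck (Suc 0) (%x. rho (n x)) T"
 shows "Ck (Suc (Suc 0)) rho T"
proof -
 let ?Q = "%x. V x (n x)"
 have TOm: "x : Om" if "x : T" for x using that T(2) B_Om by blast
 have Q: "Ck (Suc 0) ?Q T" by (rule VC'[OF _ n(2) Ck_id n(1)]) (use T in auto)
 have QQ: "Ck (Suc 0) (%x. g x (?Q x) (?Q x)) T" by (rule Ck_g[OF Ck_id Q Q]) (use TOm in auto)
 have nB: "n x : B" "x : B" if "x : T" for x using that n(2) T(2) by auto
 have dp: "0 < dl (n x) x" if "x : T" for x using dist_pos[OF nB[OF that]] foot[OF that] by blast
 have d: "dl (n x) x = sqrt (g x (?Q x) (?Q x))" "0 < g x (?Q x) (?Q x)" if "x : T" for x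
  using dist_sq[OF nB(2,1)[OF that]] dist_sym[OF nB[OF that]] dp[OF that] by simp_all
 have dC: "Ck (Suc 0) (%x. dl (n x) x) T" by (rule Ck_cong[OF Ck_sqrt[OF QQ]]) (auto simp: d)
 have "Ck (Suc 0) rho T" by (rule Ck_cong[OF Ck_add[OF rhon dC]]) (use foot in simp)
 then obtain D where D: "ALL x:T. (rho has_derivative D x) (at x within T)" "ALL b:Basis. Ck 0 (%x. D x b) T"
  by (rule Ck_SucE) (rule that, assumption+)
 show ?thesis
 proof (rule Ck_SucI)
  show "(rho has_derivative D x) (at x within T)" if "x : T" for x using D(1) that by blast
  fix b
  show "Ck (Suc 0) (%x. D x b) T"
  proof (rule Ck_cong)
   show "Ck (Suc 0) (%x. (- g x (?Q x) b) * inverse (dl (n x) x)) T"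
    by (intro Ck_mult Ck_minus Ck_g Ck_id Q Ck_const Ck_inverse dC) (use TOm dp in force)+
   fix x assume x: "x : T"
   have "(rho has_derivative D x) (at x)" using bspec[OF D(1) x] unfolding at_within_open[OF x T(1)] .
   from derivative_from_below[OF this nB[OF x]] foot[OF x]
   show "(- g x (?Q x) b) * inverse (dl (n x) x) = D x b" by (simp add: divide_inverse)
  qed
 qed
qed


lemma Ck_dist: "z : B ==> S \<subseteq> B - {z} ==> Ck (Suc 0) (%e. dl e z) S"
proof -
 assume z: "z : B" and S: "S \<subseteq> B - {z}"
 have m: "e : B" "e : Om" if "e : S" for e using that S B_Om by blast+
 have V: "Ck (Suc 0) (%e. V e z) S" by (rule VC'[OF _ _ Ck_id Ck_const]) (use z m in auto)
 have "Ck (Suc 0) (%e. sqrt (g e (V e z) (V e z))) S"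
 proof (rule Ck_sqrt)
  show "Ck (Suc 0) (%e. g e (V e z) (V e z)) S" by (rule Ck_g[OF Ck_id V V]) (use m in auto)
  show "0 < g e (V e z) (V e z)" if "e : S" for e
   unfolding dist_sq[OF m(1)[OF that] z] using less_imp_neq[OF dist_pos[OF m(1)[OF that] z]] that S by auto
 qed
 thus ?thesis by (rule Ck_cong) (use dist_eq[OF m(1) z] in simp)
qed

text \<open>The vector \<open>Z y\<close> measures how far the path from \<open>y\<close> through
  \<open>E y\<close> to \<open>z\<close> is from being straight, and drives the kernel argument. By
  \<open>push\<close>, points near \<open>x\<close> have points near \<open>w\<close> below them at
  the distance \<open>l\<close>; the local inverse of \<open>E\<close> finds these, so they are C^1
  feet and \<open>C2_of_C1_feet\<close> applies.\<close>

lemma propagate_C2: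
 assumes w: "w : ball p r'" and x: "x : ball p r'" and z: "z : ball p r'" and ne: "w ~= x" "x ~= z"
  and wx: "rho x = rho w + dl w x" and xz: "rho z = rho x + dl x z"
  and S: "open S" "w : S" "S \<subseteq> B" "Ck (Suc (Suc 0)) rho S"
  and low: "!!y. y : S ==> EX a:B. a ~= y & rho y = rho a + dl a y"
  and push: "!!Q. open Q ==> w : Q ==> EX Q'. open Q' & x : Q' & (ALL x':Q'. EX b:Q. rho x' = rho b + dl b x' & dl b x' = dl w x)"
 shows "EX T. open T & x : T & T \<subseteq> B & Ck (Suc (Suc 0)) rho T"
proof -
 define l where "l = dl w x"
 have bB: "w : B" "x : B" "z : B" using w x z small_ball_sub by blast+
 have l: "0 < l" unfolding l_def by (rule dist_pos[OF bB(1,2) ne(1)])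
 define c where "c = dl x z"
 have c: "0 < c" unfolding c_def by (rule dist_pos[OF bB(2,3) ne(2)])
 obtain Cg m where b1: "!!x u v. x : cball p r ==> \<bar>g x u v\<bar> <= Cg * norm u * norm v"
  and b2: "!!x v. x : cball p r ==> m * (norm v)\<^sup>2 <= g x v v" and Cg: "0 < Cg" and m: "0 < m"
  by (rule metric_bounds[OF compact_cball convex_cball ball_sub]) (rule that, assumption+)
 obtain D P where D: "!!y. y : S ==> (rho has_derivative D y) (at y)" and P: "!!y h. y : S ==> g y (P y) h = D y h"
  and PC: "Ck (Suc 0) P S" by (rule gradient_exists[OF S(1,3,4)]) (rule that, assumption+)
 have SB: "y : B" "y : Om" if "y : S" for y using that S(3) B_Om by blast+
 \<comment> \<open>The gradient has length one, because \<open>rho\<close> grows at unit speed from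
   a point below \<open>y\<close>.\<close>
 have PP: "g y (P y) (P y) = 1" if y: "y : S" for y
 proof -
  obtain a where a: "a : B" "a ~= y" "rho y = rho a + dl a y" using low[OF y] by blast
  have d: "0 < dl a y" by (rule dist_pos[OF a(1) SB(1)[OF y] a(2)])
  have "V y a = - dl a y *\<^sub>R P y" by (rule gradient_below[where P=P and D=D and y=y, OF P[OF y] D[OF y] a(1) SB(1)[OF y] a(2,3)])
  hence "(dl a y)\<^sup>2 = (dl a y)\<^sup>2 * g y (P y) (P y)"
   using dist_sq[OF SB(1)[OF y] a(1)] dist_sym[OF SB(1)[OF y] a(1)] bil[OF SB(2)[OF y]]
   by (simp add: bilinear_lneg bilinear_rneg bilinear_lmul bilinear_rmul power2_eq_square)
  thus ?thesis using d by simp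
 qed
 have up: "V y b = dl y b *\<^sub>R P y" if "y : S" "b : B" "b ~= y" "rho b = rho y + dl y b" for y b
  by (rule gradient_above[where P=P and D=D and y=y, OF P[OF that(1)] D[OF that(1)] that(2) SB(1)[OF that(1)] that(3,4)])
 have Vwx: "V w x = l *\<^sub>R P w" unfolding l_def by (rule up[OF S(2) bB(2) ne(1)[symmetric] wx])
 let ?j = "%y. (y, l *\<^sub>R P y)"
 define S0 where "S0 = S \<inter> ?j -` ball (p, 0) s'"
 have jC: "Ck (Suc 0) ?j S" by (intro Ck_Pair Ck_id Ck_scaleR Ck_const PC)
 have S0: "open S0" "S0 \<subseteq> S" "w : S0"
 proof -
  show "open S0" unfolding S0_def by (rule continuous_open_preimage[OF Ck_continuous_on[OF jC] S(1) open_ball])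
  show "w : S0" unfolding S0_def using S(2) small_V[OF w x] unfolding Vwx by blast
 qed (simp add: S0_def)
 define E where "E y = ex (y, l *\<^sub>R P y)" for y
 have E: "E y : B" "V y (E y) = l *\<^sub>R P y" if "y : S0" for y
  using Vex[of y "l *\<^sub>R P y"] that unfolding E_def S0_def by blast+
 have EC: "Ck (Suc 0) E S0"
  unfolding E_def by (rule Ck_compose[OF exC Ck_subset[OF jC S0(2)]]) (use s'_pos(2) in \<open>auto simp: S0_def\<close>)
 have Ew: "E w = x" unfolding E_def using exV[OF bB(1,2)] Vwx by simp
 have dE: "g y (V y (E y)) (V y (E y)) = l\<^sup>2" if "y : S0" for y
 proof -
  have "y : S" using that S0 by blast
  thus ?thesis
   using E(2)[OF that] PP[of y] bil[OF SB(2)[of y]] by (simp add: bilinear_lmul bilinear_rmul power2_eq_square)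
 qed
 define K where "K y = V (E y) y" for y
 have S0B: "S0 \<subseteq> B" using S0 S(3) by blast
 have KC: "Ck (Suc 0) K S0" unfolding K_def by (rule VC'[OF _ _ EC Ck_id]) (use E S0B in auto)
 have yex: "ex (E y, K y) = y" if "y : S0" for y
  unfolding K_def using exV[OF E(1)[OF that], of y] S0B that by blast
 \<comment> \<open>Keeps \<open>E y\<close> away from \<open>z\<close>, with distance more than half
   of \<open>c\<close>, so that the constants below are uniform.\<close>
 define S2 where "S2 = S0 \<inter> E -` (B \<inter> {e. e ~= z} \<inter> (%e. dl e z) -` {c / 2<..})"
 have oBz: "open (B \<inter> {e. e ~= z})" by (intro open_Int open_ball open_Collect_neq) (auto intro: continuous_intros)
 have W0: "Ck (Suc 0) (%e. dl e z) (B \<inter> {e. e ~= z})" by (rule Ck_dist[OF bB(3)]) auto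
 have S2: "open S2" "S2 \<subseteq> S0" "w : S2"
 proof -
  have "open (B \<inter> {e. e ~= z} \<inter> (%e. dl e z) -` {c / 2<..})"
   by (rule continuous_open_preimage[OF Ck_continuous_on[OF W0] oBz]) simp
  thus "open S2" unfolding S2_def by (rule continuous_open_preimage[OF Ck_continuous_on[OF EC] S0(1)])
  show "w : S2" unfolding S2_def using S0(3) bB(2) ne(2) c by (simp add: Ew c_def[symmetric] del: mem_ball)
 qed (simp add: S2_def)
 have Ez: "E y ~= z" "c / 2 < dl (E y) z" if "y : S2" for y using that by (auto simp: S2_def)
 define W where "W e = inverse (dl e z) *\<^sub>R V e z" for e
 have WC: "Ck (Suc 0) W (B \<inter> {e. e ~= z})" unfolding W_def
 proof (intro Ck_scaleR Ck_inverse W0)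
  show "Ck (Suc 0) (%e. V e z) (B \<inter> {e. e ~= z})" by (rule VC'[OF _ _ Ck_id Ck_const]) (use bB in auto)
  show "dl e z ~= 0" if "e : B \<inter> {e. e ~= z}" for e using dist_pos[of e z] that bB(3) by auto
 qed
 \<comment> \<open>The sum of the unit vectors at \<open>E y\<close> towards \<open>y\<close> and
   towards \<open>z\<close>. It vanishes at \<open>w\<close> by \<open>corner\<close>.\<close>
 define Z where "Z y = inverse l *\<^sub>R K y + W (E y)" for y
 have ZC: "Ck (Suc 0) Z S2" unfolding Z_def
  by (intro Ck_add Ck_scaleR Ck_const Ck_subset[OF KC S2(2)] Ck_compose[OF WC Ck_subset[OF EC S2(2)]])
   (use S2(2) E(1) Ez(1) in auto)
 \<comment> \<open>Second order constant of the two upper supports at \<open>E y\<close>: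
   \<open>C / l\<close> for the distance from \<open>y\<close>, and \<open>C / (c / 2)\<close> for
   the distance from \<open>z\<close>.\<close>
 define C' where "C' = C / l + 2 * C / c"
 have C': "0 < C'" unfolding C'_def using C_pos l c by (intro add_pos_pos) auto
 \<comment> \<open>Balances the first order gain \<open>lam * m * norm Z ^ 2\<close> from cutting
   the corner against the second order cost \<open>C' * lam ^ 2 * norm Z ^ 2\<close>: half of the
   gain survives.\<close>
 define lam where "lam = m / (2 * C')"
 have lam: "0 < lam" using m C' by (simp add: lam_def)
 define S1 where "S1 = S2 \<inter> (%y. E y + lam *\<^sub>R Z y) -` B"
 have Zw: "Z w = 0"
 proof -
  have "V x z = - (dl x z / dl x w) *\<^sub>R V x w"
  proof (rule corner[OF bB ne])
   fix y assume "y : B"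
   show "dl w x + dl x z <= dl w y + dl y z"
    using rho_lip[OF bB(1) \<open>y : B\<close>] rho_lip[OF \<open>y : B\<close> bB(3)] wx xz by linarith
  qed
  thus ?thesis using dist_sym[OF bB(1,2)] l c
   unfolding Z_def W_def K_def Ew l_def[symmetric] c_def[symmetric] by (simp add: field_simps)
 qed
 have S1: "open S1" "S1 \<subseteq> S2" "w : S1"
 proof -
  have "Ck (Suc 0) (%y. E y + lam *\<^sub>R Z y) S2"
   by (intro Ck_add Ck_scaleR Ck_const ZC Ck_subset[OF EC S2(2)])
  thus "open S1" unfolding S1_def by (intro continuous_open_preimage[OF Ck_continuous_on S2(1) open_ball])
  show "w : S1" unfolding S1_def using S2(3) bB(2) by (simp add: Ew Zw del: mem_ball)
 qed (simp add: S1_def)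
 \<comment> \<open>The path through the displaced corner \<open>E y + lam *\<^sub>R Z y\<close>
   cannot undercut \<open>rho z\<close>, and it is shorter than the one through \<open>E y\<close>
   by the amount gained at the corner. So the latter exceeds the minimum by a multiple of the square
   of \<open>Z y\<close>.\<close>
 have lower: "rho w + c + lam * m / 2 * (norm (Z y))\<^sup>2 <= rho y + dl (E y) z" if y: "y : S1" for y
 proof -
  let ?e = "E y" and ?b = "E y + lam *\<^sub>R Z y"
  have mem: "y : S2" "y : S0" "y : B" "?e : B" "?b : B" using y S1(2) S2(2) S0B E(1) unfolding S1_def by blast+
  have ye: "y ~= ?e" using dE[OF mem(2)] l V_refl[OF mem(3)] bil[OF B_Om[OF mem(3)]] by (auto simp: bilinear_lzero)
  have dye: "dl y ?e = l" using dE[OF mem(2)] l unfolding dist_eq[OF mem(3,4)] by simp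
  have ebe: "?b - ?e = lam *\<^sub>R Z y" by simp
  note gl = bil[OF B_Om[OF mem(4)]]
  let ?q = "norm (lam *\<^sub>R Z y)"
  have "rho z <= rho y + dl y ?b + dl ?b z" using rho_lip[OF mem(3,5)] rho_lip[OF mem(5) bB(3)] by linarith
  also have "dl y ?b <= l + (- g ?e (V ?e y) (lam *\<^sub>R Z y) + C * ?q\<^sup>2) / l"
   using upper_support[OF mem(3,4,5) ye] unfolding dye ebe .
  also have "dl ?b z <= dl ?e z + (- g ?e (V ?e z) (lam *\<^sub>R Z y) + C * ?q\<^sup>2) / dl ?e z"
   using upper_support[OF bB(3) mem(4,5) Ez(1)[OF mem(1), symmetric]] unfolding ebe
   using dist_sym[OF bB(3) mem(4)] dist_sym[OF bB(3) mem(5)] by simp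
  also have "rho y + (l + (- g ?e (V ?e y) (lam *\<^sub>R Z y) + C * ?q\<^sup>2) / l) + (dl ?e z + (- g ?e (V ?e z) (lam *\<^sub>R Z y) + C * ?q\<^sup>2) / dl ?e z)
   = rho y + l + dl ?e z - g ?e (Z y) (lam *\<^sub>R Z y) + (C / l + C / dl ?e z) * ?q\<^sup>2"
   unfolding Z_def[of y] W_def K_def
   by (simp add: bilinear_ladd[OF gl] bilinear_lmul[OF gl] divide_inverse algebra_simps)
  also have "(C / l + C / dl ?e z) * ?q\<^sup>2 <= C' * ?q\<^sup>2"
  proof (rule mult_right_mono)
   have "C / dl ?e z <= C / (c / 2)" using Ez(2)[OF mem(1)] c C_pos by (intro divide_left_mono) auto
   thus "C / l + C / dl ?e z <= C'" by (simp add: C'_def mult.commute)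
  qed simp
  also have "C' * ?q\<^sup>2 = lam * (m / 2 * (norm (Z y))\<^sup>2)"
   using C' by (simp add: power_mult_distrib power2_eq_square lam_def)
  also have "g ?e (Z y) (lam *\<^sub>R Z y) = lam * g ?e (Z y) (Z y)" by (simp add: bilinear_rmul[OF gl])
  finally have "rho z <= rho y + l + dl ?e z - lam * g ?e (Z y) (Z y) + lam * (m / 2 * (norm (Z y))\<^sup>2)" by simp
  moreover have "lam * (m * (norm (Z y))\<^sup>2) <= lam * g ?e (Z y) (Z y)"
   using b2[of ?e "Z y"] mem(4) lam by (intro mult_left_mono) auto
  ultimately show ?thesis using wx xz unfolding l_def[symmetric] c_def[symmetric] by (simp add: algebra_simps)
 qed
 obtain E' where E': "ALL y:S0. (E has_derivative E' y) (at y within S0)" "ALL b:Basis. Ck 0 (%y. E' y b) S0"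
  by (rule Ck_SucE[OF EC]) (rule that, assumption+)
 have E'at: "(E has_derivative E' y) (at y)" if "y : S0" for y
  using bspec[OF E'(1) that] unfolding at_within_open[OF that S0(1)] .
 \<comment> \<open>Along \<open>w + s *\<^sub>R h\<close> the quantity
   \<open>rho y + dl (E y) z\<close> has derivative \<open>- g (E y) (Z y) (E' y h)\<close>, where
   the last factor tends to 0 as \<open>h\<close> is in the kernel, while its growth dominates the
   square of \<open>Z\<close>. So \<open>vanishing_derivative\<close> makes the derivative of
   \<open>Z\<close> in the direction \<open>h\<close> zero; since \<open>E' w h = 0\<close>, this
   leaves \<open>K' h = 0\<close>.\<close>
 have inj: "h = 0" if h: "E' w h = 0" for h
 proof -
  obtain K' where K': "(K has_derivative K') (at w)"
   using Ck_has_derivative[OF KC S0(1,3)] by (rule exE)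
  have xW: "x : B \<inter> {e. e ~= z}" using bB(2) ne(2) by blast
  obtain W' where W': "(W has_derivative W') (at (E w))"
   using Ck_has_derivative[OF WC oBz xW, folded Ew] by (rule exE)
  let ?y = "%s::real. w + s *\<^sub>R h"
  have ydd: "(?y has_derivative (%s. s *\<^sub>R h)) (at s)" for s by (auto intro!: derivative_eq_intros)
  have "open (?y -` S1)" by (intro open_vimage S1(1) continuous_intros)
  moreover have "0 : ?y -` S1" using S1(3) by simp
  ultimately obtain ep where ep: "0 < ep" "ball 0 ep \<subseteq> ?y -` S1" using open_contains_ball by blast
  have yS: "?y s : S1" if "\<bar>s\<bar> < ep" for s using ep(2) that by (auto simp: subset_iff dist_norm)
  have ES: "(E has_derivative E' (?y s)) (at (?y s))" if "\<bar>s\<bar> < ep" for s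
   by (rule E'at) (use yS[OF that] S1(2) S2(2) in blast)
  have ZZ: "(Z has_derivative (%h. inverse l *\<^sub>R K' h + W' (E' w h))) (at w)" unfolding Z_def
   by (intro has_derivative_add has_derivative_scaleR_right K' has_derivative_compose[OF E'at[OF S0(3)] W'])
  have lW: "W' 0 = 0" using linear_0[OF has_derivative_linear[OF W']] .
  have "inverse l *\<^sub>R K' h = 0"
  proof (rule vanishing_derivative[where f="%s. Z (?y s)" and e=ep and T="%s. rho (?y s) + dl (E (?y s)) z"
     and T'="%s. - g (E (?y s)) (Z (?y s)) (E' (?y s) h)" and q="%s. Cg * norm (E' (?y s) h)" and k="lam * m / 2"])
   show "Z (?y 0) = 0" using Zw by simp
   have Z0: "(Z has_derivative (%h. inverse l *\<^sub>R K' h + W' (E' w h))) (at (?y 0))" using ZZ by simp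
   have "((%s. Z (?y s)) has_derivative (%s. inverse l *\<^sub>R K' (s *\<^sub>R h) + W' (E' w (s *\<^sub>R h)))) (at 0)"
    by (rule has_derivative_compose[OF ydd Z0])
   thus "((%s. Z (?y s)) has_vector_derivative inverse l *\<^sub>R K' h) (at 0)"
    unfolding has_vector_derivative_def by (rule has_derivative_eq_rhs)
     (simp add: fun_eq_iff linear_scale[OF has_derivative_linear[OF K']] linear_scale[OF has_derivative_linear[OF E'at[OF S0(3)]]] h lW)
   show "0 < ep" by (rule ep(1))
   show "((%s. Cg * norm (E' (?y s) h)) \<longlongrightarrow> 0) (at 0)"
   proof -
    have "Ck 0 (%y. E' y h) S0" by (rule Ck_derivative_dir[OF E' Ck_const])
    hence "continuous (at w) (%y. E' y h)" using S0(1,3) by (simp add: continuous_on_eq_continuous_at)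
    hence "isCont (%y. E' y h) (?y 0)" by simp
    moreover have "isCont ?y 0" by (intro continuous_intros)
    ultimately have "isCont (%s. E' (?y s) h) 0" by (rule isCont_o2[rotated])
    hence "isCont (%s. Cg * norm (E' (?y s) h)) 0" by (intro continuous_intros)
    thus ?thesis using h by (simp add: isCont_def)
   qed
   show "0 < lam * m / 2" using lam m by simp
   fix s assume s: "\<bar>s\<bar> < ep"
   let ?u = "?y s"
   have mem: "?u : S1" "?u : S2" "?u : S0" "?u : S" "?u : B" "E ?u : B"
    using yS[OF s] S1(2) S2(2) S0(2) S(3) E(1) by blast+
   show "rho (?y 0) + dl (E (?y 0)) z + lam * m / 2 * (norm (Z ?u))\<^sup>2 <= rho ?u + dl (E ?u) z"
    using lower[OF mem(1)] by (simp add: Ew c_def)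
   show "\<bar>- g (E ?u) (Z ?u) (E' ?u h)\<bar> <= Cg * norm (E' ?u h) * norm (Z ?u)"
    using b1[of "E ?u" "Z ?u" "E' ?u h"] mem(6) by (simp add: mult_ac)
   note gl = bil[OF B_Om[OF mem(6)]]
   have "g ?u (V ?u (E ?u)) h + g (E ?u) (V (E ?u) ?u) (E' ?u h) = 0"
    by (rule energy_chain[OF S0(1) mem(3) ES[OF s]]) (use E(1) S0B dE in blast)+
   hence Dh: "l * D ?u h = - g (E ?u) (K ?u) (E' ?u h)"
    unfolding E(2)[OF mem(3)] K_def using P[OF mem(4), of h] bilinear_lmul[OF bil[OF SB(2)[OF mem(4)]], of l "P ?u" h]
    by simp
   have d1: "((%s. rho (?y s)) has_derivative (%t. D ?u (t *\<^sub>R h))) (at s)"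
    by (rule has_derivative_compose[OF ydd D[OF mem(4)]])
   have d2: "((%s. E (?y s)) has_derivative (%t. E' ?u (t *\<^sub>R h))) (at s)"
    by (rule has_derivative_compose[OF ydd ES[OF s]])
   have d3: "((%s. dl (E (?y s)) z) has_derivative (%t. - g (E ?u) (V (E ?u) z) (E' ?u (t *\<^sub>R h)) / dl (E ?u) z)) (at s)"
    by (rule has_derivative_compose[OF d2 has_derivative_dist[OF bB(3) mem(6) Ez(1)[OF mem(2), symmetric]]])
   show "((%s. rho (?y s) + dl (E (?y s)) z) has_real_derivative - g (E ?u) (Z ?u) (E' ?u h)) (at s)"
    unfolding has_field_derivative_def
   proof (rule has_derivative_eq_rhs[OF has_derivative_add[OF d1 d3]], rule ext)
    fix t :: real
    have "D ?u h = - g (E ?u) (K ?u) (E' ?u h) / l" using Dh l by (simp add: field_simps)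
    thus "D ?u (t *\<^sub>R h) + - g (E ?u) (V (E ?u) z) (E' ?u (t *\<^sub>R h)) / dl (E ?u) z
     = - g (E ?u) (Z ?u) (E' ?u h) * t" unfolding Z_def[of ?u] W_def
     by (simp add: linear_scale[OF has_derivative_linear[OF D[OF mem(4)]]] linear_scale[OF has_derivative_linear[OF ES[OF s]]]
       bilinear_ladd[OF gl] bilinear_lmul[OF gl] bilinear_rmul[OF gl] divide_inverse algebra_simps)
   qed
  qed
  hence K0: "K' h = 0" using l by simp
  \<comment> \<open>\<open>ex\<close> recovers \<open>y\<close> from \<open>E y\<close> and the
    backward vector \<open>K y\<close>, so \<open>h\<close> is a linear image of
    \<open>E' w h\<close> and \<open>K' h\<close>, both of which vanish.\<close>
  have mem: "(E w, K w) : ball (p, 0) s" unfolding Ew K_def using exV[OF bB(2,1)] by blast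
  obtain ex' where ex': "(ex has_derivative ex') (at (E w, K w))"
   using Ck_has_derivative[OF exC open_ball mem] by (rule exE)
  have "((%y. ex (E y, K y)) has_derivative (%h. ex' (E' w h, K' h))) (at w)"
   by (rule has_derivative_compose[OF has_derivative_Pair[OF E'at[OF S0(3)] K'] ex'])
  moreover have "((%y. ex (E y, K y)) has_derivative (%h. h)) (at w)"
   by (rule has_derivative_transform_within_open[OF has_derivative_ident S0(1,3)]) (simp add: yex)
  ultimately have "h = ex' (E' w h, K' h)" using has_derivative_unique by (metis (no_types))
  also have "\<dots> = ex' 0" by (simp add: K0 h zero_prod_def)
  also have "\<dots> = 0" by (rule linear_0[OF has_derivative_linear[OF ex']])
  finally show "h = 0" .
 qed
 obtain U T G where UT: "open U" "U \<subseteq> S0" "w : U" "open T" "E w : T" "homeomorphism U T E G" "Ck (Suc 0) G T"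
  by (rule C1_inverse_function[OF EC S0(1,3) E'at[OF S0(3)] inj]) (assumption, rule that, assumption+)
 obtain O' where O': "open O'" "x : O'" "ALL x':O'. EX b:U. rho x' = rho b + dl b x' & dl b x' = dl w x"
  using push[OF UT(1,3)] by blast
 \<comment> \<open>\<open>push\<close> gives a point \<open>b\<close> of \<open>U\<close> below
   \<open>x'\<close> at distance \<open>l\<close>. The gradient at \<open>b\<close> points to
   \<open>x'\<close>, so \<open>E b = x'\<close> and \<open>b\<close> is the value of the local
   inverse.\<close>
 have G: "G x' : U & rho x' = rho (G x') + l & dl (G x') x' = l" if x': "x' : O' \<inter> T \<inter> B" for x'
 proof -
  obtain b where b: "b : U" "rho x' = rho b + dl b x'" "dl b x' = l" using O'(3) x' unfolding l_def by blast
  have bS: "b : S0" "b : S" "b : B" "x' : B" using b(1) UT(2) S0 S0B x' by blast+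
  have "x' ~= b" using b(3) l dist_refl[OF bS(3)] by auto
  hence "V b x' = l *\<^sub>R P b" using up[OF bS(2,4) _ b(2)] b(3) by simp
  hence "E b = x'" using exV[OF bS(3,4)] by (simp add: E_def)
  hence "G x' = b" using UT(6) b(1) by (auto simp: homeomorphism_def)
  thus ?thesis using b by simp
 qed
 have "Ck (Suc (Suc 0)) rho (O' \<inter> T \<inter> B)"
 proof (rule C2_of_C1_feet)
  show "Ck (Suc 0) G (O' \<inter> T \<inter> B)" by (rule Ck_subset[OF UT(7)]) blast
  show "Ck (Suc 0) (%x. rho (G x)) (O' \<inter> T \<inter> B)"
  proof (rule Ck_compose[OF Ck_SucD[OF S(4)] Ck_subset[OF UT(7)]])
   show "O' \<inter> T \<inter> B \<subseteq> T" by blast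
   show "G ` (O' \<inter> T \<inter> B) \<subseteq> S" using G UT(2) S0(2) by blast
  qed
  show "G ` (O' \<inter> T \<inter> B) \<subseteq> B" using G UT(2) S0B by blast
  fix x' assume x': "x' : O' \<inter> T \<inter> B"
  have "dl (G x') x' ~= dl x' x'" using G[OF x'] l dist_refl[of x'] x' by auto
  hence "G x' ~= x'" by metis
  thus "G x' ~= x' & rho x' = rho (G x') + dl (G x') x'" using G[OF x'] by simp
 qed (use O'(1) UT(4) in auto)
 moreover have "x : O' \<inter> T \<inter> B" using O'(2) UT(5) Ew bB(2) by simp
 ultimately show ?thesis using O'(1) UT(4) by (intro exI[of _ "O' \<inter> T \<inter> B"]) auto
qed

end

section \<open>Regularity of the distance near the submanifold\<close>

context distance_fn
begin

text \<open>In these coordinates the submanifold is the plane \<open>span B0\<close>. A parameter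
  \<open>u\<close> encodes a foot \<open>P u\<close> in its plane components and a normal vector
  \<open>S u\<close> in the others, and \<open>F u\<close> is the exponential of this normal vector.
  \<open>F\<close> is invertible near \<open>p\<close>, and a nearest point of the plane to
  \<open>x\<close> that is close to \<open>p\<close> must be \<open>P (H x)\<close>, a C^1 function
  of \<open>x\<close>.\<close>

lemma tubular_C2:
 assumes B0: "B0 \<subseteq> Basis" and pL: "p : span B0"
  and zero: "!!n. n : B \<inter> span B0 ==> rho n = 0"
  and le: "!!n x. n : B \<inter> span B0 ==> x : B ==> rho x <= dl n x"
  and feet: "!!Q. open Q ==> p : Q ==> EX Q'. open Q' & p : Q' & (ALL x:Q'. EX n:Q \<inter> span B0. rho x = dl n x)"
 shows "EX Q. open Q & p : Q & Q \<subseteq> B & Ck (Suc (Suc 0)) rho (Q - span B0)"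
proof -
 let ?L = "span B0"
 define P where "P u = (\<Sum>b\<in>B0. (u \<bullet> b) *\<^sub>R b)" for u :: 'e
 have finB0: "finite B0" by (rule finite_subset[OF B0 finite_Basis])
 have P_bl: "bounded_linear P"
  unfolding P_def by (intro bounded_linear_sum bounded_linear_scaleR_left[THEN bounded_linear_compose] bounded_linear_inner_left)
 have P_lin: "linear P" by (rule bounded_linear.linear[OF P_bl])
 have PL: "P u : ?L" for u unfolding P_def by (intro span_sum span_scale span_base)
 have Pb: "P b = b" if "b : B0" for b
 proof -
  have "P b = (\<Sum>c\<in>B0. (if c = b then b else 0))"
   unfolding P_def by (rule sum.cong) (use subsetD[OF B0] that in \<open>auto simp: inner_not_same_Basis\<close>)
  thus ?thesis using finB0 that by simp
 qed
 have Pid: "P n = n" if "n : ?L" for n by (rule linear_eq_on[OF P_lin linear_ident that Pb])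
 have orth: "(u - P u) \<bullet> n = 0" if "n : ?L" for u n
 proof -
  have "(u - P u) \<bullet> b = 0" if "b : B0" for b
  proof -
   have "P u \<bullet> b = (\<Sum>c\<in>B0. if c = b then u \<bullet> b else 0)"
    unfolding P_def inner_sum_left by (rule sum.cong) (use subsetD[OF B0] that in \<open>auto simp: inner_not_same_Basis\<close>)
   also have "\<dots> = u \<bullet> b" using finB0 that by simp
   finally show ?thesis by (simp add: inner_diff_left)
  qed
  hence "n : {n. (u - P u) \<bullet> n = 0}"
   using span_induct[OF that, of "%n. (u - P u) \<bullet> n = 0"] subspace_hyperplane by auto
  thus ?thesis by simp
 qed
 have pB: "p : B" using r_pos by simp
 have oB': "open (P -` B)" by (intro open_vimage open_ball linear_continuous_on[OF P_bl])
 have pB': "p : P -` B" using Pid[OF pL] pB by simp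
 have POm: "P u : Om" if "u : P -` B" for u using B_Om that by auto
 have PC: "Ck n P X" for n X by (rule Ck_linear[OF P_bl])
 define T where "T n c = (SOME z. ALL w. g n z w = c \<bullet> w)" for n c
 have T: "g n (T n c) w = c \<bullet> w" if "n : Om" for n c w
 proof -
  have "linear ((\<bullet>) c)" by (simp add: bounded_linear.linear bounded_linear_inner_right)
  from someI_ex[OF riesz_exists[OF that this]] show ?thesis unfolding T_def by blast
 qed
 have TC: "Ck (Suc 0) (%u. T (P u) b) (P -` B)" for b
 proof (rule Ck_solve[where g="%u. g (P u)" and rhs="%u. b"])
  show "Ck (Suc 0) (%x. g (P x) c c') (P -` B)" if "c : Basis" "c' : Basis" for c c'
   by (rule Ck_compose[OF smooth[OF that] PC]) (use POm in auto)
 qed (use POm bil pos T in auto)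
 \<comment> \<open>The metric dual of \<open>u - P u\<close>. Since \<open>u - P u\<close> is
   orthogonal to the plane in the Euclidean sense, \<open>S u\<close> is orthogonal to it for the
   metric at \<open>P u\<close>.\<close>
 define S where "S u = (\<Sum>b\<in>Basis. ((u - P u) \<bullet> b) *\<^sub>R T (P u) b)" for u
 have gS: "g (P u) (S u) w = (u - P u) \<bullet> w" if "u : P -` B" for u w
 proof -
  note l = g_linear(2)[OF POm[OF that], of w]
  have "g (P u) (S u) w = (\<Sum>b\<in>Basis. ((u - P u) \<bullet> b) * (b \<bullet> w))"
   unfolding S_def linear_sum[OF l] linear_scale[OF l] T[OF POm[OF that]] by simp
  also have "\<dots> = (u - P u) \<bullet> w" unfolding euclidean_inner[of "u - P u" w] by (simp only: inner_commute[of w])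
  finally show ?thesis .
 qed
 have SC: "Ck (Suc 0) S (P -` B)" unfolding S_def by (intro Ck_sum Ck_scaleR TC Ck_inner_left Ck_diff Ck_id PC)
 have Ppp: "P p = p" by (rule Pid[OF pL])
 have Sp: "S p = 0" by (simp add: S_def Ppp)
 \<comment> \<open>The derivative of \<open>S\<close> at \<open>p\<close>: the factor
   \<open>u - P u\<close> vanishes there, so the derivatives of \<open>T\<close> do not
   contribute.\<close>
 define A where "A h = (\<Sum>b\<in>Basis. ((h - P h) \<bullet> b) *\<^sub>R T p b)" for h
 have "EX k. ((%u. T (P u) b) has_derivative k) (at p)" for b
  by (rule Ck_has_derivative[OF TC oB' pB'])
 hence "ALL b. EX k. ((%u. T (P u) b) has_derivative k) (at p)" by blast
 from choice[OF this] obtain kk where kk: "((%u. T (P u) b) has_derivative kk b) (at p)" for b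
  by (rule exE) (rule that, erule spec)
 have S': "(S has_derivative A) (at p)" unfolding S_def
 proof (rule has_derivative_eq_rhs[OF has_derivative_sum])
  fix b :: 'e assume "b : Basis"
  have d: "((%u. (u - P u) \<bullet> b) has_derivative (%h. (h - P h) \<bullet> b)) (at p)"
   by (intro has_derivative_inner_left has_derivative_diff has_derivative_ident bounded_linear_imp_has_derivative P_bl)
  show "((%u. ((u - P u) \<bullet> b) *\<^sub>R T (P u) b) has_derivative (%h. ((p - P p) \<bullet> b) *\<^sub>R kk b h + ((h - P h) \<bullet> b) *\<^sub>R T (P p) b)) (at p)"
   by (rule has_derivative_scaleR[OF d kk])
 qed (simp add: Ppp A_def fun_eq_iff)
 have gA: "g p (A h) w = (h - P h) \<bullet> w" for h w
 proof -
  have pOm: "p : Om" by (rule B_Om[OF pB])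
  note l = g_linear(2)[OF pOm, of w]
  have "g p (A h) w = (\<Sum>b\<in>Basis. ((h - P h) \<bullet> b) * (b \<bullet> w))"
   unfolding A_def linear_sum[OF l] linear_scale[OF l] T[OF pOm] by simp
  also have "\<dots> = (h - P h) \<bullet> w" unfolding euclidean_inner[of "h - P h" w] by (simp only: inner_commute[of w])
  finally show ?thesis .
 qed
 define S0 where "S0 = (P -` B) \<inter> (%u. (P u, S u)) -` ball (p, 0) s'"
 have jC: "Ck (Suc 0) (%u. (P u, S u)) (P -` B)" by (intro Ck_Pair PC SC)
 have S0: "open S0" "p : S0"
 proof -
  show "open S0" unfolding S0_def by (rule continuous_open_preimage[OF Ck_continuous_on[OF jC] oB' open_ball])
  show "p : S0" unfolding S0_def using pB' s'_pos by (simp add: Ppp Sp)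
 qed
 define F where "F u = ex (P u, S u)" for u
 have FC: "Ck (Suc 0) F S0"
  unfolding F_def by (rule Ck_compose[OF exC Ck_subset[OF jC]]) (use s'_pos(2) in \<open>auto simp: S0_def\<close>)
 have Fp: "F p = p" unfolding F_def using exV[OF pB pB] V_refl[OF pB] by (simp add: Ppp Sp)
 have exd: "(ex has_derivative (%w. fst w + snd w)) (at (P p, S p))" using ex_deriv by (simp add: Ppp Sp)
 have F': "(F has_derivative (%h. P h + A h)) (at p)" unfolding F_def
  by (rule has_derivative_eq_rhs[OF has_derivative_compose[OF has_derivative_Pair[OF bounded_linear_imp_has_derivative[OF P_bl] S'] exd]]) simp
 \<comment> \<open>\<open>A h = - P h\<close> lies in the plane and is orthogonal to it, so it
   vanishes; then \<open>h - P h\<close> vanishes too.\<close>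
 have inj: "h = 0" if h: "P h + A h = 0" for h
 proof -
  have "A h = - P h" using h by (simp add: eq_neg_iff_add_eq_0 add.commute)
  hence AL: "A h : ?L" using PL span_neg by metis
  have "g p (A h) (A h) = 0" unfolding gA by (rule orth[OF AL])
  hence A0: "A h = 0" using pos[OF B_Om[OF pB], of "A h"] by force
  have "(h - P h) \<bullet> (h - P h) = 0" using gA[of h "h - P h"] A0 bil[OF B_Om[OF pB]] by (simp add: bilinear_lzero)
  thus "h = 0" using h A0 by simp
 qed
 obtain U O2 H where UO: "open U" "U \<subseteq> S0" "p : U" "open O2" "F p : O2" "homeomorphism U O2 F H" "Ck (Suc 0) H O2"
  by (rule C1_inverse_function[OF FC S0 F' inj]) (assumption, rule that, assumption+)
 \<comment> \<open>Reconstructs the parameter from foot \<open>n\<close> and end point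
   \<open>x\<close>: if \<open>V n x\<close> is normal, the coordinates of \<open>u - n\<close> are
   its components lowered by the metric.\<close>
 define k where "k z = fst z + (\<Sum>b\<in>Basis. g (fst z) (V (fst z) (snd z)) b *\<^sub>R b)" for z
 have kC: "Ck (Suc 0) k (B \<times> B)" unfolding k_def
  by (intro Ck_add Ck_fst Ck_id Ck_sum Ck_scaleR Ck_const Ck_g VC) (use B_Om in auto)
 have "open ((B \<times> B) \<inter> k -` U)"
  by (rule continuous_open_preimage[OF Ck_continuous_on[OF kC] open_Times[OF open_ball open_ball] UO(1)])
 moreover have "k (p, p) = p" using V_refl[OF pB] by (simp add: k_def g_linear[OF B_Om[OF pB], THEN linear_0])
 hence "(p, p) : (B \<times> B) \<inter> k -` U" using pB UO(3) by simp
 ultimately obtain Q1 Q2 where Q: "open Q1" "open Q2" "p : Q1" "p : Q2" "Q1 \<times> Q2 \<subseteq> (B \<times> B) \<inter> k -` U"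
  by (rule open_prod_elim) auto
 obtain Q' where Q': "open Q'" "p : Q'" "ALL x:Q'. EX n:Q1 \<inter> ?L. rho x = dl n x" using feet[OF Q(1,3)] by blast
 let ?Q = "Q' \<inter> Q2 \<inter> O2"
 have main: "P (H x) : B \<inter> ?L & rho x = dl (P (H x)) x" if x: "x : ?Q" for x
 proof -
  obtain n where n: "n : Q1" "n : ?L" "rho x = dl n x" using Q'(3) x by blast
  have "(n, x) : (B \<times> B) \<inter> k -` U" using Q(5) n(1) x by blast
  hence nx: "n : B" "x : B" "k (n, x) : U" by (simp_all del: mem_ball)
  note gn = g_linear(1)[OF B_Om[OF nx(1)], of "V n x"]
  \<comment> \<open>Among the points of the plane in the ball, \<open>n\<close> is nearest to
    \<open>x\<close>; so the derivative of the energy along the plane has a sign, which forces it to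
    vanish once applied to \<open>v\<close> and \<open>- v\<close>.\<close>
  have gL0: "g n (V n x) v <= 0" if v: "v : ?L" for v
  proof (rule small_linear_zero[OF gn nx(1) _ subspace_span v])
   fix y assume y: "y : B" "y - n : ?L"
   have "y : ?L" using span_add[OF n(2) y(2)] by simp
   hence "dl n x <= dl y x" using le[of y x] y nx n(3) by auto
   hence "(dl x n)\<^sup>2 <= (dl x y)\<^sup>2"
    using dist_sym[OF nx(1,2)] dist_sym[OF nx(2) y(1)] dist_nonneg[OF nx(1,2)] by (intro power_mono) auto
   hence "g x (V x n) (V x n) <= g x (V x y) (V x y)" unfolding dist_sq[OF nx(2,1)] dist_sq[OF nx(2) y(1)] .
   thus "g n (V n x) (y - n) <= C * (norm (y - n))\<^sup>2" using abs_le_D1[OF quad[OF nx(2,1) y(1)]] by linarith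
  qed
  have gL: "g n (V n x) v = 0" if "v : ?L" for v
   using gL0[OF that] gL0[OF span_neg[OF that]] linear_neg[OF gn, of v] by simp
  define u where "u = k (n, x)"
  have ub: "(u - n) \<bullet> b = g n (V n x) b" if "b : Basis" for b
  proof -
   show ?thesis unfolding u_def k_def using inner_sum_left_Basis[OF that, of "g n (V n x)"] by simp
  qed
  have "P (u - n) = 0" unfolding P_def
  proof (rule sum.neutral, rule ballI)
   fix b assume b: "b : B0"
   thus "((u - n) \<bullet> b) *\<^sub>R b = 0" using ub[of b] gL[OF span_base[OF b]] B0 by auto
  qed
  hence Pu: "P u = n" using Pid[OF n(2)] linear_diff[OF P_lin, of u n] by simp
  have uU: "u : U" using nx(3) u_def by simp
  hence uB: "u : P -` B" using UO(2) unfolding S0_def by blast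
  have "S u = V n x"
  proof (rule g_cancel[OF B_Om[OF nx(1)]])
   fix h
   have "g n (V n x) h = (\<Sum>b\<in>Basis. (h \<bullet> b) *\<^sub>R g n (V n x) b)" by (rule linear_sum_Basis[OF gn])
   also have "\<dots> = (u - n) \<bullet> h" using ub by (simp add: euclidean_inner[of "u - n" h] mult.commute)
   finally show "g n (S u) h = g n (V n x) h" using gS[OF uB, of h] Pu by simp
  qed
  hence "F u = x" unfolding F_def Pu using exV[OF nx(1,2)] by simp
  hence "H x = u" using UO(6) uU by (auto simp: homeomorphism_def)
  thus ?thesis using Pu n nx by simp
 qed
 have QB: "?Q \<subseteq> B" using Q(3,5) by blast
 have oQ: "open ?Q" using Q Q' UO by auto
 have "Ck (Suc (Suc 0)) rho (?Q - ?L)"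
 proof (rule C2_of_C1_feet)
  show "open (?Q - ?L)" using oQ closed_span by (rule open_Diff)
  show "Ck (Suc 0) (%x. P (H x)) (?Q - ?L)" by (rule Ck_bounded_linear[OF P_bl Ck_subset[OF UO(7)]]) blast
  show "(%x. P (H x)) ` (?Q - ?L) \<subseteq> B" using main by blast
  show "Ck (Suc 0) (%x. rho (P (H x))) (?Q - ?L)"
   by (rule Ck_cong[OF Ck_const[of _ 0]]) (use main zero in \<open>simp del: mem_ball\<close>)
  show "P (H x) ~= x & rho x = rho (P (H x)) + dl (P (H x)) x" if "x : ?Q - ?L" for x
   using main[of x] zero[of "P (H x)"] that by (metis DiffD1 DiffD2 Int_iff add_0)
 qed (use QB in auto)
 thus ?thesis using oQ Q'(2) Q(4) UO(5) QB by (intro exI[of _ ?Q]) (auto simp: Fp)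
qed

end

section \<open>Riemannian manifolds\<close>

locale smooth_atlas =
 fixes M :: "'a topology" and Ch :: "('a, 'e::euclidean_space) chart set"
 assumes chart: "\<kappa> : Ch ==> is_chart M UNIV \<kappa>"
  and trans: "\<kappa> : Ch ==> \<kappa>' : Ch ==> Ck n (transition \<kappa> \<kappa>') (snd \<kappa> ` (fst \<kappa> \<inter> fst \<kappa>'))"
begin

abbreviation "img k \<equiv> snd k ` fst k"
abbreviation "inv_chart k \<equiv> inv_into (fst k) (snd k)"

lemma open_dom: "k : Ch ==> openin M (fst k)" and open_img: "k : Ch ==> open (img k)"
 using chart[of k] by (auto simp: is_chart_def)

lemma dom_sub: "k : Ch ==> fst k \<subseteq> topspace M" using open_dom openin_subset by blast

lemma chart_homeo: "k : Ch ==> homeomorphic_map (subtopology M (fst k)) (top_of_set (img k)) (snd k)"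
 using chart[of k] by (simp add: is_chart_def)

lemma chart_inj: "k : Ch ==> inj_on (snd k) (fst k)"
 using homeomorphic_imp_injective_map[OF chart_homeo[of k]] dom_sub[of k] by (simp add: Int_absorb1)

lemma inv_chart: "k : Ch ==> q : fst k ==> inv_chart k (snd k q) = q"
 by (simp add: chart_inj)

lemma chart_inv: "x : img k ==> snd k (inv_chart k x) = x" by (rule f_inv_into_f)

lemma inv_chart_in: "x : img k ==> inv_chart k x : fst k" by (rule inv_into_into)

lemma chart_homeo_maps:
 assumes "k : Ch"
 shows "homeomorphic_maps (subtopology M (fst k)) (top_of_set (img k)) (snd k) (inv_chart k)"
proof -
 obtain h where h: "homeomorphic_maps (subtopology M (fst k)) (top_of_set (img k)) (snd k) h"
  using chart_homeo[OF assms] homeomorphic_map_maps by blast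
 have "h y = inv_chart k y" if "y : img k" for y
 proof -
  have "ALL q:fst k. h (snd k q) = q" using h dom_sub[OF assms] by (auto simp: homeomorphic_maps_def)
  thus ?thesis using that inv_chart[OF assms] by auto
 qed
 thus ?thesis
  using h homeomorphic_maps_eq[of "subtopology M (fst k)" "top_of_set (img k)" "snd k" h "snd k" "inv_chart k"] by simp
qed

lemma continuous_chart: "k : Ch ==> continuous_map (subtopology M (fst k)) euclidean (snd k)"
 using chart_homeo_maps[of k] by (auto simp: homeomorphic_maps_def intro: continuous_map_into_fulltopology)

lemma continuous_inv_chart: "k : Ch ==> continuous_map (top_of_set (img k)) M (inv_chart k)"
 using chart_homeo_maps[of k] by (auto simp: homeomorphic_maps_def intro: continuous_map_into_fulltopology)

lemma open_chart_image:
 assumes k: "k : Ch" and W: "openin M W"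
 shows "open (snd k ` (fst k \<inter> W))"
proof -
 have "openin (top_of_set (img k)) {x : topspace (top_of_set (img k)). inv_chart k x : W}"
  by (rule openin_continuous_map_preimage[OF continuous_inv_chart[OF k] W])
 also have "{x : topspace (top_of_set (img k)). inv_chart k x : W} = snd k ` (fst k \<inter> W)"
  using inv_chart[OF k] by auto
 finally show ?thesis using open_img[OF k] openin_open_trans by blast
qed

lemma open_inv_image:
 assumes k: "k : Ch" and W: "open W"
 shows "openin M {q : fst k. snd k q : W}"
proof -
 have "openin (subtopology M (fst k)) {q : topspace (subtopology M (fst k)). snd k q : W}"
  by (rule openin_continuous_map_preimage[OF continuous_chart[OF k]]) (use W in simp)
 also have "{q : topspace (subtopology M (fst k)). snd k q : W} = {q : fst k. snd k q : W}"
  using dom_sub[OF k] by auto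
 finally show ?thesis using open_dom[OF k] openin_trans_full by blast
qed

lemma open_overlap: "k : Ch ==> k' : Ch ==> open (snd k ` (fst k \<inter> fst k'))"
 by (rule open_chart_image[OF _ open_dom])

lemma transition_apply: "k : Ch ==> q : fst k ==> transition k k' (snd k q) = snd k' q"
 by (simp add: transition_def inv_chart)

definition dtrans :: "('a, 'e) chart => ('a, 'e) chart => 'e => 'e => 'e" where
 "dtrans k k' x = frechet_derivative (transition k k') (at x)"

lemma dtrans:
 assumes k: "k : Ch" "k' : Ch"
 shows "x : snd k ` (fst k \<inter> fst k') ==> (transition k k' has_derivative dtrans k k' x) (at x)"
  "b : Basis ==> Ck n (%x. dtrans k k' x b) (snd k ` (fst k \<inter> fst k'))"
proof -
 let ?S = "snd k ` (fst k \<inter> fst k')"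
 obtain f' where f': "ALL x:?S. (transition k k' has_derivative f' x) (at x within ?S)" "ALL b:Basis. Ck n (%x. f' x b) ?S"
  by (rule Ck_SucE[OF trans[OF k, of "Suc n"]]) (rule that, assumption+)
 have d: "(transition k k' has_derivative f' x) (at x)" if "x : ?S" for x
  using bspec[OF f'(1) that] unfolding at_within_open[OF that open_overlap[OF k]] .
 have eq: "dtrans k k' x = f' x" if "x : ?S" for x
  unfolding dtrans_def by (rule frechet_derivative_at[OF d[OF that], symmetric])
 show "x : ?S ==> (transition k k' has_derivative dtrans k k' x) (at x)" using d eq by simp
 show "b : Basis ==> Ck n (%x. dtrans k k' x b) ?S" by (rule Ck_cong[OF bspec[OF f'(2)]]) (simp_all add: eq)
qed

lemma dtrans_chain:
 assumes k: "k : Ch" "k' : Ch" "k'' : Ch" and q: "q : fst k" "q : fst k'" "q : fst k''"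
 shows "dtrans k k'' (snd k q) v = dtrans k' k'' (snd k' q) (dtrans k k' (snd k q) v)"
proof -
 let ?x = "snd k q"
 have d1: "(transition k k' has_derivative dtrans k k' ?x) (at ?x)" by (rule dtrans(1)[OF k(1,2)]) (use q in blast)
 have "(transition k' k'' has_derivative dtrans k' k'' (snd k' q)) (at (snd k' q))"
  by (rule dtrans(1)[OF k(2,3)]) (use q in blast)
 hence d2: "(transition k' k'' has_derivative dtrans k' k'' (snd k' q)) (at (transition k k' ?x))"
  using transition_apply[OF k(1) q(1)] by simp
 have d3: "(transition k k'' has_derivative dtrans k k'' ?x) (at ?x)" by (rule dtrans(1)[OF k(1,3)]) (use q in blast)
 let ?W = "snd k ` (fst k \<inter> (fst k' \<inter> fst k''))"
 have "open ?W" by (rule open_chart_image[OF k(1) openin_Int[OF open_dom[OF k(2)] open_dom[OF k(3)]]])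
 moreover have "?x : ?W" using q by blast
 ultimately have "(transition k k'' has_derivative (%v. dtrans k' k'' (snd k' q) (dtrans k k' ?x v))) (at ?x)"
  by (rule has_derivative_transform_within_open[OF has_derivative_compose[OF d1 d2]])
   (auto simp: transition_apply[OF k(1)] transition_apply[OF k(2)])
 from has_derivative_unique[OF d3 this] show ?thesis by simp
qed

lemma dtrans_refl: "k : Ch ==> q : fst k ==> dtrans k k (snd k q) v = v"
proof -
 assume k: "k : Ch" and q: "q : fst k"
 have "(transition k k has_derivative (%v. v)) (at (snd k q))"
  by (rule has_derivative_transform_within_open[OF has_derivative_ident open_img[OF k]])
   (use q in \<open>auto simp: transition_apply[OF k]\<close>)
 moreover have "(transition k k has_derivative dtrans k k (snd k q)) (at (snd k q))"
  by (rule dtrans(1)[OF k k]) (use q in blast)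
 ultimately show ?thesis using has_derivative_unique by metis
qed

end

locale riemannian_atlas = smooth_atlas M Ch
 for M :: "'a topology" and Ch :: "('a, 'e::euclidean_space) chart set" +
 fixes G :: "('a, 'e) metric"
 assumes hausdorff: "Hausdorff_space M" and compact: "compact_space M" and connected: "connected_space M"
  and cover: "(\<Union>\<kappa>\<in>Ch. fst \<kappa>) = topspace M"
  and metric: "\<kappa> : Ch ==> local_metric (snd \<kappa> ` fst \<kappa>) (G \<kappa>)"
  and law: "\<kappa> : Ch ==> \<kappa>' : Ch ==> q : fst \<kappa> \<inter> fst \<kappa>' ==>
   G \<kappa> (snd \<kappa> q) u v = G \<kappa>' (snd \<kappa>' q) (dtrans \<kappa> \<kappa>' (snd \<kappa> q) u) (dtrans \<kappa> \<kappa>' (snd \<kappa> q) v)"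
begin

lemma chart_at: "q : topspace M ==> EX k:Ch. q : fst k" using cover by blast

lemma transition_derivative:
 assumes "k : Ch" "k' : Ch" "x : snd k ` (fst k \<inter> fst k')"
 obtains D where "(transition k k' has_derivative D) (at x)" "ALL u v. G k x u v = G k' (transition k k' x) (D u) (D v)"
proof -
 obtain q where q: "q : fst k \<inter> fst k'" "x = snd k q" using assms(3) by blast
 show ?thesis
  by (rule that[OF dtrans(1)[OF assms]]) (use law[OF assms(1,2) q(1)] q transition_apply[OF assms(1)] in auto)
qed

section \<open>Chains of chart arcs and their lengths\<close>

definition speed_in where "speed_in k c c' t = sqrt (G k (c t) (c' t) (c' t))" for c c' :: "real => 'e"

definition arc_in where
 "arc_in k a b c c' \<longleftrightarrow> k : Ch & a < b & (ALL n. Ck n c {a..b}) & c ` {a..b} \<subseteq> img k &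
  (ALL t:{a..b}. (c has_vector_derivative c' t) (at t within {a..b}))"

lemma Ck_vector_derivative:
 fixes c :: "real => 'e"
 assumes c: "Ck (Suc n) c {a..b}" and ab: "a < b" and d: "ALL t:{a..b}. (c has_vector_derivative c' t) (at t within {a..b})"
 shows "Ck n c' {a..b}"
proof -
 obtain f' where f': "ALL x:{a..b}. (c has_derivative f' x) (at x within {a..b})" "ALL b':Basis. Ck n (%x. f' x b') {a..b}"
  by (rule Ck_SucE[OF c]) (rule that, assumption+)
 show ?thesis
 proof (rule Ck_cong)
  show "Ck n (%x. f' x 1) {a..b}" using f'(2) by simp
  fix t assume t: "t : {a..b}"
  have vd: "(c has_vector_derivative f' t 1) (at t within {a..b})" unfolding has_vector_derivative_def
  proof (rule has_derivative_eq_rhs[OF bspec[OF f'(1) t]], rule ext)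
   show "f' t h = h *\<^sub>R f' t 1" for h
    using linear_scale[OF has_derivative_linear[OF bspec[OF f'(1) t]], of h 1] by simp
  qed
  show "f' t 1 = c' t"
   by (rule vector_derivative_unique_within_closed_interval[OF ab, unfolded box_real, OF t vd bspec[OF d t]])
 qed
qed

lemma speed_in_continuous: "arc_in k a b c c' ==> continuous_on {a..b} (speed_in k c c')"
proof -
 assume arc: "arc_in k a b c c'"
 interpret local_metric "img k" "G k" using arc metric by (simp add: arc_in_def)
 have c: "Ck (Suc 0) c {a..b}" using arc by (simp add: arc_in_def del: Ck.simps)
 have c': "Ck 0 c' {a..b}" by (rule Ck_vector_derivative[OF c]) (use arc in \<open>auto simp: arc_in_def\<close>)
 have "Ck 0 (%t. G k (c t) (c' t) (c' t)) {a..b}"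
  by (rule Ck_g[OF Ck_SucD[OF c] c' c']) (use arc in \<open>auto simp: arc_in_def\<close>)
 thus ?thesis unfolding speed_in_def by (auto intro!: continuous_intros)
qed

lemma speed_in_nonneg: "arc_in k a b c c' ==> t : {a..b} ==> 0 <= speed_in k c c' t"
proof -
 assume arc: "arc_in k a b c c'" and t: "t : {a..b}"
 interpret local_metric "img k" "G k" using arc metric by (simp add: arc_in_def)
 have ct: "c t : img k" using arc t by (auto simp: arc_in_def)
 have "0 <= G k (c t) (c' t) (c' t)"
  using pos[OF ct, of "c' t"] bil[OF ct] by (cases "c' t = 0") (auto simp: bilinear_lzero)
 thus ?thesis by (simp add: speed_in_def)
qed

text \<open>Chains of smooth arcs, each inside one chart, with \<open>L\<close> the total length.
  Properties of paths become inductions over the arcs, without a common parametrisation.\<close>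

inductive reach :: "'a => 'a => real => bool" where
 reach_refl: "x : topspace M ==> reach x x 0"
| reach_step: "reach x (inv_chart k (c a)) L ==> arc_in k a b c c' ==>
  reach x (inv_chart k (c b)) (L + integral {a..b} (speed_in k c c'))"

lemma arc_ends: "arc_in k a b c c' ==> t : {a..b} ==> inv_chart k (c t) : topspace M"
 using inv_chart_in[of "c t" k] dom_sub[of k] unfolding arc_in_def by blast

lemma reach_in: "reach x y L ==> x : topspace M & y : topspace M"
proof (induction rule: reach.induct)
 case (reach_step x k c a L b c')
 thus ?case using arc_ends[OF reach_step(2), of b] by (auto simp: arc_in_def)
qed simp

lemma reach_nonneg: "reach x y L ==> 0 <= L"
proof (induction rule: reach.induct)
 case (reach_step x k c a L b c')
 have "0 <= integral {a..b} (speed_in k c c')"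
  by (rule integral_nonneg[OF integrable_continuous_real[OF speed_in_continuous[OF reach_step(2)]] speed_in_nonneg[OF reach_step(2)]])
 thus ?case using reach_step by simp
qed simp

lemma reach_arc: "arc_in k a b c c' ==> reach (inv_chart k (c a)) (inv_chart k (c b)) (integral {a..b} (speed_in k c c'))"
 using reach_step[of "inv_chart k (c a)" k c a 0 b c'] reach_refl[OF arc_ends[of k a b c c' a]] by (auto simp: arc_in_def)

lemma reach_trans: "reach y z L' ==> reach x y L ==> reach x z (L + L')"
proof (induction rule: reach.induct)
 case (reach_step y k c a L' b c')
 thus ?case using reach.reach_step[of x k c a "L + L'" b c'] by (simp add: add.assoc)
qed simp

lemma arc_in_sub: "arc_in k a b c c' ==> a <= s ==> s < t ==> t <= b ==> arc_in k s t c c'"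
proof -
 assume arc: "arc_in k a b c c'" and st: "a <= s" "s < t" "t <= b"
 have sub: "{s..t} \<subseteq> {a..b}" using st by auto
 show ?thesis using arc st sub unfolding arc_in_def
  by (auto simp del: Ck.simps intro: Ck_subset[OF _ sub] has_vector_derivative_within_subset[OF _ sub])
qed

lemma arc_in_reverse:
 assumes arc: "arc_in k a b c c'"
 shows "arc_in k (- b) (- a) (%t. c (- t)) (%t. - c' (- t))"
  "integral {- b..- a} (speed_in k (%t. c (- t)) (%t. - c' (- t))) = integral {a..b} (speed_in k c c')"
proof -
 have k: "k : Ch" using arc by (simp add: arc_in_def)
 have im: "uminus ` {- b..- a} = {a..b}" by simp
 have d: "((%t. c (- t)) has_vector_derivative - c' (- t)) (at t within {- b..- a})" if t: "t : {- b..- a}" for t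
 proof -
  have 1: "(c has_vector_derivative c' (- t)) (at (- t) within uminus ` {- b..- a})"
   unfolding im using arc t by (simp add: arc_in_def)
  have "(uminus has_vector_derivative -1) (at t within {- b..- a})" by (auto intro!: derivative_eq_intros)
  from vector_diff_chain_within[OF this 1] show ?thesis by (simp add: o_def)
 qed
 have n: "Ck n (%t. c (- t)) {- b..- a}" for n
  by (rule Ck_compose[of n c "{a..b}" uminus]) (use arc in \<open>auto simp: arc_in_def intro!: Ck_linear bounded_linear_minus bounded_linear_ident\<close>)
 show "arc_in k (- b) (- a) (%t. c (- t)) (%t. - c' (- t))" using arc d n unfolding arc_in_def by auto
 interpret local_metric "img k" "G k" using metric[OF k] .
 have "integral {- b..- a} (speed_in k (%t. c (- t)) (%t. - c' (- t))) = integral {- b..- a} (%t. speed_in k c c' (- t))"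
 proof (rule integral_cong)
  fix t assume "t : {- b..- a}"
  hence "c (- t) : img k" using arc by (auto simp: arc_in_def)
  from bil[OF this] show "speed_in k (%t. c (- t)) (%t. - c' (- t)) t = speed_in k c c' (- t)"
   by (simp add: speed_in_def bilinear_lneg bilinear_rneg)
 qed
 also have "\<dots> = integral {a..b} (speed_in k c c')" by (rule Henstock_Kurzweil_Integration.integral_reflect_real)
 finally show "integral {- b..- a} (speed_in k (%t. c (- t)) (%t. - c' (- t))) = integral {a..b} (speed_in k c c')" .
qed

lemma reach_sym: "reach x y L ==> reach y x L"
proof (induction rule: reach.induct)
 case (reach_step x k c a L b c')
 from reach_trans[OF reach_step(3) reach_arc[OF arc_in_reverse(1)[OF reach_step(2)], simplified minus_minus]] arc_in_reverse(2)[OF reach_step(2)]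
 show ?case by (simp add: add.commute)
qed (rule reach_refl)

text \<open>If the length \<open>s\<close> is attained within the last arc, the intermediate value
  theorem for the integral of the speed gives the splitting point; otherwise the earlier chain is
  split.\<close>

lemma reach_split: "reach x y L ==> 0 <= s ==> s <= L ==> EX m. reach x m s & reach m y (L - s)"
proof (induction arbitrary: s rule: reach.induct)
 case (reach_refl x)
 thus ?case using reach.reach_refl[of x] by (intro exI[of _ x]) auto
next
 case (reach_step x k c a L b c')
 note arc = reach_step(2)
 have int: "speed_in k c c' integrable_on {a..b}" by (rule integrable_continuous_real[OF speed_in_continuous[OF arc]])
 have ab: "a < b" using arc by (simp add: arc_in_def)
 show ?case
 proof (cases "s <= L")
  case True
  then obtain m where m: "reach x m s" "reach m (inv_chart k (c a)) (L - s)" using reach_step by blast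
  thus ?thesis using reach.reach_step[OF m(2) arc] by (intro exI[of _ m]) (simp add: algebra_simps)
 next
  case False
  have "EX t>=a. t <= b & integral {a..t} (speed_in k c c') = s - L"
   by (rule IVT') (use False reach_step(5) ab indefinite_integral_continuous_1[OF int] in auto)
  then obtain t where t: "a <= t" "t <= b" "integral {a..t} (speed_in k c c') = s - L" by blast
  have at: "a < t" using t False by (cases "a = t") auto
  have 1: "reach x (inv_chart k (c t)) s"
   using reach.reach_step[OF reach_step(1) arc_in_sub[OF arc _ at t(2)]] t(3) by simp
  have sum: "integral {a..t} (speed_in k c c') + integral {t..b} (speed_in k c c') = integral {a..b} (speed_in k c c')"
   by (rule Henstock_Kurzweil_Integration.integral_combine[OF t(1,2) int])
  have 2: "reach (inv_chart k (c t)) (inv_chart k (c b)) (integral {t..b} (speed_in k c c'))"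
  proof (cases "t = b")
   case True
   thus ?thesis using reach_refl[OF arc_ends[OF arc, of b]] ab by simp
  next
   case False
   thus ?thesis using reach_arc[OF arc_in_sub[OF arc t(1)]] t(2) by simp
  qed
  have eq: "L + integral {a..b} (speed_in k c c') - s = integral {t..b} (speed_in k c c')" using sum t(3) by simp
  show ?thesis by (rule exI[of _ "inv_chart k (c t)"]) (use 1 2 eq in simp)
 qed
qed

end

text \<open>Bisection applies because \<open>R\<close> is subadditive and the integral is additive
  over adjacent intervals.\<close>

lemma integral_bound_local:
 fixes R :: "real => real => real"
 assumes ab: "a <= b" and int: "q integrable_on {a..b}"
  and tri: "!!s t u. a <= s ==> s <= t ==> t <= u ==> u <= b ==> R s u <= R s t + R t u"
  and loc: "!!x. x : {a..b} ==> EX e>0. ALL s t. a <= s & s <= x & x <= t & t <= b & t - s < e --> R s t <= integral {s..t} q"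
 shows "R a b <= integral {a..b} q"
proof -
 let ?P = "%s t. a <= s & t <= b --> R s t <= integral {s..t} q"
 have "?P a b"
 proof (rule Bolzano[where P="?P", OF ab])
  fix s t u assume trans: "?P s t" "?P t u" "s <= t" "t <= u"
  show "?P s u"
  proof
   assume *: "a <= s & u <= b"
   have "q integrable_on {s..u}" by (rule integrable_on_subinterval[OF int]) (use * in auto)
   hence "integral {s..t} q + integral {t..u} q = integral {s..u} q"
    by (rule Henstock_Kurzweil_Integration.integral_combine[OF trans(3,4)])
   thus "R s u <= integral {s..u} q" using tri[of s t u] trans * by auto
  qed
 next
  fix x assume "a <= x" "x <= b"
  then obtain e where "e > 0" "ALL s t. a <= s & s <= x & x <= t & t <= b & t - s < e --> R s t <= integral {s..t} q"
   using loc[of x] by auto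
  thus "EX d>0. ALL s t. s <= x & x <= t & t - s < d --> ?P s t" by blast
 qed
 thus ?thesis by simp
qed

lemma derivative_le_integral:
 fixes h :: "real => real"
 assumes st: "s < t" and q: "continuous_on {s..t} q"
  and h: "!!x. x : {s..t} ==> (h has_vector_derivative h' x) (at x within {s..t})" and le: "!!x. x : {s..t} ==> h' x <= q x"
 shows "h t - h s <= integral {s..t} q"
proof -
 let ?k = "%x. h x - integral {s..x} q"
 have d: "(?k has_vector_derivative h' x - q x) (at x within {s..t})" if "x : {s..t}" for x
  by (intro has_vector_derivative_diff h integral_has_vector_derivative q that)
 have "?k t <= ?k s"
 proof (rule DERIV_nonpos_imp_decreasing_open[of s t ?k])
  show "EX y. (?k has_real_derivative y) (at x) & y <= 0" if "s < x" "x < t" for x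
   using d[of x] that le[of x] at_within_Icc_at[OF that]
   by (intro exI[of _ "h' x - q x"]) (auto simp: has_real_derivative_iff_has_vector_derivative)
  show "continuous_on {s..t} ?k"
   unfolding continuous_on_eq_continuous_within by (intro ballI has_vector_derivative_continuous[OF d])
 qed (use st in simp)
 thus ?thesis by simp
qed

context riemannian_atlas
begin

lemma arc_continuous: "arc_in k a b c c' ==> continuous_map (top_of_set {a..b}) M (%t. inv_chart k (c t))"
proof -
 assume arc: "arc_in k a b c c'"
 have "continuous_map (top_of_set {a..b}) (top_of_set (img k)) c"
  using arc Ck_continuous_on[of 0 c] unfolding arc_in_def by (auto simp del: Ck.simps)
 from continuous_map_compose[OF this continuous_inv_chart] arc show ?thesis by (simp add: arc_in_def o_def)
qed

lemma arc_near:
 assumes arc: "arc_in k a b c c'" and W: "openin M W" and x: "x : {a..b}" "inv_chart k (c x) : W"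
 shows "EX e>0. ALL t:{a..b}. \<bar>t - x\<bar> < e --> inv_chart k (c t) : W"
proof -
 have "openin (top_of_set {a..b}) {t : topspace (top_of_set {a..b}). inv_chart k (c t) : W}"
  by (rule openin_continuous_map_preimage[OF arc_continuous[OF arc] W])
 hence "openin (top_of_set {a..b}) {t : {a..b}. inv_chart k (c t) : W}" by simp
 then obtain e where "e > 0" "ball x e \<inter> {a..b} \<subseteq> {t : {a..b}. inv_chart k (c t) : W}"
  using x unfolding openin_contains_ball by blast
 thus ?thesis by (intro exI[of _ e]) (auto simp: subset_iff dist_real_def abs_minus_commute)
qed

lemma arc_change:
 assumes arc: "arc_in k a b c c'" and k': "k' : Ch" and sub: "!!t. t : {a..b} ==> inv_chart k (c t) : fst k'"
 obtains e e' where "arc_in k' a b e e'" "!!t. t : {a..b} ==> e t = snd k' (inv_chart k (c t))"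
  "!!t. t : {a..b} ==> speed_in k' e e' t = speed_in k c c' t"
proof -
 have k: "k : Ch" and ab: "a < b" and cC: "Ck n c {a..b}" and cim: "c ` {a..b} \<subseteq> img k"
  and c': "!!t. t : {a..b} ==> (c has_vector_derivative c' t) (at t within {a..b})" for n
  using arc unfolding arc_in_def by (auto simp del: Ck.simps)
 let ?O = "snd k ` (fst k \<inter> fst k')"
 have cO: "c t : ?O" if "t : {a..b}" for t
 proof -
  have "c t : img k" using cim that by blast
  thus ?thesis
   using sub[OF that] chart_inv[of "c t" k] inv_chart_in[of "c t" k] by (intro image_eqI[of _ _ "inv_chart k (c t)"]) auto
 qed
 have ex: "EX D. (transition k k' has_derivative D) (at x) & (ALL u v. G k x u v = G k' (transition k k' x) (D u) (D v))"
  if "x : ?O" for x by (rule transition_derivative[OF k k' that]) (rule exI, rule conjI, assumption+)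
 define T where "T x = (SOME D. (transition k k' has_derivative D) (at x) & (ALL u v. G k x u v = G k' (transition k k' x) (D u) (D v)))" for x
 have T: "(transition k k' has_derivative T x) (at x) & (ALL u v. G k x u v = G k' (transition k k' x) (T x u) (T x v))"
  if "x : ?O" for x unfolding T_def by (rule someI_ex[OF ex[OF that]])
 let ?e = "%t. transition k k' (c t)" and ?e' = "%t. T (c t) (c' t)"
 have tr: "?e t = snd k' (inv_chart k (c t))" for t by (simp add: transition_def)
 have "arc_in k' a b ?e ?e'" unfolding arc_in_def
 proof (intro conjI allI ballI)
  show "Ck n ?e {a..b}" for n by (rule Ck_compose[OF trans[OF k k'] cC]) (use cO in blast)
  show "?e ` {a..b} \<subseteq> img k'" using sub tr by auto
  fix t assume t: "t : {a..b}"
  show "(?e has_vector_derivative ?e' t) (at t within {a..b})" unfolding has_vector_derivative_def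
  proof (rule has_derivative_eq_rhs[OF has_derivative_compose[OF c'[OF t, unfolded has_vector_derivative_def] conjunct1[OF T[OF cO[OF t]]]]], rule ext)
   fix h show "T (c t) (h *\<^sub>R c' t) = h *\<^sub>R T (c t) (c' t)"
    by (rule linear_scale[OF has_derivative_linear[OF conjunct1[OF T[OF cO[OF t]]]]])
  qed
 qed (use k' ab in auto)
 moreover have "speed_in k' ?e ?e' t = speed_in k c c' t" if "t : {a..b}" for t
  using T[OF cO[OF that]] by (simp add: speed_in_def)
 ultimately show ?thesis using that tr by blast
qed

text \<open>As \<open>f >= m\<close> off the compact \<open>K\<close>, the minimum with
  \<open>m\<close> extends by the constant \<open>m\<close> beyond the chart to a function
  \<open>F\<close> whose growth along any arc is at most its length. Locally an arc is either over
  \<open>U\<close> or avoids the closed set over \<open>K\<close>, where \<open>F\<close> is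
  constant.\<close>

lemma calibration:
 assumes j: "j : Ch" and U: "open U" "U \<subseteq> img j" and K: "compact K" "K \<subseteq> U"
  and f: "ALL x:U. (f has_derivative f' x) (at x) & (ALL v. \<bar>f' x v\<bar> <= sqrt (G j x v v))"
  and m: "ALL x:U - K. m <= f x" and F: "!!q. F q = (if q : fst j & snd j q : U then min (f (snd j q)) m else m)"
  and r: "reach x y L"
 shows "F y - F x <= L" using r
proof (induction rule: reach.induct)
 case (reach_step x j' c a L b c')
 note arc = reach_step(2)
 have ab: "a < b" and j': "j' : Ch" using arc by (auto simp: arc_in_def)
 let ?q = "%t. inv_chart j' (c t)" and ?i = "speed_in j' c c'"
 have cont: "continuous_on {a..b} ?i" by (rule speed_in_continuous[OF arc])
 have int0: "0 <= integral {s..t} ?i" if "a <= s" "t <= b" for s t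
 proof (cases "s < t")
  case True
  have sub: "arc_in j' s t c c'" by (rule arc_in_sub[OF arc that(1) True that(2)])
  show ?thesis
   by (rule integral_nonneg[OF integrable_continuous_real[OF speed_in_continuous[OF sub]] speed_in_nonneg[OF sub]])
 qed (use integral_singleton[of s] in \<open>cases "s = t"; auto\<close>)
 have "F (?q b) - F (?q a) <= integral {a..b} ?i"
 proof (rule integral_bound_local[of a b ?i "%s t. F (?q t) - F (?q s)"])
  show "?i integrable_on {a..b}" by (rule integrable_continuous_real[OF cont])
  fix x assume x: "x : {a..b}"
  show "EX e>0. ALL s t. a <= s & s <= x & x <= t & t <= b & t - s < e --> F (?q t) - F (?q s) <= integral {s..t} ?i"
  proof (cases "?q x : fst j & snd j (?q x) : U")
   case True
   have "openin M {q : fst j. snd j q : U}" by (rule open_inv_image[OF j U(1)])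
   then obtain e where e: "e > 0" "ALL t:{a..b}. \<bar>t - x\<bar> < e --> ?q t : {q : fst j. snd j q : U}"
    using arc_near[OF arc _ x, of "{q : fst j. snd j q : U}"] True by blast
   have "F (?q t) - F (?q s) <= integral {s..t} ?i" if st: "a <= s" "s <= x" "x <= t" "t <= b" "t - s < e" for s t
   proof (cases "s < t")
    case True
    have sub: "?q u : fst j" "snd j (?q u) : U" if "u : {s..t}" for u using e(2) that st by auto
    note arc' = arc_in_sub[OF arc st(1) True st(4)]
    obtain w w' where w: "arc_in j s t w w'" "!!t'. t' : {s..t} ==> w t' = snd j (?q t')"
     "!!t'. t' : {s..t} ==> speed_in j w w' t' = ?i t'"
     by (rule arc_change[OF arc' j sub(1)]) (assumption, rule that, assumption+)
    have "f (w t) - f (w s) <= integral {s..t} ?i"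
    proof (rule derivative_le_integral[OF True continuous_on_subset[OF cont]])
     fix u assume u: "u : {s..t}"
     have wU: "w u : U" using w(2)[OF u] sub(2)[OF u] by simp
     have fd: "(f has_derivative f' (w u)) (at (w u))" using f wU by blast
     have wd: "(w has_derivative (%h. h *\<^sub>R w' u)) (at u within {s..t})" using w(1) u by (simp add: arc_in_def has_vector_derivative_def)
     show "((%u. f (w u)) has_vector_derivative f' (w u) (w' u)) (at u within {s..t})"
      unfolding has_vector_derivative_def
     proof (rule has_derivative_eq_rhs[OF has_derivative_compose[OF wd fd]], rule ext)
      show "f' (w u) (h *\<^sub>R w' u) = h *\<^sub>R f' (w u) (w' u)" for h
       by (rule linear_scale[OF has_derivative_linear[OF fd]])
     qed
     have "f' (w u) (w' u) <= sqrt (G j (w u) (w' u) (w' u))" using f wU by (meson abs_le_D1)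
     thus "f' (w u) (w' u) <= ?i u" using w(3)[OF u] by (simp add: speed_in_def)
    qed (use st in auto)
    hence "f (snd j (?q t)) - f (snd j (?q s)) <= integral {s..t} ?i" using w(2) True by simp
    moreover have "F (?q t) = min (f (snd j (?q t))) m" "F (?q s) = min (f (snd j (?q s))) m"
     using sub[of t] sub[of s] True by (auto simp: F)
    ultimately show ?thesis using int0[OF st(1,4)] by linarith
   next
    case False
    hence "s = t" using st by simp
    thus ?thesis by simp
   qed
   thus ?thesis using e(1) by blast
  next
   case False
   have Kc: "closedin M (inv_chart j ` K)"
   proof (rule compactin_imp_closedin[OF hausdorff])
    have "compactin (top_of_set (img j)) K" using K U by (auto simp: compactin_subtopology)
    thus "compactin M (inv_chart j ` K)" by (rule image_compactin[OF _ continuous_inv_chart[OF j]])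
   qed
   have qx: "?q x : topspace M" by (rule arc_ends[OF arc x])
   have "?q x ~: inv_chart j ` K"
   proof
    assume "?q x : inv_chart j ` K"
    then obtain k where k: "k : K" "?q x = inv_chart j k" by blast
    hence "k : img j" using K U by blast
    hence "snd j (?q x) = k" "?q x : fst j" using k(2) chart_inv[of k j] inv_chart_in[of k j] by simp_all
    thus False using False k(1) K(2) by auto
   qed
   then obtain e where e: "e > 0" "ALL t:{a..b}. \<bar>t - x\<bar> < e --> ?q t : topspace M - inv_chart j ` K"
    using arc_near[OF arc openin_diff[OF openin_topspace Kc] x] qx by blast
   have Fm: "F q = m" if "q : topspace M - inv_chart j ` K" for q
   proof (cases "q : fst j & snd j q : U")
    case True
    hence "snd j q ~: K" using that inv_chart[OF j, of q] by (metis DiffD2 image_eqI)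
    thus ?thesis using True m by (simp add: F)
   next
    case False
    thus ?thesis unfolding F by (rule if_not_P)
   qed
   have "F (?q t) - F (?q s) <= integral {s..t} ?i" if st: "a <= s" "s <= x" "x <= t" "t <= b" "t - s < e" for s t
   proof -
    have "?q t : topspace M - inv_chart j ` K" "?q s : topspace M - inv_chart j ` K"
     by (rule bspec[OF e(2), THEN mp]; use st in auto)+
    from this[THEN Fm] show ?thesis using int0[OF st(1,4)] by simp
   qed
   thus ?thesis using e(1) by blast
  qed
 qed (use ab in auto)
 thus ?case using reach_step(3) by simp
qed simp

text \<open>The value 0 for pairs not joined by a chain is a default; \<open>reach_exists\<close>
  excludes this case inside \<open>M\<close>.\<close>

definition rdist :: "'a => 'a => real" where
 "rdist x y = (if EX L. reach x y L then Inf {L. reach x y L} else 0)"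

lemma rdist_le: "reach x y L ==> rdist x y <= L"
proof -
 assume r: "reach x y L"
 have "Inf {L. reach x y L} <= L"
  by (rule cInf_lower) (use r in \<open>auto intro!: bdd_belowI[of _ 0] reach_nonneg\<close>)
 thus ?thesis using r by (auto simp: rdist_def)
qed

lemma rdist_nonneg: "0 <= rdist x y"
proof (cases "EX L. reach x y L")
 case True
 hence "0 <= Inf {L. reach x y L}" by (intro cInf_greatest) (auto intro: reach_nonneg)
 thus ?thesis by (simp add: rdist_def)
qed (simp add: rdist_def)

lemma segment_arc:
 assumes k: "k : Ch" and sub: "ball x e \<subseteq> img k" and y: "y : ball x e"
 shows "arc_in k 0 1 (%t. x + t *\<^sub>R (y - x)) (%t. y - x)" unfolding arc_in_def
proof (intro conjI allI ballI)
 show "Ck n (%t. x + t *\<^sub>R (y - x)) {0..1}" for n by (intro Ck_add Ck_const Ck_scaleR Ck_id)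
 have "dist x y < e" using y by simp
 hence "0 < e" using zero_le_dist[of x y] by linarith
 have "x + t *\<^sub>R (y - x) : ball x e" if "t : {0..1}" for t
 proof -
  have "(1 - t) *\<^sub>R x + t *\<^sub>R y : ball x e"
   by (rule convexD_alt[OF convex_ball]) (use y \<open>0 < e\<close> that in auto)
  moreover have "(1 - t) *\<^sub>R x + t *\<^sub>R y = x + t *\<^sub>R (y - x)" by (simp add: algebra_simps)
  ultimately show ?thesis by simp
 qed
 thus "(%t. x + t *\<^sub>R (y - x)) ` {0..1} \<subseteq> img k" using sub by blast
 show "((%t. x + t *\<^sub>R (y - x)) has_vector_derivative y - x) (at t within {0..1})" for t
  by (auto intro!: derivative_eq_intros)
qed (use k in auto)

text \<open>The set of points reachable from \<open>x\<close> is open and closed, because centres of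
  coordinate balls are joined to their points by straight segments and \<open>reach\<close> is
  symmetric and transitive.\<close>

lemma reach_exists:
 assumes "x : topspace M" "y : topspace M"
 shows "EX L. reach x y L"
proof -
 let ?R = "{y : topspace M. EX L. reach x y L}"
 have nbhd: "EX W. openin M W & q : W & (ALL z:W. EX L. reach q z L)" if q: "q : topspace M" for q
 proof -
  obtain k where k: "k : Ch" "q : fst k" using chart_at[OF q] by blast
  obtain e where e: "0 < e" "ball (snd k q) e \<subseteq> img k" using open_img[OF k(1)] k(2) open_contains_ball by (metis image_eqI)
  have "EX L. reach q z L" if z: "z : fst k" "snd k z : ball (snd k q) e" for z
   using reach_arc[OF segment_arc[OF k(1) e(2) z(2)]] inv_chart[OF k(1)] k(2) z(1) by auto
  thus ?thesis using open_inv_image[OF k(1), of "ball (snd k q) e"] k(2) e(1)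
   by (intro exI[of _ "{z : fst k. snd k z : ball (snd k q) e}"]) auto
 qed
 have "openin M ?R"
 proof (subst openin_subopen, intro ballI)
  fix q assume q: "q : ?R"
  then obtain W where W: "openin M W" "q : W" "ALL z:W. EX L. reach q z L" using nbhd by blast
  have "W \<subseteq> ?R" using W openin_subset[OF W(1)] q reach_trans by blast
  thus "EX T. openin M T & q : T & T \<subseteq> ?R" using W by blast
 qed
 moreover have "openin M (topspace M - ?R)"
 proof (subst openin_subopen, intro ballI)
  fix q assume q: "q : topspace M - ?R"
  then obtain W where W: "openin M W" "q : W" "ALL z:W. EX L. reach q z L" using nbhd by blast
  have "W \<subseteq> topspace M - ?R" using W openin_subset[OF W(1)] q reach_trans reach_sym by blast
  thus "EX T. openin M T & q : T & T \<subseteq> topspace M - ?R" using W by blast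
 qed
 ultimately have "?R = {} \<or> ?R = topspace M"
  using connected unfolding connected_space_clopen_in closedin_def by blast
 moreover have "x : ?R" using assms reach_refl by blast
 ultimately show ?thesis using assms by blast
qed

lemma rdist_approx:
 assumes "x : topspace M" "y : topspace M" "rdist x y < B"
 obtains L where "reach x y L" "L < B"
 using assms(3) reach_exists[OF assms(1,2)] cInf_lessD[of "{L. reach x y L}" B] unfolding rdist_def by (auto split: if_splits)

lemma rdist_greatest: "x : topspace M ==> y : topspace M ==> (!!L. reach x y L ==> B <= L) ==> B <= rdist x y"
proof -
 assume *: "x : topspace M" "y : topspace M" "!!L. reach x y L ==> B <= L"
 have "B <= Inf {L. reach x y L}" by (rule cInf_greatest) (use reach_exists[OF *(1,2)] *(3) in auto)
 thus ?thesis using reach_exists[OF *(1,2)] by (simp add: rdist_def)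
qed

lemma rdist_sym: "rdist x y = rdist y x"
proof -
 have "reach x y = reach y x" using reach_sym by blast
 thus ?thesis by (simp add: rdist_def)
qed

lemma rdist_triangle:
 assumes "x : topspace M" "y : topspace M" "z : topspace M"
 shows "rdist x z <= rdist x y + rdist y z"
proof (rule field_le_epsilon)
 fix e :: real assume "0 < e"
 hence "rdist x y < rdist x y + e / 2" "rdist y z < rdist y z + e / 2" by auto
 then obtain L L' where "reach x y L" "L < rdist x y + e / 2" "reach y z L'" "L' < rdist y z + e / 2"
  using rdist_approx assms by metis
 thus "rdist x z <= rdist x y + rdist y z + e" using rdist_le[OF reach_trans] by fastforce
qed

lemma chart_metric_bounds:
 assumes k: "k : Ch" and x: "x : img k"
 obtains r C m where "0 < r" "cball x r \<subseteq> img k" "0 < C" "0 < m"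
  "!!y v. y : cball x r ==> m * norm v <= sqrt (G k y v v) & sqrt (G k y v v) <= C * norm v"
proof -
 interpret local_metric "img k" "G k" by (rule metric[OF k])
 obtain r where r: "0 < r" "cball x r \<subseteq> img k" using open_Om x open_contains_cball by metis
 obtain C m where b1: "!!y u v. y : cball x r ==> \<bar>G k y u v\<bar> <= C * norm u * norm v"
  and b2: "!!y v. y : cball x r ==> m * (norm v)\<^sup>2 <= G k y v v" and C: "0 < C" and m: "0 < m"
  by (rule metric_bounds[OF compact_cball convex_cball r(2)]) (rule that, assumption+)
 show ?thesis
 proof (rule that[OF r, of "sqrt C" "sqrt m"])
  fix y v :: 'e assume y: "y : cball x r"
  have "sqrt m * norm v = sqrt (m * (norm v)\<^sup>2)" "sqrt C * norm v = sqrt (C * (norm v)\<^sup>2)" using m C by (auto simp: real_sqrt_mult)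
  thus "sqrt m * norm v <= sqrt (G k y v v) & sqrt (G k y v v) <= sqrt C * norm v"
   using b1[OF y, of v v] b2[OF y, of v] by (simp add: power2_eq_square mult.assoc)
 qed (use C m in auto)
qed

lemma rdist_chart_le:
 assumes k: "k : Ch" and c: "ALL n. Ck n c {0..1}"
  and c': "ALL t:{0..1}. c t : img k & (c has_vector_derivative c' t) (at t within {0..1}) & sqrt (G k (c t) (c' t) (c' t)) <= B"
 shows "rdist (inv_chart k (c 0)) (inv_chart k (c 1)) <= B"
proof -
 have arc: "arc_in k 0 1 c c'" unfolding arc_in_def using k c c' by auto
 have "integral {0..1} (speed_in k c c') <= integral {0..1} (%t::real. B)"
  by (rule Henstock_Kurzweil_Integration.integral_le[OF integrable_continuous_real[OF speed_in_continuous[OF arc]] integrable_const_ivl])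
   (use c' in \<open>auto simp: speed_in_def\<close>)
 thus ?thesis using rdist_le[OF reach_arc[OF arc]] by simp
qed

lemma rdist_calibration:
 assumes k: "k : Ch" and U: "open U" "U \<subseteq> img k" and K: "compact K" "K \<subseteq> U"
  and f: "ALL x:U. (f has_derivative f' x) (at x) & (ALL v. \<bar>f' x v\<bar> <= sqrt (G k x v v))"
  and m: "ALL x:U - K. m <= f x" and x: "x : U"
 shows "y : U ==> min (f y) m - min (f x) m <= rdist (inv_chart k x) (inv_chart k y)"
  "q : topspace M ==> ~ (q : fst k & snd k q : U) ==> m - min (f x) m <= rdist (inv_chart k x) q"
proof -
 let ?F = "%q. if q : fst k & snd k q : U then min (f (snd k q)) m else m"
 have main: "?F z - ?F w <= rdist w z" if "w : topspace M" "z : topspace M" for w z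
  by (rule rdist_greatest[OF that]) (rule calibration[OF k U K f m, of ?F], auto)
 have inU: "inv_chart k y : topspace M" "?F (inv_chart k y) = min (f y) m" if "y : U" for y
  using that U(2) inv_chart_in[of y k] chart_inv[of y k] dom_sub[OF k] by auto
 show "y : U ==> min (f y) m - min (f x) m <= rdist (inv_chart k x) (inv_chart k y)"
 proof -
  assume y: "y : U"
  from main[OF inU(1)[OF x] inU(1)[OF y]] show ?thesis unfolding inU(2)[OF x] inU(2)[OF y] .
 qed
 show "q : topspace M ==> ~ (q : fst k & snd k q : U) ==> m - min (f x) m <= rdist (inv_chart k x) q"
 proof -
  assume q: "q : topspace M" "~ (q : fst k & snd k q : U)"
  from main[OF inU(1)[OF x] q(1)] show ?thesis unfolding inU(2)[OF x] if_not_P[OF q(2)] .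
 qed
qed

lemma rdist_pos:
 assumes xy: "x : topspace M" "y : topspace M" "x ~= y"
 shows "0 < rdist x y"
proof -
 obtain k where k: "k : Ch" "x : fst k" using chart_at[OF xy(1)] by blast
 let ?p = "snd k x"
 have p: "?p : img k" using k(2) by blast
 obtain r C m where r: "0 < r" "cball ?p r \<subseteq> img k" and C: "0 < C" and m: "0 < m"
  and b: "!!y v. y : cball ?p r ==> m * norm v <= sqrt (G k y v v) & sqrt (G k y v v) <= C * norm v"
  by (rule chart_metric_bounds[OF k(1) p]) (rule that, assumption+)
 \<comment> \<open>A paraboloid as calibration: its derivative has norm at most \<open>m\<close> in
   the ball, hence at most one against the metric, and its value at radius \<open>r / 2\<close> is
   \<open>m * r / 8\<close>.\<close>
 let ?f = "%y. (m / (2 * r)) * ((y - ?p) \<bullet> (y - ?p))" and ?f' = "%y v. (m / r) * ((y - ?p) \<bullet> v)"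
 let ?m = "m * r / 8"
 have f: "ALL y:ball ?p r. (?f has_derivative ?f' y) (at y) & (ALL v. \<bar>?f' y v\<bar> <= sqrt (G k y v v))"
 proof (intro ballI conjI allI)
  fix y assume y: "y : ball ?p r"
  show "(?f has_derivative ?f' y) (at y)"
   using r(1) by (auto intro!: derivative_eq_intros simp: fun_eq_iff inner_commute field_simps)
  fix v
  have "\<bar>?f' y v\<bar> = (m / r) * \<bar>(y - ?p) \<bullet> v\<bar>" using m r by (simp add: abs_mult)
  also have "\<dots> <= (m / r) * (norm (y - ?p) * norm v)" using m r by (intro mult_left_mono Cauchy_Schwarz_ineq2) auto
  also have "\<dots> <= (m / r) * (r * norm v)"
   using m r y by (intro mult_left_mono mult_right_mono) (auto simp: dist_norm norm_minus_commute)
  also have "\<dots> = m * norm v" using r(1) by simp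
  also have "\<dots> <= sqrt (G k y v v)" using b[of y v] y by auto
  finally show "\<bar>?f' y v\<bar> <= sqrt (G k y v v)" .
 qed
 have out: "ALL y:ball ?p r - cball ?p (r / 2). ?m <= ?f y"
 proof
  fix y assume "y : ball ?p r - cball ?p (r / 2)"
  hence "r / 2 <= norm (y - ?p)" by (auto simp: dist_norm norm_minus_commute)
  hence "(r / 2) * (r / 2) <= (norm (y - ?p))\<^sup>2" using r unfolding power2_eq_square by (intro mult_mono) auto
  hence "(m / (2 * r)) * ((r / 2) * (r / 2)) <= (m / (2 * r)) * (norm (y - ?p))\<^sup>2" using m r by (intro mult_left_mono) auto
  thus "?m <= ?f y" using r by (simp add: power2_norm_eq_inner)
 qed
 have sub: "ball ?p r \<subseteq> img k" "cball ?p (r / 2) \<subseteq> ball ?p r" "?p : ball ?p r" using r by auto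
 note cal = rdist_calibration[OF k(1) open_ball sub(1) compact_cball sub(2) f out sub(3)]
 have x: "inv_chart k ?p = x" by (rule inv_chart[OF k])
 have mr: "0 < ?m" using m r by simp
 show ?thesis
 proof (cases "y : fst k & snd k y : ball ?p r")
  case True
  have "snd k y ~= ?p" using xy(3) inv_chart[OF k(1)] True k(2) by metis
  hence "0 < ?f (snd k y)" using m r by (intro mult_pos_pos) auto
  thus ?thesis using cal(1)[of "snd k y"] True mr inv_chart[OF k(1)] unfolding x by auto
 next
  case False
  thus ?thesis using cal(2)[OF xy(2) False] mr unfolding x by simp
 qed
qed

lemma rdist_refl: "x : topspace M ==> rdist x x = 0"
 using rdist_le[OF reach_refl] rdist_nonneg[of x x] by force

sublocale mt: Metric_space "topspace M" rdist
proof
 show "rdist x y = 0 \<longleftrightarrow> x = y" if "x : topspace M" "y : topspace M" for x y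
  using rdist_pos[OF that] rdist_refl[OF that(1)] by (cases "x = y") auto
qed (rule rdist_nonneg rdist_sym rdist_triangle, assumption?)+


lemma rdist_chart_small:
 assumes k: "k : Ch" and x: "x : img k"
 obtains r C where "0 < r" "0 < C" "ball x r \<subseteq> img k"
  "!!y. y : ball x r ==> rdist (inv_chart k x) (inv_chart k y) <= C * dist x y"
proof -
 obtain r C m where r: "0 < r" "cball x r \<subseteq> img k" and C: "0 < C" and m: "0 < m"
  and b: "!!y v. y : cball x r ==> m * norm v <= sqrt (G k y v v) & sqrt (G k y v v) <= C * norm v"
  by (rule chart_metric_bounds[OF k x]) (rule that, assumption+)
 have sub: "ball x r \<subseteq> img k" using r by auto
 show ?thesis
 proof (rule that[OF r(1) C sub])
  fix y assume y: "y : ball x r"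
  have arc: "arc_in k 0 1 (%t. x + t *\<^sub>R (y - x)) (%t. y - x)" by (rule segment_arc[OF k sub y])
  have "rdist (inv_chart k (x + 0 *\<^sub>R (y - x))) (inv_chart k (x + 1 *\<^sub>R (y - x))) <= C * norm (y - x)"
  proof (rule rdist_chart_le[OF k, of _ "%t. y - x"])
   show "ALL n. Ck n (%t. x + t *\<^sub>R (y - x)) {0..1}" using arc by (simp add: arc_in_def del: Ck.simps)
   show "ALL t:{0..1}. x + t *\<^sub>R (y - x) : img k & ((%t. x + t *\<^sub>R (y - x)) has_vector_derivative y - x) (at t within {0..1}) &
     sqrt (G k (x + t *\<^sub>R (y - x)) (y - x) (y - x)) <= C * norm (y - x)"
   proof (intro ballI conjI)
    fix t :: real assume t: "t : {0..1}"
    have "norm (t *\<^sub>R (y - x)) <= 1 * norm (y - x)" unfolding norm_scaleR using t by (intro mult_right_mono) auto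
    hence "x + t *\<^sub>R (y - x) : cball x r" using y by (simp add: dist_norm norm_minus_commute)
    thus "sqrt (G k (x + t *\<^sub>R (y - x)) (y - x) (y - x)) <= C * norm (y - x)" using b by blast
    show "x + t *\<^sub>R (y - x) : img k" using arc t unfolding arc_in_def by blast
   qed (use arc in \<open>auto simp: arc_in_def\<close>)
  qed
  thus "rdist (inv_chart k x) (inv_chart k y) <= C * dist x y" by (simp add: dist_norm norm_minus_commute)
 qed
qed

text \<open>The identity is continuous from a compact space onto a Hausdorff space, hence a
  homeomorphism; only an upper estimate of small distances inside a chart is required.\<close>

lemma mtopology_eq: "mt.mtopology = M"
proof -
 have c: "continuous_map M mt.mtopology id" unfolding mt.continuous_map_to_metric
 proof (intro ballI allI impI)
  fix x and ep :: real assume x: "x : topspace M" and ep: "0 < ep"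
  obtain k where k: "k : Ch" "x : fst k" using chart_at[OF x] by blast
  have p: "snd k x : img k" using k(2) by blast
  obtain r C where r: "0 < r" "0 < C" "ball (snd k x) r \<subseteq> img k"
   "!!y. y : ball (snd k x) r ==> rdist (inv_chart k (snd k x)) (inv_chart k y) <= C * dist (snd k x) y"
   by (rule rdist_chart_small[OF k(1) p]) (rule that, assumption+)
  let ?W = "{q : fst k. snd k q : ball (snd k x) (min r (ep / C))}"
  show "EX U. openin M U & x : U & (ALL y:U. id y : mt.mball (id x) ep)"
  proof (intro exI[of _ ?W] conjI ballI)
   show "openin M ?W" by (rule open_inv_image[OF k(1) open_ball])
   show "x : ?W" using k r ep by simp
   fix y assume y: "y : ?W"
   have "rdist x y <= C * dist (snd k x) (snd k y)" using r(4)[of "snd k y"] y inv_chart[OF k(1)] k(2) by simp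
   also have "\<dots> < C * (ep / C)" using y r(2) by (intro mult_strict_left_mono) auto
   also have "\<dots> = ep" using r(2) by simp
   finally show "id y : mt.mball (id x) ep" using x y dom_sub[OF k(1)] by auto
  qed
 qed
 have "homeomorphic_map M mt.mtopology id"
  by (rule continuous_imp_homeomorphic_map[OF c compact mt.Hausdorff_space_mtopology]) auto
 thus ?thesis by (simp add: homeomorphic_map_id)
qed

abbreviation "cdist k \<equiv> (%x y. rdist (inv_chart k x) (inv_chart k y))"

lemma normal_ball_at:
 assumes k: "k : Ch" and p: "p : img k"
 shows "EX r s s' C ex V. normal_ball (img k) (G k) (cdist k) p r s s' C ex V"
proof -
 interpret local_metric "img k" "G k" by (rule metric[OF k])
 show ?thesis
 proof (rule normal_ball_exists[OF p])
  show "cdist k (c 0) (c 1) <= B"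
   if "ALL n. Ck n c {0..1}" "ALL t:{0..1}. c t : img k & (c has_vector_derivative c' t) (at t within {0..1}) & sqrt (G k (c t) (c' t) (c' t)) <= B"
   for c c' B by (rule rdist_chart_le[OF k that])
  show "min (f y) m - min (f x) m <= cdist k x y" if "open U" "U \<subseteq> img k" "compact K" "K \<subseteq> U"
    "ALL x:U. (f has_derivative f' x) (at x) & (ALL v. \<bar>f' x v\<bar> <= sqrt (G k x v v))"
    "ALL x:U - K. m <= f x" "x : U" "y : U" for U f f' K m x y
   by (rule rdist_calibration(1)[OF k that])
 qed
qed

end

lemma compact_space_attains_inf:
 fixes h :: "'a => real"
 assumes "compact_space X" "topspace X ~= {}" "continuous_map X euclideanreal h"
 obtains m where "m : topspace X" "!!x. x : topspace X ==> h m <= h x"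
proof -
 have "compact (h ` topspace X)"
  using image_compactin[of X "topspace X" euclideanreal h] assms by (simp add: compact_space_def)
 then obtain y where "y : h ` topspace X" "ALL z:h ` topspace X. y <= z"
  using compact_attains_inf[of "h ` topspace X"] assms(2) by auto
 thus ?thesis using that by auto
qed

locale riemannian_submanifold = riemannian_atlas M Ch G
 for M :: "'a topology" and Ch :: "('a, 'e::euclidean_space) chart set" and G :: "('a, 'e) metric" +
 fixes N :: "'a set"
 assumes N_closed: "closedin M N" and N_nonempty: "N ~= {}"
  and slice: "q : N ==> EX \<kappa>:Ch. q : fst \<kappa> & (\<exists>B0\<subseteq>Basis. snd \<kappa> ` (fst \<kappa> \<inter> N) = img \<kappa> \<inter> span B0)"

section \<open>Intermediate points, uniform normal balls and absence of branching\<close>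

context riemannian_atlas
begin

lemma continuous_rdist: "x : topspace M ==> continuous_map M euclideanreal (rdist x)"
proof -
 assume x: "x : topspace M"
 have "continuous_map mt.mtopology euclideanreal (%z. rdist ((%z. x) z) (id z))"
  using continuous_map_mdist[of mt.mtopology mt.Self "%z. x" id] x by (simp add: mtopology_of_def)
 thus ?thesis by (simp add: mtopology_eq)
qed

text \<open>Chains of length slightly above the distance split approximately. By compactness the
  larger of the two excesses has a minimum, which is then at most zero; no limit of curves is
  taken.\<close>

lemma rdist_split:
 assumes xy: "x : topspace M" "y : topspace M" and s: "0 <= s" "s <= rdist x y"
 shows "EX m:topspace M. rdist x m = s & rdist m y = rdist x y - s"
proof -
 let ?h = "%m. max (rdist x m - s) (rdist y m - (rdist x y - s))"
 have c: "continuous_map M euclideanreal ?h"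
  by (intro continuous_map_real_max continuous_map_diff continuous_rdist xy) auto
 obtain m where m: "m : topspace M" "!!z. z : topspace M ==> ?h m <= ?h z"
  by (rule compact_space_attains_inf[OF compact _ c]) (use xy in auto)
 have "?h m <= 0"
 proof (rule field_le_epsilon)
  fix e :: real assume "0 < e"
  then obtain L where L: "reach x y L" "L < rdist x y + e" using rdist_approx[OF xy, of "rdist x y + e"] by auto
  hence "s <= L" using rdist_le s by fastforce
  then obtain z where z: "reach x z s" "reach z y (L - s)" using reach_split[OF L(1) s(1)] by blast
  have "rdist x z <= s" "rdist y z <= L - s" using rdist_le[OF z(1)] rdist_le[OF z(2)] rdist_sym[of z y] by auto
  hence "?h z <= e" using L \<open>0 < e\<close> by auto
  thus "?h m <= 0 + e" using m(2)[of z] reach_in[OF z(1)] by linarith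
 qed
 hence "rdist x m <= s" "rdist m y <= rdist x y - s" using rdist_sym[of y m] by auto
 moreover have "rdist x y <= rdist x m + rdist m y" using rdist_triangle xy m by blast
 ultimately show ?thesis using m(1) by (intro bexI[of _ m]) auto
qed

text \<open>A Lebesgue number of the covering by normal balls. The inner radius
  \<open>normal_ball.r'\<close> ensures that vectors between points of one such ball stay in the
  domain where \<open>V\<close> inverts the exponential map.\<close>

lemma uniform_normal_balls:
 obtains ep where "0 < ep" "ALL x:topspace M. EX k p r s s' C ex V. k : Ch & normal_ball (img k) (G k) (cdist k) p r s s' C ex V &
  mt.mball x ep \<subseteq> {q : fst k. snd k q : ball p (normal_ball.r' r s' C)}"
proof -
 let ?good = "%k p r s s' C ex V. k : Ch & normal_ball (img k) (G k) (cdist k) p r s s' C ex V"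
 let ?W = "%k p r s' C. {q : fst k. snd k q : ball p (normal_ball.r' r s' C)}"
 let ?F = "{W. EX k p r s s' C ex V. ?good k p r s s' C ex V & W = ?W k p r s' C}"
 have "EX ep>0. ALL x:topspace M. EX W:?F. mt.mball x ep \<subseteq> W"
 proof (rule mt.lebesgue_number)
  show "compactin mt.mtopology (topspace M)" using compact by (simp add: mtopology_eq compact_space_def)
  show "openin mt.mtopology W" if "W : ?F" for W using that open_inv_image[OF _ open_ball] by (auto simp: mtopology_eq)
  show "topspace M \<subseteq> \<Union>?F"
  proof
   fix x assume x: "x : topspace M"
   obtain k where k: "k : Ch" "x : fst k" using chart_at[OF x] by blast
   hence "snd k x : img k" by blast
   from normal_ball_at[OF k(1) this] obtain r s s' C ex V
    where nb: "normal_ball (img k) (G k) (cdist k) (snd k x) r s s' C ex V" by blast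
   have "x : ?W k (snd k x) r s' C" using normal_ball.r'_pos[OF nb] k(2) by simp
   thus "x : \<Union>?F" using nb k(1) by blast
  qed
 qed
 then obtain ep where ep: "0 < ep" "ALL x:topspace M. EX W:?F. mt.mball x ep \<subseteq> W"
  by (elim exE conjE) (rule that)
 show ?thesis
 proof (rule that[OF ep(1)], rule ballI)
  fix x assume "x : topspace M"
  from bspec[OF ep(2) this] obtain W where "W : ?F" "mt.mball x ep \<subseteq> W" by (elim bexE) (rule that)
  thus "EX k p r s s' C ex V. k : Ch & normal_ball (img k) (G k) (cdist k) p r s s' C ex V &
    mt.mball x ep \<subseteq> ?W k p r s' C" by blast
 qed
qed

definition rad :: real where
 "rad = (SOME ep. 0 < ep & (ALL x:topspace M. EX k p r s s' C ex V. k : Ch & normal_ball (img k) (G k) (cdist k) p r s s' C ex V &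
  mt.mball x ep \<subseteq> {q : fst k. snd k q : ball p (normal_ball.r' r s' C)}))"

lemma rad: "0 < rad"
 "x : topspace M ==> EX k p r s s' C ex V. k : Ch & normal_ball (img k) (G k) (cdist k) p r s s' C ex V &
  mt.mball x rad \<subseteq> {q : fst k. snd k q : ball p (normal_ball.r' r s' C)}"
proof -
 have "EX ep. 0 < ep & (ALL x:topspace M. EX k p r s s' C ex V. k : Ch & normal_ball (img k) (G k) (cdist k) p r s s' C ex V &
  mt.mball x ep \<subseteq> {q : fst k. snd k q : ball p (normal_ball.r' r s' C)})"
  by (rule uniform_normal_balls) (rule exI, rule conjI, assumption+)
 from someI_ex[OF this] show "0 < rad"
  "x : topspace M ==> EX k p r s s' C ex V. k : Ch & normal_ball (img k) (G k) (cdist k) p r s s' C ex V &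
  mt.mball x rad \<subseteq> {q : fst k. snd k q : ball p (normal_ball.r' r s' C)}"
  unfolding rad_def[symmetric] by blast+
qed

lemma chart_corner:
 assumes nb: "normal_ball (img k) (G k) (cdist k) p r s s' C ex V" and k: "k : Ch"
  and in_ball: "a : fst k" "x : fst k" "b : fst k" "snd k a : ball p r" "snd k x : ball p r" "snd k b : ball p r"
  and ne: "a ~= x" "x ~= b" and eq: "rdist a b = rdist a x + rdist x b"
 shows "V (snd k x) (snd k b) = - (rdist x b / rdist x a) *\<^sub>R V (snd k x) (snd k a)"
proof -
 interpret normal_ball "img k" "G k" "cdist k" p r s s' C ex V by (rule nb)
 note i = inv_chart[OF k in_ball(1)] inv_chart[OF k in_ball(2)] inv_chart[OF k in_ball(3)]
 have "V (snd k x) (snd k b) = - (cdist k (snd k x) (snd k b) / cdist k (snd k x) (snd k a)) *\<^sub>R V (snd k x) (snd k a)"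
 proof (rule corner[OF in_ball(4-6)])
  show "snd k a ~= snd k x" "snd k x ~= snd k b" using ne i by metis+
  fix y assume "y : B"
  hence y: "inv_chart k y : topspace M" using inv_chart_in[OF B_Om] dom_sub[OF k] by blast
  have ab: "a : topspace M" "b : topspace M" using in_ball dom_sub[OF k] by auto
  show "cdist k (snd k a) (snd k x) + cdist k (snd k x) (snd k b) <= cdist k (snd k a) y + cdist k y (snd k b)"
   unfolding i using rdist_triangle[OF ab(1) y ab(2)] eq by simp
 qed
 thus ?thesis unfolding i .
qed

text \<open>By \<open>corner\<close> the direction at \<open>x\<close> towards \<open>b\<close> is
  opposite to that towards \<open>a\<close>, and likewise for \<open>b'\<close>. At equal distance
  the two vectors at \<open>x\<close> coincide, and so do their exponentials.\<close>

lemma nonbranching: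
 assumes X: "a : topspace M" "x : topspace M" "b : topspace M" "b' : topspace M"
  and small: "rdist a x < rad" "rdist x b < rad" and ax: "a ~= x"
  and eq: "rdist a b = rdist a x + rdist x b" "rdist a b' = rdist a x + rdist x b'" "rdist x b' = rdist x b"
 shows "b = b'"
proof (cases "x = b")
 case True
 thus ?thesis using eq(3) X rdist_refl[OF X(2)] rdist_pos[OF X(2,4)] by force
next
 case False
 hence xb': "x ~= b'" using eq(3) rdist_refl[OF X(2)] rdist_pos[OF X(2,3)] by force
 obtain k p r s s' C ex V where k: "k : Ch" and nb: "normal_ball (img k) (G k) (cdist k) p r s s' C ex V"
  and sub: "mt.mball x rad \<subseteq> {q : fst k. snd k q : ball p (normal_ball.r' r s' C)}" using rad(2)[OF X(2)] by blast
 interpret normal_ball "img k" "G k" "cdist k" p r s s' C ex V by (rule nb)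
 have "a : mt.mball x rad" "x : mt.mball x rad" "b : mt.mball x rad" "b' : mt.mball x rad"
  using X small eq(3) rad(1) rdist_sym[of a x] rdist_refl[OF X(2)] by auto
 hence d: "a : fst k" "x : fst k" "b : fst k" "b' : fst k"
  and m: "snd k a : B" "snd k x : B" "snd k b : B" "snd k b' : B" using sub small_ball_sub by blast+
 have "V (snd k x) (snd k b) = V (snd k x) (snd k b')"
  using chart_corner[OF nb k d(1-3) m(1-3) ax False eq(1)] chart_corner[OF nb k d(1,2,4) m(1,2,4) ax xb' eq(2)] eq(3)
  by simp
 hence "snd k b = snd k b'" using exV[OF m(2,3)] exV[OF m(2,4)] by metis
 thus ?thesis using inv_chart[OF k] d(3,4) by metis
qed

end

context riemannian_submanifold
begin

lemma N_sub: "N \<subseteq> topspace M" using closedin_subset[OF N_closed] .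

definition rho :: "'a => real" where "rho x = Inf (rdist x ` N)"

lemma rho_le: "n : N ==> rho x <= rdist x n"
 unfolding rho_def by (rule cInf_lower) (auto intro!: bdd_belowI[of _ 0] rdist_nonneg)

lemma rho_attained:
 assumes x: "x : topspace M"
 shows "EX n:N. rho x = rdist x n"
proof -
 have cs: "compact_space (subtopology M N)"
  using closedin_compact_space[OF compact N_closed] compactin_subspace by blast
 have ct: "continuous_map (subtopology M N) euclideanreal (rdist x)"
  by (rule continuous_map_from_subtopology[OF continuous_rdist[OF x]])
 obtain n where n: "n : topspace (subtopology M N)" "!!z. z : topspace (subtopology M N) ==> rdist x n <= rdist x z"
  by (rule compact_space_attains_inf[OF cs _ ct]) (use N_nonempty N_sub in auto)
 hence "rdist x n <= rho x" unfolding rho_def using N_nonempty N_sub by (intro cInf_greatest) auto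
 thus ?thesis using rho_le[of n x] n(1) by (intro bexI[of _ n]) auto
qed

sublocale geo: geodesic_space "topspace M" rdist N rho rad
proof unfold_locales
 show "compact_space mt.mtopology" by (simp add: mtopology_eq compact)
 show "closedin mt.mtopology N" by (simp add: mtopology_eq N_closed)
qed (use N_sub rho_le rho_attained rdist_split rad(1) nonbranching in blast)+

end

section \<open>Points near which the distance to \<open>N\<close> is of class C^2\<close>

context riemannian_submanifold
begin

definition reg :: "'a => bool" where
 "reg q \<longleftrightarrow> (EX k:Ch. q : fst k &
  (EX S. open S & snd k q : S & S \<subseteq> img k & Ck (Suc (Suc 0)) (%x. rho (inv_chart k x)) S))"

lemma reg_chart:
 assumes "reg q" and k': "k' : Ch" "q : fst k'"
 shows "EX S. open S & snd k' q : S & S \<subseteq> img k' & Ck (Suc (Suc 0)) (%x. rho (inv_chart k' x)) S"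
proof -
 obtain k S where k: "k : Ch" "q : fst k" and S: "open S" "snd k q : S" "Ck (Suc (Suc 0)) (%x. rho (inv_chart k x)) S"
  using assms(1) unfolding reg_def by blast
 let ?W = "{z : fst k. snd k z : S}"
 let ?S = "snd k' ` (fst k' \<inter> ?W)"
 have "Ck (Suc (Suc 0)) (%x. (%x. rho (inv_chart k x)) (transition k' k x)) ?S"
 proof (rule Ck_compose[OF S(3)])
  show "Ck (Suc (Suc 0)) (transition k' k) ?S" by (rule Ck_subset[OF trans[OF k'(1) k(1)]]) blast
  show "transition k' k ` ?S \<subseteq> S" using transition_apply[OF k'(1), of _ k] by auto
 qed
 hence "Ck (Suc (Suc 0)) (%x. rho (inv_chart k' x)) ?S"
 proof (rule Ck_cong)
  fix x assume "x : ?S"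
  then obtain z where z: "z : fst k'" "z : fst k" "x = snd k' z" by blast
  thus "rho (inv_chart k (transition k' k x)) = rho (inv_chart k' x)"
   using transition_apply[OF k'(1) z(1), of k] inv_chart[OF k(1) z(2)] inv_chart[OF k'(1) z(1)] by simp
 qed
 moreover have "open ?S" by (rule open_chart_image[OF k'(1) open_inv_image[OF k(1) S(1)]])
 moreover have "snd k' q : ?S" "?S \<subseteq> img k'" using k' k S by auto
 ultimately show ?thesis by blast
qed

lemma reg_open: "openin M {q. reg q}"
proof (subst openin_subopen, intro ballI)
 fix q assume "q : {q. reg q}"
 then obtain k S where k: "k : Ch" "q : fst k" and S: "open S" "snd k q : S" "S \<subseteq> img k" "Ck (Suc (Suc 0)) (%x. rho (inv_chart k x)) S"
  unfolding reg_def by blast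
 hence "{z : fst k. snd k z : S} \<subseteq> {q. reg q}" unfolding reg_def by blast
 thus "EX T. openin M T & q : T & T \<subseteq> {q. reg q}"
  using open_inv_image[OF k(1) S(1)] k S by blast
qed

lemma distance_fn_rho:
 assumes "normal_ball (img k) (G k) (cdist k) p r s s' C ex V" and k: "k : Ch"
 shows "distance_fn (img k) (G k) (cdist k) p r s s' C ex V (%x. rho (inv_chart k x))"
proof -
 interpret normal_ball "img k" "G k" "cdist k" p r s s' C ex V by (rule assms)
 have "inv_chart k x : topspace M" if "x : B" for x using inv_chart_in[OF B_Om[OF that]] dom_sub[OF k] by blast
 thus ?thesis by unfold_locales (rule geo.rho_lip)
qed

lemma open_mball: "openin M (mt.mball x e)" using mt.openin_mball[of x e] by (simp add: mtopology_eq)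

lemma open_contains_mball:
 assumes "openin M W" "x : W"
 obtains e where "0 < e" "mt.mball x e \<subseteq> W"
proof -
 have "openin mt.mtopology W" using assms by (simp add: mtopology_eq)
 thus ?thesis using assms(2) that unfolding mt.openin_mtopology by blast
qed

lemma reg_near_N:
 assumes q: "q : N"
 shows "EX W. openin M W & q : W & (ALL z:W - N. reg z)"
proof -
 obtain k B0 where k: "k : Ch" "q : fst k" and B0: "B0 \<subseteq> Basis" "snd k ` (fst k \<inter> N) = img k \<inter> span B0"
  using slice[OF q] by blast
 let ?p = "snd k q"
 have p: "?p : img k" "?p : span B0" using k(2) q B0(2) by blast+
 have qX: "q : topspace M" using q N_sub by blast
 obtain r s s' C ex V where nb: "normal_ball (img k) (G k) (cdist k) ?p r s s' C ex V"
  using normal_ball_at[OF k(1) p(1)] by blast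
 interpret distance_fn "img k" "G k" "cdist k" ?p r s s' C ex V "%x. rho (inv_chart k x)"
  by (rule distance_fn_rho[OF nb k(1)])
 have inN: "inv_chart k n : N" if n: "n : img k \<inter> span B0" for n
 proof -
  obtain z where "z : fst k" "z : N" "n = snd k z" using n B0(2) by blast
  thus ?thesis using inv_chart[OF k(1)] by simp
 qed
 have "EX Q. open Q & ?p : Q & Q \<subseteq> B & Ck (Suc (Suc 0)) (%x. rho (inv_chart k x)) (Q - span B0)"
 proof (rule tubular_C2[OF B0(1) p(2)])
  show "rho (inv_chart k n) = 0" if "n : B \<inter> span B0" for n
   using inN[of n] that B_Om[of n] geo.rho_zero_iff N_sub by blast
  show "rho (inv_chart k x) <= cdist k n x" if "n : B \<inter> span B0" "x : B" for n x
   unfolding rdist_sym[of "inv_chart k n"] by (rule rho_le) (use inN[of n] that B_Om[of n] in blast)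
  fix Q assume Q: "open Q" "?p : Q"
  obtain e where e: "0 < e" "mt.mball q e \<subseteq> {z : fst k. snd k z : Q}"
   by (rule open_contains_mball[OF open_inv_image[OF k(1) Q(1)], of q]) (use k(2) Q(2) in blast)+
  \<comment> \<open>A foot of \<open>z\<close> is no farther from \<open>z\<close> than
    \<open>q\<close> is, hence within twice the distance of \<open>z\<close> from \<open>q\<close>;
    this explains the radius \<open>e / 2\<close>.\<close>
  let ?Q = "snd k ` (fst k \<inter> mt.mball q (e / 2))"
  have "open ?Q" by (rule open_chart_image[OF k(1) open_mball])
  moreover have "?p : ?Q" using k(2) qX e(1) by auto
  moreover have "EX n:Q \<inter> span B0. rho (inv_chart k x) = cdist k n x" if x: "x : ?Q" for x
  proof -
   obtain z where z: "z : fst k" "z : mt.mball q (e / 2)" "x = snd k z" using x by blast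
   have zX: "z : topspace M" using z(2) by simp
   obtain n where n: "n : N" "rho z = rdist z n" using rho_attained[OF zX] by blast
   have "rdist z n <= rdist z q" using n(2) rho_le[OF q, of z] by simp
   moreover have "rdist q n <= rdist q z + rdist z n" using rdist_triangle qX zX n(1) N_sub by blast
   ultimately have "rdist q n < e" using z(2) rdist_sym[of q z] by simp
   hence "n : mt.mball q e" using n(1) N_sub qX by auto
   hence n': "n : fst k" "snd k n : Q" using e(2) by auto
   have "snd k n : span B0" using n' n(1) B0(2) by blast
   thus ?thesis using n' n(2) z inv_chart[OF k(1)] rdist_sym[of n z] by (intro bexI[of _ "snd k n"]) auto
  qed
  ultimately show "EX Q'. open Q' & ?p : Q' & (ALL x:Q'. EX n:Q \<inter> span B0. rho (inv_chart k x) = cdist k n x)" by blast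
 qed
 then obtain Q where Q: "open Q" "?p : Q" "Q \<subseteq> B" "Ck (Suc (Suc 0)) (%x. rho (inv_chart k x)) (Q - span B0)" by blast
 let ?W = "{z : fst k. snd k z : Q}"
 have "reg z" if z: "z : ?W - N" for z
 proof -
  have "snd k z ~: span B0"
  proof
   assume "snd k z : span B0"
   hence "inv_chart k (snd k z) : N" by (intro inN) (use z in blast)
   thus False using z inv_chart[OF k(1)] by auto
  qed
  moreover have "open (Q - span B0)" by (rule open_Diff[OF Q(1) closed_span])
  moreover have "Q - span B0 \<subseteq> img k" using Q(3) B_Om by blast
  ultimately show ?thesis unfolding reg_def using k(1) z Q(4) by blast
 qed
 thus ?thesis using open_inv_image[OF k(1) Q(1)] k(2) Q(2) by blast
qed

lemma continuous_rho: "continuous_map M euclideanreal rho" using geo.continuous_map_rho by (simp add: mtopology_eq)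

text \<open>Off the neighbourhoods from \<open>reg_near_N\<close> remains a compact set disjoint
  from \<open>N\<close>. If it is nonempty, the positive minimum of \<open>rho\<close> on it serves
  as \<open>h\<close>.\<close>

lemma reg_tube: "EX h>0. ALL z:topspace M - N. rho z < h --> reg z"
proof -
 define W where "W q = (SOME W. openin M W & q : W & (ALL z:W - N. reg z))" for q
 have W: "openin M (W q) & q : W q & (ALL z:W q - N. reg z)" if "q : N" for q
  unfolding W_def by (rule someI_ex[OF reg_near_N[OF that]])
 let ?K = "topspace M - (\<Union>q\<in>N. W q)"
 have K: "closedin M ?K" using W by (intro closedin_diff closedin_topspace openin_Union) auto
 show ?thesis
 proof (cases "?K = {}")
  case True
  hence "ALL z:topspace M - N. reg z" using W by blast
  thus ?thesis by (intro exI[of _ 1]) auto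
 next
  case False
  have cs: "compact_space (subtopology M ?K)" using closedin_compact_space[OF compact K] compactin_subspace by blast
  have ct: "continuous_map (subtopology M ?K) euclideanreal rho"
   by (rule continuous_map_from_subtopology[OF continuous_rho])
  obtain m where m: "m : topspace (subtopology M ?K)" "!!z. z : topspace (subtopology M ?K) ==> rho m <= rho z"
   by (rule compact_space_attains_inf[OF cs _ ct]) (use False in auto)
  have "m : topspace M" "m ~: N" using m(1) W by auto
  hence "0 < rho m" by (rule geo.rho_pos)
  moreover have "reg z" if "z : topspace M - N" "rho z < rho m" for z
  proof -
   have "z ~: ?K" using m(2)[of z] that by auto
   thus ?thesis using that W by blast
  qed
  ultimately show ?thesis by blast
 qed
qed

text \<open>As \<open>x\<close> is not maximal, \<open>w\<close> is the only point below it at this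
  distance. The points that have such a lower point outside \<open>Q\<close> form a closed set,
  being a projection along a compact factor, and this set misses \<open>x\<close>.\<close>

lemma lower_points_open:
 assumes X: "w : topspace M" "x : topspace M" "z : topspace M" and wN: "w ~: N"
  and le: "geo.below w x" "geo.below x z" "z ~= x" and Q: "openin M Q" "w : Q"
 shows "EX Q'. openin M Q' & x : Q' & (ALL x':Q'. EX b:Q. geo.below b x' & rdist b x' = rdist w x)"
proof -
 let ?P = "prod_topology mt.mtopology mt.mtopology"
 let ?T = "{y : topspace ?P. geo.below (snd y) (fst y)} \<inter> {y : topspace ?P. rdist (snd y) (fst y) = rdist w x} \<inter>
  {y : topspace ?P. snd y : topspace M - Q}"
 have c: "continuous_map ?P mt.mtopology fst" "continuous_map ?P mt.mtopology snd" by (auto intro: continuous_map_fst continuous_map_snd)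
 have "closedin ?P ?T"
 proof (intro closedin_Int)
  show "closedin ?P {y : topspace ?P. geo.below (snd y) (fst y)}" by (rule geo.closedin_below_graph[OF c(2,1)])
  show "closedin ?P {y : topspace ?P. rdist (snd y) (fst y) = rdist w x}"
   by (rule geo.closedin_eq_reals[OF geo.continuous_map_d[OF c(2,1)]]) auto
  show "closedin ?P {y : topspace ?P. snd y : topspace M - Q}"
   by (rule closedin_continuous_map_preimage[OF c(2)]) (use Q(1) in \<open>simp add: mtopology_eq closedin_diff\<close>)
 qed
 moreover have "closed_map ?P mt.mtopology fst" by (rule closed_map_fst) (simp add: mtopology_eq compact)
 ultimately have K: "closedin M (fst ` ?T)" unfolding closed_map_def by (simp add: mtopology_eq)
 have xK: "x ~: fst ` ?T"
 proof
  assume "x : fst ` ?T"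
  then obtain b where b: "b : topspace M" "geo.below b x" "rdist b x = rdist w x" "b ~: Q" by auto
  have "rho b = rho w" using b le(1) by (simp add: geo.below_def)
  hence "w = b" by (rule geo.downward_unique[OF X(1) b(1) X(2,3) le(1) b(2) le(2,3)])
  thus False using b(4) Q(2) by simp
 qed
 \<comment> \<open>The condition on \<open>rho\<close> guarantees that a lower point at the required
   distance exists.\<close>
 let ?Q = "{y : topspace M. rho y : {rdist w x<..}} - fst ` ?T"
 have "openin M ?Q" by (rule openin_diff[OF openin_continuous_map_preimage[OF continuous_rho] K]) auto
 moreover have "x : ?Q" using xK X le(1) geo.rho_pos[OF X(1) wN] by (simp add: geo.below_def)
 moreover have "EX b:Q. geo.below b x' & rdist b x' = rdist w x" if x': "x' : ?Q" for x'
 proof -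
  have xX: "x' : topspace M" and r: "rdist w x < rho x'" using x' by auto
  obtain b where b: "b : topspace M" "geo.below b x'" "rdist b x' = rdist w x"
   using geo.lower_exists[OF xX, of "rho x' - rdist w x"] r rdist_nonneg[of w x] by auto
  have "b : Q"
  proof (rule ccontr)
   assume "b ~: Q"
   hence "(x', b) : ?T" using b xX by simp
   hence "x' : fst ` ?T" by (rule image_eqI[rotated]) simp
   thus False by (rule DiffD2[OF x'])
  qed
  thus ?thesis using b by blast
 qed
 ultimately show ?thesis by blast
qed

text \<open>\<open>propagate_C2\<close> inside a normal ball around \<open>x\<close>; its condition
  \<open>push\<close> is supplied by \<open>lower_points_open\<close>.\<close>

lemma reg_step:
 assumes X: "w : topspace M" "x : topspace M" "z : topspace M" and wN: "w ~: N" and ne: "w ~= x" "x ~= z"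
  and le: "geo.below w x" "geo.below x z" and small: "rdist w x < rad" "rdist x z < rad" and reg: "reg w"
 shows "reg x"
proof -
 obtain k p r s s' C ex V where k: "k : Ch" and nb: "normal_ball (img k) (G k) (cdist k) p r s s' C ex V"
  and sub: "mt.mball x rad \<subseteq> {q : fst k. snd k q : ball p (normal_ball.r' r s' C)}" using rad(2)[OF X(2)] by blast
 interpret distance_fn "img k" "G k" "cdist k" p r s s' C ex V "%x. rho (inv_chart k x)"
  by (rule distance_fn_rho[OF nb k])
 have "w : mt.mball x rad" "x : mt.mball x rad" "z : mt.mball x rad"
  using X small rad(1) rdist_sym[of w x] rdist_refl[OF X(2)] by auto
 hence d: "w : fst k" "x : fst k" "z : fst k" and w_ball: "w : mt.mball x rad"
  and m: "snd k w : ball p r'" "snd k x : ball p r'" "snd k z : ball p r'" using sub by blast+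
 note i = inv_chart[OF k d(1)] inv_chart[OF k d(2)] inv_chart[OF k d(3)]
 obtain S where S: "open S" "snd k w : S" "S \<subseteq> img k" "Ck (Suc (Suc 0)) (%x. rho (inv_chart k x)) S"
  using reg_chart[OF reg k d(1)] by blast
 let ?S = "S \<inter> snd k ` (fst k \<inter> (mt.mball x rad - N))"
 have "EX T. open T & snd k x : T & T \<subseteq> B & Ck (Suc (Suc 0)) (%x. rho (inv_chart k x)) T"
 proof (rule propagate_C2[OF m])
  show "snd k w ~= snd k x" "snd k x ~= snd k z" using ne i by metis+
  show "rho (inv_chart k (snd k x)) = rho (inv_chart k (snd k w)) + cdist k (snd k w) (snd k x)"
   "rho (inv_chart k (snd k z)) = rho (inv_chart k (snd k x)) + cdist k (snd k x) (snd k z)"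
   unfolding i using le by (simp_all add: geo.below_def)
  show "open ?S" by (intro open_Int S(1) open_chart_image[OF k] openin_diff open_mball N_closed)
  show "snd k w : ?S" using S(2) d(1) w_ball wN by blast
  show "?S \<subseteq> B" using sub small_ball_sub by blast
  show "Ck (Suc (Suc 0)) (%x. rho (inv_chart k x)) ?S" by (rule Ck_subset[OF S(4)]) blast
  show "EX a:B. a ~= y & rho (inv_chart k y) = rho (inv_chart k a) + cdist k a y" if y: "y : ?S" for y
  proof -
   obtain u where u: "u : fst k" "u : topspace M" "rdist x u < rad" "u ~: N" "y = snd k u" using y by auto
   \<comment> \<open>Less than the distance from \<open>u\<close> to the boundary of the ball around
     \<open>x\<close>, so that the lower point is still in the chart.\<close>
   define t where "t = min (rho u) (rad - rdist x u) / 2"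
   have t: "0 < t" "t <= rho u" "t < rad - rdist x u" using geo.rho_pos[OF u(2,4)] u(3) by (auto simp: t_def)
   obtain a where a: "a : topspace M" "geo.below a u" "rdist a u = t"
    using geo.lower_exists[OF u(2), of "rho u - t"] t by auto
   have "rdist x a < rad" using rdist_triangle[OF X(2) u(2) a(1)] rdist_sym[of u a] a(3) t(3) by linarith
   hence am: "a : fst k" "snd k a : B" using sub a(1) X(2) small_ball_sub by (auto simp del: mem_ball)
   have "a ~= u" using a(3) t(1) rdist_refl[OF u(2)] by auto
   hence "snd k a ~= snd k u" using inv_chart[OF k u(1)] inv_chart[OF k am(1)] by metis
   thus ?thesis using am a(2) u inv_chart[OF k u(1)] inv_chart[OF k am(1)]
    by (intro bexI[of _ "snd k a"]) (auto simp: geo.below_def)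
  qed
  fix Q assume Q: "open Q" "snd k w : Q"
  obtain Q' where Q': "openin M Q'" "x : Q'"
   "ALL x':Q'. EX b:{q : fst k. snd k q : Q}. geo.below b x' & rdist b x' = rdist w x"
   using lower_points_open[OF X wN le ne(2)[symmetric] open_inv_image[OF k Q(1)]] d(1) Q(2) by blast
  have "open (snd k ` (fst k \<inter> Q'))" by (rule open_chart_image[OF k Q'(1)])
  moreover have "snd k x : snd k ` (fst k \<inter> Q')" using d(2) Q'(2) by blast
  moreover have "EX b:Q. rho (inv_chart k x') = rho (inv_chart k b) + cdist k b x' & cdist k b x' = cdist k (snd k w) (snd k x)"
   if x': "x' : snd k ` (fst k \<inter> Q')" for x'
  proof -
   obtain u where u: "u : fst k" "u : Q'" "x' = snd k u" using x' by blast
   obtain b where b: "b : fst k" "snd k b : Q" "geo.below b u" "rdist b u = rdist w x" using Q'(3) u(2) by blast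
   thus ?thesis using inv_chart[OF k u(1)] inv_chart[OF k b(1)] u(3) i
    by (intro bexI[of _ "snd k b"]) (auto simp: geo.below_def)
  qed
  ultimately show "EX Q'. open Q' & snd k x : Q' & (ALL x':Q'. EX b:Q. rho (inv_chart k x') = rho (inv_chart k b) + cdist k b x' &
    cdist k b x' = cdist k (snd k w) (snd k x))" by blast
 qed
 thus ?thesis unfolding reg_def using k d(2) B_Om by blast
qed

text \<open>Induction on the height: below \<open>e\<close> the tube gives regularity, and
  \<open>reg_step\<close> raises the range by \<open>h\<close>. The point at distance
  \<open>h\<close> below \<open>x\<close> is again not maximal, having \<open>x\<close> above
  it.\<close>

lemma reg_if_not_maximal:
 assumes x: "x : topspace M" "x ~: N" and z: "z : topspace M" "geo.below x z" "x ~= z"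
 shows "reg x"
proof -
 obtain e where e: "0 < e" "ALL z:topspace M - N. rho z < e --> reg z" using reg_tube by blast
 \<comment> \<open>\<open>h < rad\<close> keeps a step inside one normal ball, and
   \<open>h <= e / 2\<close> keeps the lower point of an \<open>x\<close> of height at least
   \<open>e\<close> off \<open>N\<close>.\<close>
 define h where "h = min (rad / 2) (e / 2)"
 have h: "0 < h" "h < rad" "h <= e / 2" using rad(1) e(1) by (auto simp: h_def)
 have main: "reg x" if "x : topspace M" "x ~: N" "z : topspace M" "geo.below x z" "x ~= z" "rho x < e + real n * h" for n x z
  using that
 proof (induction n arbitrary: x z)
  case 0
  thus ?case using e(2) by simp
 next
  case (Suc n)
  note xX = Suc.prems(1)
  show ?case
  proof (cases "rho x < e")
   case True
   thus ?thesis using e(2) Suc.prems by blast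
  next
   case False
   obtain w where w: "w : topspace M" "geo.below w x" "rho w = rho x - h" "rdist w x = h"
    using geo.lower_exists[OF xX, of "rho x - h"] h False e(1) by auto
   have wN: "w ~: N" using geo.rho_zero_iff[OF w(1)] w(3) h(3) False e(1) by auto
   have wx: "w ~= x" using w(4) h(1) rdist_refl[OF xX] by auto
   have "reg w" by (rule Suc.IH[OF w(1) wN xX w(2) wx]) (use w(3) Suc.prems(6) in \<open>simp add: algebra_simps\<close>)
   have dp: "0 < rdist x z" by (rule rdist_pos[OF xX Suc.prems(3,5)])
   define t where "t = min (rdist x z) (rad / 2)"
   have t: "0 < t" "t <= rdist x z" "t < rad" using dp rad(1) by (auto simp: t_def)
   obtain z' where z': "z' : topspace M" "geo.below x z'" "rdist x z' = t"
    using geo.below_split[OF xX Suc.prems(3,4), of t] t by auto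
   have "x ~= z'" using z'(3) t(1) rdist_refl[OF xX] by auto
   thus ?thesis using reg_step[OF w(1) xX z'(1) wN wx _ w(2) z'(2)] w(4) h(2) z'(3) t(3) \<open>reg w\<close> by simp
  qed
 qed
 obtain n where "(rho x - e) / h < real n" using reals_Archimedean2 by blast
 hence "rho x < e + real n * h" using h(1) by (simp add: field_simps)
 thus ?thesis using main x z by blast
qed

lemma not_maximal_if_reg:
 assumes x: "x : topspace M" "x ~: N" and reg: "reg x"
 shows "EX y:topspace M. geo.below x y & y ~= x"
proof -
 obtain k p r s s' C ex V where k: "k : Ch" and nb: "normal_ball (img k) (G k) (cdist k) p r s s' C ex V"
  and sub: "mt.mball x rad \<subseteq> {q : fst k. snd k q : ball p (normal_ball.r' r s' C)}" using rad(2)[OF x(1)] by blast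
 interpret distance_fn "img k" "G k" "cdist k" p r s s' C ex V "%x. rho (inv_chart k x)"
  by (rule distance_fn_rho[OF nb k])
 have "x : mt.mball x rad" using x rad(1) rdist_refl[OF x(1)] by simp
 hence d: "x : fst k" using sub by blast
 obtain S where S: "open S" "snd k x : S" "S \<subseteq> img k" "Ck (Suc (Suc 0)) (%x. rho (inv_chart k x)) S"
  using reg_chart[OF reg k d] by blast
 \<comment> \<open>Points within \<open>e\<close> of \<open>x\<close> have height at least
   \<open>e\<close> because \<open>2 * e <= rho x\<close>, so lower points at distance less than
   \<open>e\<close> exist; by \<open>2 * e <= rad\<close> they stay in the chart.\<close>
 define e where "e = min (rho x) rad / 2"
 have e: "0 < e" "2 * e <= rho x" "2 * e <= rad" using geo.rho_pos[OF x] rad(1) by (auto simp: e_def)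
 let ?S = "S \<inter> snd k ` (fst k \<inter> mt.mball x e)"
 have esub: "mt.mball x e \<subseteq> mt.mball x rad" using e by (intro mt.mball_subset_concentric) auto
 have "EX z:B. z ~= snd k x & rho (inv_chart k z) = rho (inv_chart k (snd k x)) + cdist k (snd k x) z"
 proof (rule not_maximal_if_C1[of ?S, OF _ _ _ _ e(1)])
  show "open ?S" by (intro open_Int S(1) open_chart_image[OF k] open_mball)
  show "?S \<subseteq> B" using sub small_ball_sub esub by blast
  show "snd k x : ?S" using S(2) d x(1) e(1) rdist_refl by auto
  show "Ck (Suc 0) (%x. rho (inv_chart k x)) ?S" by (rule Ck_subset[OF Ck_SucD[OF S(4)]]) blast
  show "EX a:B. rho (inv_chart k z) = rho (inv_chart k a) + cdist k a z & cdist k a z = t"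
   if z: "z : ?S" and t: "0 < t" "t < e" for z t
  proof -
   obtain u where u: "u : fst k" "u : topspace M" "rdist x u < e" "z = snd k u" using z by auto
   have "rho x <= rho u + rdist u x" by (rule geo.rho_lip[OF u(2) x(1)])
   hence "t <= rho u" using u(3) rdist_sym[of x u] e(2) t by linarith
   then obtain a where a: "a : topspace M" "geo.below a u" "rdist a u = t"
    using geo.lower_exists[OF u(2), of "rho u - t"] t by auto
   have "rdist x a < rad" using rdist_triangle[OF x(1) u(2) a(1)] rdist_sym[of u a] a(3) u(3) t e(3) by linarith
   hence am: "a : fst k" "snd k a : B" using sub a(1) x(1) small_ball_sub by (auto simp del: mem_ball)
   thus ?thesis using a(2,3) u inv_chart[OF k u(1)] inv_chart[OF k am(1)]
    by (intro bexI[of _ "snd k a"]) (auto simp: geo.below_def)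
  qed
 qed
 then obtain z where z: "z : B" "z ~= snd k x" "rho (inv_chart k z) = rho (inv_chart k (snd k x)) + cdist k (snd k x) z" by blast
 have "z : img k" by (rule B_Om[OF z(1)])
 hence "inv_chart k z : topspace M" "snd k (inv_chart k z) = z"
  using inv_chart_in[of z k] chart_inv[of z k] dom_sub[OF k] by blast+
 hence "inv_chart k z : topspace M" "inv_chart k z ~= x" using z(2) by auto
 thus ?thesis using z(3) inv_chart[OF k d] by (intro bexI[of _ "inv_chart k z"]) (auto simp: geo.below_def)
qed

text \<open>Off \<open>N\<close> the maximal points are exactly the points that are not regular, and
  regularity is open. Nothing is known about regularity on \<open>N\<close> itself, so the tube of
  height \<open>h\<close>, which contains no maximal point off \<open>N\<close>, is removed
  separately.\<close>

theorem closedin_cut: "closedin M geo.cut"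
proof -
 obtain h where h: "0 < h" "ALL z:topspace M - N. rho z < h --> reg z" using reg_tube by blast
 have "geo.cut = {q : topspace M. rho q : {h..}} - {q. reg q}"
 proof (intro set_eqI iffI)
  fix q assume q: "q : geo.cut"
  hence "~ reg q" using not_maximal_if_reg[of q] by (auto simp: geo.cut_def)
  thus "q : {q : topspace M. rho q : {h..}} - {q. reg q}" using q h(2) by (force simp: geo.cut_def)
 next
  fix q assume q: "q : {q : topspace M. rho q : {h..}} - {q. reg q}"
  hence "q ~: N" using geo.rho_zero_iff[of q] h(1) by auto
  thus "q : geo.cut" using q reg_if_not_maximal[of q] by (auto simp: geo.cut_def)
 qed
 moreover have "closedin M {q : topspace M. rho q : {h..}}"
  by (rule closedin_continuous_map_preimage[OF continuous_rho]) auto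
 ultimately show ?thesis using closedin_diff[OF _ reg_open] by simp
qed

theorem homotopic_distance_le_geo_cut:
 assumes "continuous_map M Y f" "continuous_map M Y g"
 shows "homotopic_distance M Y f g <= subspace_distance M N Y f g + subspace_distance M geo.cut Y f g + 1"
 using geo.homotopic_distance_le_cut[of Y f g] closedin_cut assms by (simp add: mtopology_eq)

end

section \<open>Smooth curves\<close>

lemma Icc_not_bot: "a < b ==> x : {a..b::real} ==> at x within {a..b} ~= bot"
proof -
 assume ab: "a < b" "x : {a..b}"
 have "{a..b} ~= {z}" for z
 proof
  assume "{a..b} = {z}"
  hence "a : {z}" "b : {z}" using ab by (metis atLeastAtMost_iff less_imp_le order_refl)+
  thus False using ab by simp
 qed
 hence "x islimpt {a..b}" by (intro connected_imp_perfect ab) auto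
 thus ?thesis using trivial_limit_within by blast
qed

lemma at_within_near:
 fixes x :: real
 assumes "0 < e" and "!!t. \<bar>t - x\<bar> < e ==> t : S \<longleftrightarrow> t : T"
 shows "at x within S = at x within T"
 by (rule at_within_nhd[of x "ball x e"]) (use assms in \<open>auto simp: dist_real_def abs_minus_commute\<close>)

lemma vector_derivative_near:
 fixes f g :: "real => 'e::real_normed_vector"
 assumes e: "0 < e" and ST: "!!t. \<bar>t - x\<bar> < e ==> t : S \<longleftrightarrow> t : T" and x: "x : S"
  and eq: "!!t. t : S ==> \<bar>t - x\<bar> < e ==> f t = g t"
 shows "vector_derivative f (at x within S) = vector_derivative g (at x within T)"
  "(f has_vector_derivative v) (at x within S) ==> (g has_vector_derivative v) (at x within T)"
proof -
 have ae: "at x within S = at x within T" by (rule at_within_near[OF e ST])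
 have "vector_derivative f (at x within S) = vector_derivative g (at x within S)"
 proof (rule vector_derivative_cong_eq)
  have "\<forall>\<^sub>F t in nhds x. dist t x < e" using e by (rule eventually_nhds_metric[THEN iffD2, OF exI, OF conjI]) auto
  thus "\<forall>\<^sub>F t in nhds x. t : S --> f t = g t" by (rule eventually_mono) (use eq in \<open>auto simp: dist_real_def\<close>)
 qed (use x in auto)
 thus "vector_derivative f (at x within S) = vector_derivative g (at x within T)" by (simp add: ae)
 assume "(f has_vector_derivative v) (at x within S)"
 hence "(g has_vector_derivative v) (at x within S)"
  by (rule has_vector_derivative_transform_within[OF _ e x]) (use eq in \<open>auto simp: dist_real_def\<close>)
 thus "(g has_vector_derivative v) (at x within T)" by (simp add: ae)
qed

lemma continuous_curve_near:
 fixes S :: "real set"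
 assumes c: "continuous_map (top_of_set S) M c" and W: "openin M W" and u: "u : S" "c u : W"
 shows "EX e>0. ALL t:S. \<bar>t - u\<bar> < e --> c t : W"
proof -
 have "openin (top_of_set S) {t : topspace (top_of_set S). c t : W}"
  by (rule openin_continuous_map_preimage[OF c W])
 hence "openin (top_of_set S) {t : S. c t : W}" by simp
 then obtain e where "e > 0" "ball u e \<inter> S \<subseteq> {t : S. c t : W}"
  using u unfolding openin_contains_ball by blast
 thus ?thesis by (intro exI[of _ e]) (auto simp: subset_iff dist_real_def abs_minus_commute)
qed

lemma smooth_on_cong:
 assumes "smooth_on x S" "!!t. t : S ==> x t = y t"
 shows "smooth_on y S"
proof -
 obtain D where D: "D 0 = x" "!!k t. t : S ==> (D k has_vector_derivative D (Suc k) t) (at t within S)"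
  using assms(1) unfolding smooth_on_def by blast
 show ?thesis unfolding smooth_on_def
 proof (intro exI[of _ "D(0 := y)"] conjI allI ballI)
  fix k t assume t: "t : S"
  show "((D(0 := y)) k has_vector_derivative (D(0 := y)) (Suc k) t) (at t within S)"
  proof (cases k)
   case 0
   have "(y has_vector_derivative D (Suc 0) t) (at t within S)"
    by (rule has_vector_derivative_transform_within[OF D(2)[OF t, of 0] zero_less_one t]) (use assms(2) D(1) in simp)
   thus ?thesis by (simp add: 0)
  qed (use D(2)[OF t] in simp)
 qed simp
qed

lemma smooth_on_const: "smooth_on (%t. c) S" unfolding smooth_on_def
 by (intro exI[of _ "%k t. if k = 0 then c else 0"]) auto

lemma smooth_curve_cong:
 assumes c: "smooth_curve M A I c" and eq: "!!t. t : I ==> c t = c' t"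
 shows "smooth_curve M A I c'" unfolding smooth_curve_def
proof (intro conjI ballI)
 show "continuous_map (top_of_set I) M c'"
  by (rule continuous_map_eq[of _ _ c]) (use c eq in \<open>auto simp: smooth_curve_def\<close>)
 fix k assume "k : A"
 hence "smooth_on (snd k \<circ> c) {t:I. c t : fst k}" using c by (auto simp: smooth_curve_def)
 moreover have "{t:I. c t : fst k} = {t:I. c' t : fst k}" using eq by auto
 ultimately have "smooth_on (snd k \<circ> c) {t:I. c' t : fst k}" by simp
 thus "smooth_on (snd k \<circ> c') {t:I. c' t : fst k}" by (rule smooth_on_cong) (simp add: eq)
qed

lemma speed_near:
 fixes G :: "('a, 'e::euclidean_space) metric"
 assumes e: "0 < e" and ST: "!!t. \<bar>t - x\<bar> < e ==> t : S \<longleftrightarrow> t : T" and x: "x : S"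
  and eq: "!!t. t : S ==> \<bar>t - x\<bar> < e ==> c t = c' t"
 shows "speed A G S c x = speed A G T c' x"
proof -
 have "velocity k S c x = velocity k T c' x" for k :: "('a, 'e) chart"
  unfolding velocity_def by (rule vector_derivative_near[OF e ST x]) (use eq in auto)
 moreover have "c x = c' x" using eq x e by simp
 ultimately show ?thesis by (simp add: speed_def)
qed

text \<open>\<open>A\<close> is the atlas to which curves, speed and geodesics refer; the larger
  family \<open>Ch\<close> contains the slice charts and carries the geometry.\<close>

locale riemannian_subatlas = riemannian_submanifold M Ch G N
 for M :: "'a topology" and Ch :: "('a, 'e::euclidean_space) chart set" and G :: "('a, 'e) metric" and N :: "'a set" +
 fixes A :: "('a, 'e) chart set"
 assumes A_sub: "A \<subseteq> Ch" and A_cover: "(\<Union>\<kappa>\<in>A. fst \<kappa>) = topspace M"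
begin

lemma A_chart: "k : A ==> k : Ch" using A_sub by blast

lemma A_chart_at: "q : topspace M ==> EX k. k : A & q : fst k" using A_cover by blast

lemma velocity_change:
 assumes k: "k : Ch" "k' : Ch" and c: "continuous_map (top_of_set S) M c" and u: "u : S" "c u : fst k" "c u : fst k'"
  and v: "(snd k \<circ> c has_vector_derivative v) (at u within S)"
 obtains v' where "(snd k' \<circ> c has_vector_derivative v') (at u within S)"
  "G k' (snd k' (c u)) v' v' = G k (snd k (c u)) v v"
proof -
 have x: "(snd k \<circ> c) u : snd k ` (fst k \<inter> fst k')" using u by auto
 obtain D where D: "(transition k k' has_derivative D) (at ((snd k \<circ> c) u))"
  "ALL v w. G k ((snd k \<circ> c) u) v w = G k' (transition k k' ((snd k \<circ> c) u)) (D v) (D w)"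
  by (rule transition_derivative[OF k x]) (rule that, assumption+)
 obtain e where e: "e > 0" "ALL t:S. \<bar>t - u\<bar> < e --> c t : fst k"
  using continuous_curve_near[OF c open_dom[OF k(1)] u(1,2)] by blast
 have "((%t. transition k k' ((snd k \<circ> c) t)) has_derivative (%h. h *\<^sub>R D v)) (at u within S)"
  by (rule has_derivative_eq_rhs[OF has_derivative_compose[OF v[unfolded has_vector_derivative_def] D(1)]], rule ext)
   (rule linear_scale[OF has_derivative_linear[OF D(1)]])
 hence "((%t. transition k k' ((snd k \<circ> c) t)) has_vector_derivative D v) (at u within S)"
  by (simp add: has_vector_derivative_def)
 hence "(snd k' \<circ> c has_vector_derivative D v) (at u within S)"
  by (rule has_vector_derivative_transform_within[OF _ e(1) u(1)])
   (use e(2) transition_apply[OF k(1)] in \<open>auto simp: dist_real_def\<close>)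
 moreover have "G k' (snd k' (c u)) (D v) (D v) = G k (snd k (c u)) v v"
  using D(2) transition_apply[OF k(1) u(2), of k'] by simp
 ultimately show ?thesis by (rule that)
qed

text \<open>By the transformation law any chart may replace the one chosen in \<open>speed\<close>;
  the condition on the filter makes the derivative unique.\<close>

lemma speed_eq:
 assumes j: "j : Ch" and c: "continuous_map (top_of_set S) M c" and u: "u : S" "c u : fst j"
  and v: "(snd j \<circ> c has_vector_derivative v) (at u within S)" and S: "at u within S ~= bot"
 shows "speed A G S c u = sqrt (G j (snd j (c u)) v v)"
proof -
 let ?j = "SOME j. j : A & c u : fst j"
 have k: "?j : A & c u : fst ?j" by (rule someI_ex[OF A_chart_at]) (use dom_sub[OF j] u in blast)
 obtain v' where v': "(snd ?j \<circ> c has_vector_derivative v') (at u within S)"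
  "G ?j (snd ?j (c u)) v' v' = G j (snd j (c u)) v v"
  by (rule velocity_change[OF j A_chart[OF conjunct1[OF k]] c u conjunct2[OF k] v]) (rule that, assumption+)
 have "velocity ?j S c u = v'" unfolding velocity_def by (rule vector_derivative_within[OF S v'(1)])
 thus ?thesis unfolding speed_def Let_def using v'(2) by simp
qed

lemma arc_smooth_curve:
 assumes arc: "arc_in k a b w w'"
 shows "smooth_curve M A {a..b} (%t. inv_chart k (w t))"
  "t : {a..b} ==> speed A G {a..b} (%t. inv_chart k (w t)) t = speed_in k w w' t"
proof -
 let ?c = "%t. inv_chart k (w t)"
 have k: "k : Ch" and ab: "a < b" and C: "Ck n w {a..b}" and im: "w ` {a..b} \<subseteq> img k"
  and w': "!!t. t : {a..b} ==> (w has_vector_derivative w' t) (at t within {a..b})" for n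
  using arc unfolding arc_in_def by (auto simp del: Ck.simps)
 have ct: "continuous_map (top_of_set {a..b}) M ?c" by (rule arc_continuous[OF arc])
 have cd: "?c t : fst k" "snd k (?c t) = w t" if "t : {a..b}" for t
 proof -
  have "w t : img k" using im that by blast
  from inv_chart_in[OF this] chart_inv[OF this] show "?c t : fst k" "snd k (?c t) = w t" .
 qed
 show "smooth_curve M A {a..b} ?c" unfolding smooth_curve_def
 proof (intro conjI ballI ct)
  fix k' assume k': "k' : A"
  let ?S = "{t:{a..b}. ?c t : fst k'}"
  show "smooth_on (snd k' \<circ> ?c) ?S"
  proof (rule Ck_imp_smooth_on)
   fix n
   have "Ck n (%t. transition k k' (w t)) ?S"
   proof (rule Ck_compose[OF trans[OF k A_chart[OF k']] Ck_subset[OF C]])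
    show "w ` ?S \<subseteq> snd k ` (fst k \<inter> fst k')"
    proof
     fix y assume "y : w ` ?S"
     then obtain t where t: "t : {a..b}" "?c t : fst k'" "y = w t" by blast
     thus "y : snd k ` (fst k \<inter> fst k')" using cd[OF t(1)] by (intro image_eqI[of _ _ "?c t"]) auto
    qed
   qed auto
   thus "Ck n (snd k' \<circ> ?c) ?S" by (rule Ck_cong) (simp add: transition_def)
  next
   fix t assume t: "t : ?S"
   obtain e where e: "e > 0" "ALL s:{a..b}. \<bar>s - t\<bar> < e --> ?c s : fst k'"
    using continuous_curve_near[OF ct open_dom[OF A_chart[OF k']], of t] t by blast
   have "at t within ?S = at t within {a..b}" by (rule at_within_near[OF e(1)]) (use e(2) in blast)
   thus "at t within ?S ~= bot" using Icc_not_bot[OF ab, of t] t by auto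
  qed
 qed
 assume t: "t : {a..b}"
 have "(snd k \<circ> ?c has_vector_derivative w' t) (at t within {a..b})"
  by (rule has_vector_derivative_transform_within[OF w'[OF t] zero_less_one t]) (use cd in simp)
 from speed_eq[OF k ct t cd(1)[OF t] this Icc_not_bot[OF ab t]]
 show "speed A G {a..b} ?c t = speed_in k w w' t" by (simp add: speed_in_def cd[OF t])
qed

lemma smooth_curve_velocity:
 assumes c: "smooth_curve M A {a..b} c" and ab: "a < b" and j: "j : A" and t: "t : {a..b}" "c t : fst j"
 shows "(snd j \<circ> c has_vector_derivative velocity j {a..b} c t) (at t within {a..b})"
proof -
 let ?S = "{t:{a..b}. c t : fst j}"
 have ct: "continuous_map (top_of_set {a..b}) M c" and sm: "smooth_on (snd j \<circ> c) ?S" using c j by (auto simp: smooth_curve_def)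
 obtain D where D: "D 0 = snd j \<circ> c" "ALL k. ALL t:?S. (D k has_vector_derivative D (Suc k) t) (at t within ?S)"
  using sm unfolding smooth_on_def by blast
 obtain e where e: "e > 0" "ALL s:{a..b}. \<bar>s - t\<bar> < e --> c s : fst j"
  using continuous_curve_near[OF ct open_dom[OF A_chart[OF j]] t] by blast
 have ae: "at t within ?S = at t within {a..b}" by (rule at_within_near[OF e(1)]) (use e(2) in blast)
 have "(D 0 has_vector_derivative D (Suc 0) t) (at t within ?S)" using D(2) t by blast
 hence d: "(snd j \<circ> c has_vector_derivative D (Suc 0) t) (at t within {a..b})" unfolding ae D(1) .
 hence "velocity j {a..b} c t = D (Suc 0) t"
  unfolding velocity_def by (rule vector_derivative_within[OF Icc_not_bot[OF ab t(1)]])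
 thus ?thesis using d by simp
qed

lemma smooth_arc:
 assumes c: "smooth_curve M A {a..b} c" and k: "k : A" and st: "a <= s" "s < t" "t <= b"
  and sub: "!!u. u : {s..t} ==> c u : fst k"
 shows "arc_in k s t (snd k \<circ> c) (velocity k {a..b} c)"
  "u : {s..t} ==> speed_in k (snd k \<circ> c) (velocity k {a..b} c) u = speed A G {a..b} c u"
proof -
 have ab: "a < b" using st by simp
 have stab: "{s..t} \<subseteq> {a..b}" using st by auto
 have v: "(snd k \<circ> c has_vector_derivative velocity k {a..b} c u) (at u within {a..b})" if "u : {s..t}" for u
  using smooth_curve_velocity[OF c ab k] sub[OF that] that stab by blast
 show "arc_in k s t (snd k \<circ> c) (velocity k {a..b} c)" unfolding arc_in_def
 proof (intro conjI allI ballI)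
  fix n show "Ck n (snd k \<circ> c) {s..t}"
   by (rule Ck_subset[OF smooth_on_imp_Ck[of _ "{t:{a..b}. c t : fst k}"]]) (use c k sub stab in \<open>auto simp: smooth_curve_def\<close>)
  fix u assume "u : {s..t}"
  from has_vector_derivative_within_subset[OF v[OF this] stab]
  show "(snd k \<circ> c has_vector_derivative velocity k {a..b} c u) (at u within {s..t})" .
 qed (use A_chart[OF k] st sub in auto)
 assume u: "u : {s..t}"
 have ct: "continuous_map (top_of_set {a..b}) M c" using c by (simp add: smooth_curve_def)
 have "speed A G {a..b} c u = sqrt (G k (snd k (c u)) (velocity k {a..b} c u) (velocity k {a..b} c u))"
  by (rule speed_eq[OF A_chart[OF k] ct _ sub[OF u] v[OF u]]) (use u stab Icc_not_bot[OF ab] in auto)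
 thus "speed_in k (snd k \<circ> c) (velocity k {a..b} c) u = speed A G {a..b} c u" by (simp add: speed_in_def)
qed

lemma smooth_curve_in: "smooth_curve M A I c ==> t : I ==> c t : topspace M"
 unfolding smooth_curve_def using continuous_map_image_subset_topspace[of "top_of_set I" M c] by auto

lemma smooth_curve_chart_near:
 assumes c: "smooth_curve M A {a..b} c" and x: "x : {a..b}"
 obtains k e where "k : A" "0 < e" "ALL t:{a..b}. \<bar>t - x\<bar> < e --> c t : fst k"
proof -
 obtain k where k: "k : A" "c x : fst k" using A_chart_at[OF smooth_curve_in[OF c x]] by blast
 have ct: "continuous_map (top_of_set {a..b}) M c" using c by (simp add: smooth_curve_def)
 obtain e where "e > 0" "ALL t:{a..b}. \<bar>t - x\<bar> < e --> c t : fst k"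
  using continuous_curve_near[OF ct open_dom[OF A_chart[OF k(1)]] x k(2)] by blast
 thus ?thesis using that k(1) by blast
qed

lemma smooth_speed_continuous:
 assumes c: "smooth_curve M A {a..b} c" and ab: "a < b"
 shows "continuous_on {a..b} (speed A G {a..b} c)" unfolding continuous_on_eq_continuous_within
proof
 fix x assume x: "x : {a..b}"
 obtain k e where k: "k : A" and e: "0 < e" "ALL t:{a..b}. \<bar>t - x\<bar> < e --> c t : fst k"
  by (rule smooth_curve_chart_near[OF c x]) (rule that, assumption+)
 define s t where "s = max a (x - e / 2)" and "t = min b (x + e / 2)"
 have st: "a <= s" "s < t" "t <= b" "x : {s..t}" "!!u. u : {s..t} ==> \<bar>u - x\<bar> < e"
  using x ab e(1) by (auto simp: s_def t_def)
 have sub: "c u : fst k" if "u : {s..t}" for u using e(2) st(5)[OF that] that st(1,3) by auto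
 note arc = smooth_arc[OF c k st(1-3) sub]
 have "continuous_on {s..t} (speed A G {a..b} c)"
  using speed_in_continuous[OF arc(1)] arc(2) by (subst continuous_on_cong[OF refl, symmetric]) auto
 hence "continuous (at x within {s..t}) (speed A G {a..b} c)"
  using st(4) by (simp add: continuous_on_eq_continuous_within)
 moreover have "at x within {s..t} = at x within {a..b}"
  by (rule at_within_near[of "e / 2"]) (use e(1) in \<open>auto simp: s_def t_def abs_if split: if_splits\<close>)
 ultimately show "continuous (at x within {a..b}) (speed A G {a..b} c)" by simp
qed

lemma smooth_curve_rdist_le:
 assumes c: "smooth_curve M A {a..b} c" and ab: "a < b" and l: "a <= l" "l <= r" "r <= b"
 shows "rdist (c l) (c r) <= integral {l..r} (speed A G {a..b} c)"
proof (rule integral_bound_local[OF l(2)])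
 have cont: "continuous_on {a..b} (speed A G {a..b} c)" by (rule smooth_speed_continuous[OF c ab])
 show "speed A G {a..b} c integrable_on {l..r}"
  by (rule integrable_continuous_real[OF continuous_on_subset[OF cont]]) (use l in auto)
 show "rdist (c s) (c u) <= rdist (c s) (c t) + rdist (c t) (c u)" if "l <= s" "s <= t" "t <= u" "u <= r" for s t u
  by (intro rdist_triangle smooth_curve_in[OF c]) (use that l in auto)
 fix x assume "x : {l..r}"
 hence x: "x : {a..b}" using l by auto
 obtain k e where k: "k : A" and e: "0 < e" "ALL t:{a..b}. \<bar>t - x\<bar> < e --> c t : fst k"
  by (rule smooth_curve_chart_near[OF c x]) (rule that, assumption+)
 have "rdist (c s) (c t) <= integral {s..t} (speed A G {a..b} c)"
  if st: "l <= s" "s <= x" "x <= t" "t <= r" "t - s < e" for s t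
 proof (cases "s < t")
  case True
  have sub: "c u : fst k" if "u : {s..t}" for u using e(2) that st l by auto
  note arc = smooth_arc[OF c k _ True _ sub]
  have 1: "arc_in k s t (snd k \<circ> c) (velocity k {a..b} c)" by (rule arc(1)) (use st l in auto)
  have "integral {s..t} (speed_in k (snd k \<circ> c) (velocity k {a..b} c)) = integral {s..t} (speed A G {a..b} c)"
   by (rule integral_cong, rule arc(2)) (use st l in auto)
  thus ?thesis using rdist_le[OF reach_arc[OF 1]] inv_chart[OF A_chart[OF k]] sub[of s] sub[of t] True by simp
 next
  case False
  hence "s = t" using st by simp
  thus ?thesis using rdist_refl[OF smooth_curve_in[OF c]] st l by simp
 qed
 thus "EX e>0. ALL s t. l <= s & s <= x & x <= t & t <= r & t - s < e --> rdist (c s) (c t) <= integral {s..t} (speed A G {a..b} c)"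
  using e(1) by blast
qed

lemma piecewise_rdist_le:
 assumes "piecewise_smooth_curve M A a b c"
 shows "rdist (c a) (c b) <= curve_length A G a b c" "c a : topspace M" "c b : topspace M"
proof -
 obtain n h where ab: "a < b" and ct: "continuous_map (top_of_set {a..b}) M c" and h: "h 0 = a" "h n = b"
  "ALL i<n. h i < h (Suc i) & smooth_curve M A {h i..h (Suc i)} c"
  using assms unfolding piecewise_smooth_curve_def by blast
 have top: "c t : topspace M" if "t : {a..b}" for t
  using continuous_map_image_subset_topspace[OF ct] that by auto
 show "c a : topspace M" "c b : topspace M" using top ab by auto
 have mono: "h i <= h j" if "i <= j" "j <= n" for i j using that
 proof (induction j)
  case (Suc j)
  thus ?case using h(3)[rule_format, of j] by (cases "i = Suc j") auto
 qed simp
 have "EX L. (speed A G {a..b} c has_integral L) {a..h i} & rdist (c a) (c (h i)) <= L" if "i <= n" for i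
  using that
 proof (induction i)
  case 0
  show ?case using has_integral_refl(2)[of "speed A G {a..b} c" a] rdist_refl[of "c a"] top ab h(1)
   by (intro exI[of _ 0]) auto
 next
  case (Suc i)
  then obtain L where L: "(speed A G {a..b} c has_integral L) {a..h i}" "rdist (c a) (c (h i)) <= L" by auto
  let ?l = "h i" and ?r = "h (Suc i)"
  have lr: "?l < ?r" and sm: "smooth_curve M A {?l..?r} c" using h(3) Suc.prems by auto
  have al: "a <= ?l" and rb: "?r <= b" using mono[of 0 i] mono[of "Suc i" n] Suc.prems h(1,2) by auto
  let ?L = "integral {?l..?r} (speed A G {?l..?r} c)"
  have "(speed A G {?l..?r} c has_integral ?L) {?l..?r}"
   by (rule integrable_integral[OF integrable_continuous_real[OF smooth_speed_continuous[OF sm lr]]])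
  \<comment> \<open>Derivatives within the whole interval and within the piece can differ only at
    the end points of the piece, a finite set without influence on the integral.\<close>
  hence "(speed A G {a..b} c has_integral ?L) {?l..?r}"
  proof (rule has_integral_spike_finite[of "{?l, ?r}", rotated 2])
   fix x assume x: "x : {?l..?r} - {?l, ?r}"
   show "speed A G {a..b} c x = speed A G {?l..?r} c x"
    by (rule speed_near[of "min (x - ?l) (?r - x)"]) (use x al rb in auto)
  qed simp
  from has_integral_combine[OF al _ L(1) this]
  have "(speed A G {a..b} c has_integral L + ?L) {a..?r}" using lr by simp
  moreover have "rdist (c a) (c ?r) <= rdist (c a) (c ?l) + rdist (c ?l) (c ?r)"
   by (intro rdist_triangle top) (use al rb lr ab in auto)
  hence "rdist (c a) (c ?r) <= L + ?L" using L(2) smooth_curve_rdist_le[OF sm lr, of ?l ?r] lr by simp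
  ultimately show ?case by blast
 qed
 from this[of n] obtain L where "(speed A G {a..b} c has_integral L) {a..b}" "rdist (c a) (c b) <= L" using h(2) by auto
 thus "rdist (c a) (c b) <= curve_length A G a b c" unfolding curve_length_def by (simp add: integral_unique)
qed

end

section \<open>Chains of arcs as piecewise smooth curves, and agreement of the distances\<close>

context riemannian_subatlas
begin

lemma arc_in_shift:
 assumes arc: "arc_in k a b c c'"
 shows "arc_in k (a + d) (b + d) (%t. c (t - d)) (%t. c' (t - d))"
  "integral {a + d..b + d} (speed_in k (%t. c (t - d)) (%t. c' (t - d))) = integral {a..b} (speed_in k c c')"
proof -
 have im: "(%t. t - d) ` {a + d..b + d} = {a..b}" by (simp add: image_minus_const_atLeastAtMost')
 show "arc_in k (a + d) (b + d) (%t. c (t - d)) (%t. c' (t - d))" unfolding arc_in_def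
 proof (intro conjI allI ballI)
  show "Ck n (%t. c (t - d)) {a + d..b + d}" for n
   by (rule Ck_compose[of n c "{a..b}" "%t. t - d"]) (use arc im in \<open>auto simp: arc_in_def intro!: Ck_diff Ck_id Ck_const simp del: Ck.simps\<close>)
  fix t assume t: "t : {a + d..b + d}"
  have 1: "(c has_vector_derivative c' (t - d)) (at (t - d) within (%t. t - d) ` {a + d..b + d})"
   unfolding im using arc t by (simp add: arc_in_def)
  have "((%t. t - d) has_vector_derivative 1) (at t within {a + d..b + d})" by (auto intro!: derivative_eq_intros)
  from vector_diff_chain_within[OF this 1]
  show "((%t. c (t - d)) has_vector_derivative c' (t - d)) (at t within {a + d..b + d})" by (simp add: o_def)
 qed (use arc in \<open>auto simp: arc_in_def\<close>)
 have "speed_in k (%t. c (t - d)) (%t. c' (t - d)) \<circ> ((+) d) = speed_in k c c'" by (auto simp: speed_in_def fun_eq_iff)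
 thus "integral {a + d..b + d} (speed_in k (%t. c (t - d)) (%t. c' (t - d))) = integral {a..b} (speed_in k c c')"
  using integral_shift_Icc_real[of a b "speed_in k (%t. c (t - d)) (%t. c' (t - d))" d] by simp
qed

lemma smooth_curve_const: "x : topspace M ==> smooth_curve M A I (%t. x)"
 unfolding smooth_curve_def by (auto simp: o_def intro: smooth_on_const)

text \<open>Each further arc is shifted in time and appended. The empty chain becomes a constant
  curve on the unit interval, since a curve needs an interval of positive length.\<close>

lemma reach_curve:
 "reach x y L ==> EX b c. piecewise_smooth_curve M A 0 b c & c 0 = x & c b = y & (speed A G {0..b} c has_integral L) {0..b}"
proof (induction rule: reach.induct)
 case (reach_refl x)
 let ?c = "%t::real. x"
 have sm: "smooth_curve M A I ?c" for I by (rule smooth_curve_const[OF reach_refl])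
 have "piecewise_smooth_curve M A 0 1 ?c" unfolding piecewise_smooth_curve_def
  by (intro conjI exI[of _ "Suc 0"] exI[of _ real]) (use sm reach_refl in \<open>auto simp: smooth_curve_def[of M A "{0..1}"]\<close>)
 moreover have "speed A G {0..1} ?c t = 0" if t: "t : {0..1}" for t
 proof -
  obtain j where j: "j : Ch" "x : fst j" using chart_at[OF reach_refl] by blast
  interpret local_metric "img j" "G j" by (rule metric[OF j(1)])
  have "speed A G {0..1} ?c t = sqrt (G j (snd j (?c t)) 0 0)"
   by (rule speed_eq[OF j(1) _ t j(2)]) (use sm Icc_not_bot[of 0 1] t in \<open>auto simp: smooth_curve_def o_def\<close>)
  thus ?thesis using bil[of "snd j x"] j(2) by (simp add: bilinear_lzero)
 qed
 hence "(speed A G {0..1} ?c has_integral 0) {0..1}" by (intro has_integral_is_0) auto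
 ultimately show ?case by blast
next
 case (reach_step x j u a L b u')
 then obtain b0 c n h where b0: "0 < b0" and ct: "continuous_map (top_of_set {0..b0}) M c"
  and h: "h 0 = 0" "h n = b0" "ALL i<n. h i < h (Suc i) & smooth_curve M A {h i..h (Suc i)} c"
  and c: "c 0 = x" "c b0 = inv_chart j (u a)" and len: "(speed A G {0..b0} c has_integral L) {0..b0}"
  unfolding piecewise_smooth_curve_def by blast
 define d where "d = b0 - a"
 define b1 where "b1 = b + d"
 let ?u = "%t. u (t - d)" and ?u' = "%t. u' (t - d)"
 have ad: "a + d = b0" by (simp add: d_def)
 have arc: "arc_in j b0 b1 ?u ?u'" and int: "integral {b0..b1} (speed_in j ?u ?u') = integral {a..b} (speed_in j u u')"
  using arc_in_shift[OF reach_step(2), of d] by (simp_all add: ad b1_def)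
 have b01: "b0 < b1" using arc by (simp add: arc_in_def)
 let ?w = "%t. inv_chart j (?u t)"
 have join: "c b0 = ?w b0" using c(2) by (simp add: d_def)
 define e where "e t = (if t <= b0 then c t else ?w t)" for t
 have e: "e t = c t" if "t <= b0" for t using that by (simp add: e_def)
 have e': "e t = ?w t" if "b0 <= t" for t using that join by (cases "t = b0") (auto simp: e_def)
 have cont: "continuous_map (top_of_set {0..b1}) M e" unfolding e_def
 proof (rule continuous_map_cases_le)
  have "{t : topspace (top_of_set {0..b1}). t <= b0} = {0..b0}" "{t : topspace (top_of_set {0..b1}). b0 <= t} = {b0..b1}"
   "{0..b1} \<inter> {0..b0} = {0..b0}" "{0..b1} \<inter> {b0..b1} = {b0..b1}" using b0 b01 by auto
  thus "continuous_map (subtopology (top_of_set {0..b1}) {t : topspace (top_of_set {0..b1}). t <= b0}) M c"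
   "continuous_map (subtopology (top_of_set {0..b1}) {t : topspace (top_of_set {0..b1}). b0 <= t}) M ?w"
   using ct arc_continuous[OF arc] by (simp_all only: subtopology_subtopology)
 qed (use join in auto)
 have mono: "h i <= b0" if "i <= n" for i using that
 proof (induction "n - i" arbitrary: i)
  case (Suc k)
  hence "i < n" by simp
  hence "h i < h (Suc i)" using h(3) by blast
  moreover have "h (Suc i) <= b0" by (rule Suc.hyps(1)) (use Suc.hyps(2) \<open>i < n\<close> in auto)
  ultimately show ?case by simp
 qed (use h(2) in simp)
 have pw: "piecewise_smooth_curve M A 0 b1 e" unfolding piecewise_smooth_curve_def
 proof (intro conjI exI[of _ "Suc n"] exI[of _ "%i. if i <= n then h i else b1"] allI impI cont)
  show "0 < b1" using b0 b01 by simp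
  show "(if 0 <= n then h 0 else b1) = 0" using h(1) by simp
  show "(if Suc n <= n then h (Suc n) else b1) = b1" by simp
  fix i assume i: "i < Suc n"
  show "(if i <= n then h i else b1) < (if Suc i <= n then h (Suc i) else b1)"
   using i h(2,3) b01 by (cases "i = n") auto
  show "smooth_curve M A {if i <= n then h i else b1..if Suc i <= n then h (Suc i) else b1} e"
  proof (cases "i = n")
   case True
   have "smooth_curve M A {b0..b1} e" by (rule smooth_curve_cong[OF arc_smooth_curve(1)[OF arc]]) (use e' in auto)
   thus ?thesis using True h(2) by simp
  next
   case False
   hence "i < n" using i by simp
   hence "smooth_curve M A {h i..h (Suc i)} e"
    using mono[of "Suc i"] h(3) by (intro smooth_curve_cong[of M A _ c e]) (auto simp: e)
   thus ?thesis using \<open>i < n\<close> by simp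
  qed
 qed
 have "(speed A G {0..b1} e has_integral L) {0..b0}"
 proof (rule has_integral_spike_finite[of "{0, b0}", OF _ _ len])
  fix t assume t: "t : {0..b0} - {0, b0}"
  show "speed A G {0..b1} e t = speed A G {0..b0} c t"
   by (rule speed_near[of "min t (b0 - t)"]) (use t b01 in \<open>auto simp: e\<close>)
 qed simp
 moreover have "(speed A G {0..b1} e has_integral integral {a..b} (speed_in j u u')) {b0..b1}"
 proof (rule has_integral_spike_finite[of "{b0, b1}" _ _ "speed_in j ?u ?u'"])
  fix t assume t: "t : {b0..b1} - {b0, b1}"
  have "speed A G {0..b1} e t = speed A G {b0..b1} ?w t"
   by (rule speed_near[of "min (t - b0) (b1 - t)"]) (use t b0 in \<open>auto simp: e'\<close>)
  thus "speed A G {0..b1} e t = speed_in j ?u ?u' t" using arc_smooth_curve(2)[OF arc] t by simp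
 next
  show "(speed_in j ?u ?u' has_integral integral {a..b} (speed_in j u u')) {b0..b1}"
   unfolding int[symmetric] by (rule integrable_integral[OF integrable_continuous_real[OF speed_in_continuous[OF arc]]])
 qed simp
 ultimately have "(speed A G {0..b1} e has_integral L + integral {a..b} (speed_in j u u')) {0..b1}"
  by (rule has_integral_combine[rotated 2]) (use b0 b01 in auto)
 moreover have "e 0 = x" "e b1 = inv_chart j (u b)" using e[of 0] e'[of b1] b0 b01 c(1) by (auto simp: b1_def)
 ultimately show ?case using pw by blast
qed

lemma dist_to_eq:
 assumes y: "y : topspace M"
 shows "dist_to M A G N y = rho y"
proof -
 let ?S = "{curve_length A G a b c | a b c. piecewise_smooth_curve M A a b c & c a = y & c b : N}"
 have low: "rho y <= l" if l: "l : ?S" for l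
 proof -
  obtain a b c where *: "l = curve_length A G a b c" "piecewise_smooth_curve M A a b c" "c a = y" "c b : N" using l by blast
  have "rho y <= rdist y (c b)" by (rule rho_le[OF *(4)])
  also have "\<dots> <= l" using piecewise_rdist_le(1)[OF *(2)] *(1,3) by simp
  finally show ?thesis .
 qed
 obtain n where n: "n : N" "rho y = rdist y n" using rho_attained[OF y] by blast
 have nX: "n : topspace M" using n(1) N_sub by blast
 have curve: "L : ?S" if r: "reach y n L" for L
 proof -
  obtain b c where "piecewise_smooth_curve M A 0 b c" "c 0 = y" "c b = n" "(speed A G {0..b} c has_integral L) {0..b}"
   using reach_curve[OF r] by blast
  thus ?thesis using n(1) by (intro CollectI exI[of _ "0::real"] exI[of _ b] exI[of _ c]) (auto simp: curve_length_def integral_unique)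
 qed
 have "Inf ?S <= rdist y n"
 proof (rule rdist_greatest[OF y nX])
  fix L assume r: "reach y n L"
  show "Inf ?S <= L" by (rule cInf_lower[OF curve[OF r] bdd_belowI[of _ "rho y", OF low]])
 qed
 moreover have "rho y <= Inf ?S" by (rule cInf_greatest) (use curve reach_exists[OF y nX] low in blast)+
 ultimately show ?thesis using n(2) unfolding dist_to_def by simp
qed

text \<open>For a distance-preserving curve, the absence of corners at \<open>c t\<close> puts all
  points of the piece in the direction opposite to the point at \<open>t - sg * h\<close>, hence on
  one ray of the exponential map, traversed at unit speed. The sign \<open>sg\<close> lets time run
  backwards, for pieces at the start of an interval where nothing precedes.\<close>

lemma geodesic_piece:
 assumes nb: "normal_ball (img j) (G j) (cdist j) p r s s' C ex V" and j: "j : Ch"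
  and iso: "!!u u'. u : I ==> u' : I ==> rdist (c u) (c u') = \<bar>u' - u\<bar>"
  and in_ball: "!!u. u : I ==> c u : fst j & snd j (c u) : ball p r"
  and sg: "sg = 1 \<or> sg = -1" and h: "0 < h" "0 < l"
  and I: "t - sg * h : I" "!!u. 0 <= sg * (u - t) ==> sg * (u - t) <= l ==> u : I"
  and J: "J = {u. 0 <= sg * (u - t) & sg * (u - t) <= l}"
 shows "(ALL n. Ck n (snd j \<circ> c) J) & (EX w. ALL u:J. (snd j \<circ> c has_vector_derivative w u) (at u within J) &
  (w has_vector_derivative - local_metric.chris (G j) (snd j (c u)) (w u) (w u)) (at u within J) & G j (snd j (c u)) (w u) (w u) = 1)"
proof -
 interpret normal_ball "img j" "G j" "cdist j" p r s s' C ex V by (rule nb)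
 have sgsg: "sg * sg = 1" "\<bar>sg\<bar> = 1" "sg * (sg * x) = x" for x using sg by auto
 have JI: "J \<subseteq> I" using I(2) J by auto
 have tJ: "t : J" using h J by simp
 have endJ: "t + sg * l : J" using h J by (simp add: sgsg)
 let ?x = "snd j (c t)" and ?y = "snd j (c (t + sg * l))"
 define v where "v = V ?x ?y"
 have xB: "?x : B" "?y : B" and xd: "c t : fst j" "c (t + sg * l) : fst j" using in_ball tJ endJ JI by blast+
 have aI: "c (t - sg * h) : fst j" "snd j (c (t - sg * h)) : B" using in_ball I(1) by blast+
 have ne: "c u ~= c u'" if "u : I" "u' : I" "u ~= u'" for u u'
  using iso[OF that(1,2)] that(3) rdist_refl[of "c u"] in_ball[OF that(1)] dom_sub[OF j] by auto
 have dir: "V ?x (snd j (c (t + sg * i))) = - (i / h) *\<^sub>R V ?x (snd j (c (t - sg * h)))" if i: "0 < i" "i <= l" for i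
 proof -
  have uJ: "t + sg * i : J" using i J by (simp add: sgsg)
  have uI: "t + sg * i : I" "t : I" using uJ tJ JI by auto
  have dd: "rdist (c t) (c (t + sg * i)) = i" "rdist (c t) (c (t - sg * h)) = h" "rdist (c (t - sg * h)) (c t) = h"
   "rdist (c (t - sg * h)) (c (t + sg * i)) = h + i"
   using iso[OF uI(2,1)] iso[OF uI(2) I(1)] iso[OF I(1) uI(2)] iso[OF I(1) uI(1)] i h sg by auto
  show ?thesis using chart_corner[OF nb j aI(1) xd(1) _ aI(2) xB(1), of "c (t + sg * i)"] in_ball[OF uI(1)]
    ne[OF I(1) uI(2)] ne[OF uI(2,1)] h(1) i(1) sg dd by auto
 qed
 have pos: "snd j (c (t + sg * i)) = ex (?x, (i / l) *\<^sub>R v)" if i: "0 <= i" "i <= l" for i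
 proof (cases "i = 0")
  case True
  thus ?thesis using exV[OF xB(1,1)] V_refl[OF xB(1)] by simp
 next
  case False
  hence "0 < i" using i by simp
  have "(i / l) *\<^sub>R v = V ?x (snd j (c (t + sg * i)))"
   unfolding v_def dir[OF h(2) order_refl] dir[OF \<open>0 < i\<close> i(2)] using h by simp
  moreover have "snd j (c (t + sg * i)) : B" using in_ball[of "t + sg * i"] I(2)[of "t + sg * i"] i by (simp add: sgsg)
  ultimately show ?thesis using exV[OF xB(1)] by simp
 qed
 have "(?x, v) : ball (p, 0) s" unfolding v_def using exV[OF xB] by blast
 from ex_geod[OF this] obtain a where a: "geod a" "a 0 = (?x, v)" "ALL s:{0..1}. fst (a s) = ex (?x, s *\<^sub>R v)" by blast
 have aC: "Ck n a {0..1}" for n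
  by (rule Ck_ode_solution[OF spray_Ck]) (use a(1) in \<open>auto simp: geod_def mem_Times_iff\<close>)
 define k where "k = sg / l"
 let ?b = "%u. k * (u - t)"
 have b: "?b u : {0..1}" if "u : J" for u using that h(2) by (auto simp: J k_def field_simps)
 have eq: "fst (a (?b u)) = snd j (c u)" if u: "u : J" for u
 proof -
  have "snd j (c (t + sg * (sg * (u - t)))) = ex (?x, (sg * (u - t) / l) *\<^sub>R v)" by (rule pos) (use u J in auto)
  thus ?thesis using a(3) b[OF u] by (simp add: sgsg k_def)
 qed
 have bC: "Ck n ?b J" for n by (intro Ck_mult Ck_const Ck_diff Ck_id)
 have "Ck n (snd j \<circ> c) J" for n by (rule Ck_cong[OF Ck_compose[OF Ck_fst[OF aC] bC]]) (use b eq in auto)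
 moreover
 have bd: "(?b has_vector_derivative k) (at u within J)" for u by (auto intro!: derivative_eq_intros)
 have chain: "((%u. f (?b u)) has_vector_derivative k *\<^sub>R f') (at u within J)"
  if "(f has_vector_derivative f') (at (?b u) within {0..1})" for f :: "real => 'e" and f' u
 proof -
  have "?b ` J \<subseteq> {0..1}" using b by blast
  from vector_diff_chain_within[OF bd has_vector_derivative_within_subset[OF that this]] show ?thesis by (simp add: o_def)
 qed
 define w where "w u = k *\<^sub>R snd (a (?b u))" for u
 have "(snd j \<circ> c has_vector_derivative w u) (at u within J) &
  (w has_vector_derivative - chris (snd j (c u)) (w u) (w u)) (at u within J) & G j (snd j (c u)) (w u) (w u) = 1"
  if u: "u : J" for u
 proof (intro conjI)
  have Om: "snd j (c u) : img j" using geod_in[OF a(1) b[OF u]] eq[OF u] by simp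
  show "(snd j \<circ> c has_vector_derivative w u) (at u within J)" unfolding w_def
   by (rule has_vector_derivative_transform_within[OF chain[OF geod_fst[OF a(1) b[OF u]]] zero_less_one u]) (simp add: eq)
  have "((%u. k *\<^sub>R snd (a (?b u))) has_vector_derivative k *\<^sub>R k *\<^sub>R - chris (fst (a (?b u))) (snd (a (?b u))) (snd (a (?b u)))) (at u within J)"
   by (rule bounded_linear.has_vector_derivative[OF bounded_linear_scaleR_right chain[OF geod_snd[OF a(1) b[OF u]]]])
  thus "(w has_vector_derivative - chris (snd j (c u)) (w u) (w u)) (at u within J)"
   unfolding w_def eq[OF u] by (simp add: chris_scale[OF Om])
  have "G j (snd j (c u)) (snd (a (?b u))) (snd (a (?b u))) = G j ?x v v"
   using geod_energy[OF a(1) b[OF u]] eq[OF u] a(2) by simp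
  also have "\<dots> = l\<^sup>2" unfolding v_def dist_sq[OF xB] inv_chart[OF j xd(1)] inv_chart[OF j xd(2)]
   using iso[of t "t + sg * l"] tJ endJ JI sgsg(2) h(2) by (simp add: subset_iff abs_mult)
  finally have "G j (snd j (c u)) (w u) (w u) = (k * k) * l\<^sup>2"
   using bil[OF Om] by (simp add: w_def bilinear_lmul bilinear_rmul)
  also have "\<dots> = 1" using h(2) sgsg(1) by (simp add: k_def power2_eq_square)
  finally show "G j (snd j (c u)) (w u) (w u) = 1" .
 qed
 ultimately show ?thesis by blast
qed

end

text \<open>The iterated vector derivative within \<open>S\<close> agrees near each point, order by
  order, with the derivatives on the local set \<open>J\<close>.\<close>

lemma smooth_on_local:
 assumes S: "!!t. t : S ==> at t within S ~= bot"
  and loc: "!!t. t : S ==> EX J e. 0 < e & (ALL u. \<bar>u - t\<bar> < e --> (u : S \<longleftrightarrow> u : J)) & smooth_on x J"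
 shows "smooth_on x S"
proof -
 define D where "D = rec_nat x (%_ f t. vector_derivative f (at t within S))"
 have D0: "D 0 = x" and DS: "!!k. D (Suc k) = (%t. vector_derivative (D k) (at t within S))"
  by (auto simp: D_def)
 have "(D k has_vector_derivative D (Suc k) t) (at t within S)" if t: "t : S" for k t
 proof -
  obtain J e where e: "0 < e" "ALL u. \<bar>u - t\<bar> < e --> (u : S \<longleftrightarrow> u : J)" and sm: "smooth_on x J"
   using loc[OF t] by blast
  obtain E where E: "E 0 = x" "ALL k. ALL u:J. (E k has_vector_derivative E (Suc k) u) (at u within J)"
   using sm unfolding smooth_on_def by blast
  have step: "(D k has_vector_derivative E (Suc k) u) (at u within S) & D (Suc k) u = E (Suc k) u"
   if eq: "ALL u:S. \<bar>u - t\<bar> < e --> D k u = E k u" and u: "u : S" "\<bar>u - t\<bar> < e" for k u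
  proof -
   have "(E k has_vector_derivative E (Suc k) u) (at u within J)" using E(2) e(2) u by blast
   hence "(D k has_vector_derivative E (Suc k) u) (at u within S)"
    by (rule vector_derivative_near(2)[of "e - \<bar>u - t\<bar>", rotated -1]) (use e(2) eq u in auto)
   thus ?thesis using vector_derivative_within[OF S[OF u(1)]] by (simp add: DS)
  qed
  have "ALL u:S. \<bar>u - t\<bar> < e --> D k u = E k u" for k
  proof (induction k)
   case (Suc k)
   show ?case using step[OF Suc] by blast
  qed (simp add: D0 E(1))
  from step[OF this t] show ?thesis using e(1) by simp
 qed
 thus ?thesis unfolding smooth_on_def using D0 by blast
qed

section \<open>Distance-preserving curves, \<open>N\<close>-segments and the cut locus\<close>

context riemannian_subatlas
begin

lemma isometric_curve_continuous:
 assumes top: "!!u. u : S ==> c u : topspace M"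
  and iso: "!!u u'. u : S ==> u' : S ==> rdist (c u) (c u') = \<bar>u' - u\<bar>"
 shows "continuous_map (top_of_set S) M c"
proof -
 have "continuous_map (top_of_set S) mt.mtopology c" unfolding mt.continuous_map_to_metric
 proof (intro ballI allI impI)
  fix x and ep :: real assume x: "x : topspace (top_of_set S)" and ep: "0 < ep"
  show "EX U. openin (top_of_set S) U & x : U & (ALL y:U. c y : mt.mball (c x) ep)"
   by (rule exI[of _ "S \<inter> ball x ep"]) (use x ep top iso in \<open>auto simp: openin_open_Int dist_real_def abs_minus_commute\<close>)
 qed
 thus ?thesis by (simp add: mtopology_eq)
qed

text \<open>If \<open>t >= 2 * h\<close>, the piece starts at \<open>t - h\<close> with
  \<open>t - 2 * h\<close> as preceding point. Otherwise it runs backwards from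
  \<open>t + h\<close>, with \<open>t + 2 * h\<close> in that role; this lies in the interval
  because \<open>4 * h <= t0\<close>.\<close>

lemma local_geodesic:
 assumes t0: "0 < t0" and top': "ALL u:{0..t0}. c u : topspace M"
  and iso': "ALL u:{0..t0}. ALL u':{0..t0}. rdist (c u) (c u') = \<bar>u' - u\<bar>"
  and k: "k : Ch" and t: "t : {0..t0}" "c t : fst k"
 shows "EX a b e w. a < b & 0 < e & (ALL u. \<bar>u - t\<bar> < e --> (u : {0..t0} \<longleftrightarrow> u : {a..b})) & (ALL u:{a..b}. c u : fst k) &
  (ALL n. Ck n (snd k \<circ> c) {a..b}) & (ALL u:{a..b}. (snd k \<circ> c has_vector_derivative w u) (at u within {a..b}) &
  (w has_vector_derivative - local_metric.chris (G k) (snd k (c u)) (w u) (w u)) (at u within {a..b}) & G k (snd k (c u)) (w u) (w u) = 1)"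
proof -
 note top = bspec[OF top'] and iso = bspec[OF bspec[OF iso']]
 have p: "snd k (c t) : img k" using t(2) by blast
 obtain r s s' C ex V where nb: "normal_ball (img k) (G k) (cdist k) (snd k (c t)) r s s' C ex V"
  using normal_ball_at[OF k p] by blast
 let ?W = "{q : fst k. snd k q : ball (snd k (c t)) r}"
 have "c t : ?W" using t(2) normal_ball.r_pos[OF nb] by simp
 then obtain e where e: "0 < e" "mt.mball (c t) e \<subseteq> ?W"
  using open_contains_mball[OF open_inv_image[OF k open_ball]] by blast
 define h where "h = min (e / 4) (t0 / 4)"
 have h: "0 < h" "2 * h < e" "4 * h <= t0" using e(1) t0 by (auto simp: h_def)
 define I where "I = {u : {0..t0}. \<bar>u - t\<bar> <= 2 * h}"
 have inW: "c u : fst k & snd k (c u) : ball (snd k (c t)) r" if "u : I" for u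
 proof -
  have "u : {0..t0}" "\<bar>u - t\<bar> < e" using that h(2) by (auto simp: I_def)
  hence "c u : mt.mball (c t) e" using iso[OF t(1)] top t(1) by auto
  thus ?thesis using e(2) by blast
 qed
 have isoI: "rdist (c u) (c u') = \<bar>u' - u\<bar>" if "u : I" "u' : I" for u u'
  using iso that by (auto simp: I_def)
 have fin: ?thesis if J: "J = {a..b}" "J \<subseteq> I" "a < b" "ALL u. \<bar>u - t\<bar> < h --> (u : {0..t0} \<longleftrightarrow> u : J)"
  and ex: "(ALL n. Ck n (snd k \<circ> c) J) & (EX w. ALL u:J. (snd k \<circ> c has_vector_derivative w u) (at u within J) &
   (w has_vector_derivative - local_metric.chris (G k) (snd k (c u)) (w u) (w u)) (at u within J) & G k (snd k (c u)) (w u) (w u) = 1)"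
  for J a b
 proof -
  obtain w where w: "ALL u:J. (snd k \<circ> c has_vector_derivative w u) (at u within J) &
   (w has_vector_derivative - local_metric.chris (G k) (snd k (c u)) (w u) (w u)) (at u within J) & G k (snd k (c u)) (w u) (w u) = 1"
   using conjunct2[OF ex] by (rule exE)
  have JW: "ALL u:J. c u : fst k" using inW J(2) by blast
  show ?thesis by (rule exI[of _ a], rule exI[of _ b], rule exI[of _ h], rule exI[of _ w], intro conjI)
    (use J(3) h(1) J(4) JW conjunct1[OF ex] w in \<open>simp_all only: J(1) simp_thms\<close>)
 qed
 show ?thesis
 proof (cases "2 * h <= t")
  case True
  let ?l = "min t0 (t + h) - (t - h)"
  let ?J = "{u. 0 <= 1 * (u - (t - h)) & 1 * (u - (t - h)) <= ?l}"
  have J: "?J = {t - h..min t0 (t + h)}" by auto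
  show ?thesis
  proof (rule fin[OF J])
   show "?J \<subseteq> I" using True t(1) h by (auto simp: I_def)
   show "t - h < min t0 (t + h)" using t(1) h by auto
   show "ALL u. \<bar>u - t\<bar> < h --> (u : {0..t0} \<longleftrightarrow> u : ?J)" using True h by auto
   show "(ALL n. Ck n (snd k \<circ> c) ?J) & (EX w. ALL u:?J. (snd k \<circ> c has_vector_derivative w u) (at u within ?J) &
    (w has_vector_derivative - local_metric.chris (G k) (snd k (c u)) (w u) (w u)) (at u within ?J) & G k (snd k (c u)) (w u) (w u) = 1)"
    by (rule geodesic_piece[where sg=1 and h=h and l="?l" and t="t - h" and I=I, OF nb k isoI inW]) (use True t(1) h in \<open>auto simp: I_def\<close>)
  qed
 next
  case False
  let ?l = "(t + h) - max 0 (t - h)"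
  let ?J = "{u. 0 <= -1 * (u - (t + h)) & -1 * (u - (t + h)) <= ?l}"
  have J: "?J = {max 0 (t - h)..t + h}" by auto
  show ?thesis
  proof (rule fin[OF J])
   show "?J \<subseteq> I" using False t(1) h by (auto simp: I_def)
   show "max 0 (t - h) < t + h" using t(1) h by auto
   show "ALL u. \<bar>u - t\<bar> < h --> (u : {0..t0} \<longleftrightarrow> u : ?J)" using False h by auto
   show "(ALL n. Ck n (snd k \<circ> c) ?J) & (EX w. ALL u:?J. (snd k \<circ> c has_vector_derivative w u) (at u within ?J) &
    (w has_vector_derivative - local_metric.chris (G k) (snd k (c u)) (w u) (w u)) (at u within ?J) & G k (snd k (c u)) (w u) (w u) = 1)"
    by (rule geodesic_piece[where sg="-1" and h=h and l="?l" and t="t + h" and I=I, OF nb k isoI inW]) (use False t(1) h in \<open>auto simp: I_def\<close>)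
  qed
 qed
qed

lemma christoffel_eq:
 assumes k: "k : Ch" and x: "x : img k"
 shows "christoffel UNIV G k x u v = local_metric.chris (G k) x u v"
proof -
 interpret local_metric "img k" "G k" by (rule metric[OF k])
 have "metric_deriv UNIV G k x w a b = dg x w a b" for w a b
 proof -
  have "((%y. G k y a b) has_derivative (%w. dg x w a b)) (at x)" using has_derivative_g[OF x] by simp
  from frechet_derivative_at[OF this] show ?thesis by (simp add: metric_deriv_def) metis
 qed
 thus ?thesis by (simp add: christoffel_def chris_def)
qed

lemma isometric_curve_geodesic:
 assumes t0: "0 < t0" and top: "!!u. u : {0..t0} ==> c u : topspace M"
  and iso: "!!u u'. u : {0..t0} ==> u' : {0..t0} ==> rdist (c u) (c u') = \<bar>u' - u\<bar>"
 shows "geodesic M UNIV A G {0..t0} c" "t : {0..t0} ==> speed A G {0..t0} c t = 1"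
proof -
 let ?I = "{0..t0}"
 have top': "ALL u:?I. c u : topspace M" and iso': "ALL u:?I. ALL u':?I. rdist (c u) (c u') = \<bar>u' - u\<bar>" using top iso by blast+
 have sm: "smooth_curve M A ?I c" unfolding smooth_curve_def
 proof (intro conjI ballI)
  show "continuous_map (top_of_set ?I) M c" by (rule isometric_curve_continuous[OF top iso])
  fix j assume j: "j : A"
  let ?S = "{t:?I. c t : fst j}"
  have near: "EX a b e. a < b & 0 < e & (ALL u. \<bar>u - t\<bar> < e --> (u : ?S \<longleftrightarrow> u : {a..b})) & (ALL n. Ck n (snd j \<circ> c) {a..b})"
   if t: "t : ?S" for t
  proof -
   have "t : ?I" "c t : fst j" using t by auto
   from local_geodesic[OF t0 top' iso' A_chart[OF j] this] obtain a b e where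
    "a < b" "0 < e" "ALL u. \<bar>u - t\<bar> < e --> (u : ?I \<longleftrightarrow> u : {a..b})" "ALL u:{a..b}. c u : fst j" "ALL n. Ck n (snd j \<circ> c) {a..b}"
    by (elim exE conjE) (rule that, assumption+)
   thus ?thesis by (rule_tac exI[of _ a], rule_tac exI[of _ b], rule_tac exI[of _ e]) blast
  qed
  show "smooth_on (snd j \<circ> c) ?S"
  proof (rule smooth_on_local)
   fix t assume t: "t : ?S"
   obtain a b e where *: "a < b" "0 < e" "ALL u. \<bar>u - t\<bar> < e --> (u : ?S \<longleftrightarrow> u : {a..b})" "ALL n. Ck n (snd j \<circ> c) {a..b}"
    using near[OF t] by (elim exE conjE) (rule that, assumption+)
   have "at t within ?S = at t within {a..b}" by (rule at_within_near[OF *(2)]) (use *(3) in blast)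
   moreover have "t : {a..b}" using *(2,3) t by (metis abs_zero diff_self)
   ultimately show "at t within ?S ~= bot" using Icc_not_bot[OF *(1)] by simp
   have "smooth_on (snd j \<circ> c) {a..b}" by (rule Ck_imp_smooth_on[OF spec[OF *(4)] Icc_not_bot[OF *(1)]])
   thus "EX J e. 0 < e & (ALL u. \<bar>u - t\<bar> < e --> (u : ?S \<longleftrightarrow> u : J)) & smooth_on (snd j \<circ> c) J"
    using *(2,3) by blast
  qed
 qed
 have main: "vector_derivative (velocity j ?I c) (at t within ?I) + christoffel UNIV G j (snd j (c t)) (velocity j ?I c t) (velocity j ?I c t) = 0
   & G j (snd j (c t)) (velocity j ?I c t) (velocity j ?I c t) = 1"
  if j: "j : A" and t: "t : ?I" "c t : fst j" for j t
 proof -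
  obtain a b e w where ab: "a < b" and e: "0 < e" "ALL u. \<bar>u - t\<bar> < e --> (u : ?I \<longleftrightarrow> u : {a..b})"
   and w: "ALL u:{a..b}. (snd j \<circ> c has_vector_derivative w u) (at u within {a..b}) &
   (w has_vector_derivative - local_metric.chris (G j) (snd j (c u)) (w u) (w u)) (at u within {a..b}) & G j (snd j (c u)) (w u) (w u) = 1"
   using local_geodesic[OF t0 top' iso' A_chart[OF j] t] by (elim exE conjE) (rule that, assumption+)
  have tJ: "t : {a..b}" using e t(1) by (metis abs_zero diff_self)
  have vel: "velocity j ?I c u = w u" if u: "u : ?I" "\<bar>u - t\<bar> < e" for u
  proof -
   have uJ: "u : {a..b}" using e(2) u by blast
   have "(snd j \<circ> c has_vector_derivative w u) (at u within {a..b})" using w uJ by blast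
   hence "(snd j \<circ> c has_vector_derivative w u) (at u within ?I)"
    by (rule vector_derivative_near(2)[of "e - \<bar>u - t\<bar>", rotated -1]) (use e(2) u uJ in auto)
   thus ?thesis unfolding velocity_def by (rule vector_derivative_within[OF Icc_not_bot[OF t0 u(1)]])
  qed
  have vt: "velocity j ?I c t = w t" using vel[OF t(1)] e(1) by simp
  have "(w has_vector_derivative - local_metric.chris (G j) (snd j (c t)) (w t) (w t)) (at t within {a..b})" using w tJ by blast
  hence "(velocity j ?I c has_vector_derivative - local_metric.chris (G j) (snd j (c t)) (w t) (w t)) (at t within ?I)"
   by (rule vector_derivative_near(2)[of e, rotated -1]) (use e tJ vel in auto)
  hence "vector_derivative (velocity j ?I c) (at t within ?I) = - local_metric.chris (G j) (snd j (c t)) (w t) (w t)"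
   by (rule vector_derivative_within[OF Icc_not_bot[OF t0 t(1)]])
  moreover have "christoffel UNIV G j (snd j (c t)) (w t) (w t) = local_metric.chris (G j) (snd j (c t)) (w t) (w t)"
   by (rule christoffel_eq[OF A_chart[OF j]]) (use t(2) in blast)
  ultimately show ?thesis using w tJ by (simp add: vt)
 qed
 show "geodesic M UNIV A G ?I c" unfolding geodesic_def using sm main by blast
 assume t: "t : ?I"
 let ?j = "SOME j. j : A & c t : fst j"
 have k: "?j : A & c t : fst ?j" by (rule someI_ex[OF A_chart_at[OF top[OF t]]])
 show "speed A G ?I c t = 1" unfolding speed_def Let_def using main[OF conjunct1[OF k] t conjunct2[OF k]] by simp
qed

text \<open>Unit speed bounds the distance of two points of a segment by the difference of their
  parameters, which are their heights. Conversely the order makes the curve distance-preserving,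
  hence a geodesic. The cut locus thereby becomes a matter of the order alone.\<close>

lemma N_segment_iff:
 "N_segment M UNIV A G N t0 c \<longleftrightarrow> 0 < t0 & (ALL u:{0..t0}. c u : topspace M & rho (c u) = u) &
  (ALL u:{0..t0}. ALL u':{0..t0}. u <= u' --> geo.below (c u) (c u'))"
proof
 assume seg: "N_segment M UNIV A G N t0 c"
 hence t0: "0 < t0" and sm: "smooth_curve M A {0..t0} c" and sp: "!!t. t : {0..t0} ==> speed A G {0..t0} c t = 1"
  by (auto simp: N_segment_def geodesic_def)
 have top: "c u : topspace M" if "u : {0..t0}" for u by (rule smooth_curve_in[OF sm that])
 have rho: "rho (c u) = u" if "u : {0..t0}" for u
  using seg that dist_to_eq[OF top[OF that]] by (simp add: N_segment_def)
 have "geo.below (c u) (c u')" if u: "u : {0..t0}" "u' : {0..t0}" "u <= u'" for u u'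
 proof -
  have "rdist (c u) (c u') <= integral {u..u'} (speed A G {0..t0} c)"
   by (rule smooth_curve_rdist_le[OF sm t0]) (use u in auto)
  also have "\<dots> = integral {u..u'} (%t. 1)" by (rule integral_cong, rule sp) (use u in auto)
  also have "\<dots> = u' - u" using u(3) by simp
  finally have "rdist (c u) (c u') <= u' - u" .
  moreover have "rho (c u') <= rho (c u) + rdist (c u) (c u')" by (rule geo.rho_lip[OF top[OF u(1)] top[OF u(2)]])
  ultimately show ?thesis using rho u by (simp add: geo.below_def)
 qed
 thus "0 < t0 & (ALL u:{0..t0}. c u : topspace M & rho (c u) = u) &
  (ALL u:{0..t0}. ALL u':{0..t0}. u <= u' --> geo.below (c u) (c u'))" using t0 top rho by blast
next
 assume *: "0 < t0 & (ALL u:{0..t0}. c u : topspace M & rho (c u) = u) &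
  (ALL u:{0..t0}. ALL u':{0..t0}. u <= u' --> geo.below (c u) (c u'))"
 hence t0: "0 < t0" and top: "!!u. u : {0..t0} ==> c u : topspace M" and rho: "!!u. u : {0..t0} ==> rho (c u) = u"
  and below: "!!u u'. u : {0..t0} ==> u' : {0..t0} ==> u <= u' ==> geo.below (c u) (c u')" by blast+
 have iso: "rdist (c u) (c u') = \<bar>u' - u\<bar>" if u: "u : {0..t0}" "u' : {0..t0}" for u u'
 proof (cases "u <= u'")
  case True
  thus ?thesis using below[OF u True] rho[OF u(1)] rho[OF u(2)] by (simp add: geo.below_def)
 next
  case False
  thus ?thesis using below[OF u(2,1)] rho[OF u(1)] rho[OF u(2)] rdist_sym[of "c u"] by (simp add: geo.below_def)
 qed
 have 0: "(0::real) : {0..t0}" using t0 by simp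
 have "c 0 : N" using geo.rho_zero_iff[OF top[OF 0]] rho[OF 0] by simp
 thus "N_segment M UNIV A G N t0 c" unfolding N_segment_def
  using t0 isometric_curve_geodesic[OF t0 top iso] dist_to_eq[OF top] rho by auto
qed

text \<open>A point between \<open>c t0\<close> and \<open>y\<close> is chosen at each height; by
  \<open>upward_unique\<close> these independent choices form a chain.\<close>

lemma N_segment_extend:
 assumes seg: "N_segment M UNIV A G N t0 c" and y: "y : topspace M" "geo.below (c t0) y" "y ~= c t0"
 shows "EX c'. N_segment M UNIV A G N (rho y) c' & t0 < rho y & c' (rho y) = y & (ALL t:{0..t0}. c' t = c t)"
proof -
 let ?m = "c t0"
 have t0: "0 < t0" and top: "!!u. u : {0..t0} ==> c u : topspace M" and rho: "!!u. u : {0..t0} ==> rho (c u) = u"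
  and below: "!!u u'. u : {0..t0} ==> u' : {0..t0} ==> u <= u' ==> geo.below (c u) (c u')"
  using seg unfolding N_segment_iff by blast+
 have m: "?m : topspace M" "rho ?m = t0" using top[of t0] rho[of t0] t0 by auto
 have mN: "?m ~: N" using geo.rho_zero_iff[OF m(1)] m(2) t0 by auto
 have d: "rho y = t0 + rdist ?m y" using y(2) m(2) by (simp add: geo.below_def)
 hence ty: "t0 < rho y" using rdist_pos[OF m(1) y(1)] y(3) by auto
 have ex: "EX z. z : topspace M & geo.below ?m z & geo.below z y & rho z = s" if s: "t0 <= s" "s <= rho y" for s
 proof -
  obtain z where "z : topspace M" "geo.below ?m z" "geo.below z y" "rdist ?m z = s - t0" "rdist z y = rdist ?m y - (s - t0)"
   by (rule geo.below_split[OF m(1) y(1,2), of "s - t0"]) (use s d in auto)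
  thus ?thesis using m(2) by (intro exI[of _ z]) (auto simp: geo.below_def)
 qed
 define h where "h s = (SOME z. z : topspace M & geo.below ?m z & geo.below z y & rho z = s)" for s
 have h: "h s : topspace M" "geo.below ?m (h s)" "geo.below (h s) y" "rho (h s) = s" if "t0 <= s" "s <= rho y" for s
  using someI_ex[OF ex[OF that]] unfolding h_def[symmetric] by blast+
 have h_below: "geo.below (h s) (h t)" if st: "t0 <= s" "s <= t" "t <= rho y" for s t
 proof -
  have t: "t0 <= t" "t <= rho y" and s: "t0 <= s" "s <= rho y" using st by auto
  have "rdist ?m (h t) = t - t0" using h(2,4)[OF t] m(2) by (simp add: geo.below_def)
  then obtain z where z: "z : topspace M" "geo.below ?m z" "geo.below z (h t)" "rdist ?m z = s - t0"
   by (rule_tac geo.below_split[OF m(1) h(1,2)[OF t], of "s - t0"]) (use st in auto)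
  have "rho z = rho (h s)" using z(2,4) m(2) h(4)[OF s] by (simp add: geo.below_def)
  hence "h s = z" by (rule geo.upward_unique[OF m(1) h(1)[OF s] z(1) mN h(2)[OF s] z(2)])
  thus ?thesis using z(3) by simp
 qed
 let ?g = "%u. if u <= t0 then c u else h u"
 have "N_segment M UNIV A G N (rho y) ?g" unfolding N_segment_iff
 proof (intro conjI ballI impI)
  show "0 < rho y" using t0 ty by simp
  fix u assume u: "u : {0..rho y}"
  show "?g u : topspace M" "rho (?g u) = u" using u top rho h(1,4) by auto
  fix u' assume u': "u' : {0..rho y}" "u <= u'"
  consider "u' <= t0" | "u <= t0" "t0 < u'" | "t0 < u" by linarith
  thus "geo.below (?g u) (?g u')"
  proof cases
   case 1
   thus ?thesis using below[of u u'] u u' by simp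
  next
   case 2
   have "geo.below (c u) ?m" by (rule below) (use 2 u t0 in auto)
   from geo.below_trans(1)[OF _ m(1) _ this h(2)] show ?thesis using 2 u u' top h(1) by simp
  next
   case 3
   thus ?thesis using h_below[of u u'] u u' by simp
  qed
 qed
 moreover have "?g (rho y) = y"
 proof -
  have e: "t0 <= rho y" "rho y <= rho y" using ty by auto
  have "rdist (h (rho y)) y = 0" using h(3,4)[OF e] by (simp add: geo.below_def)
  hence "h (rho y) = y" using rdist_pos[OF h(1)[OF e] y(1)] by force
  thus ?thesis using ty by simp
 qed
 ultimately show ?thesis using ty by (intro exI[of _ ?g]) auto
qed

text \<open>Below \<open>x\<close>, possibly a cut point, choices at different heights might belong
  to different segments. Below the point \<open>m\<close> at half the height they are unique, since
  \<open>m\<close> has \<open>x\<close> above it; the resulting segment is extended from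
  \<open>m\<close> to \<open>x\<close>.\<close>

lemma N_segment_exists:
 assumes x: "x : topspace M" "x ~: N"
 shows "EX c. N_segment M UNIV A G N (rho x) c & c (rho x) = x"
proof -
 have px: "0 < rho x" by (rule geo.rho_pos[OF x])
 obtain m where m: "m : topspace M" "geo.below m x" "rho m = rho x / 2"
  by (rule geo.lower_exists[OF x(1), of "rho x / 2"]) (use px in auto)
 have mx: "x ~= m" using m(3) px by auto
 have ex: "EX z. z : topspace M & geo.below z m & rho z = s" if s: "0 <= s" "s <= rho m" for s
  by (rule geo.lower_exists[OF m(1) s]) blast
 define c where "c s = (SOME z. z : topspace M & geo.below z m & rho z = s)" for s
 have c: "c s : topspace M" "geo.below (c s) m" "rho (c s) = s" if "s : {0..rho m}" for s
 proof -
  have "0 <= s" "s <= rho m" using that by auto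
  from someI_ex[OF ex[OF this]] show "c s : topspace M" "geo.below (c s) m" "rho (c s) = s"
   unfolding c_def[symmetric] by blast+
 qed
 have "geo.below (c s) (c t)" if st: "s : {0..rho m}" "t : {0..rho m}" "s <= t" for s t
 proof -
  obtain z where z: "z : topspace M" "geo.below z (c t)" "rho z = s"
   by (rule geo.lower_exists[OF c(1)[OF st(2)], of s]) (use st c(3)[OF st(2)] in auto)
  have zm: "geo.below z m" by (rule geo.below_trans(1)[OF z(1) c(1)[OF st(2)] m(1) z(2) c(2)[OF st(2)]])
  have "rho z = rho (c s)" using z(3) c(3)[OF st(1)] by simp
  hence "c s = z" by (rule geo.downward_unique[OF c(1)[OF st(1)] z(1) m(1) x(1) c(2)[OF st(1)] zm m(2) mx])
  thus ?thesis using z(2) by simp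
 qed
 hence seg: "N_segment M UNIV A G N (rho m) c" unfolding N_segment_iff using c(1,3) m(3) px by auto
 have e: "rho m : {0..rho m}" using m(3) px by simp
 have "rdist (c (rho m)) m = 0" using c(2,3)[OF e] by (simp add: geo.below_def)
 hence "c (rho m) = m" using rdist_pos[OF c(1)[OF e] m(1)] by force
 thus ?thesis using N_segment_extend[OF seg x(1)] m(2) mx by auto
qed

text \<open>An extension of a segment reaches a point strictly above its end point, and
  \<open>N_segment_extend\<close> turns such a point into an extension.\<close>

theorem cut_locus_eq: "cut_locus M UNIV A G N = geo.cut"
proof (intro set_eqI iffI)
 fix x assume "x : cut_locus M UNIV A G N"
 then obtain c t0 where x: "x = c t0" and seg: "N_segment M UNIV A G N t0 c"
  and max: "~ (EX t1>t0. EX c'. N_segment M UNIV A G N t1 c' & (ALL t:{0..t0}. c' t = c t))"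
  unfolding cut_locus_def by blast
 have t0: "0 < t0" and xX: "x : topspace M" "rho x = t0" using seg x unfolding N_segment_iff by auto
 have "x ~: N" using geo.rho_zero_iff[OF xX(1)] xX(2) t0 by auto
 moreover have "y = x" if "y : topspace M" "geo.below x y" for y
  using N_segment_extend[OF seg that(1)] that(2) max x by blast
 ultimately show "x : geo.cut" using xX(1) by (auto simp: geo.cut_def)
next
 fix x assume cut: "x : geo.cut"
 hence x: "x : topspace M" "x ~: N" by (auto simp: geo.cut_def)
 obtain c where seg: "N_segment M UNIV A G N (rho x) c" "c (rho x) = x" using N_segment_exists[OF x] by blast
 have "~ (EX t1>rho x. EX c'. N_segment M UNIV A G N t1 c' & (ALL t:{0..rho x}. c' t = c t))"
 proof
  assume "EX t1>rho x. EX c'. N_segment M UNIV A G N t1 c' & (ALL t:{0..rho x}. c' t = c t)"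
  then obtain t1 c' where t1: "rho x < t1" and seg': "N_segment M UNIV A G N t1 c'" and eq: "ALL t:{0..rho x}. c' t = c t" by blast
  have px: "0 < rho x" by (rule geo.rho_pos[OF x])
  have "c' (rho x) = x" using eq seg(2) px by simp
  moreover have "geo.below (c' (rho x)) (c' t1)" "c' t1 : topspace M" "rho (c' t1) = t1"
   using seg' t1 px unfolding N_segment_iff by auto
  ultimately show False using cut t1 by (auto simp: geo.cut_def)
 qed
 thus "x : cut_locus M UNIV A G N" unfolding cut_locus_def mem_Collect_eq
  by (rule_tac exI[of _ c], rule_tac exI[of _ "rho x"], intro conjI) (simp_all only: seg)
qed

theorem homotopic_distance_le_cut_locus:
 assumes "continuous_map M Y f" "continuous_map M Y g"
 shows "homotopic_distance M Y f g <= subspace_distance M N Y f g + subspace_distance M (cut_locus M UNIV A G N) Y f g + 1"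
 unfolding cut_locus_eq by (rule homotopic_distance_le_geo_cut[OF assms])

end

text \<open>The metric is constrained on the charts of \<open>A\<close>; its values on other charts
  may be arbitrary and are replaced by the transport from a chart of \<open>A\<close> with a larger
  domain.\<close>

locale pullback_metric = smooth_atlas M Ch
 for M :: "'a topology" and Ch :: "('a, 'e::euclidean_space) chart set" +
 fixes A :: "('a, 'e) chart set" and G :: "('a, 'e) metric"
 assumes A_sub: "A \<subseteq> Ch" and dominated: "\<kappa> : Ch ==> EX \<kappa>':A. fst \<kappa> \<subseteq> fst \<kappa>'"
  and metric_A: "\<kappa> : A ==> local_metric (img \<kappa>) (G \<kappa>)"
  and law_A: "\<kappa> : A ==> \<kappa>' : A ==> q : fst \<kappa> \<inter> fst \<kappa>' ==>
   G \<kappa> (snd \<kappa> q) u v = G \<kappa>' (snd \<kappa>' q) (dtrans \<kappa> \<kappa>' (snd \<kappa> q) u) (dtrans \<kappa> \<kappa>' (snd \<kappa> q) v)"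
begin

definition base :: "('a, 'e) chart => ('a, 'e) chart" where
 "base k = (SOME k'. k' : A & fst k \<subseteq> fst k')"

lemma base: "k : Ch ==> base k : A" "k : Ch ==> fst k \<subseteq> fst (base k)"
proof -
 assume "k : Ch"
 hence "EX k'. k' : A & fst k \<subseteq> fst k'" using dominated by blast
 from someI_ex[OF this] show "base k : A" "fst k \<subseteq> fst (base k)" by (auto simp: base_def)
qed

definition pullback :: "('a, 'e) metric" where
 "pullback k x u v = (if k : A then G k x u v else
  G (base k) (transition k (base k) x) (dtrans k (base k) x u) (dtrans k (base k) x v))"

lemma pullback_eq: "k : A ==> pullback k = G k" by (simp add: pullback_def fun_eq_iff)

lemma pullback_law_A:
 assumes k: "k : Ch" "k' : A" and q: "q : fst k" "q : fst k'"
 shows "pullback k (snd k q) u v = G k' (snd k' q) (dtrans k k' (snd k q) u) (dtrans k k' (snd k q) v)"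
proof (cases "k : A")
 case True
 thus ?thesis using law_A[of k k' q u v] k q by (simp add: pullback_eq)
next
 case False
 let ?b = "base k"
 have qb: "q : fst ?b" using base(2)[OF k(1)] q by blast
 have bC: "?b : Ch" "k' : Ch" using base(1)[OF k(1)] k(2) A_sub by blast+
 have "pullback k (snd k q) u v = G ?b (snd ?b q) (dtrans k ?b (snd k q) u) (dtrans k ?b (snd k q) v)"
  using False by (simp add: pullback_def transition_apply[OF k(1) q(1)])
 also have "\<dots> = G k' (snd k' q) (dtrans ?b k' (snd ?b q) (dtrans k ?b (snd k q) u)) (dtrans ?b k' (snd ?b q) (dtrans k ?b (snd k q) v))"
  by (rule law_A[OF base(1)[OF k(1)] k(2)]) (use qb q in blast)
 also have "\<dots> = G k' (snd k' q) (dtrans k k' (snd k q) u) (dtrans k k' (snd k q) v)"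
  using dtrans_chain[OF k(1) bC q(1) qb q(2)] by simp
 finally show ?thesis .
qed

lemma local_metric_pullback:
 assumes k: "k : Ch"
 shows "local_metric (img k) (pullback k)"
proof (cases "k : A")
 case True
 thus ?thesis using metric_A by (simp add: pullback_eq)
next
 case False
 let ?b = "base k"
 have b: "?b : A" "?b : Ch" "fst k \<subseteq> fst ?b" using base[OF k] A_sub by blast+
 have int: "fst k \<inter> fst ?b = fst k" using b(3) by blast
 interpret B: local_metric "img ?b" "G ?b" by (rule metric_A[OF b(1)])
 have at: "pullback k x u v = G ?b (transition k ?b x) (dtrans k ?b x u) (dtrans k ?b x v)" for x u v
  using False by (simp add: pullback_def)
 have T: "transition k ?b x : img ?b" if "x : img k" for x
  using that b(3) by (auto simp: transition_apply[OF k])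
 have lin: "linear (dtrans k ?b x)" if "x : img k" for x
  using has_derivative_linear[OF dtrans(1)[OF k b(2)]] that int by simp
 \<comment> \<open>By the chain rule the derivative of the inverse transition undoes
   \<open>dtrans\<close>.\<close>
 have inj: "dtrans k ?b x v ~= 0" if x: "x : img k" and v: "v ~= 0" for x v
 proof
  assume 0: "dtrans k ?b x v = 0"
  obtain q where q: "q : fst k" "x = snd k q" using x by blast
  have qb: "q : fst ?b" using q(1) b(3) by blast
  have "v = dtrans k k (snd k q) v" using dtrans_refl[OF k q(1)] by simp
  also have "\<dots> = dtrans ?b k (snd ?b q) 0" using dtrans_chain[OF k b(2) k q(1) qb q(1)] 0 q(2) by simp
  also have "\<dots> = 0" using linear_0[OF has_derivative_linear[OF dtrans(1)[OF b(2) k]]] qb q(1) by blast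
  finally show False using v by simp
 qed
 show ?thesis
 proof
  show "open (img k)" by (rule open_img[OF k])
  show "bilinear (pullback k x)" if x: "x : img k" for x
  proof -
   note l = lin[OF x] and bl = B.bil[OF T[OF x]]
   show ?thesis unfolding bilinear_def at by (intro conjI allI linearI)
     (simp_all add: linear_add[OF l] linear_scale[OF l] bilinear_ladd[OF bl] bilinear_radd[OF bl] bilinear_lmul[OF bl] bilinear_rmul[OF bl])
  qed
  show "pullback k x u v = pullback k x v u" if "x : img k" for x u v unfolding at by (rule B.sym[OF T[OF that]])
  show "0 < pullback k x v v" if "x : img k" "v ~= 0" for x v
   unfolding at by (rule B.pos[OF T[OF that(1)] inj[OF that]])
  show "Ck n (%x. pullback k x b b') (img k)" if "b : Basis" "b' : Basis" for b b' n unfolding at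
   by (rule B.Ck_g) (use trans[OF k b(2), of n] dtrans(2)[OF k b(2)] that T in \<open>simp_all add: int image_subset_iff\<close>)
 qed
qed

lemma pullback_law:
 assumes k: "k : Ch" "k' : Ch" and q: "q : fst k \<inter> fst k'"
 shows "pullback k (snd k q) u v = pullback k' (snd k' q) (dtrans k k' (snd k q) u) (dtrans k k' (snd k q) v)"
proof -
 let ?b = "base k"
 have b: "?b : A" "?b : Ch" "q : fst ?b" using base[OF k(1)] A_sub q by blast+
 have q': "q : fst k" "q : fst k'" using q by auto
 show ?thesis unfolding pullback_law_A[OF k(1) b(1) q'(1) b(3)] pullback_law_A[OF k(2) b(1) q'(2) b(3)]
  using dtrans_chain[OF k b(2) q' b(3)] by simp
qed

end

lemma is_chart_restrict:
 assumes k: "is_chart M UNIV k" and W: "openin M W"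
 shows "is_chart M UNIV (fst k \<inter> W, snd k)"
proof -
 have hom: "homeomorphic_map (subtopology M (fst k)) (top_of_set (snd k ` fst k)) (snd k)"
  and op: "openin M (fst k)" "open (snd k ` fst k)" using k by (auto simp: is_chart_def)
 have sub: "fst k \<subseteq> topspace M" by (rule openin_subset[OF op(1)])
 have "openin (subtopology M (fst k)) (fst k \<inter> W)" by (rule openin_subtopology_Int2[OF W])
 hence "openin (top_of_set (snd k ` fst k)) (snd k ` (fst k \<inter> W))"
  using homeomorphic_imp_open_map[OF hom] by (simp add: open_map_def)
 hence o: "open (snd k ` (fst k \<inter> W))" using op(2) openin_open_trans by blast
 have "homeomorphic_map (subtopology (subtopology M (fst k)) (fst k \<inter> W))
   (subtopology (top_of_set (snd k ` fst k)) (snd k ` (fst k \<inter> W))) (snd k)"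
  by (rule homeomorphic_map_subtopologies[OF hom]) (use sub in auto)
 moreover have "fst k \<inter> (fst k \<inter> W) = fst k \<inter> W" "snd k ` fst k \<inter> snd k ` (fst k \<inter> W) = snd k ` (fst k \<inter> W)" by auto
 ultimately show ?thesis using o openin_Int[OF op(1) W] by (simp add: is_chart_def subtopology_subtopology)
qed

lemma is_chart_inj: "is_chart M UNIV k ==> inj_on (snd k) (fst k)"
proof -
 assume "is_chart M UNIV k"
 hence "homeomorphic_map (subtopology M (fst k)) (top_of_set (snd k ` fst k)) (snd k)" "openin M (fst k)"
  by (auto simp: is_chart_def)
 from homeomorphic_imp_injective_map[OF this(1)] openin_subset[OF this(2)] show ?thesis by (simp add: Int_absorb1)
qed

text \<open>Charts of the maximal atlas are compatible with \<open>A\<close> by definition, but not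
  with each other. Cut down to the domain of a chart of \<open>A\<close>, their transitions factor
  through that chart, and the transport of the metric has a chart to start from.\<close>

definition small_charts :: "'a topology => ('a, 'e::euclidean_space) chart set => ('a, 'e) chart set" where
 "small_charts M A = {(fst k \<inter> fst k', snd k) | k k'. analytic_chart M UNIV A k & k' : A}"

lemma smooth_atlas_small_charts:
 fixes A :: "('a, 'e::euclidean_space) chart set"
 assumes A: "!!k. k : A ==> is_chart M UNIV k"
 shows "smooth_atlas M (small_charts M A)"
proof
 fix k assume "k : small_charts M A"
 then obtain m l where m: "analytic_chart M UNIV A m" "l : A" and k: "k = (fst m \<inter> fst l, snd m)"
  unfolding small_charts_def by blast
 have l: "is_chart M UNIV l" by (rule A[OF m(2)])
 have mc: "is_chart M UNIV m" using m(1) by (simp add: analytic_chart_def)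
 show "is_chart M UNIV k"
  unfolding k by (rule is_chart_restrict[OF mc]) (use l in \<open>simp add: is_chart_def\<close>)
 fix k' n assume "k' : small_charts M A"
 then obtain m' l' where m': "analytic_chart M UNIV A m'" and k': "k' = (fst m' \<inter> fst l', snd m')" "l' : A"
  unfolding small_charts_def by blast
 have m'c: "is_chart M UNIV m'" using m'(1) by (simp add: analytic_chart_def)
 have an: "real_analytic_on (transition m l) (snd m ` (fst m \<inter> fst l))"
  "real_analytic_on (transition l m') (snd l ` (fst m' \<inter> fst l))"
  using m m' by (auto simp: analytic_chart_def compatible_def)
 have o: "open (snd k1 ` (fst k1 \<inter> fst k2))" if "is_chart M UNIV k1" "is_chart M UNIV k2" for k1 k2 :: "('a, 'e) chart"
  using is_chart_restrict[OF that(1), of "fst k2"] that(2) by (simp add: is_chart_def)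
 have c1: "Ck n (transition m l) (snd m ` (fst m \<inter> fst l))" by (rule real_analytic_on_imp_Ck[OF o[OF mc l] an(1)])
 have "open (snd l ` (fst m' \<inter> fst l))" using o[OF l m'c] by (simp add: Int_commute)
 hence c2: "Ck n (transition l m') (snd l ` (fst m' \<inter> fst l))" by (rule real_analytic_on_imp_Ck[OF _ an(2)])
 have tr: "transition m1 m2 (snd m1 q) = snd m2 q" if "is_chart M UNIV m1" "q : fst m1" for m1 m2 :: "('a, 'e) chart" and q
  using is_chart_inj[OF that(1)] that(2) by (simp add: transition_def)
 have tr': "transition k k' (snd m q) = snd m' q" if "q : fst m \<inter> fst l" for q
  using tr[OF \<open>is_chart M UNIV k\<close>, of q k'] that by (simp add: k k'(1))
 let ?S = "snd k ` (fst k \<inter> fst k')"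
 have S: "?S = snd m ` (fst m \<inter> fst l \<inter> (fst m' \<inter> fst l'))" by (simp add: k k'(1))
 have "Ck n (%x. transition l m' (transition m l x)) ?S"
 proof (rule Ck_compose[OF c2 Ck_subset[OF c1]])
  show "?S \<subseteq> snd m ` (fst m \<inter> fst l)" unfolding S by blast
  show "transition m l ` ?S \<subseteq> snd l ` (fst m' \<inter> fst l)" unfolding S by (auto simp: tr[OF mc])
 qed
 thus "Ck n (transition k k') ?S"
 proof (rule Ck_cong)
  fix x assume "x : ?S"
  then obtain q where q: "q : fst m" "q : fst l" "x = snd m q" unfolding S by blast
  thus "transition l m' (transition m l x) = transition k k' x" using tr[OF mc q(1)] tr[OF l q(2)] tr'[of q] by simp
 qed
qed

lemma speed_cong_metric:
 assumes "!!k. k : A ==> G' k = G k" "EX k:A. c t : fst k"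
 shows "speed A G' I c t = speed A G I c t"
proof -
 have "(SOME k. k : A & c t : fst k) : A" using someI_ex[of "%k. k : A & c t : fst k"] assms(2) by blast
 thus ?thesis unfolding speed_def Let_def by (simp add: assms(1))
qed

text \<open>Length, geodesics and Christoffel vectors evaluate the metric on charts of
  \<open>A\<close> only; for the speed, which chooses its chart, this holds because \<open>A\<close>
  covers \<open>M\<close>.\<close>

lemma cut_locus_cong_metric:
 assumes eq: "!!k. k : A ==> G' k = G k" and cover: "(\<Union>k\<in>A. fst k) = topspace M"
 shows "cut_locus M V A G' N = cut_locus M V A G N"
proof -
 have sp: "speed A G' I c t = speed A G I c t" if "continuous_map (top_of_set I) M c" "t : I" for I c t
 proof (rule speed_cong_metric[OF eq])
  have "c t : topspace M" using continuous_map_image_subset_topspace[OF that(1)] that(2) by auto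
  thus "EX k:A. c t : fst k" using cover by blast
 qed
 have len: "curve_length A G' a b c = curve_length A G a b c" if "piecewise_smooth_curve M A a b c" for a b c
  unfolding curve_length_def by (rule integral_cong, rule sp) (use that in \<open>auto simp: piecewise_smooth_curve_def\<close>)
 have dist: "dist_to M A G' N y = dist_to M A G N y" for y
  unfolding dist_to_def using len by (metis (no_types, lifting))
 have chr: "christoffel V G' k = christoffel V G k" if "k : A" for k
  unfolding christoffel_def metric_deriv_def eq[OF that] ..
 have geo: "geodesic M V A G' I c = geodesic M V A G I c" for I c unfolding geodesic_def using chr by auto
 have "N_segment M V A G' N t0 w = N_segment M V A G N t0 w" for t0 w
 proof (cases "geodesic M V A G {0..t0} w")
  case True
  hence "continuous_map (top_of_set {0..t0}) M w" by (simp add: geodesic_def smooth_curve_def)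
  from sp[OF this] show ?thesis unfolding N_segment_def geo dist by auto
 qed (simp add: N_segment_def geo)
 thus ?thesis by (simp add: cut_locus_def)
qed

lemma homotopic_distance_le_subspace_distance_topspace:
 "homotopic_distance M Y f g <= subspace_distance M (topspace M) Y f g + (d + 1)"
 by (simp add: subspace_distance_def)

lemma riemannian_case:
 fixes M :: "'a topology" and A :: "('a, 'e::euclidean_space) chart set" and G :: "('a, 'e) metric"
 assumes man: "real_analytic_manifold M UNIV A" and G: "analytic_riemannian_metric UNIV A G"
  and "compact_space M" and "path_connected_space M"
  and N: "analytic_embedded_submanifold M UNIV A k N" "closedin M N" "N ~= {}"
  and fg: "continuous_map M Y f" "continuous_map M Y g"
 shows "homotopic_distance M Y f g <= subspace_distance M N Y f g + subspace_distance M (cut_locus M UNIV A G N) Y f g + 1"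
proof -
 have A: "is_chart M UNIV j" if "j : A" for j using man that by (simp add: real_analytic_manifold_def)
 have cover: "(\<Union>j\<in>A. fst j) = topspace M" and haus: "Hausdorff_space M" using man by (simp_all add: real_analytic_manifold_def)
 let ?Ch = "small_charts M A"
 interpret smooth_atlas M ?Ch by (rule smooth_atlas_small_charts[OF A])
 have sub: "A \<subseteq> ?Ch"
 proof
  fix j assume j: "j : A"
  hence "analytic_chart M UNIV A j" using man by (simp add: analytic_chart_def real_analytic_manifold_def)
  thus "j : ?Ch" unfolding small_charts_def using j by (intro CollectI exI[of _ j]) simp
 qed
 interpret pullback_metric M ?Ch A G
 proof (intro pullback_metric.intro pullback_metric_axioms.intro)
  show "smooth_atlas M ?Ch" by (rule smooth_atlas_axioms)
  show "A \<subseteq> ?Ch" by (rule sub)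
  show "EX j':A. fst j \<subseteq> fst j'" if ch: "j : ?Ch" for j
  proof -
   obtain m l where "l : A" "j = (fst m \<inter> fst l, snd m)" using ch unfolding small_charts_def by blast
   thus ?thesis by (intro bexI[of _ l]) auto
  qed
  show "local_metric (img j) (G j)" if j: "j : A" for j
  proof
   show o: "open (img j)" using A[OF j] by (simp add: is_chart_def)
   show "Ck n (%x. G j x b b') (img j)" if "b : Basis" "b' : Basis" for b b' n
    by (rule real_analytic_on_imp_Ck[OF o]) (use G j that in \<open>simp add: analytic_riemannian_metric_def\<close>)
  qed (use G j in \<open>auto simp: analytic_riemannian_metric_def\<close>)
  show "G j (snd j q) u v = G j' (snd j' q) (dtrans j j' (snd j q) u) (dtrans j j' (snd j q) v)"
   if "j : A" "j' : A" "q : fst j \<inter> fst j'" for j j' q u v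
  proof -
   have L: "ALL j:A. ALL j':A. ALL p:fst j \<inter> fst j'. ALL u:UNIV. ALL v:UNIV.
     let D = frechet_derivative (transition j j') (at (snd j p) within UNIV)
     in G j (snd j p) u v = G j' (snd j' p) (D u) (D v)"
    using G unfolding analytic_riemannian_metric_def by (elim conjE)
   show ?thesis
    using bspec[OF bspec[OF bspec[OF bspec[OF bspec[OF L that(1)] that(2)] that(3)] UNIV_I[of u]] UNIV_I[of v]]
    unfolding dtrans_def Let_def .
  qed
 qed
 have chart_of: "EX j:?Ch. q : fst j & (\<exists>B0\<subseteq>Basis. snd j ` (fst j \<inter> N) = snd j ` fst j \<inter> span B0)" if q: "q : N" for q
 proof -
  obtain j B0 where j: "analytic_chart M UNIV A j" "q : fst j" and B0: "B0 \<subseteq> Basis" "snd j ` (fst j \<inter> N) = snd j ` fst j \<inter> span B0"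
   using N(1) q unfolding analytic_embedded_submanifold_def by auto
  have "q : topspace M" using N(2) q closedin_subset by blast
  then obtain l where l: "l : A" "q : fst l" using cover by blast
  \<comment> \<open>A slice chart remains one on a smaller domain, here cut down to lie in a chart
    of \<open>A\<close>.\<close>
  let ?j = "(fst j \<inter> fst l, snd j)"
  have inj: "inj_on (snd j) (fst j)" by (rule is_chart_inj[of M]) (use j(1) in \<open>simp add: analytic_chart_def\<close>)
  have "snd j ` (fst j \<inter> fst l \<inter> N) = snd j ` (fst j \<inter> fst l) \<inter> snd j ` (fst j \<inter> N)"
   using inj_on_image_Int[OF inj, of "fst j \<inter> fst l" "fst j \<inter> N"] by (simp add: Int_ac Int_absorb1)
  hence "snd j ` (fst j \<inter> fst l \<inter> N) = snd j ` (fst j \<inter> fst l) \<inter> span B0"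
   unfolding B0(2) by blast
  moreover have "?j : ?Ch" unfolding small_charts_def using j(1) l(1) by blast
  ultimately show ?thesis using j(2) l(2) B0(1) by (intro bexI[of _ ?j]) auto
 qed
 interpret riemannian_subatlas M ?Ch pullback N A
 proof (intro riemannian_subatlas.intro riemannian_subatlas_axioms.intro riemannian_submanifold.intro
   riemannian_submanifold_axioms.intro riemannian_atlas.intro riemannian_atlas_axioms.intro)
  show "smooth_atlas M ?Ch" by (rule smooth_atlas_axioms)
  show "Hausdorff_space M" "compact_space M" by (rule haus, rule assms(3))
  show "connected_space M" using assms(4) by (rule path_connected_imp_connected_space)
  have "(\<Union>j\<in>?Ch. fst j) \<subseteq> topspace M" using open_dom openin_subset by blast
  thus "(\<Union>j\<in>?Ch. fst j) = topspace M" using cover sub by blast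
  show "local_metric (img j) (pullback j)" if "j : ?Ch" for j by (rule local_metric_pullback[OF that])
  show "pullback j (snd j q) u v = pullback j' (snd j' q) (dtrans j j' (snd j q) u) (dtrans j j' (snd j q) v)"
   if "j : ?Ch" "j' : ?Ch" "q : fst j \<inter> fst j'" for j j' q u v by (rule pullback_law[OF that])
  show "closedin M N" "N ~= {}" by (rule N(2), rule N(3))
  show "EX j:?Ch. q : fst j & (\<exists>B0\<subseteq>Basis. snd j ` (fst j \<inter> N) = img j \<inter> span B0)" if "q : N" for q
   by (rule chart_of[OF that])
  show "A \<subseteq> ?Ch" by (rule sub)
  show "(\<Union>j\<in>A. fst j) = topspace M" by (rule cover)
 qed
 have "cut_locus M UNIV A pullback N = cut_locus M UNIV A G N"
  by (rule cut_locus_cong_metric[where A=A and G'=pullback and G=G and M=M, OF _ A_cover]) (rule pullback_eq)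
 thus ?thesis using homotopic_distance_le_cut_locus[OF fg] by simp
qed

text \<open>Coordinates in \<open>{0}\<close> make every point open, so a connected manifold is a
  single point.\<close>

lemma zero_dimensional_case:
 fixes M :: "'a topology" and A :: "('a, 'e::euclidean_space) chart set"
 assumes man: "real_analytic_manifold M {0} A" and conn: "path_connected_space M"
  and N: "N \<subseteq> topspace M" "N ~= {}"
 shows "N = topspace M"
proof -
 have single: "openin M {q}" if q: "q : topspace M" for q
 proof -
  obtain k where k: "k : A" "q : fst k" using man q unfolding real_analytic_manifold_def by blast
  have c: "is_chart M {0} k" using man k(1) by (simp add: real_analytic_manifold_def)
  have inj: "inj_on (snd k) (fst k)"
   using c homeomorphic_imp_injective_map[of "subtopology M (fst k)" _ "snd k"] openin_subset[of M "fst k"]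
   by (auto simp: is_chart_def Int_absorb1)
  have "snd k ` fst k \<subseteq> {0}" using c openin_subset[of "top_of_set {0}"] by (auto simp: is_chart_def)
  hence "x = q" if "x : fst k" for x using inj_onD[OF inj _ that k(2)] that k(2) by (simp add: image_subset_iff)
  hence "fst k = {q}" using k(2) by blast
  thus ?thesis using c by (simp add: is_chart_def)
 qed
 obtain q where q: "q : N" using N(2) by blast
 have "openin M (topspace M - {q})"
 proof (subst openin_subopen, intro ballI)
  fix z assume "z : topspace M - {q}"
  thus "EX T. openin M T & z : T & T \<subseteq> topspace M - {q}" using single[of z] by (intro exI[of _ "{z}"]) auto
 qed
 moreover have "openin M {q}" using single q N(1) by blast
 moreover have "connected_space M" by (rule path_connected_imp_connected_space[OF conn])
 ultimately have "topspace M = {q}" using q N(1) unfolding connected_space_clopen_in closedin_def by blast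
 thus ?thesis using q N(1) by auto
qed

theorem theorem5p8:
 fixes M :: "'a topology" and V :: "'e::euclidean_space set"
  and A :: "('a, 'e) chart set" and G :: "('a, 'e) metric"
  and k :: nat and N :: "'a set"
  and Y :: "'b topology" and f g :: "'a \<Rightarrow> 'b"
 assumes "real_analytic_manifold M V A"
  and "analytic_riemannian_metric V A G"
  and "compact_space M" and "path_connected_space M"
  and "analytic_embedded_submanifold M V A k N"
  and "closedin M N" and "path_connectedin M N" and "N \<noteq> {}"
  and "path_connected_space Y"
  and "continuous_map M Y f" and "continuous_map M Y g"
 shows "homotopic_distance M Y f g \<le>
  subspace_distance M N Y f g + subspace_distance M (cut_locus M V A G N) Y f g + 1"
proof (cases "V = UNIV")
 case True
 thus ?thesis using riemannian_case[of M A G k N Y f g] assms by simp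
next
 case False
 hence "V = {0}" using assms(1) by (simp add: real_analytic_manifold_def)
 hence "N = topspace M" using zero_dimensional_case[of M A N] assms(1,4,6,8) closedin_subset by blast
 \<comment> \<open>Over \<open>N = topspace M\<close> the subspace distance is the distance itself,
   and the other summands only enlarge the right side.\<close>
 hence "homotopic_distance M Y f g \<le> subspace_distance M N Y f g + (subspace_distance M (cut_locus M V A G N) Y f g + 1)"
  using homotopic_distance_le_subspace_distance_topspace by blast
 thus ?thesis by (simp add: add.assoc)
qed

end
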